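(* Let $(\mathcal Q,d,\mathcal E)$ be as in the context. (1) Let $q\in \mathrm{BV}([0,T];\mathcal Q)$ be a BV solution of $(\mathcal Q,d,\mathcal E)$, with jump curves $y^t$, $t\in \mathrm J_q$, as in condition (iv) of the definition of BV solution. Let $\sigma(t)=t+\mathrm{Var}(q,[0,t])$, $S=\sigma(T)$, and let $(\hat t,\hat q):[0,S]\to[0,T]\times\mathcal Q$ be a $1$-Lipschitz map (for the distance $|t_0-t_1|+d(q_0,q_1)$ on $[0,T]\times\mathcal Q$) such that $(t,q(t))=(\hat t(\sigma(t)),\hat q(\sigma(t)))$ for all $t\in[0,T]$, where $\hat t(s)=\sup\{t\in[0,T]:\sigma(t)<s\}$ for $s\in(0,S]$ and $\hat t(0)=0$. Put $\hat{\mathrm C}_q=\hat t^{-1}(\mathrm C_q)$ and $\hat{\mathrm J}_q=\hat t^{-1}(\mathrm J_q)=[0,S]\setminus\hat{\mathrm C}_q$, and define $$\hat z(s)=\begin{cases}\hat q(s)&\text{if }s\in\hat{\mathrm C}_q,\\ y^t(\theta)&\text{if }s\in\hat{\mathrm J}_q,\ \hat t(s)=t,\ s=(1-\theta)\sigma(t^-)+\theta\sigma(t^+)\text{ for }\theta\in[0,1].\end{cases}$$ Then $(\hat t,\hat z):[0,S]\to[0,T]\times\mathcal Q$ is a parametrized metric solution of $(\mathcal Q,d,\mathcal E)$. (2) Conversely, let $(\hat t,\hat q):[s_0,s_1]\to[0,T]\times\mathcal Q$ be a surjective parametrized metric solution of $(\mathcal Q,d,\mathcal E)$ (i.e. $\hat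 t(s_0)=0$ and $\hat t(s_1)=T$). Then any map $q:[0,T]\to\mathcal Q$ of the form $q(t)=\hat q(\sigma(t))$, where for each $t\in[0,T]$ the number $\sigma(t)$ is chosen in $\{s\in[s_0,s_1]:\hat t(s)=t\}$, is a BV solution of $(\mathcal Q,d,\mathcal E)$.
   Context: Setting. $T>0$; $\mathcal Q$ is a finite-dimensional smooth manifold; $\mathcal E\in C^1([0,T]\times\mathcal Q)$ is real-valued, with differential $\mathrm D_q\mathcal E(t,q)\in \mathrm T_q^*\mathcal Q$ in $q$. $\mathcal R_1:\mathrm T\mathcal Q\to[0,\infty)$ is continuous and $\mathcal R_1(q,\cdot)$ is a norm on $\mathrm T_q\mathcal Q$ for every $q$. $\mathcal A(q_0,q_1)$ is the set of $y\in \mathrm{AC}([0,1],\mathcal Q)$ with $y(0)=q_0$, $y(1)=q_1$. The distance $d:\mathcal Q\times\mathcal Q\to[0,\infty)$ is $d(q_0,q_1)=\min\{\int_0^1\mathcal R_1(y(s),y'(s))\,\mathrm ds: y\in\mathcal A(q_0,q_1)\}$, and $(\mathcal Q,d)$ is assumed complete. For an absolutely continuous curve $q$, $|q'|(t):=\mathcal R_1(q(t),q'(t))$. The local slope is $|\partial_q\mathcal E|(t,q):=\sup_{v\in \mathrm T_q\mathcal Q\setminus\{0\}}\frac{\langle \mathrm D_q\mathcal E(t,q),v\rangle}{\mathcal R_1(q,v)}$. BV functions. $\mathrm{Var}(q,I)=\sup\sum_{j=1}^n d(q(\tau_{j-1}),q(\tau_j))$ over all $n$ and all $\tau_0<\dots<\tau_n$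 in $I$; $\mathrm{BV}([0,T];\mathcal Q)$ is the set of everywhere-defined $q:[0,T]\to\mathcal Q$ with $\mathrm{Var}(q,[0,T])<\infty$. One-sided limits $q(t^\pm)$ exist, with $q(0^-)=q(0)$, $q(T^+)=q(T)$ (same convention for $\sigma(t^\pm)$). $\mathrm C_q=\{t:q(t^-)=q(t)=q(t^+)\}$, $\mathrm J_q=[0,T]\setminus \mathrm C_q$. $V_q(t)=\mathrm{Var}(q,[0,t])$, and $\mu_q$ is the nonnegative Radon measure on $[0,T]$ given by the distributional derivative of $V_q$: $\mu_q([s,t])=V_q(t)-V_q(s)$ for $s\le t$ in $\mathrm C_q$, with atoms $\mu_q(\{t\})=d(q(t^-),q(t))+d(q(t),q(t^+))$ at $t\in \mathrm J_q$. Its diffuse part is $\mu_q^{\mathrm{co}}(A)=\mu_q(A\cap \mathrm C_q)$. Slope distance: $S_0(t;q_0,q_1)=\inf\{\int_0^1|\partial_q\mathcal E|(t,y(s))\,|y'|(s)\,\mathrm ds: y\in\mathcal A(q_0,q_1)\}$. For $0\le t_0\le t_1\le T$, $$\Sigma_0(q,[t_0,t_1])=\int_{t_0}^{t_1}|\partial_q\mathcal E|(r,q(r))\,\mu_q^{\mathrm{co}}(\mathrm dr)+S_0(t_0;q(t_0),q(t_0^+))+S_0(t_1;q(t_1^-),q(t_1))+\sum_{t\in \mathrm J_q\cap(t_0,t_1)}\big[S_0(t;q(t^-),q(t))+S_0(t;q(t),q(t^+))\big].$$ BV solution: $q\in \mathrm{BV}([0,T];\mathcal Q)$ is a BV solution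 of $(\mathcal Q,d,\mathcal E)$ if: (i) $\mathcal E(t_1,q(t_1))-\mathcal E(t_0,q(t_0))-\int_{t_0}^{t_1}\partial_t\mathcal E(t,q(t))\,\mathrm dt\le-\Sigma_0(q,[t_0,t_1])$ for $0\le t_0<t_1\le T$; (ii) $|\partial_q\mathcal E|(t,q(t))\le1$ for $t\in[0,T]\setminus \mathrm J_q$; (iii) $|\partial_q\mathcal E|(t,q(t))\ge1$ for $t$ in the support of $\mu_q$; (iv) for every $t\in \mathrm J_q$ there exist $y^t\in\mathcal A(q(t^-),q(t^+))$ and $\theta^t\in[0,1]$ with $y^t(\theta^t)=q(t)$, $|\partial_q\mathcal E|(t,y^t(\theta))\ge1$ for all $\theta\in[0,1]$, and $\mathcal E(t,q(t^+))-\mathcal E(t,q(t^-))=-\int_0^1|\partial_q\mathcal E|(t,y^t(\theta))\,|(y^t)'|(\theta)\,\mathrm d\theta$. Parametrized metric solutions. Let $\Xi\subset[0,\infty)^3$ be the union of $\{(\alpha,0,\xi):\alpha\ge0,\ \xi\in[0,1)\}$, $\{(\alpha,\nu,1):\alpha>0,\ \nu\ge0\}$ and $\{(0,\nu,\xi):\nu\ge0,\ \xi\ge1\}$. Let $M:[0,\infty)^3\to[0,\infty]$ be any function which is lower semicontinuous, satisfies $M(\gamma\alpha,\gamma\nu,\xi)=\gamma M(\alpha,\nu,\xi)$ for all $\alpha,\nu,\xi,\gamma\ge0$, $M(\alpha,\nu,\xi)\ge\nu\xi$ for all $\alpha,\nu,\xi\ge 0$, and $M(\alpha,\nu,\xi)=\nu\xi\iff(\alpha,\nu,\xi)\in\Xi$.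 The notion below does not depend on the choice of $M$. An absolutely continuous curve $(\hat t,\hat q)$ from an interval with endpoints $s_0<s_1$ to $[0,T]\times\mathcal Q$ is a parametrized metric solution of $(\mathcal Q,d,\mathcal E)$ if (a) $\hat t$ is nondecreasing; (b) $\hat t'(s)+|\hat q'|(s)>0$ for a.a. $s\in(s_0,s_1)$; (c) $\frac{\mathrm d}{\mathrm ds}\mathcal E(\hat t(s),\hat q(s))-\partial_t\mathcal E(\hat t(s),\hat q(s))\hat t'(s)\le -M\big(\hat t'(s),|\hat q'|(s),|\partial_q\mathcal E|(\hat t(s),\hat q(s))\big)$ for a.a. $s\in(s_0,s_1)$.
   Formalization: In part (1), condition (b) is claimed only if the jump curves satisfy |(y^t)'|>0 a.e. in (0,1), since it fails for jump curves that pause; this is necessary for (b). All other conditions of a parametrized metric solution are proved for arbitrary jump curves. *)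

theory Defs
  imports "HOL-Analysis.Analysis"
begin

section \<open>Smooth manifolds\<close>

text \<open>Iterated continuous differentiability on an open set, via directional derivatives of the
  Frechet derivative.\<close>

primrec Ck_on :: "nat \<Rightarrow> 'a::euclidean_space set \<Rightarrow> ('a \<Rightarrow> 'b::euclidean_space) \<Rightarrow> bool" where
  "Ck_on 0 S f \<longleftrightarrow> continuous_on S f"
| "Ck_on (Suc k) S f \<longleftrightarrow>
     (\<forall>x\<in>S. f differentiable (at x)) \<and> (\<forall>v. Ck_on k S (\<lambda>x. frechet_derivative f (at x) v))"

text \<open>The manifold is the whole type \<^typ>\<open>'q\<close>, with its class topology (Hausdorff and second
  countable), modelled on \<^typ>\<open>'e\<close>. A chart is a domain together with a coordinate map, whose
  values off the domain are irrelevant.\<close>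

type_synonym ('q, 'e) chart = "'q set \<times> ('q \<Rightarrow> 'e)"

abbreviation chart_image :: "('q, 'e) chart \<Rightarrow> 'e set" where
  "chart_image c \<equiv> snd c ` fst c"

definition chart_inv :: "('q, 'e) chart \<Rightarrow> 'e \<Rightarrow> 'q" where
  "chart_inv c = inv_into (fst c) (snd c)"

definition smooth_atlas ::
    "('q::{t2_space,second_countable_topology}, 'e::euclidean_space) chart set \<Rightarrow> bool" where
  "smooth_atlas A \<longleftrightarrow>
     (\<forall>c\<in>A. open (fst c) \<and> open (chart_image c) \<and>
            homeomorphism (fst c) (chart_image c) (snd c) (chart_inv c)) \<and>
     (\<Union>c\<in>A. fst c) = UNIV \<and>
     (\<forall>c\<in>A. \<forall>c'\<in>A. \<forall>k. Ck_on k (snd c ` (fst c \<inter> fst c')) (snd c' \<circ> chart_inv c))"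

definition charts_at :: "('q, 'e) chart set \<Rightarrow> 'q \<Rightarrow> ('q, 'e) chart set" where
  "charts_at A q = {c\<in>A. q \<in> fst c}"

text \<open>A tangent vector at \<^term>\<open>q\<close> is the family of its coordinate vectors in all charts
  around \<^term>\<open>q\<close>, related by the differentials of the transition maps; the value at all other
  charts is fixed to be 0. The vector space structure is pointwise.\<close>

type_synonym ('q, 'e) tvec = "('q, 'e) chart \<Rightarrow> 'e"

definition tangent_space ::
    "('q::topological_space, 'e::euclidean_space) chart set \<Rightarrow> 'q \<Rightarrow> ('q, 'e) tvec set" where
  "tangent_space A q = {v.
     (\<forall>c\<in>charts_at A q. \<forall>c'\<in>charts_at A q.
        v c' = frechet_derivative (snd c' \<circ> chart_inv c) (at (snd c q)) (v c)) \<and>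
     (\<forall>c. c \<notin> charts_at A q \<longrightarrow> v c = 0)}"

text \<open>The tangent vector at \<^term>\<open>q\<close> whose coordinate vector in the chart \<^term>\<open>c\<close> is
  \<^term>\<open>w\<close>.\<close>

definition tvec_of ::
    "('q::topological_space, 'e::euclidean_space) chart set \<Rightarrow> ('q, 'e) chart \<Rightarrow> 'q \<Rightarrow> 'e \<Rightarrow> ('q, 'e) tvec"
  where
  "tvec_of A c q w = (\<lambda>c'. if c' \<in> charts_at A q
     then frechet_derivative (snd c' \<circ> chart_inv c) (at (snd c q)) w else 0)"

text \<open>A norm on every tangent space, continuous on the tangent bundle. The topology of the tangent
  bundle is the one given by the bundle charts, so continuity is tested in these.\<close>

definition finsler_norm ::
    "('q::topological_space, 'e::euclidean_space) chart set \<Rightarrow> ('q \<Rightarrow> ('q, 'e) tvec \<Rightarrow> real) \<Rightarrow> bool"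
  where
  "finsler_norm A R \<longleftrightarrow>
     (\<forall>q. (\<forall>v\<in>tangent_space A q. 0 \<le> R q v \<and> (R q v = 0 \<longleftrightarrow> v = (\<lambda>_. 0))) \<and>
          (\<forall>v\<in>tangent_space A q. \<forall>a. R q (\<lambda>c. a *\<^sub>R v c) = \<bar>a\<bar> * R q v) \<and>
          (\<forall>v\<in>tangent_space A q. \<forall>w\<in>tangent_space A q.
              R q (\<lambda>c. v c + w c) \<le> R q v + R q w)) \<and>
     (\<forall>c\<in>A. continuous_on (chart_image c \<times> UNIV)
        (\<lambda>(x, w). R (chart_inv c x) (tvec_of A c (chart_inv c x) w)))"


section \<open>Absolutely continuous curves and the distance\<close>

definition abs_cont :: "real \<Rightarrow> real \<Rightarrow> (real \<Rightarrow> 'a::real_normed_vector) \<Rightarrow> bool" where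
  "abs_cont a b f \<longleftrightarrow> (\<forall>\<epsilon>>0. \<exists>\<delta>>0. \<forall>(n::nat) l r.
     (\<forall>i<n. a \<le> l i \<and> l i \<le> r i \<and> r i \<le> b) \<and>
     (\<forall>i<n. \<forall>j<n. i \<noteq> j \<longrightarrow> {l i<..<r i} \<inter> {l j<..<r j} = {}) \<and>
     (\<Sum>i<n. r i - l i) < \<delta> \<longrightarrow> (\<Sum>i<n. norm (f (r i) - f (l i))) < \<epsilon>)"

definition ac_curve ::
    "('q::topological_space, 'e::euclidean_space) chart set \<Rightarrow> real \<Rightarrow> real \<Rightarrow> (real \<Rightarrow> 'q) \<Rightarrow> bool" where
  "ac_curve A a b y \<longleftrightarrow> continuous_on {a..b} y \<and>
     (\<forall>c\<in>A. \<forall>u v. a \<le> u \<and> u \<le> v \<and> v \<le> b \<and> y ` {u..v} \<subseteq> fst c \<longrightarrow> abs_cont u v (snd c \<circ> y))"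

definition velocity ::
    "('q::topological_space, 'e::euclidean_space) chart set \<Rightarrow> (real \<Rightarrow> 'q) \<Rightarrow> real \<Rightarrow> ('q, 'e) tvec" where
  "velocity A y s = (\<lambda>c. if c \<in> charts_at A (y s) then vector_derivative (snd c \<circ> y) (at s) else 0)"

definition speed ::
    "('q::topological_space, 'e::euclidean_space) chart set \<Rightarrow> ('q \<Rightarrow> ('q, 'e) tvec \<Rightarrow> real) \<Rightarrow>
     (real \<Rightarrow> 'q) \<Rightarrow> real \<Rightarrow> real" where
  "speed A R y s = R (y s) (velocity A y s)"

definition curves ::
    "('q::topological_space, 'e::euclidean_space) chart set \<Rightarrow> 'q \<Rightarrow> 'q \<Rightarrow> (real \<Rightarrow> 'q) set" where
  "curves A p q = {y. ac_curve A 0 1 y \<and> y 0 = p \<and> y 1 = q}"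

definition curve_length ::
    "('q::topological_space, 'e::euclidean_space) chart set \<Rightarrow> ('q \<Rightarrow> ('q, 'e) tvec \<Rightarrow> real) \<Rightarrow>
     (real \<Rightarrow> 'q) \<Rightarrow> real" where
  "curve_length A R y = integral {0..1} (speed A R y)"

text \<open>That the infimum is over a nonempty set and is attained is part of the setting, see
  \<open>has_minimal_curves\<close>.\<close>

definition fdist ::
    "('q::topological_space, 'e::euclidean_space) chart set \<Rightarrow> ('q \<Rightarrow> ('q, 'e) tvec \<Rightarrow> real) \<Rightarrow>
     'q \<Rightarrow> 'q \<Rightarrow> real" where
  "fdist A R p q = (INF y\<in>curves A p q. curve_length A R y)"

definition has_minimal_curves ::
    "('q::topological_space, 'e::euclidean_space) chart set \<Rightarrow> ('q \<Rightarrow> ('q, 'e) tvec \<Rightarrow> real) \<Rightarrow> bool" where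
  "has_minimal_curves A R \<longleftrightarrow> (\<forall>p q. \<exists>y\<in>curves A p q. curve_length A R y = fdist A R p q)"


section \<open>Energy and slope\<close>

definition C1_energy ::
    "('q::topological_space, 'e::euclidean_space) chart set \<Rightarrow> real \<Rightarrow> (real \<Rightarrow> 'q \<Rightarrow> real) \<Rightarrow> bool" where
  "C1_energy A T E \<longleftrightarrow> (\<forall>c\<in>A. \<exists>E' :: real \<times> 'e \<Rightarrow> (real \<times> 'e) \<Rightarrow>\<^sub>L real.
     (\<forall>p\<in>{0..T} \<times> chart_image c.
        ((\<lambda>(t, x). E t (chart_inv c x)) has_derivative blinfun_apply (E' p))
          (at p within {0..T} \<times> chart_image c)) \<and>
     continuous_on ({0..T} \<times> chart_image c) E')"

text \<open>The partial derivative in time, one-sided at the end points of the time interval.\<close>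

definition dtE :: "real \<Rightarrow> (real \<Rightarrow> 'q \<Rightarrow> real) \<Rightarrow> real \<Rightarrow> 'q \<Rightarrow> real" where
  "dtE T E t q = vector_derivative (\<lambda>r. E r q) (at t within {0..T})"

text \<open>The differential of a function at a point, applied to a tangent vector there. The chart in
  which it is computed does not matter.\<close>

definition differential ::
    "('q::topological_space, 'e::euclidean_space) chart set \<Rightarrow> ('q \<Rightarrow> real) \<Rightarrow> 'q \<Rightarrow> ('q, 'e) tvec \<Rightarrow> real"
  where
  "differential A f q v = (let c = (SOME c. c \<in> charts_at A q) in
     frechet_derivative (f \<circ> chart_inv c) (at (snd c q)) (v c))"

definition slope ::
    "('q::topological_space, 'e::euclidean_space) chart set \<Rightarrow> ('q \<Rightarrow> ('q, 'e) tvec \<Rightarrow> real) \<Rightarrow>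
     (real \<Rightarrow> 'q \<Rightarrow> real) \<Rightarrow> real \<Rightarrow> 'q \<Rightarrow> real" where
  "slope A R E t q = (SUP v\<in>tangent_space A q - {\<lambda>_. 0}. differential A (E t) q v / R q v)"


section \<open>Functions of bounded variation on \<open>[0,T]\<close>\<close>

definition Var :: "('q \<Rightarrow> 'q \<Rightarrow> real) \<Rightarrow> (real \<Rightarrow> 'q) \<Rightarrow> real set \<Rightarrow> ennreal" where
  "Var d q I = Sup {ennreal (\<Sum>j<n. d (q (\<tau> j)) (q (\<tau> (Suc j)))) | (n::nat) \<tau>.
     (\<forall>j\<le>n. \<tau> j \<in> I) \<and> (\<forall>j<n. \<tau> j < \<tau> (Suc j))}"

definition BV :: "('q \<Rightarrow> 'q \<Rightarrow> real) \<Rightarrow> real \<Rightarrow> (real \<Rightarrow> 'q) \<Rightarrow> bool" where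
  "BV d T q \<longleftrightarrow> Var d q {0..T} < top"

definition V_fun :: "('q \<Rightarrow> 'q \<Rightarrow> real) \<Rightarrow> (real \<Rightarrow> 'q) \<Rightarrow> real \<Rightarrow> real" where
  "V_fun d q t = enn2real (Var d q {0..t})"

definition lim_left :: "(real \<Rightarrow> 'a::t2_space) \<Rightarrow> real \<Rightarrow> 'a" where
  "lim_left f t = (if t \<le> 0 then f 0 else Lim (at_left t) f)"

definition lim_right :: "real \<Rightarrow> (real \<Rightarrow> 'a::t2_space) \<Rightarrow> real \<Rightarrow> 'a" where
  "lim_right T f t = (if T \<le> t then f T else Lim (at_right t) f)"

definition Cset :: "real \<Rightarrow> (real \<Rightarrow> 'q::t2_space) \<Rightarrow> real set" where
  "Cset T q = {t\<in>{0..T}. lim_left q t = q t \<and> q t = lim_right T q t}"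

definition Jset :: "real \<Rightarrow> (real \<Rightarrow> 'q::t2_space) \<Rightarrow> real set" where
  "Jset T q = {0..T} - Cset T q"

text \<open>The distributional derivative of the variation function, extended by its boundary values
  outside \<open>[0,T]\<close>, i.e. the Stieltjes measure of its right-continuous modification. It
  charges \<open>0\<close> and \<open>T\<close> with the jumps of \<open>q\<close> there and vanishes outside \<open>[0,T]\<close>.\<close>

definition mu :: "('q \<Rightarrow> 'q \<Rightarrow> real) \<Rightarrow> real \<Rightarrow> (real \<Rightarrow> 'q) \<Rightarrow> real measure" where
  "mu d T q = interval_measure (\<lambda>t. if t < 0 then 0 else lim_right T (V_fun d q) t)"

definition mu_co :: "('q \<Rightarrow> 'q \<Rightarrow> real) \<Rightarrow> real \<Rightarrow> (real \<Rightarrow> 'q::t2_space) \<Rightarrow> real measure" where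
  "mu_co d T q = density (mu d T q) (indicator (Cset T q))"

definition msupport :: "real measure \<Rightarrow> real set" where
  "msupport M = {t. \<forall>U. open U \<and> t \<in> U \<longrightarrow> 0 < emeasure M U}"


section \<open>BV solutions\<close>

definition S0 ::
    "('q::topological_space, 'e::euclidean_space) chart set \<Rightarrow> ('q \<Rightarrow> ('q, 'e) tvec \<Rightarrow> real) \<Rightarrow>
     (real \<Rightarrow> 'q \<Rightarrow> real) \<Rightarrow> real \<Rightarrow> 'q \<Rightarrow> 'q \<Rightarrow> real" where
  "S0 A R E t p q =
     (INF y\<in>curves A p q. integral {0..1} (\<lambda>s. slope A R E t (y s) * speed A R y s))"

definition Sigma0 ::
    "('q::t2_space, 'e::euclidean_space) chart set \<Rightarrow> ('q \<Rightarrow> ('q, 'e) tvec \<Rightarrow> real) \<Rightarrow>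
     (real \<Rightarrow> 'q \<Rightarrow> real) \<Rightarrow> real \<Rightarrow> (real \<Rightarrow> 'q) \<Rightarrow> real \<Rightarrow> real \<Rightarrow> ennreal" where
  "Sigma0 A R E T q t0 t1 =
     (\<integral>\<^sup>+r\<in>{t0..t1}. ennreal (slope A R E r (q r)) \<partial>mu_co (fdist A R) T q) +
     ennreal (S0 A R E t0 (q t0) (lim_right T q t0)) +
     ennreal (S0 A R E t1 (lim_left q t1) (q t1)) +
     (\<Sum>\<^sub>\<infinity>t\<in>Jset T q \<inter> {t0<..<t1}.
        ennreal (S0 A R E t (lim_left q t) (q t)) + ennreal (S0 A R E t (q t) (lim_right T q t)))"

definition jump_curve ::
    "('q::t2_space, 'e::euclidean_space) chart set \<Rightarrow> ('q \<Rightarrow> ('q, 'e) tvec \<Rightarrow> real) \<Rightarrow>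
     (real \<Rightarrow> 'q \<Rightarrow> real) \<Rightarrow> real \<Rightarrow> (real \<Rightarrow> 'q) \<Rightarrow> real \<Rightarrow> (real \<Rightarrow> 'q) \<Rightarrow> bool" where
  "jump_curve A R E T q t y \<longleftrightarrow>
     y \<in> curves A (lim_left q t) (lim_right T q t) \<and>
     (\<exists>\<theta>\<in>{0..1}. y \<theta> = q t) \<and>
     (\<forall>\<theta>\<in>{0..1}. slope A R E t (y \<theta>) \<ge> 1) \<and>
     E t (lim_right T q t) - E t (lim_left q t)
       = - integral {0..1} (\<lambda>\<theta>. slope A R E t (y \<theta>) * speed A R y \<theta>)"

definition BV_solution ::
    "('q::t2_space, 'e::euclidean_space) chart set \<Rightarrow> ('q \<Rightarrow> ('q, 'e) tvec \<Rightarrow> real) \<Rightarrow>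
     (real \<Rightarrow> 'q \<Rightarrow> real) \<Rightarrow> real \<Rightarrow> (real \<Rightarrow> 'q) \<Rightarrow> bool" where
  "BV_solution A R E T q \<longleftrightarrow>
     BV (fdist A R) T q \<and>
     (\<forall>t0 t1. 0 \<le> t0 \<and> t0 < t1 \<and> t1 \<le> T \<longrightarrow>
        ereal (E t1 (q t1) - E t0 (q t0) - integral {t0..t1} (\<lambda>t. dtE T E t (q t)))
          \<le> - enn2ereal (Sigma0 A R E T q t0 t1)) \<and>
     (\<forall>t\<in>{0..T} - Jset T q. slope A R E t (q t) \<le> 1) \<and>
     (\<forall>t\<in>msupport (mu (fdist A R) T q). slope A R E t (q t) \<ge> 1) \<and>
     (\<forall>t\<in>Jset T q. \<exists>y. jump_curve A R E T q t y)"


section \<open>Parametrized metric solutions\<close>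

definition Xi :: "(real \<times> real \<times> real) set" where
  "Xi = {(\<alpha>, 0, \<xi>) | \<alpha> \<xi>. \<alpha> \<ge> 0 \<and> 0 \<le> \<xi> \<and> \<xi> < 1} \<union>
        {(\<alpha>, \<nu>, 1) | \<alpha> \<nu>. \<alpha> > 0 \<and> \<nu> \<ge> 0} \<union>
        {(0, \<nu>, \<xi>) | \<nu> \<xi>. \<nu> \<ge> 0 \<and> \<xi> \<ge> 1}"

definition admissible_M :: "(real \<times> real \<times> real \<Rightarrow> ennreal) \<Rightarrow> bool" where
  "admissible_M M \<longleftrightarrow>
     (\<forall>p\<in>{0..} \<times> {0..} \<times> {0..}. M p \<le> Liminf (at p within {0..} \<times> {0..} \<times> {0..}) M) \<and>
     (\<forall>\<alpha>\<ge>0. \<forall>\<nu>\<ge>0. \<forall>\<xi>\<ge>0.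
        (\<forall>\<gamma>\<ge>0. M (\<gamma> * \<alpha>, \<gamma> * \<nu>, \<xi>) = ennreal \<gamma> * M (\<alpha>, \<nu>, \<xi>)) \<and>
        M (\<alpha>, \<nu>, \<xi>) \<ge> ennreal (\<nu> * \<xi>) \<and>
        (M (\<alpha>, \<nu>, \<xi>) = ennreal (\<nu> * \<xi>) \<longleftrightarrow> (\<alpha>, \<nu>, \<xi>) \<in> Xi))"

text \<open>All requirements on a parametrized metric solution on \<open>[s0,s1]\<close> except that it never
  stops, i.e. that \<open>tt' + |qq'|\<close> is positive almost everywhere.\<close>

definition stopping_parametrized_solution ::
    "('q::topological_space, 'e::euclidean_space) chart set \<Rightarrow> ('q \<Rightarrow> ('q, 'e) tvec \<Rightarrow> real) \<Rightarrow>
     (real \<Rightarrow> 'q \<Rightarrow> real) \<Rightarrow> real \<Rightarrow> (real \<times> real \<times> real \<Rightarrow> ennreal) \<Rightarrow>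
     real \<Rightarrow> real \<Rightarrow> (real \<Rightarrow> real) \<Rightarrow> (real \<Rightarrow> 'q) \<Rightarrow> bool" where
  "stopping_parametrized_solution A R E T M s0 s1 tt qq \<longleftrightarrow>
     s0 < s1 \<and>
     abs_cont s0 s1 tt \<and> tt ` {s0..s1} \<subseteq> {0..T} \<and> ac_curve A s0 s1 qq \<and>
     mono_on {s0..s1} tt \<and>
     (AE s in lebesgue. s \<in> {s0<..<s1} \<longrightarrow>
        ereal (deriv (\<lambda>r. E (tt r) (qq r)) s - dtE T E (tt s) (qq s) * deriv tt s)
          \<le> - enn2ereal (M (deriv tt s, speed A R qq s, slope A R E (tt s) (qq s))))"

definition parametrized_metric_solution ::
    "('q::topological_space, 'e::euclidean_space) chart set \<Rightarrow> ('q \<Rightarrow> ('q, 'e) tvec \<Rightarrow> real) \<Rightarrow>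
     (real \<Rightarrow> 'q \<Rightarrow> real) \<Rightarrow> real \<Rightarrow> (real \<times> real \<times> real \<Rightarrow> ennreal) \<Rightarrow>
     real \<Rightarrow> real \<Rightarrow> (real \<Rightarrow> real) \<Rightarrow> (real \<Rightarrow> 'q) \<Rightarrow> bool" where
  "parametrized_metric_solution A R E T M s0 s1 tt qq \<longleftrightarrow>
     stopping_parametrized_solution A R E T M s0 s1 tt qq \<and>
     (AE s in lebesgue. s \<in> {s0<..<s1} \<longrightarrow> deriv tt s + speed A R qq s > 0)"

end

(* Both directions compare two clocks. A map tt that is monotone from [s0,s1] onto [0,T] has
   interval fibres [lo t, hi t], nondegenerate for countably many t only, and pushes densities on
   [s0,s1] forward to measures on [0,T].

   From a parametrized solution: tightness of the dissipation inequality puts (tt', speed, slope)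
   into Xi almost everywhere and turns it into an energy identity. The measure mu of q is dominated
   by the image of the speed, and S_0 across a jump by the integral of slope times speed over its
   fibre, so Sigma_0 is at most the dissipation of the curve. Nonstopping makes the nondegenerate
   fibres exactly the jumps.

   From a BV solution: the energy inequality bounds the total length of the jump curves, since the
   slope is at least 1 on them; inserting them into the fibres therefore gives an absolutely
   continuous curve. Off the fibres of the jumps its speed is at most 1 - tt' almost everywhere, and
   the image of 1 - tt' is dominated by mu. Hence the dissipation of the curve is at most Sigma_0,
   and together with the chain rule the energy inequality becomes an equality almost everywhere. *)
theory Submission
  imports Defs
begin

section \<open>Differentiation of indefinite integrals\<close>

text \<open>A Vitali cover by the intervals on which the difference quotient is off by more than
  \<open>1/n\<close> has, by Henstock's lemma, arbitrarily small total length.\<close>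

lemma negligible_bad_difference_quotient:
  fixes g :: "real \<Rightarrow> 'b::euclidean_space"
  assumes g: "g integrable_on {a..b}" and "0 < k"
  shows "negligible {x\<in>{a..b}. \<forall>d>0. \<exists>y\<in>{a..b}. y \<noteq> x \<and> \<bar>y - x\<bar> < d \<and>
           norm (\<bar>y - x\<bar> *\<^sub>R g x - integral {min x y..max x y} g) > k * \<bar>y - x\<bar>}"
    (is "negligible ?E")
  unfolding negligible_outer_le
proof (intro allI impI)
  fix e :: real assume "e > 0"
  obtain \<gamma> where \<gamma>: "gauge \<gamma>" and H: "\<And>p. \<lbrakk>p tagged_partial_division_of (cbox a b); \<gamma> fine p\<rbrakk> \<Longrightarrow>
             sum (\<lambda>(x,k). norm(measure lborel k *\<^sub>R g x - integral k g)) p < k * e"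
    using Henstock_lemma[of g a b "k * e"] g \<open>e > 0\<close> \<open>0 < k\<close> by (auto simp: cbox_interval)
  define EE where "EE = ?E"
  have EE_sub: "EE \<subseteq> {a..b}" by (auto simp: EE_def)
  have EE_D: "\<exists>y\<in>{a..b}. y \<noteq> x \<and> \<bar>y - x\<bar> < d \<and>
           norm (\<bar>y - x\<bar> *\<^sub>R g x - integral {min x y..max x y} g) > k * \<bar>y - x\<bar>"
    if "x \<in> EE" "d > 0" for x d using that unfolding EE_def by blast
  define I where "I = {(x,y). x \<in> EE \<and> y \<in> {a..b} \<and> y \<noteq> x \<and> {min x y..max x y} \<subseteq> \<gamma> x \<and>
      norm (\<bar>y - x\<bar> *\<^sub>R g x - integral {min x y..max x y} g) > k * \<bar>y - x\<bar>}"
  define c where "c = (\<lambda>(x,y). (x + y) / 2 :: real)"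
  define r where "r = (\<lambda>(x,y). \<bar>y - x\<bar> / 2 :: real)"
  have cb: "cball (c i) (r i) = {min (fst i) (snd i)..max (fst i) (snd i)}" for i
    by (cases i) (simp add: c_def r_def cball_eq_atLeastAtMost min_def max_def field_simps abs_if)
  have ID: "fst i \<in> {a..b}" "snd i \<in> {a..b}" "snd i \<noteq> fst i" "cball (c i) (r i) \<subseteq> \<gamma> (fst i)"
      "norm (\<bar>snd i - fst i\<bar> *\<^sub>R g (fst i) - integral (cball (c i) (r i)) g) > k * \<bar>snd i - fst i\<bar>"
    if "i \<in> I" for i
    using that EE_sub unfolding cb by (auto simp: I_def)
  have fine: "\<exists>i. i \<in> I \<and> x \<in> cball (c i) (r i) \<and> r i < d" if x: "x \<in> EE" and "0 < d" for x d
  proof -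
    have "open (\<gamma> x)" "x \<in> \<gamma> x" using \<gamma> by (auto simp: gauge_def)
    then obtain \<delta> where "\<delta> > 0" "ball x \<delta> \<subseteq> \<gamma> x" by (meson open_contains_ball)
    have "\<exists>y\<in>{a..b}. y \<noteq> x \<and> \<bar>y - x\<bar> < min d \<delta> \<and>
           norm (\<bar>y - x\<bar> *\<^sub>R g x - integral {min x y..max x y} g) > k * \<bar>y - x\<bar>"
      using EE_D[OF x, of "min d \<delta>"] \<open>\<delta> > 0\<close> \<open>0 < d\<close> by simp
    then obtain y where y: "y\<in>{a..b}" "y \<noteq> x" "\<bar>y - x\<bar> < min d \<delta>"
      "norm (\<bar>y - x\<bar> *\<^sub>R g x - integral {min x y..max x y} g) > k * \<bar>y - x\<bar>" by blast
    have "{min x y..max x y} \<subseteq> ball x \<delta>" using y by (auto simp: dist_real_def)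
    with y x \<open>ball x \<delta> \<subseteq> \<gamma> x\<close> have "(x,y) \<in> I" unfolding I_def by blast
    moreover have "x \<in> cball (c (x,y)) (r (x,y))" unfolding cb by auto
    moreover have "r (x,y) < d" using y by (auto simp: r_def)
    ultimately show ?thesis by blast
  qed
  have rpos: "0 < r i" if "i \<in> I" for i using ID(3)[OF that] by (cases i) (auto simp: r_def)
  obtain C where C: "countable C" "C \<subseteq> I"
     "pairwise (\<lambda>i j. disjnt (cball (c i) (r i)) (cball (c j) (r j))) C"
     "negligible(EE - (\<Union>i \<in> C. cball (c i) (r i)))"
    using Vitali_covering_theorem_cballs[where K=I and r=r and a=c and S="EE"] rpos fine by blast
  have bound: "measure lebesgue (\<Union>i\<in>F. cball (c i) (r i)) \<le> e" if F: "F \<subseteq> C" "finite F" for F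
  proof -
    define p where "p = (\<lambda>i. (fst i, cball (c i) (r i))) ` F"
    have inj: "inj_on (\<lambda>i. (fst i, cball (c i) (r i))) F"
    proof (rule inj_onI)
      fix i j assume ij: "i \<in> F" "j \<in> F" "(fst i, cball (c i) (r i)) = (fst j, cball (c j) (r j))"
      then have "\<not> disjnt (cball (c i) (r i)) (cball (c j) (r j))"
        using rpos[of i] F C by (auto simp: disjnt_def)
      then show "i = j" using C F ij unfolding pairwise_def by (metis subsetD)
    qed
    have "p tagged_partial_division_of (cbox a b)"
      unfolding tagged_partial_division_of_def
    proof (intro conjI allI impI)
      show "finite p" using F by (simp add: p_def)
      fix x K assume "(x,K) \<in> p"
      then obtain i where i: "i \<in> F" "x = fst i" "K = cball (c i) (r i)" by (auto simp: p_def)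
      then have "i \<in> I" using F C by auto
      then show "x \<in> K" "K \<subseteq> cbox a b"
        using i ID(1,2)[of i] unfolding i(3) cb cbox_interval by auto
      show "\<exists>a b. K = cbox a b" unfolding i(3) cb by (metis cbox_interval)
    next
      fix x1 K1 x2 K2 assume "(x1, K1) \<in> p \<and> (x2, K2) \<in> p \<and> (x1, K1) \<noteq> (x2, K2)"
      then obtain i j where "i \<in> F" "j \<in> F" "i \<noteq> j" "K1 = cball (c i) (r i)" "K2 = cball (c j) (r j)"
        by (auto simp: p_def)
      then have "disjnt K1 K2" using C F by (meson pairwiseD subsetD)
      then show "interior K1 \<inter> interior K2 = {}" using interior_subset by (fastforce simp: disjnt_def)
    qed
    moreover have "\<gamma> fine p"
      unfolding fine_def p_def using F C ID(4) by blast
    ultimately have *: "(\<Sum>(x,K)\<in>p. norm (measure lborel K *\<^sub>R g x - integral K g)) < k * e" by (rule H)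
    have "k * (\<Sum>i\<in>F. \<bar>snd i - fst i\<bar>) \<le> (\<Sum>i\<in>F. norm (\<bar>snd i - fst i\<bar> *\<^sub>R g (fst i) - integral (cball (c i) (r i)) g))"
      unfolding sum_distrib_left
    proof (rule sum_mono)
      fix i assume "i \<in> F" then have "i \<in> I" using F C by auto
      then show "k * \<bar>snd i - fst i\<bar> \<le> norm (\<bar>snd i - fst i\<bar> *\<^sub>R g (fst i) - integral (cball (c i) (r i)) g)"
        using ID(5)[of i] by simp
    qed
    also have "\<dots> = (\<Sum>(x,K)\<in>p. norm (measure lborel K *\<^sub>R g x - integral K g))"
      unfolding p_def sum.reindex[OF inj] by (intro sum.cong refl) (auto simp: cb abs_if)
    finally have "k * (\<Sum>i\<in>F. \<bar>snd i - fst i\<bar>) < k * e" using * by linarith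
    then have "(\<Sum>i\<in>F. \<bar>snd i - fst i\<bar>) < e" using \<open>0 < k\<close> by simp
    moreover have "measure lebesgue (\<Union>i\<in>F. cball (c i) (r i)) \<le> (\<Sum>i\<in>F. measure lebesgue (cball (c i) (r i)))"
      by (rule measure_UNION_le) (use F in auto)
    moreover have "measure lebesgue (cball (c i) (r i)) = \<bar>snd i - fst i\<bar>" for i
      unfolding cb by (auto simp: abs_if)
    ultimately show ?thesis by simp
  qed
  let ?U = "\<Union>i\<in>C. cball (c i) (r i)"
  have U: "?U \<in> lmeasurable" "measure lebesgue ?U \<le> e"
    using fmeasurable_UN_bound[OF \<open>countable C\<close>, of "\<lambda>i. cball (c i) (r i)" lebesgue e]
      measure_UN_bound[OF \<open>countable C\<close>, of "\<lambda>i. cball (c i) (r i)" lebesgue e] bound by auto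
  let ?N = "EE - ?U"
  have "?N \<in> lmeasurable" "measure lebesgue ?N = 0"
    using C(4) by (auto simp: negligible_iff_measure)
  moreover then have "measure lebesgue (?U \<union> ?N) \<le> measure lebesgue ?U + measure lebesgue ?N"
    using U by (intro measure_Un_le) auto
  moreover have "?U \<union> ?N \<in> lmeasurable" by (rule fmeasurable.Un[OF U(1) \<open>?N \<in> lmeasurable\<close>])
  ultimately show "\<exists>T. ?E \<subseteq> T \<and> T \<in> lmeasurable \<and> measure lebesgue T \<le> e"
    unfolding EE_def[symmetric] using U(2) by (intro exI[of _ "?U \<union> ?N"]) auto
qed

theorem negligible_not_has_vector_derivative_integral:
  fixes g :: "real \<Rightarrow> 'b::euclidean_space"
  assumes g: "g integrable_on {a..b}"
  shows "\<exists>N. negligible N \<and> (\<forall>x\<in>{a<..<b} - N. ((\<lambda>x. integral {a..x} g) has_vector_derivative g x) (at x))"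
proof (intro exI conjI ballI)
  let ?E = "\<lambda>k. {x\<in>{a..b}. \<forall>d>0. \<exists>y\<in>{a..b}. y \<noteq> x \<and> \<bar>y - x\<bar> < d \<and>
           norm (\<bar>y - x\<bar> *\<^sub>R g x - integral {min x y..max x y} g) > k * \<bar>y - x\<bar>}"
  let ?N = "\<Union>n. ?E (inverse (real (Suc n)))"
  show "negligible ?N"
    by (rule negligible_Union_nat) (rule negligible_bad_difference_quotient[OF g], simp)
  fix x assume x: "x \<in> {a<..<b} - ?N"
  show "((\<lambda>x. integral {a..x} g) has_vector_derivative g x) (at x)"
    unfolding has_vector_derivative_def has_derivative_at_alt
  proof (intro conjI allI impI)
    show "bounded_linear (\<lambda>h. h *\<^sub>R g x)" by (rule bounded_linear_scaleR_left)
    fix e :: real assume "e > 0"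
    then obtain n where n: "inverse (real (Suc n)) < e" using reals_Archimedean by blast
    have "\<not> (\<forall>d>0. \<exists>y\<in>{a..b}. y \<noteq> x \<and> \<bar>y - x\<bar> < d \<and>
           norm (\<bar>y - x\<bar> *\<^sub>R g x - integral {min x y..max x y} g) > inverse (real (Suc n)) * \<bar>y - x\<bar>)"
    proof
      assume "\<forall>d>0. \<exists>y\<in>{a..b}. y \<noteq> x \<and> \<bar>y - x\<bar> < d \<and>
           norm (\<bar>y - x\<bar> *\<^sub>R g x - integral {min x y..max x y} g) > inverse (real (Suc n)) * \<bar>y - x\<bar>"
      then have "x \<in> ?E (inverse (real (Suc n)))" using x by simp
      then show False using x by blast
    qed
    then obtain d where "d > 0" and d: "\<And>y. y\<in>{a..b} \<Longrightarrow> y \<noteq> x \<Longrightarrow> \<bar>y - x\<bar> < d \<Longrightarrow>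
           norm (\<bar>y - x\<bar> *\<^sub>R g x - integral {min x y..max x y} g) \<le> inverse (real (Suc n)) * \<bar>y - x\<bar>"
      by (meson not_less)
    have "norm (integral {a..y} g - integral {a..x} g - (y - x) *\<^sub>R g x) \<le> e * norm (y - x)"
      if y: "norm (y - x) < min d (min (x - a) (b - x))" for y
    proof (cases "y = x")
      case False
      have yab: "y \<in> {a..b}" "\<bar>y - x\<bar> < d" using y by auto
      have int: "g integrable_on {a..max x y}"
        by (rule integrable_on_subinterval[OF g]) (use x yab in auto)
      have eq: "integral {a..min x y} g + integral {min x y..max x y} g = integral {a..max x y} g"
        by (rule Henstock_Kurzweil_Integration.integral_combine) (use x yab int in auto)
      have "norm (integral {a..y} g - integral {a..x} g - (y - x) *\<^sub>R g x) =
            norm (\<bar>y - x\<bar> *\<^sub>R g x - integral {min x y..max x y} g)"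
      proof (cases "x < y")
        case True
        with eq have "integral {a..y} g - integral {a..x} g = integral {x..y} g" by (simp add: algebra_simps)
        with True show ?thesis by (simp add: norm_minus_commute)
      next
        case False
        with eq have "integral {a..x} g - integral {a..y} g = integral {y..x} g" by (simp add: algebra_simps)
        then have *: "integral {a..y} g - integral {a..x} g = - integral {y..x} g" by (simp add: algebra_simps)
        have "\<bar>y - x\<bar> = x - y" "min x y = y" "max x y = x" using False by auto
        then show ?thesis unfolding * by (simp add: algebra_simps)
      qed
      also have "\<dots> \<le> inverse (real (Suc n)) * \<bar>y - x\<bar>" by (rule d[OF yab(1) False yab(2)])
      also have "\<dots> \<le> e * \<bar>y - x\<bar>" using n by (intro mult_right_mono) auto
      finally show ?thesis by simp
    qed simp
    then show "\<exists>d>0. \<forall>y. norm (y - x) < d \<longrightarrow>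
      norm (integral {a..y} g - integral {a..x} g - (y - x) *\<^sub>R g x) \<le> e * norm (y - x)"
      using x \<open>d > 0\<close> by (intro exI[of _ "min d (min (x - a) (b - x))"] conjI allI impI) simp_all
  qed
qed

section \<open>Variation\<close>

definition partition_in :: "real set \<Rightarrow> nat \<Rightarrow> (nat \<Rightarrow> real) \<Rightarrow> bool" where
  "partition_in I n \<tau> \<longleftrightarrow> (\<forall>j\<le>n. \<tau> j \<in> I) \<and> (\<forall>j<n. \<tau> j < \<tau> (Suc j))"

lemma Var_alt: "Var d q I = (SUP (n, \<tau>)\<in>{(n, \<tau>). partition_in I n \<tau>}.
    ennreal (\<Sum>j<n. d (q (\<tau> j)) (q (\<tau> (Suc j)))))"
  unfolding Var_def partition_in_def by (rule arg_cong[where f=Sup]) auto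

lemma Var_ge:
  "partition_in I n \<tau> \<Longrightarrow> ennreal (\<Sum>j<n. d (q (\<tau> j)) (q (\<tau> (Suc j)))) \<le> Var d q I"
  unfolding Var_alt by (rule SUP_upper2[of "(n,\<tau>)"]) auto

lemma Var_le:
  "(\<And>n \<tau>. partition_in I n \<tau> \<Longrightarrow> ennreal (\<Sum>j<n. d (q (\<tau> j)) (q (\<tau> (Suc j)))) \<le> B) \<Longrightarrow> Var d q I \<le> B"
  unfolding Var_alt by (rule SUP_least) auto

lemma Var_mono: "I \<subseteq> J \<Longrightarrow> Var d q I \<le> Var d q J"
  by (rule Var_le, rule Var_ge) (auto simp: partition_in_def)

lemma partition_in_singleton: "x \<in> I \<Longrightarrow> partition_in I 0 (\<lambda>_. x)"
  by (auto simp: partition_in_def)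

lemma partition_in_Suc: "partition_in I (Suc n) \<tau> \<longleftrightarrow> partition_in I n \<tau> \<and> \<tau> (Suc n) \<in> I \<and> \<tau> n < \<tau> (Suc n)"
  by (auto simp: partition_in_def less_Suc_eq le_Suc_eq)

lemma partition_in_append:
  assumes "partition_in I n \<tau>" "x \<in> I" "\<tau> n < x"
  shows "partition_in I (Suc n) (\<tau>(Suc n := x))"
  using assms by (auto simp: partition_in_def less_Suc_eq le_Suc_eq)

lemma sum_fun_upd_Suc:
  "(\<Sum>j<n. f ((\<tau>(Suc n := x)) j) ((\<tau>(Suc n := x)) (Suc j))) = (\<Sum>j<n. f (\<tau> j) (\<tau> (Suc j)))"
  by (intro sum.cong) auto

lemma partition_in_le:
  assumes "partition_in I n \<tau>" "i \<le> j" "j \<le> n"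
  shows "\<tau> i \<le> \<tau> j"
  using assms(2,3)
proof (induction j)
  case (Suc j)
  then show ?case using assms(1) by (cases "i = Suc j") (auto simp: partition_in_def intro: order_trans[OF _ less_imp_le])
qed simp

lemma partition_in_subset:
  assumes "partition_in I n \<tau>" shows "partition_in (I \<inter> {..\<tau> n}) n \<tau>"
  using partition_in_le[OF assms] assms by (auto simp: partition_in_def)

locale variation_dist =
  fixes d :: "'q \<Rightarrow> 'q \<Rightarrow> real"
  assumes d_nonneg: "0 \<le> d x y" and d_self: "d x x = 0" and d_tri: "d x z \<le> d x y + d y z"
begin

lemma Var_singleton: "Var d q {a..a} = 0"
proof -
  have "Var d q {a..a} \<le> 0"
  proof (rule Var_le)
    fix n \<tau> assume p: "partition_in {a..a} n \<tau>"
    have "n = 0"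
    proof (rule ccontr)
      assume "n \<noteq> 0" then have "\<tau> 0 < \<tau> 1" "\<tau> 0 \<in> {a..a}" "\<tau> 1 \<in> {a..a}"
        using p by (auto simp: partition_in_def)
      then show False by simp
    qed
    then show "ennreal (\<Sum>j<n. d (q (\<tau> j)) (q (\<tau> (Suc j)))) \<le> 0" by simp
  qed
  then show ?thesis by simp
qed

lemma Var_ge_append:
  assumes "partition_in I n \<tau>" "x \<in> I" "\<tau> n \<le> x"
  shows "ennreal ((\<Sum>j<n. d (q (\<tau> j)) (q (\<tau> (Suc j)))) + d (q (\<tau> n)) (q x)) \<le> Var d q I"
proof (cases "\<tau> n = x")
  case True
  then show ?thesis using Var_ge[OF assms(1), of d q] by (simp add: d_self)
next
  case False
  then show ?thesis
    using Var_ge[OF partition_in_append[OF assms(1,2)], of d q] assms(3)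
    by (simp add: sum_fun_upd_Suc[of "\<lambda>x y. d (q x) (q y)"] del: fun_upd_apply) simp
qed

lemma dist_le_Var: "u \<in> I \<Longrightarrow> v \<in> I \<Longrightarrow> u \<le> v \<Longrightarrow> ennreal (d (q u) (q v)) \<le> Var d q I"
  using Var_ge_append[OF partition_in_singleton, of u I v q] by simp

lemma Var_step:
  assumes "a \<le> l" "l \<le> r"
  shows "Var d q {a..l} + ennreal (d (q l) (q r)) \<le> Var d q {a..r}"
proof -
  have "ennreal (\<Sum>j<n. d (q (\<tau> j)) (q (\<tau> (Suc j)))) + ennreal (d (q l) (q r)) \<le> Var d q {a..r}"
    if p: "partition_in {a..l} n \<tau>" for n \<tau>
  proof -
    have p': "partition_in {a..r} n \<tau>" and \<tau>n: "\<tau> n \<le> l" using p assms by (auto simp: partition_in_def)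
    have S: "0 \<le> (\<Sum>j<n. d (q (\<tau> j)) (q (\<tau> (Suc j))))" by (intro sum_nonneg d_nonneg)
    show ?thesis
    proof (cases "\<tau> n = l")
      case True
      then show ?thesis using Var_ge_append[OF p', of r q] assms S d_nonneg by (simp add: ennreal_plus)
    next
      case False
      then have "partition_in {a..r} (Suc n) (\<tau>(Suc n := l))"
        using \<tau>n assms by (intro partition_in_append p') auto
      from Var_ge_append[OF this, of r q] assms
      have "ennreal ((\<Sum>j<n. d (q (\<tau> j)) (q (\<tau> (Suc j)))) + d (q (\<tau> n)) (q l) + d (q l) (q r)) \<le> Var d q {a..r}"
        by (simp add: sum_fun_upd_Suc[of "\<lambda>x y. d (q x) (q y)"] del: fun_upd_apply) simp
      moreover have "ennreal (\<Sum>j<n. d (q (\<tau> j)) (q (\<tau> (Suc j)))) + ennreal (d (q l) (q r)) \<le>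
         ennreal ((\<Sum>j<n. d (q (\<tau> j)) (q (\<tau> (Suc j)))) + d (q (\<tau> n)) (q l) + d (q l) (q r))"
        using S d_nonneg by (simp add: ennreal_plus[symmetric] del: ennreal_plus)
      ultimately show ?thesis by (rule order_trans[rotated])
    qed
  qed
  moreover have "{(n, \<tau>). partition_in {a..l} n \<tau>} \<noteq> {}"
    using partition_in_singleton[of a "{a..l}"] assms by auto
  ultimately show ?thesis
    unfolding Var_alt[of d q "{a..l}"]
    by (subst ennreal_SUP_add_left[symmetric]) (auto intro!: SUP_least)
qed

lemma Var_subadd:
  assumes "a \<le> t" "t \<le> u"
  shows "Var d q {a..u} \<le> Var d q {a..t} + Var d q {t..u}"
proof (rule Var_le)
  fix n \<tau> assume "partition_in {a..u} n \<tau>"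
  then have "ennreal (\<Sum>j<n. d (q (\<tau> j)) (q (\<tau> (Suc j)))) \<le> Var d q {a..t} + (if \<tau> n \<le> t then 0 else Var d q {t..\<tau> n})"
  proof (induction n)
    case (Suc n)
    then have p: "partition_in {a..u} n \<tau>" and I: "\<tau> (Suc n) \<in> {a..u}" "\<tau> n < \<tau> (Suc n)"
      by (auto simp: partition_in_Suc)
    have S: "0 \<le> (\<Sum>j<n. d (q (\<tau> j)) (q (\<tau> (Suc j))))" by (intro sum_nonneg d_nonneg)
    consider "\<tau> (Suc n) \<le> t" | "\<tau> n \<le> t" "t < \<tau> (Suc n)" | "t < \<tau> n" by linarith
    then show ?case
    proof cases
      case 1
      have "partition_in {a..t} (Suc n) \<tau>"
        using partition_in_subset[OF Suc.prems] 1 by (auto simp: partition_in_def)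
      from Var_ge[OF this, of d q] 1 show ?thesis by simp
    next
      case 2
      have "partition_in {a..t} n \<tau>"
        using partition_in_subset[OF p] 2 by (auto simp: partition_in_def)
      from Var_ge_append[OF this, of t q] 2 assms
      have "ennreal ((\<Sum>j<n. d (q (\<tau> j)) (q (\<tau> (Suc j)))) + d (q (\<tau> n)) (q t)) \<le> Var d q {a..t}" by simp
      moreover have "ennreal (d (q t) (q (\<tau> (Suc n)))) \<le> Var d q {t..\<tau> (Suc n)}"
        using 2 by (intro dist_le_Var) auto
      ultimately have "ennreal ((\<Sum>j<n. d (q (\<tau> j)) (q (\<tau> (Suc j)))) + d (q (\<tau> n)) (q t)) +
         ennreal (d (q t) (q (\<tau> (Suc n)))) \<le> Var d q {a..t} + Var d q {t..\<tau> (Suc n)}"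
        by (rule add_mono)
      moreover have "ennreal (\<Sum>j<Suc n. d (q (\<tau> j)) (q (\<tau> (Suc j)))) \<le>
         ennreal ((\<Sum>j<n. d (q (\<tau> j)) (q (\<tau> (Suc j)))) + d (q (\<tau> n)) (q t)) + ennreal (d (q t) (q (\<tau> (Suc n))))"
        using S d_nonneg d_tri[of "q (\<tau> n)" "q (\<tau> (Suc n))" "q t"]
        by (simp add: ennreal_plus[symmetric] del: ennreal_plus)
      ultimately show ?thesis using 2 by (auto intro: order_trans)
    next
      case 3
      have "ennreal (\<Sum>j<n. d (q (\<tau> j)) (q (\<tau> (Suc j)))) \<le> Var d q {a..t} + Var d q {t..\<tau> n}"
        using Suc.IH[OF p] 3 by simp
      then have "ennreal (\<Sum>j<n. d (q (\<tau> j)) (q (\<tau> (Suc j)))) + ennreal (d (q (\<tau> n)) (q (\<tau> (Suc n))))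
         \<le> Var d q {a..t} + (Var d q {t..\<tau> n} + ennreal (d (q (\<tau> n)) (q (\<tau> (Suc n)))))"
        by (metis add.assoc add_right_mono)
      also have "\<dots> \<le> Var d q {a..t} + Var d q {t..\<tau> (Suc n)}"
        using 3 I by (intro add_left_mono Var_step) auto
      finally show ?thesis using 3 I S d_nonneg by (simp add: ennreal_plus)
    qed
  qed simp
  also have "\<dots> \<le> Var d q {a..t} + Var d q {t..u}"
    using \<open>partition_in {a..u} n \<tau>\<close>
    by (intro add_left_mono) (auto intro!: Var_mono simp: partition_in_def)
  finally show "ennreal (\<Sum>j<n. d (q (\<tau> j)) (q (\<tau> (Suc j)))) \<le> Var d q {a..t} + Var d q {t..u}" .
qed

lemma Var_le_telescope:
  assumes H: "\<And>u v. a \<le> u \<Longrightarrow> u \<le> v \<Longrightarrow> v \<le> b \<Longrightarrow> d (q u) (q v) \<le> H v - H u" and "a \<le> b"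
  shows "Var d q {a..b} \<le> ennreal (H b - H a)"
proof (rule Var_le)
  fix n \<tau> assume p: "partition_in {a..b} n \<tau>"
  then have "(\<Sum>j<n. d (q (\<tau> j)) (q (\<tau> (Suc j)))) \<le> H (\<tau> n) - H (\<tau> 0)"
  proof (induction n)
    case (Suc n)
    then have "d (q (\<tau> n)) (q (\<tau> (Suc n))) \<le> H (\<tau> (Suc n)) - H (\<tau> n)"
      by (intro H) (auto simp: partition_in_def less_imp_le)
    with Suc show ?case by (simp add: partition_in_Suc)
  qed simp
  also have "\<dots> \<le> H b - H a"
  proof -
    have "\<tau> n \<in> {a..b}" "\<tau> 0 \<in> {a..b}" using p by (auto simp: partition_in_def)
    then show ?thesis
      using H[of a "\<tau> 0"] H[of "\<tau> n" b] d_nonneg[of "q a" "q (\<tau> 0)"] d_nonneg[of "q (\<tau> n)" "q b"] by auto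
  qed
  finally show "ennreal (\<Sum>j<n. d (q (\<tau> j)) (q (\<tau> (Suc j)))) \<le> ennreal (H b - H a)"
    by (rule ennreal_leI)
qed

lemma Var_increment_avoiding:
  assumes fin: "Var d q {a..b} < top" and "\<epsilon> > 0" "a \<le> b"
  obtains P where "finite P"
    "\<And>u v. a \<le> u \<Longrightarrow> u \<le> v \<Longrightarrow> v \<le> b \<Longrightarrow> {u<..<v} \<inter> P = {} \<Longrightarrow>
       enn2real (Var d q {a..v}) - enn2real (Var d q {a..u}) \<le> d (q u) (q v) + \<epsilon>"
proof -
  define V where "V x = enn2real (Var d q {a..x})" for x
  have V: "ennreal (V x) = Var d q {a..x}" if "x \<le> b" for x
  proof -
    have "Var d q {a..x} \<le> Var d q {a..b}" by (rule Var_mono) (use that in auto)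
    then show ?thesis using fin unfolding V_def by (simp add: order_le_less_trans)
  qed
  have V0: "0 \<le> V x" for x by (simp add: V_def)
  have step: "V l + d (q l) (q r) \<le> V r" if "a \<le> l" "l \<le> r" "r \<le> b" for l r
  proof -
    have "ennreal (V l + d (q l) (q r)) \<le> ennreal (V r)"
      using Var_step[OF that(1,2), of q] that V V0 d_nonneg by (simp add: ennreal_plus)
    then show ?thesis using V0 by simp
  qed
  have "\<exists>n \<tau>. partition_in {a..b} n \<tau> \<and> V b - \<epsilon> < (\<Sum>j<n. d (q (\<tau> j)) (q (\<tau> (Suc j))))"
  proof (rule ccontr)
    assume "\<not> ?thesis"
    then have "Var d q {a..b} \<le> ennreal (V b - \<epsilon>)" by (intro Var_le ennreal_leI) (auto simp: not_less)
    then have *: "ennreal (V b) \<le> ennreal (V b - \<epsilon>)" using V by simp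
    then have "V b = 0"
      using \<open>\<epsilon> > 0\<close> V0[of b] by (cases "0 \<le> V b - \<epsilon>") (auto simp: ennreal_neg)
    then have "V b - \<epsilon> < (\<Sum>j<(0::nat). d (q a) (q a))" using \<open>\<epsilon> > 0\<close> by simp
    with \<open>\<not> ?thesis\<close> show False
      using partition_in_singleton[of a "{a..b}"] \<open>a \<le> b\<close> by fastforce
  qed
  then obtain n \<tau> where p: "partition_in {a..b} n \<tau>" and n: "V b - \<epsilon> < (\<Sum>j<n. d (q (\<tau> j)) (q (\<tau> (Suc j))))"
    by blast
  show thesis
  proof (rule that[of "\<tau> ` {..n}"])
    fix u v assume uv: "a \<le> u" "u \<le> v" "v \<le> b" "{u<..<v} \<inter> \<tau> ` {..n} = {}"
    have "(\<Sum>j<n. d (q (\<tau> j)) (q (\<tau> (Suc j)))) \<le> V (\<tau> n) + (if \<tau> n \<le> u then 0 else d (q u) (q v) + V u - V v)"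
      using p uv(4)
    proof (induction n)
      case (Suc n)
      then have p: "partition_in {a..b} n \<tau>" and I: "\<tau> (Suc n) \<in> {a..b}" "\<tau> n \<in> {a..b}" "\<tau> n < \<tau> (Suc n)"
        by (auto simp: partition_in_Suc) (auto simp: partition_in_def)
      have IH: "(\<Sum>j<n. d (q (\<tau> j)) (q (\<tau> (Suc j)))) \<le> V (\<tau> n) + (if \<tau> n \<le> u then 0 else d (q u) (q v) + V u - V v)"
        using Suc.IH[OF p] Suc.prems(2) by force
      have "\<tau> (Suc n) \<notin> {u<..<v}" using Suc.prems(2) by blast
      then consider "\<tau> (Suc n) \<le> u" | "u < \<tau> n" | "\<tau> n \<le> u" "v \<le> \<tau> (Suc n)" "u < \<tau> (Suc n)" by force
      then show ?case
      proof cases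
        case 1
        then show ?thesis using IH step[of "\<tau> n" "\<tau> (Suc n)"] I uv by auto
      next
        case 2
        then show ?thesis using IH step[of "\<tau> n" "\<tau> (Suc n)"] I uv by auto
      next
        case 3
        have "d (q (\<tau> n)) (q (\<tau> (Suc n))) \<le> d (q (\<tau> n)) (q u) + d (q u) (q v) + d (q v) (q (\<tau> (Suc n)))"
          using d_tri[of "q (\<tau> n)" "q (\<tau> (Suc n))" "q u"] d_tri[of "q u" "q (\<tau> (Suc n))" "q v"] by linarith
        then show ?thesis using IH 3 step[of "\<tau> n" u] step[of v "\<tau> (Suc n)"] I uv by auto
      qed
    next
      case 0
      then have "\<tau> 0 \<in> {a..b}" "\<tau> 0 \<le> u \<or> v \<le> \<tau> 0" by (force simp: partition_in_def)+
      then show ?case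
        using step[of v "\<tau> 0"] uv V0[of "\<tau> 0"] V0[of u] d_nonneg[of "q u" "q v"] d_nonneg[of "q v" "q (\<tau> 0)"]
        by auto
    qed
    moreover have "V (\<tau> n) \<le> V b" "\<tau> n \<le> u \<Longrightarrow> V (\<tau> n) \<le> V u" "V v \<le> V b"
      using p uv step[of "\<tau> n" b] step[of "\<tau> n" u] step[of v b] d_nonneg[of "q (\<tau> n)" "q b"]
        d_nonneg[of "q (\<tau> n)" "q u"] d_nonneg[of "q v" "q b"] by (auto simp: partition_in_def)
    ultimately show "enn2real (Var d q {a..v}) - enn2real (Var d q {a..u}) \<le> d (q u) (q v) + \<epsilon>"
      using n d_nonneg[of "q u" "q v"] unfolding V_def[symmetric] by (auto split: if_splits)
  qed simp
qed

end

section \<open>Absolutely continuous functions\<close>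

definition ac_modulus :: "real \<Rightarrow> real \<Rightarrow> (real \<Rightarrow> 'a::real_normed_vector) \<Rightarrow> real \<Rightarrow> real \<Rightarrow> bool" where
  "ac_modulus a b f \<epsilon> \<delta> \<longleftrightarrow> (\<forall>(n::nat) l r.
     (\<forall>i<n. a \<le> l i \<and> l i \<le> r i \<and> r i \<le> b) \<and>
     (\<forall>i<n. \<forall>j<n. i \<noteq> j \<longrightarrow> {l i<..<r i} \<inter> {l j<..<r j} = {}) \<and>
     (\<Sum>i<n. r i - l i) < \<delta> \<longrightarrow> (\<Sum>i<n. norm (f (r i) - f (l i))) < \<epsilon>)"

lemma abs_cont_iff_modulus: "abs_cont a b f \<longleftrightarrow> (\<forall>\<epsilon>>0. \<exists>\<delta>>0. ac_modulus a b f \<epsilon> \<delta>)"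
  unfolding abs_cont_def ac_modulus_def ..

lemma abs_cont_modulus:
  assumes "abs_cont a b f" "\<epsilon> > 0"
  obtains \<delta> where "\<delta> > 0" "ac_modulus a b f \<epsilon> \<delta>"
  using assms unfolding abs_cont_iff_modulus by blast

lemma ac_modulusI:
  assumes "\<And>(n::nat) l r. \<lbrakk>\<And>i. i < n \<Longrightarrow> a \<le> l i \<and> l i \<le> r i \<and> r i \<le> b;
     \<And>i j. i < n \<Longrightarrow> j < n \<Longrightarrow> i \<noteq> j \<Longrightarrow> {l i<..<r i} \<inter> {l j<..<r j} = {}; (\<Sum>i<n. r i - l i) < \<delta>\<rbrakk>
     \<Longrightarrow> (\<Sum>i<n. norm (f (r i) - f (l i))) < \<epsilon>"
  shows "ac_modulus a b f \<epsilon> \<delta>"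
  unfolding ac_modulus_def
proof (intro allI impI, elim conjE)
  fix n :: nat and l r :: "nat \<Rightarrow> real"
  assume "\<forall>i<n. a \<le> l i \<and> l i \<le> r i \<and> r i \<le> b"
    "\<forall>i<n. \<forall>j<n. i \<noteq> j \<longrightarrow> {l i<..<r i} \<inter> {l j<..<r j} = {}" "(\<Sum>i<n. r i - l i) < \<delta>"
  then show "(\<Sum>i<n. norm (f (r i) - f (l i))) < \<epsilon>" by (intro assms) blast+
qed

lemma ac_modulusD:
  fixes I :: "'i set"
  assumes m: "ac_modulus a b f \<epsilon> \<delta>"
    and I: "finite I" "\<And>i. i \<in> I \<Longrightarrow> a \<le> l i \<and> l i \<le> r i \<and> r i \<le> b"
     "\<And>i j. i \<in> I \<Longrightarrow> j \<in> I \<Longrightarrow> i \<noteq> j \<Longrightarrow> {l i<..<r i} \<inter> {l j<..<r j} = {}" "(\<Sum>i\<in>I. r i - l i) < \<delta>"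
  shows "(\<Sum>i\<in>I. norm (f (r i) - f (l i))) < \<epsilon>"
proof -
  obtain h where h: "bij_betw h {..<card I} I"
    using ex_bij_betw_nat_finite[OF I(1)] by (auto simp: atLeast0LessThan)
  have hI: "h i \<in> I" if "i < card I" for i using h that by (auto simp: bij_betw_def)
  have "(\<Sum>i<card I. norm (f (r (h i)) - f (l (h i)))) < \<epsilon>"
  proof (rule m[unfolded ac_modulus_def, THEN spec, THEN spec, THEN spec, THEN mp], intro conjI)
    show "\<forall>i<card I. a \<le> l (h i) \<and> l (h i) \<le> r (h i) \<and> r (h i) \<le> b" using I(2) hI by blast
    show "\<forall>i<card I. \<forall>j<card I. i \<noteq> j \<longrightarrow> {l (h i)<..<r (h i)} \<inter> {l (h j)<..<r (h j)} = {}"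
    proof (intro allI impI)
      fix i j assume ij: "i < card I" "j < card I" "i \<noteq> j"
      then have "h i \<noteq> h j" using h by (auto simp: bij_betw_def inj_on_def)
      then show "{l (h i)<..<r (h i)} \<inter> {l (h j)<..<r (h j)} = {}" using ij by (intro I(3) hI)
    qed
    show "(\<Sum>i<card I. r (h i) - l (h i)) < \<delta>"
      using I(4) sum.reindex_bij_betw[OF h, of "\<lambda>i. r i - l i"] by simp
  qed
  then show ?thesis
    using sum.reindex_bij_betw[OF h, of "\<lambda>i. norm (f (r i) - f (l i))"] by simp
qed

lemma ac_modulus_dist:
  assumes "ac_modulus a b f \<epsilon> \<delta>" "a \<le> x" "x \<le> y" "y \<le> b" "y - x < \<delta>"
  shows "norm (f y - f x) < \<epsilon>"
  using ac_modulusD[OF assms(1), of "{0::nat}" "\<lambda>_. x" "\<lambda>_. y"] assms by simp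

lemma abs_cont_imp_continuous_on:
  assumes "abs_cont a b f"
  shows "continuous_on {a..b} f"
  unfolding continuous_on_iff
proof (intro ballI allI impI)
  fix x and e :: real assume x: "x \<in> {a..b}" and "0 < e"
  obtain \<delta> where "\<delta> > 0" and \<delta>: "ac_modulus a b f e \<delta>"
    using abs_cont_modulus[OF assms \<open>0 < e\<close>] by blast
  have "dist (f x') (f x) < e" if "x' \<in> {a..b}" "dist x' x < \<delta>" for x'
    using ac_modulus_dist[OF \<delta>, of x x'] ac_modulus_dist[OF \<delta>, of x' x] that x
    by (cases "x \<le> x'") (auto simp: dist_norm norm_minus_commute)
  then show "\<exists>d>0. \<forall>x'\<in>{a..b}. dist x' x < d \<longrightarrow> dist (f x') (f x) < e"
    using \<open>\<delta> > 0\<close> by blast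
qed

lemma abs_cont_add:
  assumes "abs_cont a b f" "abs_cont a b g"
  shows "abs_cont a b (\<lambda>x. f x + g x)"
  unfolding abs_cont_iff_modulus
proof (intro allI impI)
  fix \<epsilon> :: real assume "\<epsilon> > 0"
  then have e2: "\<epsilon> / 2 > 0" by simp
  obtain d1 where "d1 > 0" and d1: "ac_modulus a b f (\<epsilon>/2) d1"
    using abs_cont_modulus[OF assms(1) e2] by blast
  obtain d2 where "d2 > 0" and d2: "ac_modulus a b g (\<epsilon>/2) d2"
    using abs_cont_modulus[OF assms(2) e2] by blast
  have "ac_modulus a b (\<lambda>x. f x + g x) \<epsilon> (min d1 d2)"
  proof (rule ac_modulusI)
    fix n :: nat and l r
    assume *: "\<And>i. i < n \<Longrightarrow> a \<le> l i \<and> l i \<le> r i \<and> r i \<le> b"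
      "\<And>i j. i < n \<Longrightarrow> j < n \<Longrightarrow> i \<noteq> j \<Longrightarrow> {l i<..<r i} \<inter> {l j<..<r j} = {}" "(\<Sum>i<n. r i - l i) < min d1 d2"
    have "(\<Sum>i<n. norm (f (r i) - f (l i))) < \<epsilon> / 2"
      by (rule ac_modulusD[OF d1]) (use * in \<open>simp_all del: Int_greaterThanLessThan\<close>)
    moreover have "(\<Sum>i<n. norm (g (r i) - g (l i))) < \<epsilon> / 2"
      by (rule ac_modulusD[OF d2]) (use * in \<open>simp_all del: Int_greaterThanLessThan\<close>)
    moreover have "(\<Sum>i<n. norm ((f (r i) + g (r i)) - (f (l i) + g (l i)))) \<le>
        (\<Sum>i<n. norm (f (r i) - f (l i)) + norm (g (r i) - g (l i)))"
      by (intro sum_mono) (metis add_diff_add norm_triangle_ineq)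
    ultimately show "(\<Sum>i<n. norm ((f (r i) + g (r i)) - (f (l i) + g (l i)))) < \<epsilon>"
      by (simp add: sum.distrib)
  qed
  then show "\<exists>\<delta>>0. ac_modulus a b (\<lambda>x. f x + g x) \<epsilon> \<delta>"
    using \<open>d1 > 0\<close> \<open>d2 > 0\<close> by (intro exI[of _ "min d1 d2"]) auto
qed

lemma abs_cont_dominated:
  assumes g: "abs_cont a b g"
    and "\<And>x y. a \<le> x \<Longrightarrow> x \<le> y \<Longrightarrow> y \<le> b \<Longrightarrow> norm (f y - f x) \<le> norm (g y - g x)"
  shows "abs_cont a b f"
  unfolding abs_cont_iff_modulus
proof (intro allI impI)
  fix \<epsilon> :: real assume "\<epsilon> > 0"
  then obtain \<delta> where "\<delta> > 0" and \<delta>: "ac_modulus a b g \<epsilon> \<delta>"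
    using abs_cont_modulus[OF g] by blast
  have "ac_modulus a b f \<epsilon> \<delta>"
  proof (rule ac_modulusI)
    fix n :: nat and l r
    assume *: "\<And>i. i < n \<Longrightarrow> a \<le> l i \<and> l i \<le> r i \<and> r i \<le> b"
      "\<And>i j. i < n \<Longrightarrow> j < n \<Longrightarrow> i \<noteq> j \<Longrightarrow> {l i<..<r i} \<inter> {l j<..<r j} = {}" "(\<Sum>i<n. r i - l i) < \<delta>"
    have "(\<Sum>i<n. norm (f (r i) - f (l i))) \<le> (\<Sum>i<n. norm (g (r i) - g (l i)))"
      by (intro sum_mono assms(2)) (use * in auto)
    also have "\<dots> < \<epsilon>" by (rule ac_modulusD[OF \<delta>]) (use * in \<open>simp_all del: Int_greaterThanLessThan\<close>)
    finally show "(\<Sum>i<n. norm (f (r i) - f (l i))) < \<epsilon>" .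
  qed
  with \<open>\<delta> > 0\<close> show "\<exists>\<delta>>0. ac_modulus a b f \<epsilon> \<delta>" by blast
qed

text \<open>The Stieltjes measure of a monotone absolutely continuous function has a density by
  Radon--Nikodym.\<close>

lemma mono_abs_cont_integral:
  fixes g :: "real \<Rightarrow> real"
  assumes ac: "abs_cont a b g" and mono: "mono_on {a..b} g" and ab: "a < b"
  obtains h where "\<And>x. 0 \<le> h x"
    "\<And>l r. a \<le> l \<Longrightarrow> l \<le> r \<Longrightarrow> r \<le> b \<Longrightarrow> (h has_integral (g r - g l)) {l..r}"
proof -
  define c where "c x = max a (min b x)" for x
  define G where "G x = g (c x)" for x
  have c: "c x \<in> {a..b}" for x using ab by (auto simp: c_def)
  have c_id: "c x = x" if "x \<in> {a..b}" for x using that by (auto simp: c_def)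
  have G_mono: "G x \<le> G y" if "x \<le> y" for x y
    unfolding G_def by (rule mono_onD[OF mono c c]) (use that in \<open>auto simp: c_def\<close>)
  have "continuous_on UNIV c" unfolding c_def by (intro continuous_intros)
  then have G_cont: "continuous_on UNIV G"
    unfolding G_def by (rule continuous_on_compose2[OF abs_cont_imp_continuous_on[OF ac]]) (use c in auto)
  have G_right: "continuous (at_right x) G" for x
    using G_cont by (auto simp: continuous_on_eq_continuous_within intro: continuous_at_imp_continuous_at_within)
  let ?M = "interval_measure G"
  have Ioc: "emeasure ?M {l<..r} = ennreal (G r - G l)" if "l \<le> r" for l r
    by (rule emeasure_interval_measure_Ioc) (use that G_mono G_right in auto)
  have Icc: "emeasure ?M {l..r} = ennreal (G r - G l)" if "l \<le> r" for l r
    by (rule emeasure_interval_measure_Icc) (use that G_mono G_cont in auto)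
  have "absolutely_continuous lborel ?M"
    unfolding absolutely_continuous_def
  proof
    fix N :: "real set" assume N: "N \<in> null_sets lborel"
    then have [measurable]: "N \<in> sets borel" by auto
    have ab0: "emeasure ?M (N \<inter> {a..b}) \<le> ennreal \<epsilon>" if "\<epsilon> > 0" for \<epsilon>
    proof -
      obtain \<delta> where "\<delta> > 0" and \<delta>: "ac_modulus a b g \<epsilon> \<delta>"
        using abs_cont_modulus[OF ac \<open>\<epsilon> > 0\<close>] by blast
      obtain U where U: "open U" "N \<subseteq> U" "emeasure lborel (U - N) \<le> \<delta> / 2"
        using outer_regular_lborel_le[of N "\<delta>/2"] \<open>\<delta> > 0\<close> by auto
      have "emeasure lborel U \<le> emeasure lborel (U - N) + emeasure lborel N"
        using U by (intro order_trans[OF emeasure_mono[of U "(U - N) \<union> N"] emeasure_subadditive]) auto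
      then have lU: "emeasure lborel U \<le> ennreal (\<delta> / 2)" using U N by (auto simp: null_sets_def)
      have mU: "U \<in> lmeasurable" "measure lebesgue U \<le> \<delta> / 2"
      proof -
        show "U \<in> lmeasurable" using U(1) lU by (auto simp: fmeasurable_def top.not_eq_extremum intro: le_less_trans)
        show "measure lebesgue U \<le> \<delta> / 2"
          using enn2real_leI[OF _ lU] \<open>\<delta> > 0\<close> U(1) by (simp add: measure_def)
      qed
      let ?\<gamma> = "\<lambda>x. if x \<in> U then U else UNIV"
      have cov: "N \<inter> {a..b} \<subseteq> cbox a b" "box a b \<noteq> {}" "gauge ?\<gamma>"
        using U ab by (auto simp: gauge_def)
      have "\<exists>D. countable D \<and> \<Union>D \<subseteq> cbox a b \<and> (\<forall>K\<in>D. interior K \<noteq> {} \<and> (\<exists>c d. K = cbox c d)) \<and>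
         pairwise (\<lambda>A B. interior A \<inter> interior B = {}) D \<and>
         (\<forall>K\<in>D. \<exists>x \<in> (N \<inter> {a..b}) \<inter> K. K \<subseteq> ?\<gamma> x) \<and> N \<inter> {a..b} \<subseteq> \<Union>D"
      proof (rule covering_lemma[OF cov], goal_cases)
        case (1 D)
        show ?case
          by (intro exI[of _ D] conjI ballI) (rule 1(1,2,4,5,7) 1(3)[THEN conjunct1] 1(3)[THEN conjunct2] | assumption)+
      qed
      then obtain D where D: "countable D" "\<Union>D \<subseteq> cbox a b"
         "\<forall>K\<in>D. interior K \<noteq> {} \<and> (\<exists>c d. K = cbox c d)"
         "pairwise (\<lambda>A B. interior A \<inter> interior B = {}) D"
         "\<forall>K\<in>D. \<exists>x \<in> (N \<inter> {a..b}) \<inter> K. K \<subseteq> ?\<gamma> x" "N \<inter> {a..b} \<subseteq> \<Union>D"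
        by (elim exE conjE) (rule that)
      have DU: "K \<subseteq> U" if "K \<in> D" for K using D(5)[THEN bspec, OF that] U(2) by (auto split: if_splits)
      have DI: "\<exists>l r. l < r \<and> K = {l..r}" if Kin: "K \<in> D" for K
      proof -
        obtain l r where "interior K \<noteq> {}" "K = {l..r}" using D(3)[THEN bspec, OF Kin] by (auto simp: cbox_interval)
        then show ?thesis by (intro exI[of _ l] exI[of _ r]) auto
      qed
      then obtain l r where lr: "\<And>K. K \<in> D \<Longrightarrow> l K < r K \<and> K = {l K..r K}" by metis
      have Kfm: "K \<in> lmeasurable" if "K \<in> D" for K
      proof -
        have "{l K..r K} \<in> lmeasurable" by simp
        then show ?thesis using lr[OF that] by metis
      qed
      have bound: "measure ?M (\<Union>F) \<le> \<epsilon>" if F: "F \<subseteq> D" "finite F" for F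
      proof -
        have "(\<Sum>K\<in>F. r K - l K) = (\<Sum>K\<in>F. measure lebesgue K)"
        proof (rule sum.cong)
          fix K assume "K \<in> F" then have "l K < r K" "K = {l K..r K}" using lr[of K] F by auto
          moreover from \<open>l K < r K\<close> have "measure lebesgue {l K..r K} = r K - l K" by simp
          ultimately show "r K - l K = measure lebesgue K" by metis
        qed simp
        also have "\<dots> = measure lebesgue (\<Union>F)"
        proof (rule measure_negligible_finite_Union[symmetric])
          show "pairwise (\<lambda>S T. negligible (S \<inter> T)) F"
          proof (rule pairwiseI)
            fix A B assume AB: "A \<in> F" "B \<in> F" "A \<noteq> B"
            then have "interior A \<inter> interior B = {}" using D(4) F by (meson pairwiseD subsetD)
            moreover have "A = {l A..r A}" "B = {l B..r B}" using AB F lr by auto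
            moreover have "{l A..r A} \<inter> {l B..r B} = cbox (max (l A) (l B)) (min (r A) (r B))"
              by (auto simp: cbox_interval)
            ultimately show "negligible (A \<inter> B)"
              by (metis interior_Int interior_cbox negligible_interval(1))
          qed
        qed (use F Kfm in auto)
        also have "\<dots> \<le> measure lebesgue U"
          by (rule measure_mono_fmeasurable)
             (use DU F mU Kfm in \<open>auto intro!: sets.finite_Union\<close>)
        also have "\<dots> < \<delta>" using mU \<open>\<delta> > 0\<close> by linarith
        finally have "(\<Sum>K\<in>F. r K - l K) < \<delta>" .
        moreover have lrab: "a \<le> l K \<and> l K \<le> r K \<and> r K \<le> b" if "K \<in> F" for K
        proof -
          have "l K < r K" "K = {l K..r K}" using lr[of K] F that by auto
          moreover have "K \<subseteq> {a..b}" using D(2) F that by (auto simp: cbox_interval)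
          ultimately show ?thesis by (metis atLeastatMost_subset_iff less_imp_le)
        qed
        moreover have "{l i<..<r i} \<inter> {l j<..<r j} = {}" if "i \<in> F" "j \<in> F" "i \<noteq> j" for i j
        proof -
          have "interior i \<inter> interior j = {}" using D(4) F that by (meson pairwiseD subsetD)
          moreover have "interior i = {l i<..<r i}" "interior j = {l j<..<r j}"
            using lr F that by (metis subsetD interior_atLeastAtMost_real)+
          ultimately show ?thesis by simp
        qed
        ultimately have S: "(\<Sum>i\<in>F. norm (g (r i) - g (l i))) < \<epsilon>" using F(2) by (intro ac_modulusD[OF \<delta>]) auto
        have "emeasure ?M (\<Union>K\<in>F. {l K..r K}) \<le> (\<Sum>K\<in>F. emeasure ?M {l K..r K})"
          by (rule emeasure_subadditive_finite) (use F in auto)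
        also have "\<dots> = (\<Sum>K\<in>F. ennreal (norm (g (r K) - g (l K))))"
        proof (rule sum.cong)
          fix K assume "K \<in> F"
          from lrab[OF this] show "emeasure ?M {l K..r K} = ennreal (norm (g (r K) - g (l K)))"
            using G_mono[of "l K" "r K"] by (subst Icc) (auto simp: G_def c_id)
        qed simp
        also have "\<dots> = ennreal (\<Sum>K\<in>F. norm (g (r K) - g (l K)))" by (rule sum_ennreal) auto
        also have "\<dots> \<le> ennreal \<epsilon>" using S by (intro ennreal_leI) auto
        also have "(\<Union>K\<in>F. {l K..r K}) = (\<Union>K\<in>F. K)"
          by (rule SUP_cong[OF refl]) (use F lr in \<open>metis subsetD\<close>)
        finally show ?thesis using \<open>\<epsilon> > 0\<close> unfolding measure_def by (intro enn2real_leI) auto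
      qed
      have fm: "K \<in> fmeasurable ?M" if "K \<in> D" for K
      proof -
        have "l K < r K" "K = {l K..r K}" using lr[OF that] by auto
        moreover have "{l K..r K} \<in> fmeasurable ?M" using Icc[of "l K" "r K"] \<open>l K < r K\<close> by (intro fmeasurableI) auto
        ultimately show ?thesis by metis
      qed
      have "measure ?M (\<Union>D) \<le> \<epsilon>" "(\<Union>D) \<in> fmeasurable ?M"
        using measure_UN_bound[OF D(1), of "\<lambda>K. K" ?M \<epsilon>] fmeasurable_UN_bound[OF D(1), of "\<lambda>K. K" ?M \<epsilon>] fm bound by auto
      then have "emeasure ?M (\<Union>D) \<le> ennreal \<epsilon>"
        by (simp add: emeasure_eq_measure2 ennreal_leI)
      moreover have "emeasure ?M (N \<inter> {a..b}) \<le> emeasure ?M (\<Union>D)"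
        using D(6) \<open>(\<Union>D) \<in> fmeasurable ?M\<close> by (intro emeasure_mono) (auto dest: fmeasurableD)
      ultimately show ?thesis by simp
    qed
    have "emeasure ?M (N \<inter> {a..b}) = 0"
      by (metis ab0 ennreal_le_epsilon add_0 le_zero_eq)
    moreover have "emeasure ?M (- {a..b}) = 0"
    proof -
      have "emeasure ?M {- real n<..a} = 0" "emeasure ?M {b<..real n} = 0" for n
        using Ioc[of "- real n" a] Ioc[of b "real n"] ab
        by (cases "- real n \<le> a"; cases "b \<le> real n"; auto simp: G_def c_def min_absorb1 max_absorb2)+
      moreover have "emeasure ?M {a} = 0" using Icc[of a a] by simp
      ultimately have "(\<Union>n. {- real n<..a} \<union> {b<..real n}) \<in> null_sets ?M"
        by (intro null_sets_UN null_sets.Un null_setsI) auto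
      moreover have "- {a..b} \<subseteq> (\<Union>n. {- real n<..a} \<union> {b<..real n})"
      proof
        fix x assume x: "x \<in> - {a..b}"
        obtain n where "\<bar>x\<bar> < real n" using reals_Archimedean2 by blast
        then show "x \<in> (\<Union>n. {- real n<..a} \<union> {b<..real n})" using x by (intro UN_I[of n]) auto
      qed
      ultimately show ?thesis by (metis emeasure_eq_0 null_setsD1 null_setsD2)
    qed
    ultimately have "(N \<inter> {a..b}) \<union> (- {a..b}) \<in> null_sets ?M" by (intro null_sets.Un null_setsI) auto
    then show "N \<in> null_sets ?M" by (rule null_sets_subset) auto
  qed
  then obtain h where h[measurable]: "h \<in> borel_measurable lborel" and dens: "density lborel h = ?M"
    using sigma_finite_measure.Radon_Nikodym[OF lborel.sigma_finite_measure_axioms, of ?M] by auto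
  have tot: "(\<integral>\<^sup>+x\<in>{a<..b}. h x \<partial>lborel) = ennreal (g b - g a)"
    using Ioc[of a b] ab emeasure_density[of h lborel "{a<..b}"] by (simp add: dens G_def c_id)
  have "AE x in lborel. h x * indicator {a<..b} x \<noteq> \<infinity>"
    by (rule nn_integral_PInf_AE) (use tot in auto)
  then have fin: "AE x in lborel. x \<in> {a<..b} \<longrightarrow> h x \<noteq> \<infinity>" by eventually_elim auto
  define k where "k x = enn2real (h x)" for x
  show thesis
  proof (rule that[of k])
    show "0 \<le> k x" for x by (simp add: k_def)
    fix l r assume lr: "a \<le> l" "l \<le> r" "r \<le> b"
    have gmono: "g l \<le> g r" by (rule mono_onD[OF mono]) (use lr in auto)
    have "(\<integral>\<^sup>+x. ennreal (k x * indicator {l<..r} x) \<partial>lborel) = (\<integral>\<^sup>+x. h x * indicator {l<..r} x \<partial>lborel)"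
    proof (rule nn_integral_cong_AE)
      show "AE x in lborel. ennreal (k x * indicator {l<..r} x) = h x * indicator {l<..r} x"
        using fin by eventually_elim (use lr in \<open>auto simp: k_def indicator_def top.not_eq_extremum\<close>)
    qed
    also have "\<dots> = emeasure ?M {l<..r}" unfolding dens[symmetric] by (rule emeasure_density[symmetric]) auto
    also have "\<dots> = ennreal (g r - g l)" using Ioc[OF lr(2)] lr by (simp add: G_def c_id)
    finally have "((\<lambda>x. k x * indicator {l<..r} x) has_integral (g r - g l)) UNIV"
      using gmono by (intro nn_integral_has_integral) (auto simp: k_def)
    then have "(k has_integral (g r - g l)) {l<..r}"
      by (subst has_integral_restrict_UNIV[symmetric]) (simp add: indicator_def of_bool_def if_distrib[of "(*) _"] cong: if_cong)
    then show "(k has_integral (g r - g l)) {l..r}"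
      by (subst has_integral_spike_set_eq[where T="{l<..r}"]) (auto intro: negligible_subset[of "{l}"])
  qed
qed

global_interpretation dist_var: variation_dist "dist :: 'a::metric_space \<Rightarrow> 'a \<Rightarrow> real"
  by unfold_locales (auto simp: dist_triangle)

lemma partition_in_intervals_disjoint:
  assumes "partition_in I n \<tau>" "i < n" "j < n" "i \<noteq> j"
  shows "{\<tau> i<..<\<tau> (Suc i)} \<inter> {\<tau> j<..<\<tau> (Suc j)} = {}"
proof (cases "i < j")
  case True
  then have "\<tau> (Suc i) \<le> \<tau> j" by (intro partition_in_le[OF assms(1)]) (use assms in auto)
  then show ?thesis by auto
next
  case False
  then have "\<tau> (Suc j) \<le> \<tau> i" by (intro partition_in_le[OF assms(1)]) (use assms in auto)
  then show ?thesis by auto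
qed

lemma Var_le_modulus:
  assumes m: "ac_modulus a b f \<epsilon> \<delta>" and "a \<le> l" "l \<le> r" "r \<le> b" "r - l < \<delta>"
  shows "Var dist f {l..r} \<le> ennreal \<epsilon>"
proof (rule Var_le, rule ennreal_leI)
  fix n \<tau> assume p: "partition_in {l..r} n \<tau>"
  then have \<tau>: "\<And>i. i \<le> n \<Longrightarrow> \<tau> i \<in> {l..r}" "\<And>i. i < n \<Longrightarrow> \<tau> i < \<tau> (Suc i)" by (auto simp: partition_in_def)
  have "(\<Sum>i<n. norm (f (\<tau> (Suc i)) - f (\<tau> i))) < \<epsilon>"
  proof (rule ac_modulusD[OF m])
    show "(\<Sum>i<n. \<tau> (Suc i) - \<tau> i) < \<delta>"
      using \<tau>(1)[of 0] \<tau>(1)[of n] assms(5) by (simp add: sum_lessThan_telescope)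
    fix i assume "i \<in> {..<n}"
    then show "a \<le> \<tau> i \<and> \<tau> i \<le> \<tau> (Suc i) \<and> \<tau> (Suc i) \<le> b"
      using \<tau>(1)[of i] \<tau>(1)[of "Suc i"] \<tau>(2)[of i] assms by auto
  next
    fix i j assume "i \<in> {..<n}" "j \<in> {..<n}" "i \<noteq> j"
    then show "{\<tau> i<..<\<tau> (Suc i)} \<inter> {\<tau> j<..<\<tau> (Suc j)} = {}"
      by (intro partition_in_intervals_disjoint[OF p]) auto
  qed simp
  then show "(\<Sum>j<n. dist (f (\<tau> j)) (f (\<tau> (Suc j)))) \<le> \<epsilon>" by (simp add: dist_norm norm_minus_commute)
qed

lemma abs_cont_Var_finite:
  assumes ac: "abs_cont a b f" and "a \<le> b"
  shows "Var dist f {a..b} < top"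
proof -
  obtain \<delta> where "\<delta> > 0" and \<delta>: "ac_modulus a b f 1 \<delta>" using abs_cont_modulus[OF ac, of 1] by auto
  have "a \<le> a \<and> b \<le> b \<longrightarrow> Var dist f {a..b} < top"
    using \<open>a \<le> b\<close>
  proof (induction rule: Bolzano[where P = "\<lambda>u v. a \<le> u \<and> v \<le> b \<longrightarrow> Var dist f {u..v} < top"])
    case (trans u v w)
    show ?case
    proof
      assume "a \<le> u \<and> w \<le> b"
      then have "Var dist f {u..v} + Var dist f {v..w} < top" using trans by auto
      then show "Var dist f {u..w} < top"
        using dist_var.Var_subadd[OF trans(3,4), of f] by (rule le_less_trans[rotated])
    qed
  next
    case (local x)
    have "Var dist f {u..v} < top" if "a \<le> u \<and> v \<le> b" "u \<le> x \<and> x \<le> v \<and> v - u < \<delta>" for u v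
      using Var_le_modulus[OF \<delta>, of u v] that by (auto intro: le_less_trans)
    then show ?case using \<open>\<delta> > 0\<close> by blast
  qed
  then show ?thesis by simp
qed

lemma partition_approximating_Var:
  assumes "Var d q I < top" "\<eta> > 0" "I \<noteq> {}"
  shows "\<exists>n \<tau>. partition_in I n \<tau> \<and> enn2real (Var d q I) - \<eta> < (\<Sum>j<n. d (q (\<tau> j)) (q (\<tau> (Suc j))))"
proof (rule ccontr)
  assume neg: "\<not> ?thesis"
  have le: "(\<Sum>j<n. d (q (\<tau> j)) (q (\<tau> (Suc j)))) \<le> enn2real (Var d q I) - \<eta>" if p: "partition_in I n \<tau>" for n \<tau>
    using neg p not_less by blast
  obtain x where "x \<in> I" using \<open>I \<noteq> {}\<close> by blast
  have pos: "0 \<le> enn2real (Var d q I) - \<eta>" using le[OF partition_in_singleton[OF \<open>x \<in> I\<close>]] by simp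
  have "Var d q I \<le> ennreal (enn2real (Var d q I) - \<eta>)" by (intro Var_le ennreal_leI le)
  then have "enn2real (Var d q I) \<le> enn2real (Var d q I) - \<eta>" using pos by (intro enn2real_leI)
  then show False using \<open>\<eta> > 0\<close> by simp
qed

lemma abs_cont_variation:
  assumes ac: "abs_cont a b f" and ab: "a < b"
  obtains v where "abs_cont a b v" "mono_on {a..b} v"
    "\<And>l r. a \<le> l \<Longrightarrow> l \<le> r \<Longrightarrow> r \<le> b \<Longrightarrow> norm (f r - f l) \<le> v r - v l"
proof -
  define v where "v x = enn2real (Var dist f {a..x})" for x
  have fin: "Var dist f {l..r} < top" if "a \<le> l" "r \<le> b" for l r
  proof -
    have "Var dist f {l..r} \<le> Var dist f {a..b}" by (rule Var_mono) (use that in auto)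
    also have "\<dots> < top" by (rule abs_cont_Var_finite[OF ac]) (use ab in auto)
    finally show ?thesis .
  qed
  have step: "norm (f r - f l) \<le> v r - v l" if "a \<le> l" "l \<le> r" "r \<le> b" for l r
  proof -
    have "enn2real (Var dist f {a..l} + ennreal (dist (f l) (f r))) \<le> v r"
      unfolding v_def by (rule enn2real_mono[OF dist_var.Var_step[OF that(1,2)]]) (use fin[of a r] that in auto)
    then show ?thesis using fin[of a l] that by (simp add: enn2real_plus v_def dist_norm norm_minus_commute)
  qed
  have sub: "v r - v l \<le> enn2real (Var dist f {l..r})" if "a \<le> l" "l \<le> r" "r \<le> b" for l r
  proof -
    have "v r \<le> enn2real (Var dist f {a..l} + Var dist f {l..r})"
      unfolding v_def by (rule enn2real_mono[OF dist_var.Var_subadd[OF that(1,2)]]) (use fin that in auto)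
    then show ?thesis using fin[of a l] fin[of l r] that by (simp add: enn2real_plus v_def)
  qed
  have "mono_on {a..b} v"
  proof (rule mono_onI)
    fix l r assume "l \<in> {a..b}" "r \<in> {a..b}" "l \<le> r"
    then have "norm (f r - f l) \<le> v r - v l" by (intro step) auto
    then show "v l \<le> v r" using norm_ge_zero[of "f r - f l"] by linarith
  qed
  moreover have "abs_cont a b v"
    unfolding abs_cont_iff_modulus
  proof (intro allI impI)
    fix \<epsilon> :: real assume "\<epsilon> > 0"
    then obtain \<delta> where "\<delta> > 0" and \<delta>: "ac_modulus a b f (\<epsilon>/2) \<delta>" using abs_cont_modulus[OF ac, of "\<epsilon>/2"] by auto
    have "ac_modulus a b v \<epsilon> \<delta>"
    proof (rule ac_modulusI)
      fix n :: nat and l r :: "nat \<Rightarrow> real"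
      assume lr: "\<And>i. i < n \<Longrightarrow> a \<le> l i \<and> l i \<le> r i \<and> r i \<le> b"
        and disj: "\<And>i j. i < n \<Longrightarrow> j < n \<Longrightarrow> i \<noteq> j \<Longrightarrow> {l i<..<r i} \<inter> {l j<..<r j} = {}"
        and tot: "(\<Sum>i<n. r i - l i) < \<delta>"
      define \<eta> where "\<eta> = \<epsilon> / (2 * (real n + 1))"
      have "\<eta> > 0" using \<open>\<epsilon> > 0\<close> by (simp add: \<eta>_def)
      have "\<exists>m \<tau>. i < n \<longrightarrow> partition_in {l i..r i} m \<tau> \<and>
          enn2real (Var dist f {l i..r i}) - \<eta> < (\<Sum>j<m. dist (f (\<tau> j)) (f (\<tau> (Suc j))))" for i
      proof (cases "i < n")
        case True
        have "Var dist f {l i..r i} < top" "{l i..r i} \<noteq> {}" using fin lr[OF True] by auto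
        then show ?thesis using partition_approximating_Var[OF _ \<open>\<eta> > 0\<close>] by blast
      qed auto
      then obtain m \<tau> where p: "\<And>i. i < n \<Longrightarrow> partition_in {l i..r i} (m i) (\<tau> i)"
        and big: "\<And>i. i < n \<Longrightarrow> enn2real (Var dist f {l i..r i}) - \<eta> < (\<Sum>j<m i. dist (f (\<tau> i j)) (f (\<tau> i (Suc j))))"
        by metis
      have \<tau>: "\<tau> i j \<in> {l i..r i}" if "i < n" "j \<le> m i" for i j using p[OF that(1)] that(2) by (auto simp: partition_in_def)
      have \<tau>_less: "\<tau> i j < \<tau> i (Suc j)" if "i < n" "j < m i" for i j using p[OF that(1)] that(2) by (auto simp: partition_in_def)
      let ?I = "SIGMA i:{..<n}. {..<m i}"
      have "(\<Sum>k\<in>?I. norm (f (\<tau> (fst k) (Suc (snd k))) - f (\<tau> (fst k) (snd k)))) < \<epsilon> / 2"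
      proof (rule ac_modulusD[OF \<delta>])
        show "finite ?I" by simp
        have "(\<Sum>k\<in>?I. \<tau> (fst k) (Suc (snd k)) - \<tau> (fst k) (snd k)) = (\<Sum>i<n. \<Sum>j<m i. \<tau> i (Suc j) - \<tau> i j)"
          by (subst sum.Sigma) (auto simp: split_def)
        also have "\<dots> \<le> (\<Sum>i<n. r i - l i)"
        proof (rule sum_mono)
          fix i assume "i \<in> {..<n}"
          then show "(\<Sum>j<m i. \<tau> i (Suc j) - \<tau> i j) \<le> r i - l i"
            using \<tau>[of i 0] \<tau>[of i "m i"] by (simp add: sum_lessThan_telescope)
        qed
        finally show "(\<Sum>k\<in>?I. \<tau> (fst k) (Suc (snd k)) - \<tau> (fst k) (snd k)) < \<delta>" using tot by linarith
        fix k assume k: "k \<in> ?I"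
        then show "a \<le> \<tau> (fst k) (snd k) \<and> \<tau> (fst k) (snd k) \<le> \<tau> (fst k) (Suc (snd k)) \<and> \<tau> (fst k) (Suc (snd k)) \<le> b"
          using \<tau>[of "fst k" "snd k"] \<tau>[of "fst k" "Suc (snd k)"] \<tau>_less[of "fst k" "snd k"] lr[of "fst k"] by auto
        fix k' assume k': "k' \<in> ?I" "k \<noteq> k'"
        show "{\<tau> (fst k) (snd k)<..<\<tau> (fst k) (Suc (snd k))} \<inter> {\<tau> (fst k') (snd k')<..<\<tau> (fst k') (Suc (snd k'))} = {}"
        proof (cases "fst k = fst k'")
          case True
          then have "snd k \<noteq> snd k'" using k' by (auto simp: prod_eq_iff)
          with True k k' show ?thesis
            using partition_in_intervals_disjoint[OF p[of "fst k"], of "snd k" "snd k'"] by auto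
        next
          case False
          have "{l (fst k)<..<r (fst k)} \<inter> {l (fst k')<..<r (fst k')} = {}"
            by (rule disj) (use k k' False in auto)
          moreover have "{\<tau> (fst k) (snd k)<..<\<tau> (fst k) (Suc (snd k))} \<subseteq> {l (fst k)<..<r (fst k)}"
            using \<tau>[of "fst k" "snd k"] \<tau>[of "fst k" "Suc (snd k)"] k by auto
          moreover have "{\<tau> (fst k') (snd k')<..<\<tau> (fst k') (Suc (snd k'))} \<subseteq> {l (fst k')<..<r (fst k')}"
            using \<tau>[of "fst k'" "snd k'"] \<tau>[of "fst k'" "Suc (snd k')"] k' by auto
          ultimately show ?thesis by blast
        qed
      qed
      moreover have "(\<Sum>k\<in>?I. norm (f (\<tau> (fst k) (Suc (snd k))) - f (\<tau> (fst k) (snd k)))) =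
          (\<Sum>i<n. \<Sum>j<m i. dist (f (\<tau> i j)) (f (\<tau> i (Suc j))))"
        by (subst sum.Sigma) (auto simp: split_def dist_norm norm_minus_commute)
      moreover have "(\<Sum>i<n. norm (v (r i) - v (l i))) \<le> (\<Sum>i<n. (\<Sum>j<m i. dist (f (\<tau> i j)) (f (\<tau> i (Suc j)))) + \<eta>)"
      proof (rule sum_mono)
        fix i assume "i \<in> {..<n}"
        then have "i < n" by simp
        then have i: "a \<le> l i" "l i \<le> r i" "r i \<le> b" using lr by auto
        have "v (l i) \<le> v (r i)" using step[OF i] norm_ge_zero[of "f (r i) - f (l i)"] by linarith
        then show "norm (v (r i) - v (l i)) \<le> (\<Sum>j<m i. dist (f (\<tau> i j)) (f (\<tau> i (Suc j)))) + \<eta>"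
          using sub[OF i] big[OF \<open>i < n\<close>] unfolding real_norm_def by linarith
      qed
      moreover have "real n * \<eta> \<le> \<epsilon> / 2"
        using \<open>\<epsilon> > 0\<close> unfolding \<eta>_def by (simp add: field_simps)
      ultimately show "(\<Sum>i<n. norm (v (r i) - v (l i))) < \<epsilon>"
        by (simp add: sum.distrib)
    qed
    with \<open>\<delta> > 0\<close> show "\<exists>\<delta>>0. ac_modulus a b v \<epsilon> \<delta>" by blast
  qed
  ultimately show thesis using that step by blast
qed

lemma abs_cont_integral_real:
  fixes f :: "real \<Rightarrow> real"
  assumes ac: "abs_cont a b f" and ab: "a < b"
  obtains g where "g absolutely_integrable_on {a..b}"
    "\<And>l r. a \<le> l \<Longrightarrow> l \<le> r \<Longrightarrow> r \<le> b \<Longrightarrow> (g has_integral (f r - f l)) {l..r}"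
proof -
  obtain v where v: "abs_cont a b v" "mono_on {a..b} v"
    and fv: "\<And>l r. a \<le> l \<Longrightarrow> l \<le> r \<Longrightarrow> r \<le> b \<Longrightarrow> norm (f r - f l) \<le> v r - v l"
    using abs_cont_variation[OF ac ab] by blast
  have "mono_on {a..b} (\<lambda>x. f x + v x)"
  proof (rule mono_onI)
    fix l r assume "l \<in> {a..b}" "r \<in> {a..b}" "l \<le> r"
    then show "f l + v l \<le> f r + v r" using fv[of l r] by auto
  qed
  then obtain h where h: "\<And>x. 0 \<le> h x"
    "\<And>l r. a \<le> l \<Longrightarrow> l \<le> r \<Longrightarrow> r \<le> b \<Longrightarrow> (h has_integral ((f r + v r) - (f l + v l))) {l..r}"
    using mono_abs_cont_integral[OF abs_cont_add[OF ac v(1)] _ ab] by blast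
  obtain k where k: "\<And>x. 0 \<le> k x"
    "\<And>l r. a \<le> l \<Longrightarrow> l \<le> r \<Longrightarrow> r \<le> b \<Longrightarrow> (k has_integral (v r - v l)) {l..r}"
    using mono_abs_cont_integral[OF v ab] by blast
  show thesis
  proof (rule that[of "\<lambda>x. h x - k x"])
    have "h absolutely_integrable_on {a..b}" "k absolutely_integrable_on {a..b}"
      using h(2)[of a b] k(2)[of a b] h(1) k(1) ab
      by (auto intro!: nonnegative_absolutely_integrable_1 has_integral_integrable)
    then show "(\<lambda>x. h x - k x) absolutely_integrable_on {a..b}" by (rule set_integral_diff(1))
    fix l r assume "a \<le> l" "l \<le> r" "r \<le> b"
    from has_integral_diff[OF h(2)[OF this] k(2)[OF this]]
    show "((\<lambda>x. h x - k x) has_integral (f r - f l)) {l..r}" by (simp add: algebra_simps)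
  qed
qed

lemma abs_cont_FTC:
  fixes f :: "real \<Rightarrow> 'e::euclidean_space"
  assumes ac: "abs_cont a b f" and ab: "a < b"
  shows "\<exists>g N. g absolutely_integrable_on {a..b} \<and> negligible N \<and>
    (\<forall>s\<in>{a<..<b} - N. (f has_vector_derivative g s) (at s)) \<and>
    (\<forall>l r. a \<le> l \<longrightarrow> l \<le> r \<longrightarrow> r \<le> b \<longrightarrow> (g has_integral (f r - f l)) {l..r})"
proof -
  have "\<exists>g. g absolutely_integrable_on {a..b} \<and> (\<forall>l r. a \<le> l \<longrightarrow> l \<le> r \<longrightarrow> r \<le> b \<longrightarrow>
      (g has_integral (f r \<bullet> i - f l \<bullet> i)) {l..r})" if "i \<in> Basis" for i
  proof -
    have "abs_cont a b (\<lambda>x. f x \<bullet> i)"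
      by (rule abs_cont_dominated[OF ac]) (metis Basis_le_norm inner_diff_left real_norm_def that)
    from abs_cont_integral_real[OF this ab] show ?thesis by metis
  qed
  then obtain G where G: "\<And>i. i \<in> Basis \<Longrightarrow> G i absolutely_integrable_on {a..b}"
    "\<And>i l r. i \<in> Basis \<Longrightarrow> a \<le> l \<Longrightarrow> l \<le> r \<Longrightarrow> r \<le> b \<Longrightarrow> (G i has_integral (f r \<bullet> i - f l \<bullet> i)) {l..r}"
    by metis
  define g where "g x = (\<Sum>i\<in>Basis. G i x *\<^sub>R i)" for x
  have gi: "g x \<bullet> i = G i x" if "i \<in> Basis" for x i
    using that by (simp add: g_def inner_sum_left_Basis)
  have int: "g absolutely_integrable_on {a..b}"
    by (rule absolutely_integrable_componentwise) (simp add: gi G cong: set_integrable_cong)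
  have FTC: "(g has_integral (f r - f l)) {l..r}" if "a \<le> l" "l \<le> r" "r \<le> b" for l r
    by (rule has_integral_componentwise) (use G(2) that in \<open>simp add: gi inner_diff_left\<close>)
  have "g integrable_on {a..b}" using FTC[of a b] ab by (auto intro: has_integral_integrable)
  from negligible_not_has_vector_derivative_integral[OF this]
  obtain N where N: "negligible N"
    "\<forall>x\<in>{a<..<b} - N. ((\<lambda>x. integral {a..x} g) has_vector_derivative g x) (at x)" by blast
  have "(f has_vector_derivative g s) (at s)" if "s \<in> {a<..<b} - N" for s
  proof -
    have "((\<lambda>x. f a + integral {a..x} g) has_vector_derivative g s) (at s)"
      using has_vector_derivative_add[OF has_vector_derivative_const N(2)[THEN bspec, OF that]] by simp
    then show ?thesis
    proof (rule has_vector_derivative_transform_within_open[of _ _ _ "{a<..<b}"])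
      fix x assume "x \<in> {a<..<b}"
      then show "f a + integral {a..x} g = f x" using FTC[of a x] by (simp add: integral_unique)
    qed (use that in auto)
  qed
  with int N(1) FTC show ?thesis by blast
qed

section \<open>Increments dominated by an integral\<close>

definition dominated :: "real \<Rightarrow> real \<Rightarrow> (real \<Rightarrow> real \<Rightarrow> real) \<Rightarrow> bool" where
  "dominated a b D \<longleftrightarrow> (\<exists>h. (\<forall>x. 0 \<le> h x) \<and> h integrable_on {a..b} \<and>
     (\<forall>l r. a \<le> l \<longrightarrow> l \<le> r \<longrightarrow> r \<le> b \<longrightarrow> D l r \<le> integral {l..r} h))"

lemma dominatedI:
  assumes "\<And>x. 0 \<le> h x" "h integrable_on {a..b}"
    "\<And>l r. a \<le> l \<Longrightarrow> l \<le> r \<Longrightarrow> r \<le> b \<Longrightarrow> D l r \<le> integral {l..r} h"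
  shows "dominated a b D"
  using assms unfolding dominated_def by blast

lemma dominated_mono:
  assumes "dominated a b D" "0 \<le> K" "\<And>l r. a \<le> l \<Longrightarrow> l \<le> r \<Longrightarrow> r \<le> b \<Longrightarrow> D' l r \<le> K * D l r"
  shows "dominated a b D'"
proof -
  obtain h where h: "\<And>x. 0 \<le> h x" "h integrable_on {a..b}"
    "\<And>l r. a \<le> l \<Longrightarrow> l \<le> r \<Longrightarrow> r \<le> b \<Longrightarrow> D l r \<le> integral {l..r} h"
    using assms(1) unfolding dominated_def by blast
  show ?thesis
  proof (rule dominatedI[of "\<lambda>x. K * h x"])
    fix l r assume lr: "a \<le> l" "l \<le> r" "r \<le> b"
    have "D' l r \<le> K * D l r" by (rule assms(3)[OF lr])
    also have "\<dots> \<le> K * integral {l..r} h" using h(3)[OF lr] assms(2) by (rule mult_left_mono)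
    finally show "D' l r \<le> integral {l..r} (\<lambda>x. K * h x)" by simp
  qed (use h assms(2) in \<open>auto intro: integrable_on_mult_right\<close>)
qed

lemma dominated_subinterval:
  assumes "dominated a b D" "a \<le> u" "v \<le> b"
  shows "dominated u v D"
proof -
  obtain h where h: "\<And>x. 0 \<le> h x" "h integrable_on {a..b}"
    "\<And>l r. a \<le> l \<Longrightarrow> l \<le> r \<Longrightarrow> r \<le> b \<Longrightarrow> D l r \<le> integral {l..r} h"
    using assms(1) unfolding dominated_def by blast
  show ?thesis
  proof (rule dominatedI[of h])
    show "h integrable_on {u..v}" using h(2) by (rule integrable_on_subinterval) (use assms in auto)
  qed (use h assms in auto)
qed

lemma dominated_add:
  assumes "dominated a b D" "dominated a b D'"
  shows "dominated a b (\<lambda>l r. D l r + D' l r)"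
proof -
  obtain h where h: "\<And>x. 0 \<le> h x" "h integrable_on {a..b}"
    "\<And>l r. a \<le> l \<Longrightarrow> l \<le> r \<Longrightarrow> r \<le> b \<Longrightarrow> D l r \<le> integral {l..r} h"
    using assms(1) unfolding dominated_def by blast
  obtain k where k: "\<And>x. 0 \<le> k x" "k integrable_on {a..b}"
    "\<And>l r. a \<le> l \<Longrightarrow> l \<le> r \<Longrightarrow> r \<le> b \<Longrightarrow> D' l r \<le> integral {l..r} k"
    using assms(2) unfolding dominated_def by blast
  show ?thesis
  proof (rule dominatedI[of "\<lambda>x. h x + k x"])
    fix l r assume lr: "a \<le> l" "l \<le> r" "r \<le> b"
    have "h integrable_on {l..r}" "k integrable_on {l..r}"
      using h(2) k(2) lr by (auto intro: integrable_on_subinterval)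
    then show "D l r + D' l r \<le> integral {l..r} (\<lambda>x. h x + k x)"
      using h(3)[OF lr] k(3)[OF lr] by (simp add: Henstock_Kurzweil_Integration.integral_add)
  qed (use h k in \<open>auto intro: integrable_add\<close>)
qed

lemma dominated_concat:
  assumes 1: "dominated a b D" and 2: "dominated b c D" and "a \<le> b" "b \<le> c"
    and tri: "\<And>l m r. a \<le> l \<Longrightarrow> l \<le> m \<Longrightarrow> m \<le> r \<Longrightarrow> r \<le> c \<Longrightarrow> D l r \<le> D l m + D m r"
  shows "dominated a c D"
proof -
  obtain h where h: "\<And>x. 0 \<le> h x" "h integrable_on {a..b}"
    "\<And>l r. a \<le> l \<Longrightarrow> l \<le> r \<Longrightarrow> r \<le> b \<Longrightarrow> D l r \<le> integral {l..r} h"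
    using 1 unfolding dominated_def by blast
  obtain k where k: "\<And>x. 0 \<le> k x" "k integrable_on {b..c}"
    "\<And>l r. b \<le> l \<Longrightarrow> l \<le> r \<Longrightarrow> r \<le> c \<Longrightarrow> D l r \<le> integral {l..r} k"
    using 2 unfolding dominated_def by blast
  define m where "m x = (if x < b then h x else k x)" for x
  have mh: "integral {l..r} m = integral {l..r} h" "m integrable_on {l..r} \<longleftrightarrow> h integrable_on {l..r}" if "r \<le> b" for l r
  proof -
    show "integral {l..r} m = integral {l..r} h"
      by (rule integral_spike[of "{b}"]) (use that in \<open>auto simp: m_def\<close>)
    show "m integrable_on {l..r} \<longleftrightarrow> h integrable_on {l..r}"
      by (intro iffI; erule integrable_spike[where S="{b}"]) (use that in \<open>auto simp: m_def\<close>)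
  qed
  have mk: "integral {l..r} m = integral {l..r} k" "m integrable_on {l..r} \<longleftrightarrow> k integrable_on {l..r}" if "b \<le> l" for l r
    by (rule Henstock_Kurzweil_Integration.integral_cong Henstock_Kurzweil_Integration.integrable_cong;
        use that in \<open>simp add: m_def\<close>)+
  show ?thesis
  proof (rule dominatedI[of m])
    show m0: "0 \<le> m x" for x using h(1) k(1) by (simp add: m_def)
    show int: "m integrable_on {a..c}"
      by (rule Henstock_Kurzweil_Integration.integrable_combine[of a b c]) (use assms mh mk h k in auto)
    fix l r assume lr: "a \<le> l" "l \<le> r" "r \<le> c"
    consider "r \<le> b" | "b \<le> l" | "l \<le> b" "b \<le> r" by linarith
    then show "D l r \<le> integral {l..r} m"
    proof cases
      case 3
      have "D l r \<le> D l b + D b r" by (rule tri) (use lr 3 in auto)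
      also have "\<dots> \<le> integral {l..b} h + integral {b..r} k"
        using lr 3 h(3)[of l b] k(3)[of b r] by auto
      also have "\<dots> = integral {l..b} m + integral {b..r} m" by (simp add: mh mk)
      also have "\<dots> = integral {l..r} m"
        using lr 3 int by (intro Henstock_Kurzweil_Integration.integral_combine) (auto intro: integrable_on_subinterval)
      finally show ?thesis .
    qed (use lr h k mh mk in auto)
  qed
qed

lemma dominated_local:
  assumes "a \<le> b"
    and tri: "\<And>l m r. a \<le> l \<Longrightarrow> l \<le> m \<Longrightarrow> m \<le> r \<Longrightarrow> r \<le> b \<Longrightarrow> D l r \<le> D l m + D m r"
    and loc: "\<And>x. a \<le> x \<Longrightarrow> x \<le> b \<Longrightarrow> \<exists>d>0. \<forall>u v. a \<le> u \<and> u \<le> x \<and> x \<le> v \<and> v \<le> b \<and> v - u < d \<longrightarrow> dominated u v D"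
  shows "dominated a b D"
proof -
  have "a \<le> a \<and> b \<le> b \<longrightarrow> dominated a b D"
    using \<open>a \<le> b\<close>
  proof (induction rule: Bolzano[where P = "\<lambda>u v. a \<le> u \<and> v \<le> b \<longrightarrow> dominated u v D"])
    case (trans u v w)
    show ?case
    proof
      assume *: "a \<le> u \<and> w \<le> b"
      show "dominated u w D" by (rule dominated_concat[where a=u and b=v and c=w]) (use trans * tri in auto)
    qed
  next
    case (local x)
    from loc[OF this] show ?case by blast
  qed
  then show ?thesis by simp
qed

text \<open>Uniform integrability: split the density at a large height.\<close>

lemma sum_integral_disjoint_le:
  fixes k :: "real \<Rightarrow> real"
  assumes k: "k integrable_on {a..b}" "\<And>x. 0 \<le> k x"
    and I: "finite I" "\<And>i. i \<in> I \<Longrightarrow> a \<le> l i \<and> l i \<le> r i \<and> r i \<le> b"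
     "\<And>i j. i \<in> I \<Longrightarrow> j \<in> I \<Longrightarrow> i \<noteq> j \<Longrightarrow> {l i<..<r i} \<inter> {l j<..<r j} = {}"
  shows "(\<Sum>i\<in>I. integral {l i..r i} k) \<le> integral {a..b} k"
proof -
  have ki: "((\<lambda>x. if x \<in> {l i<..<r i} then k x else 0) has_integral integral {l i..r i} k) UNIV" if "i \<in> I" for i
  proof -
    have "k integrable_on {l i..r i}" using k(1) I(2)[OF that] by (auto intro: integrable_on_subinterval)
    then have "(k has_integral integral {l i..r i} k) {l i<..<r i}"
      by (simp add: has_integral_integrable_integral integral_open_interval_real integrable_on_open_interval_real)
    then show ?thesis by (subst has_integral_restrict_UNIV)
  qed
  have "((\<lambda>x. \<Sum>i\<in>I. if x \<in> {l i<..<r i} then k x else 0) has_integral (\<Sum>i\<in>I. integral {l i..r i} k)) UNIV"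
    by (rule has_integral_sum[OF I(1) ki])
  moreover have "((\<lambda>x. if x \<in> {a..b} then k x else 0) has_integral integral {a..b} k) UNIV"
    unfolding has_integral_restrict_UNIV using k(1) by (rule integrable_integral)
  moreover have "(\<Sum>i\<in>I. if x \<in> {l i<..<r i} then k x else 0) \<le> (if x \<in> {a..b} then k x else 0)" for x
  proof (cases "\<exists>i\<in>I. x \<in> {l i<..<r i}")
    case True
    then obtain i where i: "i \<in> I" "x \<in> {l i<..<r i}" by blast
    then have "x \<notin> {l j<..<r j}" if "j \<in> I" "j \<noteq> i" for j using I(3)[OF i(1) that(1)] that i by blast
    then have "(\<Sum>j\<in>I. if x \<in> {l j<..<r j} then k x else 0) = (\<Sum>j\<in>I. if j = i then k x else 0)"
      using i by (intro sum.cong) auto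
    moreover have "x \<in> {a..b}" using i I(2)[OF i(1)] by auto
    ultimately show ?thesis using i I(1) by simp
  next
    case False
    then have "(\<Sum>i\<in>I. if x \<in> {l i<..<r i} then k x else 0) = 0" by (intro sum.neutral) auto
    then show ?thesis using k(2) by simp
  qed
  ultimately show ?thesis by (rule has_integral_le)
qed

lemma dominated_imp_abs_cont:
  assumes "dominated a b (\<lambda>l r. norm (f r - f l))"
  shows "abs_cont a b f"
proof -
  obtain h where h: "\<And>x. 0 \<le> h x" "h integrable_on {a..b}"
    "\<And>l r. a \<le> l \<Longrightarrow> l \<le> r \<Longrightarrow> r \<le> b \<Longrightarrow> norm (f r - f l) \<le> integral {l..r} h"
    using assms unfolding dominated_def by blast
  define t where "t n x = min (h x) (real n)" for n x
  have t: "t n integrable_on {a..b}" for n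
  proof -
    have "h absolutely_integrable_on {a..b}" "(\<lambda>x. real n) absolutely_integrable_on {a..b}"
      using h by (auto intro: nonnegative_absolutely_integrable_1)
    from absolutely_integrable_min[OF this] show ?thesis
      by (simp add: t_def[abs_def] set_lebesgue_integral_eq_integral)
  qed
  have "(\<lambda>n. integral {a..b} (t n)) \<longlonglongrightarrow> integral {a..b} h"
  proof (rule dominated_convergence(2)[OF t h(2)])
    show "norm (t n x) \<le> h x" for n x using h(1)[of x] by (simp add: t_def)
    show "(\<lambda>n. t n x) \<longlonglongrightarrow> h x" for x
    proof (rule tendsto_eventually)
      obtain N where "h x \<le> real N" using real_arch_simple by blast
      then show "\<forall>\<^sub>F n in sequentially. t n x = h x"
        unfolding t_def by (intro eventually_sequentiallyI[of N]) (auto simp: min_absorb1)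
    qed
  qed
  show ?thesis
    unfolding abs_cont_iff_modulus
  proof (intro allI impI)
    fix \<epsilon> :: real assume "\<epsilon> > 0"
    then have "\<forall>\<^sub>F n in sequentially. dist (integral {a..b} (t n)) (integral {a..b} h) < \<epsilon> / 2"
      using \<open>(\<lambda>n. integral {a..b} (t n)) \<longlonglongrightarrow> integral {a..b} h\<close> by (intro tendstoD) auto
    then obtain n where n: "dist (integral {a..b} (t n)) (integral {a..b} h) < \<epsilon> / 2"
      by (auto simp: eventually_sequentially)
    define \<delta> where "\<delta> = \<epsilon> / (2 * (real n + 1))"
    have "\<delta> > 0" using \<open>\<epsilon> > 0\<close> by (simp add: \<delta>_def)
    have "ac_modulus a b f \<epsilon> \<delta>"
    proof (rule ac_modulusI)
      fix m :: nat and l r :: "nat \<Rightarrow> real"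
      assume lr: "\<And>i. i < m \<Longrightarrow> a \<le> l i \<and> l i \<le> r i \<and> r i \<le> b"
        and disj: "\<And>i j. i < m \<Longrightarrow> j < m \<Longrightarrow> i \<noteq> j \<Longrightarrow> {l i<..<r i} \<inter> {l j<..<r j} = {}"
        and tot: "(\<Sum>i<m. r i - l i) < \<delta>"
      have "(\<Sum>i<m. norm (f (r i) - f (l i))) \<le> (\<Sum>i<m. integral {l i..r i} (\<lambda>x. h x - t n x) + real n * (r i - l i))"
      proof (rule sum_mono)
        fix i assume "i \<in> {..<m}"
        then have i: "a \<le> l i" "l i \<le> r i" "r i \<le> b" using lr by auto
        then have sub: "h integrable_on {l i..r i}" "t n integrable_on {l i..r i}"
          using i by (auto intro: integrable_on_subinterval[OF h(2)] integrable_on_subinterval[OF t])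
        have "norm (f (r i) - f (l i)) \<le> integral {l i..r i} h" by (rule h(3)[OF i])
        also have "\<dots> = integral {l i..r i} (\<lambda>x. h x - t n x) + integral {l i..r i} (t n)"
          by (simp add: Henstock_Kurzweil_Integration.integral_diff sub)
        also have "integral {l i..r i} (t n) \<le> integral {l i..r i} (\<lambda>_. real n)"
          by (rule integral_le[OF sub(2)]) (auto simp: t_def)
        finally show "norm (f (r i) - f (l i)) \<le> integral {l i..r i} (\<lambda>x. h x - t n x) + real n * (r i - l i)"
          using i by (simp add: mult.commute)
      qed
      also have "\<dots> = (\<Sum>i<m. integral {l i..r i} (\<lambda>x. h x - t n x)) + real n * (\<Sum>i<m. r i - l i)"
        by (simp add: sum.distrib sum_distrib_left)
      also have "(\<Sum>i<m. integral {l i..r i} (\<lambda>x. h x - t n x)) \<le> integral {a..b} (\<lambda>x. h x - t n x)"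
        by (rule sum_integral_disjoint_le)
           (use lr disj integrable_diff[OF h(2) t] in \<open>simp_all add: t_def del: Int_greaterThanLessThan\<close>)
      also have "\<dots> < \<epsilon> / 2"
        using n by (simp add: Henstock_Kurzweil_Integration.integral_diff h t dist_real_def abs_if split: if_splits)
      also have "real n * (\<Sum>i<m. r i - l i) \<le> real n * \<delta>" using tot by (intro mult_left_mono) auto
      also have "real n * \<delta> \<le> \<epsilon> / 2" using \<open>\<epsilon> > 0\<close> by (simp add: \<delta>_def field_simps)
      finally show "(\<Sum>i<m. norm (f (r i) - f (l i))) < \<epsilon>" by simp
    qed
    with \<open>\<delta> > 0\<close> show "\<exists>\<delta>>0. ac_modulus a b f \<epsilon> \<delta>" by blast
  qed
qed

lemma abs_cont_imp_dominated:
  fixes f :: "real \<Rightarrow> 'e::euclidean_space"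
  assumes "abs_cont a b f" "a \<le> b"
  shows "dominated a b (\<lambda>l r. norm (f r - f l))"
proof (cases "a = b")
  case True
  have eq: "f r = f l" if "a \<le> l" "l \<le> r" "r \<le> b" for l r
  proof -
    have "l = r" using that True by linarith
    then show ?thesis by simp
  qed
  show ?thesis
  proof (rule dominatedI[of "\<lambda>_. 0"])
    fix l r assume "a \<le> l" "l \<le> r" "r \<le> b"
    from eq[OF this] show "norm (f r - f l) \<le> integral {l..r} (\<lambda>_. 0)" by simp
  qed (simp_all add: integrable_0)
next
  case False
  then have "a < b" using assms by simp
  then obtain g where g: "g absolutely_integrable_on {a..b}"
    "\<forall>l r. a \<le> l \<longrightarrow> l \<le> r \<longrightarrow> r \<le> b \<longrightarrow> (g has_integral (f r - f l)) {l..r}"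
    using abs_cont_FTC[OF assms(1) \<open>a < b\<close>] by blast
  show ?thesis
  proof (rule dominatedI[of "\<lambda>x. norm (g x)"])
    show "(\<lambda>x. norm (g x)) integrable_on {a..b}" using g(1) by (simp add: absolutely_integrable_on_def)
    fix l r assume lr: "a \<le> l" "l \<le> r" "r \<le> b"
    have "norm (integral {l..r} g) \<le> integral {l..r} (\<lambda>x. norm (g x))"
      by (rule integral_norm_bound_integral)
         (use g lr in \<open>auto simp: absolutely_integrable_on_def intro: integrable_on_subinterval\<close>)
    then show "norm (f r - f l) \<le> integral {l..r} (\<lambda>x. norm (g x))"
      using integral_unique[OF g(2)[rule_format, OF lr]] by simp
  qed simp
qed

section \<open>Charts and tangent vectors\<close>

lemma norm_linear_le_Basis:
  fixes L :: "'a::euclidean_space \<Rightarrow> 'b::real_normed_vector"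
  assumes "linear L"
  shows "norm (L v) \<le> (\<Sum>b\<in>Basis. norm (L b)) * norm v"
proof -
  have "L v = (\<Sum>b\<in>Basis. (v \<bullet> b) *\<^sub>R L b)"
    by (subst euclidean_representation[of v, symmetric]) (simp add: linear_sum[OF assms] linear_scale[OF assms])
  also have "norm \<dots> \<le> (\<Sum>b\<in>Basis. \<bar>v \<bullet> b\<bar> * norm (L b))" by (rule order_trans[OF norm_sum]) simp
  also have "\<dots> \<le> (\<Sum>b\<in>Basis. norm v * norm (L b))"
    by (intro sum_mono mult_right_mono) (auto simp: Basis_le_norm)
  finally show ?thesis by (simp add: sum_distrib_left mult.commute)
qed

lemma norm_diff_triangle_via: "norm (c - a) \<le> norm (b - a) + norm (c - (b :: 'a::real_normed_vector))"
  using norm_triangle_ineq[of "b - a" "c - b"] by simp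

lemma C1_locally_Lipschitz:
  fixes f :: "'a::euclidean_space \<Rightarrow> 'b::euclidean_space"
  assumes C1: "Ck_on (Suc 0) W f" and "open W" "x0 \<in> W"
  shows "\<exists>r>0. \<exists>K\<ge>0. cball x0 r \<subseteq> W \<and> (\<forall>x\<in>cball x0 r. \<forall>y\<in>cball x0 r. norm (f x - f y) \<le> K * norm (x - y))"
proof -
  obtain r where r: "r > 0" "cball x0 r \<subseteq> W" using assms open_contains_cball by blast
  let ?D = "\<lambda>x. frechet_derivative f (at x)"
  have "continuous_on (cball x0 r) (\<lambda>x. \<Sum>b\<in>Basis. norm (?D x b))"
    using C1 r(2) by (intro continuous_intros) (auto intro: continuous_on_subset)
  then have "compact ((\<lambda>x. \<Sum>b\<in>Basis. norm (?D x b)) ` cball x0 r)"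
    by (rule compact_continuous_image) simp
  then obtain K where "K > 0" and K: "\<And>x. x \<in> cball x0 r \<Longrightarrow> norm (\<Sum>b\<in>Basis. norm (?D x b)) \<le> K"
    using bounded_pos[of "(\<lambda>x. \<Sum>b\<in>Basis. norm (?D x b)) ` cball x0 r"] compact_imp_bounded by blast
  have "norm (f x - f y) \<le> K * norm (x - y)" if "x \<in> cball x0 r" "y \<in> cball x0 r" for x y
  proof (rule differentiable_bound[where S="cball x0 r" and f'="?D"])
    show "convex (cball x0 r)" by simp
    fix z assume z: "z \<in> cball x0 r"
    then have der: "(f has_derivative ?D z) (at z)"
      using C1 r(2) by (auto simp: frechet_derivative_works[symmetric])
    then show "(f has_derivative ?D z) (at z within cball x0 r)" by (rule has_derivative_at_withinI)
    show "onorm (?D z) \<le> K"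
    proof (rule onorm_le)
      fix v
      have "norm (?D z v) \<le> (\<Sum>b\<in>Basis. norm (?D z b)) * norm v"
        using der by (intro norm_linear_le_Basis has_derivative_linear)
      also have "\<dots> \<le> K * norm v" using K[OF z] by (intro mult_right_mono) auto
      finally show "norm (?D z v) \<le> K * norm v" .
    qed
  qed (use that in auto)
  with r \<open>K > 0\<close> show ?thesis by (intro exI[of _ r] conjI exI[of _ K]) auto
qed

locale finsler_manifold =
  fixes A :: "('q::{t2_space,second_countable_topology}, 'e::euclidean_space) chart set"
    and R :: "'q \<Rightarrow> ('q, 'e) tvec \<Rightarrow> real"
  assumes atlas: "smooth_atlas A" and finsler: "finsler_norm A R"
    and connected: "curves A p q \<noteq> {}"
begin

lemma chart:
  assumes "c \<in> A"
  shows open_dom: "open (fst c)" and open_chart_image: "open (chart_image c)"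
    and chart_inv_chart: "p \<in> fst c \<Longrightarrow> chart_inv c (snd c p) = p"
    and chart_chart_inv: "x \<in> chart_image c \<Longrightarrow> snd c (chart_inv c x) = x"
    and chart_inv_in: "x \<in> chart_image c \<Longrightarrow> chart_inv c x \<in> fst c"
    and continuous_on_chart: "continuous_on (fst c) (snd c)"
    and continuous_on_chart_inv: "continuous_on (chart_image c) (chart_inv c)"
proof -
  have h: "open (fst c)" "open (chart_image c)" "homeomorphism (fst c) (chart_image c) (snd c) (chart_inv c)"
    using atlas assms unfolding smooth_atlas_def by auto
  then show "open (fst c)" "open (chart_image c)" "continuous_on (fst c) (snd c)" "continuous_on (chart_image c) (chart_inv c)"
    by (auto simp: homeomorphism_def)
  show "p \<in> fst c \<Longrightarrow> chart_inv c (snd c p) = p" "x \<in> chart_image c \<Longrightarrow> snd c (chart_inv c x) = x"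
    "x \<in> chart_image c \<Longrightarrow> chart_inv c x \<in> fst c" using h(3) unfolding homeomorphism_def by blast+
qed

lemma chart_around: obtains c where "c \<in> charts_at A q"
  using atlas unfolding smooth_atlas_def charts_at_def by blast

lemma open_chart_inv_image:
  assumes "c \<in> A" "open V" "V \<subseteq> chart_image c"
  shows "open (chart_inv c ` V)"
proof -
  have "chart_inv c ` V = fst c \<inter> snd c -` V"
  proof (intro equalityI subsetI)
    fix p assume "p \<in> chart_inv c ` V"
    then obtain x where "x \<in> V" "p = chart_inv c x" by blast
    then show "p \<in> fst c \<inter> snd c -` V"
      using assms(3) chart_chart_inv[OF assms(1), of x] chart_inv_in[OF assms(1), of x] by auto
  next
    fix p assume "p \<in> fst c \<inter> snd c -` V"
    then show "p \<in> chart_inv c ` V" using chart_inv_chart[OF assms(1), of p] by (intro image_eqI[of _ _ "snd c p"]) auto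
  qed
  also have "open \<dots>"
    using assms chart[OF assms(1)] by (intro continuous_open_preimage) auto
  finally show ?thesis .
qed

definition tr :: "('q,'e) chart \<Rightarrow> ('q,'e) chart \<Rightarrow> 'e \<Rightarrow> 'e" where
  "tr c c' = snd c' \<circ> chart_inv c"

definition overlap :: "('q,'e) chart \<Rightarrow> ('q,'e) chart \<Rightarrow> 'e set" where
  "overlap c c' = snd c ` (fst c \<inter> fst c')"

lemma tr_C1: "c \<in> A \<Longrightarrow> c' \<in> A \<Longrightarrow> Ck_on (Suc 0) (overlap c c') (tr c c')"
  using atlas unfolding smooth_atlas_def tr_def overlap_def by blast

lemma overlap_iff: "c \<in> A \<Longrightarrow> x \<in> overlap c c' \<longleftrightarrow> x \<in> chart_image c \<and> chart_inv c x \<in> fst c'"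
  using chart[of c] unfolding overlap_def by (force simp: image_iff)

lemma open_overlap:
  assumes "c \<in> A" "c' \<in> A"
  shows "open (overlap c c')"
proof -
  have "overlap c c' = chart_image c \<inter> chart_inv c -` fst c'"
    by (intro set_eqI) (simp add: overlap_iff[OF assms(1)])
  also have "open \<dots>" using chart[OF assms(1)] chart[OF assms(2)] by (intro continuous_open_preimage) auto
  finally show ?thesis .
qed

lemma overlap_mem: "c \<in> charts_at A q \<Longrightarrow> c' \<in> charts_at A q \<Longrightarrow> snd c q \<in> overlap c c'"
  by (auto simp: overlap_def charts_at_def)

lemma tr_has_derivative:
  assumes "c \<in> charts_at A q" "c' \<in> charts_at A q"
  shows "(tr c c' has_derivative frechet_derivative (tr c c') (at (snd c q))) (at (snd c q))"
  using tr_C1[of c c'] overlap_mem[OF assms] assms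
  by (auto simp: frechet_derivative_works[symmetric] charts_at_def)

lemma tr_chain:
  assumes c: "c \<in> charts_at A q" "c' \<in> charts_at A q" "c'' \<in> charts_at A q"
  shows "frechet_derivative (tr c c'') (at (snd c q)) w =
    frechet_derivative (tr c' c'') (at (snd c' q)) (frechet_derivative (tr c c') (at (snd c q)) w)"
proof -
  let ?D = "\<lambda>c c'. frechet_derivative (tr c c') (at (snd c q))"
  have A: "c \<in> A" "c' \<in> A" "c'' \<in> A" and q: "q \<in> fst c" "q \<in> fst c'" "q \<in> fst c''"
    using c by (auto simp: charts_at_def)
  have t: "tr c c' (snd c q) = snd c' q" using A q chart by (simp add: tr_def)
  have "(tr c' c'' \<circ> tr c c' has_derivative ?D c' c'' \<circ> ?D c c') (at (snd c q))"
    by (rule diff_chain_at[OF tr_has_derivative[OF c(1,2)]]) (use tr_has_derivative[OF c(2,3)] t in simp)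
  then have "(tr c c'' has_derivative ?D c' c'' \<circ> ?D c c') (at (snd c q))"
  proof (rule has_derivative_transform_within_open)
    show "open (overlap c c')" using A by (intro open_overlap)
    show "snd c q \<in> overlap c c'" by (rule overlap_mem[OF c(1,2)])
    fix x assume "x \<in> overlap c c'"
    then show "(tr c' c'' \<circ> tr c c') x = tr c c'' x"
      using overlap_iff[OF A(1)] chart_inv_chart[OF A(2)] by (simp add: tr_def)
  qed
  then show ?thesis by (simp add: frechet_derivative_at[symmetric])
qed

lemma tvec_of_at: "c' \<in> charts_at A q \<Longrightarrow> tvec_of A c q w c' = frechet_derivative (tr c c') (at (snd c q)) w"
  by (simp add: tvec_of_def tr_def)

lemma tvec_of_self:
  assumes "c \<in> charts_at A q"
  shows "tvec_of A c q w c = w"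
proof -
  have A: "c \<in> A" "q \<in> fst c" using assms by (auto simp: charts_at_def)
  have "((\<lambda>x. x) has_derivative (\<lambda>x. x)) (at (snd c q))" by (rule has_derivative_ident)
  then have "(tr c c has_derivative (\<lambda>x. x)) (at (snd c q))"
    by (rule has_derivative_transform_within_open[of _ _ _ _ "chart_image c"])
       (use chart[OF A(1)] A in \<open>auto simp: tr_def\<close>)
  then show ?thesis by (simp add: tvec_of_at[OF assms] frechet_derivative_at[symmetric])
qed

lemma tvec_of_in_tangent_space:
  assumes "c \<in> charts_at A q"
  shows "tvec_of A c q w \<in> tangent_space A q"
  unfolding tangent_space_def tr_def[symmetric]
proof (intro CollectI conjI ballI allI impI)
  fix c1 c2 assume c12: "c1 \<in> charts_at A q" "c2 \<in> charts_at A q"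
  show "tvec_of A c q w c2 = frechet_derivative (tr c1 c2) (at (snd c1 q)) (tvec_of A c q w c1)"
    unfolding tvec_of_at[OF c12(1)] tvec_of_at[OF c12(2)] by (rule tr_chain[OF assms c12])
qed (simp add: tvec_of_def)

lemma tangent_space_tvec_of:
  assumes "v \<in> tangent_space A q" "c \<in> charts_at A q"
  shows "v = tvec_of A c q (v c)"
proof
  fix c'
  show "v c' = tvec_of A c q (v c) c'"
  proof (cases "c' \<in> charts_at A q")
    case True
    have "\<forall>c\<in>charts_at A q. \<forall>c'\<in>charts_at A q. v c' = frechet_derivative (tr c c') (at (snd c q)) (v c)"
      using assms(1) unfolding tangent_space_def tr_def by blast
    from this[THEN bspec, OF assms(2), THEN bspec, OF True] show ?thesis unfolding tvec_of_at[OF True] .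
  next
    case False
    have "\<forall>c. c \<notin> charts_at A q \<longrightarrow> v c = 0" using assms(1) unfolding tangent_space_def by blast
    from this[THEN spec, THEN mp, OF False] False show ?thesis by (simp add: tvec_of_def)
  qed
qed

lemma tvec_of_linear:
  assumes "c \<in> charts_at A q"
  shows "tvec_of A c q (v + w) = (\<lambda>c'. tvec_of A c q v c' + tvec_of A c q w c')"
    "tvec_of A c q (a *\<^sub>R w) = (\<lambda>c'. a *\<^sub>R tvec_of A c q w c')"
proof -
  have "linear (frechet_derivative (tr c c') (at (snd c q)))" if "c' \<in> charts_at A q" for c'
    using has_derivative_linear[OF tr_has_derivative[OF assms that]] .
  then show "tvec_of A c q (v + w) = (\<lambda>c'. tvec_of A c q v c' + tvec_of A c q w c')"
    "tvec_of A c q (a *\<^sub>R w) = (\<lambda>c'. a *\<^sub>R tvec_of A c q w c')"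
    unfolding tvec_of_def tr_def[symmetric] by (simp_all add: fun_eq_iff linear_add linear_scale)
qed

text \<open>The norm in the coordinates of a chart.\<close>

definition rho :: "('q,'e) chart \<Rightarrow> 'e \<Rightarrow> 'e \<Rightarrow> real" where
  "rho c x w = R (chart_inv c x) (tvec_of A c (chart_inv c x) w)"

lemma chart_inv_charts_at: "c \<in> A \<Longrightarrow> x \<in> chart_image c \<Longrightarrow> c \<in> charts_at A (chart_inv c x)"
  by (simp add: charts_at_def chart_inv_in)

lemma rho_at: "c \<in> charts_at A q \<Longrightarrow> rho c (snd c q) w = R q (tvec_of A c q w)"
  by (simp add: rho_def chart_inv_chart charts_at_def)

lemma rho_norm:
  assumes "c \<in> A" "x \<in> chart_image c"
  shows rho_nonneg: "0 \<le> rho c x w" and rho_eq_0_iff: "rho c x w = 0 \<longleftrightarrow> w = 0"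
    and rho_scale: "rho c x (a *\<^sub>R w) = \<bar>a\<bar> * rho c x w"
    and rho_triangle: "rho c x (v + w) \<le> rho c x v + rho c x w"
proof -
  note c = chart_inv_charts_at[OF assms]
  have T: "tvec_of A c (chart_inv c x) w \<in> tangent_space A (chart_inv c x)" for w
    by (rule tvec_of_in_tangent_space[OF c])
  note F = finsler[unfolded finsler_norm_def, THEN conjunct1, THEN spec]
  note F1 = F[THEN conjunct1] and F2 = F[THEN conjunct2, THEN conjunct1] and F3 = F[THEN conjunct2, THEN conjunct2]
  show "0 \<le> rho c x w" unfolding rho_def by (rule F1[THEN bspec, OF T, THEN conjunct1])
  have "tvec_of A c (chart_inv c x) w = (\<lambda>_. 0) \<longleftrightarrow> w = 0"
  proof
    assume "tvec_of A c (chart_inv c x) w = (\<lambda>_. 0)"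
    then show "w = 0" using tvec_of_self[OF c, of w] by simp
  next
    assume "w = 0"
    then show "tvec_of A c (chart_inv c x) w = (\<lambda>_. 0)" using tvec_of_linear(2)[OF c, of 0 w] by simp
  qed
  then show "rho c x w = 0 \<longleftrightarrow> w = 0"
    unfolding rho_def using F1[THEN bspec, OF T[of w], THEN conjunct2] by simp
  show "rho c x (a *\<^sub>R w) = \<bar>a\<bar> * rho c x w"
    unfolding rho_def tvec_of_linear(2)[OF c] by (rule F2[THEN bspec, OF T, THEN spec])
  show "rho c x (v + w) \<le> rho c x v + rho c x w"
    unfolding rho_def tvec_of_linear(1)[OF c] by (rule F3[THEN bspec, OF T, THEN bspec, OF T])
qed

lemma continuous_on_rho: "c \<in> A \<Longrightarrow> continuous_on (chart_image c \<times> UNIV) (\<lambda>(x, w). rho c x w)"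
  using finsler unfolding finsler_norm_def rho_def by blast

lemma rho_zero: "c \<in> A \<Longrightarrow> x \<in> chart_image c \<Longrightarrow> rho c x 0 = 0"
  using rho_eq_0_iff by blast

lemma rho_bounds:
  assumes "c \<in> A" "compact K" "K \<subseteq> chart_image c"
  shows "\<exists>m>0. \<exists>M>0. \<forall>x\<in>K. \<forall>w. m * norm w \<le> rho c x w \<and> rho c x w \<le> M * norm w"
proof (cases "K = {}")
  case False
  let ?S = "K \<times> sphere (0::'e) 1"
  have "compact ?S" using assms by (intro compact_Times) auto
  moreover have "?S \<noteq> {}"
    using False vector_choose_size[of 1, where 'a='e] by (auto simp: sphere_def dist_norm)
  moreover have cont: "continuous_on ?S (\<lambda>(x, w). rho c x w)"
    by (rule continuous_on_subset[OF continuous_on_rho[OF assms(1)]]) (use assms in auto)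
  ultimately obtain p1 p2 where p: "p1 \<in> ?S" "\<forall>z\<in>?S. (case p1 of (x, w) \<Rightarrow> rho c x w) \<le> (case z of (x, w) \<Rightarrow> rho c x w)"
     "p2 \<in> ?S" "\<forall>z\<in>?S. (case z of (x, w) \<Rightarrow> rho c x w) \<le> (case p2 of (x, w) \<Rightarrow> rho c x w)"
    using continuous_attains_inf[of ?S "\<lambda>(x, w). rho c x w"] continuous_attains_sup[of ?S "\<lambda>(x, w). rho c x w"] by blast
  define m M where "m = (case p1 of (x, w) \<Rightarrow> rho c x w)" and "M = (case p2 of (x, w) \<Rightarrow> rho c x w)"
  have pos: "0 < rho c x w" if "(x,w) \<in> ?S" for x w
  proof -
    have "x \<in> chart_image c" "w \<noteq> 0" using that assms by auto
    then show ?thesis using rho_nonneg[OF assms(1), of x w] rho_eq_0_iff[OF assms(1), of x w] by linarith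
  qed
  have "0 < m" "0 < M" using pos[of "fst p1" "snd p1"] pos[of "fst p2" "snd p2"] p by (auto simp: m_def M_def split: prod.splits)
  have "m * norm w \<le> rho c x w \<and> rho c x w \<le> M * norm w" if "x \<in> K" for x w
  proof (cases "w = 0")
    case True
    have "x \<in> chart_image c" using that assms by blast
    then show ?thesis using True rho_zero[OF assms(1), of x] by simp
  next
    case False
    let ?u = "(1 / norm w) *\<^sub>R w"
    have "(x, ?u) \<in> ?S" using that False by simp
    then have "m \<le> rho c x ?u" "rho c x ?u \<le> M" using p by (auto simp: m_def M_def)
    moreover have "rho c x ?u = rho c x w / norm w"
      using rho_scale[OF assms(1), of x "1 / norm w" w] that assms(3) by (auto simp: divide_simps)
    ultimately show ?thesis using False by (simp add: field_simps)
  qed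
  with \<open>0 < m\<close> \<open>0 < M\<close> show ?thesis by blast
qed (auto intro: exI[of _ 1])

text \<open>Near a point the norms are uniformly comparable to the norm at the point.\<close>

lemma rho_almost_constant:
  assumes "c \<in> A" "x0 \<in> chart_image c" "0 < \<epsilon>"
  shows "\<exists>r>0. cball x0 r \<subseteq> chart_image c \<and> (\<forall>x\<in>cball x0 r. \<forall>w. (1 - \<epsilon>) * rho c x0 w \<le> rho c x w)"
proof -
  obtain r0 where r0: "r0 > 0" "cball x0 r0 \<subseteq> chart_image c"
    using assms open_chart_image[OF assms(1)] open_contains_cball by blast
  obtain m where m: "0 < m" and mM: "\<forall>x\<in>cball x0 r0. \<forall>w. m * norm w \<le> rho c x w"
    using rho_bounds[OF assms(1) _ r0(2)] by auto
  have "uniformly_continuous_on (cball x0 r0 \<times> sphere (0::'e) 1) (\<lambda>(x, w). rho c x w)"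
    by (rule compact_uniformly_continuous[OF continuous_on_subset[OF continuous_on_rho[OF assms(1)]]])
       (use r0 in \<open>auto intro: compact_Times\<close>)
  moreover have "0 < \<epsilon> * m" using m assms by simp
  ultimately obtain d where d: "d > 0"
    "\<forall>p\<in>cball x0 r0 \<times> sphere (0::'e) 1. \<forall>p'\<in>cball x0 r0 \<times> sphere (0::'e) 1. dist p' p < d \<longrightarrow>
       dist ((\<lambda>(x, w). rho c x w) p') ((\<lambda>(x, w). rho c x w) p) < \<epsilon> * m"
    unfolding uniformly_continuous_on_def by blast
  show ?thesis
  proof (intro exI[of _ "min r0 (d/2)"] conjI ballI allI)
    show "0 < min r0 (d/2)" "cball x0 (min r0 (d/2)) \<subseteq> chart_image c" using r0 d by auto
    fix x w assume x: "x \<in> cball x0 (min r0 (d/2))"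
    show "(1 - \<epsilon>) * rho c x0 w \<le> rho c x w"
    proof (cases "w = 0")
      case True
      then show ?thesis using rho_zero[OF assms(1)] assms x r0 by (auto simp: subset_iff)
    next
      case False
      let ?u = "(1 / norm w) *\<^sub>R w"
      have xx: "x \<in> cball x0 r0" "x0 \<in> cball x0 r0" using x r0 by auto
      have "dist (rho c x ?u) (rho c x0 ?u) < \<epsilon> * m"
        using d(2)[THEN bspec, THEN bspec, of "(x0,?u)" "(x,?u)"] xx x False d(1) by (auto simp: dist_Pair_Pair dist_commute)
      then have "rho c x0 ?u - \<epsilon> * m \<le> rho c x ?u" by (auto simp: dist_real_def abs_if split: if_splits)
      moreover have "\<epsilon> * m \<le> \<epsilon> * rho c x0 ?u"
        using mM[THEN bspec, OF xx(2), THEN spec, of ?u] False assms(3) by (intro mult_left_mono) auto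
      moreover have "rho c x ?u = rho c x w / norm w" "rho c x0 ?u = rho c x0 w / norm w"
        using rho_scale[OF assms(1), of x "1 / norm w" w] rho_scale[OF assms(1), of x0 "1 / norm w" w] xx r0(2)
        by (auto simp: divide_simps subset_iff)
      ultimately have "(1 - \<epsilon>) * (rho c x0 w / norm w) \<le> rho c x w / norm w"
        by (simp add: algebra_simps diff_divide_distrib)
      then have "((1 - \<epsilon>) * rho c x0 w) / norm w \<le> rho c x w / norm w" by simp
      then show ?thesis using False divide_le_cancel[of "(1 - \<epsilon>) * rho c x0 w" "norm w" "rho c x w"] by simp
    qed
  qed
qed

section \<open>Absolutely continuous curves\<close>

lemma ac_curve_continuous: "ac_curve A a b y \<Longrightarrow> continuous_on {a..b} y"
  by (simp add: ac_curve_def)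

lemma ac_curve_chart:
  "ac_curve A a b y \<Longrightarrow> c \<in> A \<Longrightarrow> a \<le> u \<Longrightarrow> u \<le> v \<Longrightarrow> v \<le> b \<Longrightarrow> y ` {u..v} \<subseteq> fst c \<Longrightarrow> abs_cont u v (snd c \<circ> y)"
  unfolding ac_curve_def by blast

lemma ac_curve_subinterval: "ac_curve A a b y \<Longrightarrow> a \<le> u \<Longrightarrow> v \<le> b \<Longrightarrow> ac_curve A u v y"
  unfolding ac_curve_def by (meson atLeastatMost_subset_iff continuous_on_subset order_trans)

lemma continuous_on_locally_in_open:
  fixes y :: "real \<Rightarrow> 'q"
  assumes "continuous_on {a..b} y" "x \<in> {a..b}" "open V" "y x \<in> V"
  shows "\<exists>d>0. \<forall>s\<in>{a..b}. \<bar>s - x\<bar> < d \<longrightarrow> y s \<in> V"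
proof -
  have "(y \<longlongrightarrow> y x) (at x within {a..b})" using assms by (auto simp: continuous_on_def)
  from topological_tendstoD[OF this assms(3,4)]
  obtain d where "d > 0" "\<forall>s\<in>{a..b}. s \<noteq> x \<and> dist s x < d \<longrightarrow> y s \<in> V"
    by (auto simp: eventually_at)
  then show ?thesis using assms(4) by (intro exI[of _ d]) (auto simp: dist_real_def)
qed

lemma ac_curve_local_chart:
  fixes y :: "real \<Rightarrow> 'q"
  assumes "continuous_on {a..b} y" "x \<in> {a..b}"
  shows "\<exists>c\<in>charts_at A (y x). \<exists>d>0. \<forall>s\<in>{a..b}. \<bar>s - x\<bar> < d \<longrightarrow> y s \<in> fst c"
proof -
  obtain c where c: "c \<in> charts_at A (y x)" by (rule chart_around)
  then have "open (fst c)" "y x \<in> fst c" using open_dom by (auto simp: charts_at_def)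
  from continuous_on_locally_in_open[OF assms this] c show ?thesis by blast
qed

lemma ac_curveI:
  assumes cont: "continuous_on {a..b} y"
    and loc: "\<And>x. x \<in> {a..b} \<Longrightarrow> \<exists>c\<in>charts_at A (y x). \<exists>d>0. \<forall>u v. a \<le> u \<and> u \<le> x \<and> x \<le> v \<and> v \<le> b \<and> v - u < d \<longrightarrow>
       dominated u v (\<lambda>l r. norm (snd c (y r) - snd c (y l)))"
  shows "ac_curve A a b y"
  unfolding ac_curve_def
proof (intro conjI cont ballI allI impI)
  fix c' u v assume c': "c' \<in> A" and uv: "a \<le> u \<and> u \<le> v \<and> v \<le> b \<and> y ` {u..v} \<subseteq> fst c'"
  have "dominated u v (\<lambda>l r. norm ((snd c' \<circ> y) r - (snd c' \<circ> y) l))"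
  proof (rule dominated_local)
    show "u \<le> v" using uv by simp
    fix l m r :: real
    show "norm ((snd c' \<circ> y) r - (snd c' \<circ> y) l) \<le> norm ((snd c' \<circ> y) m - (snd c' \<circ> y) l) + norm ((snd c' \<circ> y) r - (snd c' \<circ> y) m)"
      by (rule norm_diff_triangle_via)
  next
    fix x assume x: "u \<le> x" "x \<le> v"
    then have xab: "x \<in> {a..b}" using uv by auto
    obtain c d where c: "c \<in> charts_at A (y x)" and "d > 0" and d:
      "\<forall>u v. a \<le> u \<and> u \<le> x \<and> x \<le> v \<and> v \<le> b \<and> v - u < d \<longrightarrow> dominated u v (\<lambda>l r. norm (snd c (y r) - snd c (y l)))"
      using loc[OF xab] by blast
    have cA: "c \<in> A" "y x \<in> fst c" using c by (auto simp: charts_at_def)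
    have "y x \<in> fst c'" using uv x by auto
    then have x0: "snd c (y x) \<in> overlap c c'" using cA by (auto simp: overlap_def)
    obtain r K where r: "r > 0" "K \<ge> 0" "cball (snd c (y x)) r \<subseteq> overlap c c'"
      and K: "\<forall>z\<in>cball (snd c (y x)) r. \<forall>z'\<in>cball (snd c (y x)) r.
         norm (tr c c' z - tr c c' z') \<le> K * norm (z - z')"
      using C1_locally_Lipschitz[OF tr_C1[OF cA(1) c'] open_overlap[OF cA(1) c'] x0] by blast
    let ?V = "chart_inv c ` (ball (snd c (y x)) r)"
    have sub: "ball (snd c (y x)) r \<subseteq> chart_image c"
    proof
      fix z assume "z \<in> ball (snd c (y x)) r"
      then have "z \<in> overlap c c'" using r(3) ball_subset_cball by blast
      then show "z \<in> chart_image c" by (simp add: overlap_iff[OF cA(1)])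
    qed
    have "open ?V" by (rule open_chart_inv_image[OF cA(1) open_ball sub])
    moreover have "y x \<in> ?V" using chart_inv_chart[OF cA] r(1) by (intro image_eqI[of _ _ "snd c (y x)"]) auto
    ultimately obtain d' where "d' > 0" and d': "\<forall>s\<in>{a..b}. \<bar>s - x\<bar> < d' \<longrightarrow> y s \<in> ?V"
      using continuous_on_locally_in_open[OF cont xab, of ?V] by blast
    have near: "snd c (y s) \<in> cball (snd c (y x)) r \<and> tr c c' (snd c (y s)) = snd c' (y s)"
      if s: "s \<in> {a..b}" "\<bar>s - x\<bar> < d'" for s
    proof -
      obtain z where z: "z \<in> ball (snd c (y x)) r" "y s = chart_inv c z" using d'[THEN bspec, OF s(1)] s(2) by blast
      then have "snd c (y s) = z" "y s \<in> fst c" using sub chart_chart_inv[OF cA(1)] chart_inv_in[OF cA(1)] by auto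
      then show ?thesis using z by (auto simp: tr_def)
    qed
    show "\<exists>d>0. \<forall>u' v'. u \<le> u' \<and> u' \<le> x \<and> x \<le> v' \<and> v' \<le> v \<and> v' - u' < d \<longrightarrow>
      dominated u' v' (\<lambda>l r. norm ((snd c' \<circ> y) r - (snd c' \<circ> y) l))"
    proof (intro exI[of _ "min d d'"] conjI allI impI)
      fix u' v' assume uv': "u \<le> u' \<and> u' \<le> x \<and> x \<le> v' \<and> v' \<le> v \<and> v' - u' < min d d'"
      have "dominated u' v' (\<lambda>l r. norm (snd c (y r) - snd c (y l)))" using d uv uv' by force
      then show "dominated u' v' (\<lambda>l r. norm ((snd c' \<circ> y) r - (snd c' \<circ> y) l))"
      proof (rule dominated_mono[OF _ r(2)])
        fix l r' assume lr: "u' \<le> l" "l \<le> r'" "r' \<le> v'"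
        then have "l \<in> {a..b}" "\<bar>l - x\<bar> < d'" "r' \<in> {a..b}" "\<bar>r' - x\<bar> < d'" using uv uv' by auto
        then show "norm ((snd c' \<circ> y) r' - (snd c' \<circ> y) l) \<le> K * norm (snd c (y r') - snd c (y l))"
          using near[of l] near[of r'] K[THEN bspec, THEN bspec, of "snd c (y r')" "snd c (y l)"] by simp
      qed
    qed (use \<open>d > 0\<close> \<open>d' > 0\<close> in auto)
  qed
  then show "abs_cont u v (snd c' \<circ> y)" by (rule dominated_imp_abs_cont)
qed

lemma ac_curve_cong:
  assumes "ac_curve A a b y" "\<And>s. s \<in> {a..b} \<Longrightarrow> y' s = y s"
  shows "ac_curve A a b y'"
  unfolding ac_curve_def
proof (intro conjI ballI allI impI)
  show "continuous_on {a..b} y'" by (rule continuous_on_eq[OF ac_curve_continuous[OF assms(1)]]) (simp add: assms(2))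
  fix c u v assume c: "c \<in> A" and uv: "a \<le> u \<and> u \<le> v \<and> v \<le> b \<and> y' ` {u..v} \<subseteq> fst c"
  then have eq: "y' s = y s" if "s \<in> {u..v}" for s using assms(2) that by auto
  then have "y ` {u..v} \<subseteq> fst c" using uv by force
  then have "abs_cont u v (snd c \<circ> y)" using ac_curve_chart[OF assms(1) c] uv by blast
  then show "abs_cont u v (snd c \<circ> y')" by (rule abs_cont_dominated) (use eq in auto)
qed

lemma ac_curve_concat:
  assumes 1: "ac_curve A a b y" and 2: "ac_curve A b c y" and "a \<le> b" "b \<le> c"
  shows "ac_curve A a c y"
  unfolding ac_curve_def
proof (intro conjI ballI allI impI)
  have "continuous_on ({a..b} \<union> {b..c}) y" using 1 2 by (intro continuous_on_closed_Un) (auto simp: ac_curve_def)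
  then show "continuous_on {a..c} y" using assms by (simp add: ivl_disj_un_two_touch)
  fix k u v assume k: "k \<in> A" and uv: "a \<le> u \<and> u \<le> v \<and> v \<le> c \<and> y ` {u..v} \<subseteq> fst k"
  consider "v \<le> b" | "b \<le> u" | "u \<le> b" "b \<le> v" by linarith
  then show "abs_cont u v (snd k \<circ> y)"
  proof cases
    case 3
    have sub: "y ` {u..b} \<subseteq> fst k" "y ` {b..v} \<subseteq> fst k" using uv 3 by (auto simp: image_subset_iff)
    have ac1: "abs_cont u b (snd k \<circ> y)" by (rule ac_curve_chart[OF 1 k]) (use uv 3 sub in auto)
    have ac2: "abs_cont b v (snd k \<circ> y)" by (rule ac_curve_chart[OF 2 k]) (use uv 3 sub in auto)
    have "dominated u v (\<lambda>l r. norm ((snd k \<circ> y) r - (snd k \<circ> y) l))"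
      by (rule dominated_concat[OF abs_cont_imp_dominated[OF ac1] abs_cont_imp_dominated[OF ac2]])
         (use 3 in \<open>simp_all add: norm_diff_triangle_via\<close>)
    then show ?thesis by (rule dominated_imp_abs_cont)
  next
    case 1
    then show ?thesis using uv by (intro ac_curve_chart[OF \<open>ac_curve A a b y\<close> k]) auto
  next
    case 2
    then show ?thesis using uv by (intro ac_curve_chart[OF \<open>ac_curve A b c y\<close> k]) auto
  qed
qed

end

lemma abs_cont_affine:
  assumes "abs_cont (m * u + k) (m * v + k) f" "m > 0"
  shows "abs_cont u v (\<lambda>s. f (m * s + k))"
  unfolding abs_cont_iff_modulus
proof (intro allI impI)
  fix \<epsilon> :: real assume "\<epsilon> > 0"
  then obtain \<delta> where "\<delta> > 0" and \<delta>: "ac_modulus (m * u + k) (m * v + k) f \<epsilon> \<delta>"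
    using abs_cont_modulus[OF assms(1)] by blast
  have "ac_modulus u v (\<lambda>s. f (m * s + k)) \<epsilon> (\<delta> / m)"
  proof (rule ac_modulusI)
    fix n :: nat and l r :: "nat \<Rightarrow> real"
    assume *: "\<And>i. i < n \<Longrightarrow> u \<le> l i \<and> l i \<le> r i \<and> r i \<le> v"
      "\<And>i j. i < n \<Longrightarrow> j < n \<Longrightarrow> i \<noteq> j \<Longrightarrow> {l i<..<r i} \<inter> {l j<..<r j} = {}" "(\<Sum>i<n. r i - l i) < \<delta> / m"
    show "(\<Sum>i<n. norm (f (m * r i + k) - f (m * l i + k))) < \<epsilon>"
    proof (rule ac_modulusD[OF \<delta>])
      show "(\<Sum>i<n. m * r i + k - (m * l i + k)) < \<delta>"
        using *(3) assms(2) by (simp add: sum_distrib_left[symmetric] right_diff_distrib[symmetric] pos_less_divide_eq mult.commute)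
      fix i assume "i \<in> {..<n}"
      then show "m * u + k \<le> m * l i + k \<and> m * l i + k \<le> m * r i + k \<and> m * r i + k \<le> m * v + k"
        using *(1)[of i] assms(2) by simp
      fix j assume "j \<in> {..<n}" "i \<noteq> j"
      with \<open>i \<in> {..<n}\<close> have disj: "{l i<..<r i} \<inter> {l j<..<r j} = {}" by (intro *(2)) auto
      show "{m * l i + k<..<m * r i + k} \<inter> {m * l j + k<..<m * r j + k} = {}"
      proof (rule ccontr)
        assume "\<not> ?thesis"
        then obtain x where x: "x \<in> {m * l i + k<..<m * r i + k}" "x \<in> {m * l j + k<..<m * r j + k}" by blast
        then have "(x - k) / m \<in> {l i<..<r i} \<inter> {l j<..<r j}"
          using assms(2) by (auto simp: field_simps)
        with disj show False by blast
      qed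
    qed simp
  qed
  moreover have "\<delta> / m > 0" using \<open>\<delta> > 0\<close> assms(2) by simp
  ultimately show "\<exists>\<delta>>0. ac_modulus u v (\<lambda>s. f (m * s + k)) \<epsilon> \<delta>" by blast
qed

lemma abs_cont_reflect:
  assumes "abs_cont (- v) (- u) f"
  shows "abs_cont u v (\<lambda>s. f (- s))"
  unfolding abs_cont_iff_modulus
proof (intro allI impI)
  fix \<epsilon> :: real assume "\<epsilon> > 0"
  then obtain \<delta> where "\<delta> > 0" and \<delta>: "ac_modulus (- v) (- u) f \<epsilon> \<delta>"
    using abs_cont_modulus[OF assms(1)] by blast
  have "ac_modulus u v (\<lambda>s. f (- s)) \<epsilon> \<delta>"
  proof (rule ac_modulusI)
    fix n :: nat and l r :: "nat \<Rightarrow> real"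
    assume *: "\<And>i. i < n \<Longrightarrow> u \<le> l i \<and> l i \<le> r i \<and> r i \<le> v"
      "\<And>i j. i < n \<Longrightarrow> j < n \<Longrightarrow> i \<noteq> j \<Longrightarrow> {l i<..<r i} \<inter> {l j<..<r j} = {}" "(\<Sum>i<n. r i - l i) < \<delta>"
    have "(\<Sum>i<n. norm (f (- l i) - f (- r i))) < \<epsilon>"
    proof (rule ac_modulusD[OF \<delta>])
      show "(\<Sum>i<n. - l i - - r i) < \<delta>" using *(3) by simp
      fix i assume "i \<in> {..<n}"
      then show "- v \<le> - r i \<and> - r i \<le> - l i \<and> - l i \<le> - u" using *(1)[of i] by simp
      fix j assume "j \<in> {..<n}" "i \<noteq> j"
      with \<open>i \<in> {..<n}\<close> have disj: "{l i<..<r i} \<inter> {l j<..<r j} = {}" by (intro *(2)) auto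
      show "{- r i<..<- l i} \<inter> {- r j<..<- l j} = {}"
      proof (rule ccontr)
        assume "\<not> ?thesis"
        then obtain x where "x \<in> {- r i<..<- l i}" "x \<in> {- r j<..<- l j}" by blast
        then have "- x \<in> {l i<..<r i} \<inter> {l j<..<r j}" by auto
        with disj show False by blast
      qed
    qed simp
    then show "(\<Sum>i<n. norm (f (- r i) - f (- l i))) < \<epsilon>" by (simp add: norm_minus_commute)
  qed
  with \<open>\<delta> > 0\<close> show "\<exists>\<delta>>0. ac_modulus u v (\<lambda>s. f (- s)) \<epsilon> \<delta>" by blast
qed

context finsler_manifold
begin

definition regular :: "(real \<Rightarrow> 'q) \<Rightarrow> real \<Rightarrow> bool" where
  "regular y s \<longleftrightarrow> velocity A y s \<in> tangent_space A (y s) \<and>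
     (\<forall>c\<in>charts_at A (y s). ((\<lambda>r. snd c (y r)) has_vector_derivative velocity A y s c) (at s))"

lemma regularD:
  "regular y s \<Longrightarrow> c \<in> charts_at A (y s) \<Longrightarrow> ((\<lambda>r. snd c (y r)) has_vector_derivative velocity A y s c) (at s)"
  by (simp add: regular_def)

lemma speed_regular:
  assumes "regular y s" "c \<in> charts_at A (y s)"
  shows "speed A R y s = rho c (snd c (y s)) (velocity A y s c)"
proof -
  have "velocity A y s = tvec_of A c (y s) (velocity A y s c)"
    by (rule tangent_space_tvec_of) (use assms in \<open>auto simp: regular_def\<close>)
  then show ?thesis unfolding speed_def rho_at[OF assms(2)] by simp
qed

lemma speed_nonneg: "regular y s \<Longrightarrow> 0 \<le> speed A R y s"
  using finsler unfolding regular_def speed_def finsler_norm_def by blast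

lemma regularI:
  assumes c: "c \<in> charts_at A (y s)" and S: "open S" "s \<in> S" "\<And>r. r \<in> S \<Longrightarrow> y r \<in> fst c"
    and g: "((\<lambda>r. snd c (y r)) has_vector_derivative g) (at s)"
  shows "regular y s" "velocity A y s c = g" "speed A R y s = rho c (snd c (y s)) g"
proof -
  have cA: "c \<in> A" using c by (simp add: charts_at_def)
  have der: "((\<lambda>r. snd c' (y r)) has_vector_derivative frechet_derivative (tr c c') (at (snd c (y s))) g) (at s)"
    if c': "c' \<in> charts_at A (y s)" for c'
  proof -
    let ?D = "frechet_derivative (tr c c') (at (snd c (y s)))"
    have tr: "(tr c c' has_derivative ?D) (at (snd c (y s)))" by (rule tr_has_derivative[OF c c'])
    have "((\<lambda>r. tr c c' (snd c (y r))) has_derivative (\<lambda>h. ?D (h *\<^sub>R g))) (at s)"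
      by (rule has_derivative_compose[OF g[unfolded has_vector_derivative_def] tr])
    then have "((\<lambda>r. tr c c' (snd c (y r))) has_vector_derivative ?D g) (at s)"
      unfolding has_vector_derivative_def by (simp add: linear_scale[OF has_derivative_linear[OF tr]])
    then show ?thesis
      by (rule has_vector_derivative_transform_within_open[OF _ S(1,2)])
         (use S(3) chart_inv_chart[OF cA] in \<open>simp add: tr_def\<close>)
  qed
  have vel: "velocity A y s = tvec_of A c (y s) g"
  proof
    fix c' show "velocity A y s c' = tvec_of A c (y s) g c'"
    proof (cases "c' \<in> charts_at A (y s)")
      case True
      then show ?thesis using vector_derivative_at[OF der[OF True]]
        by (simp add: velocity_def tvec_of_at o_def)
    qed (simp add: velocity_def tvec_of_def)
  qed
  show "regular y s"
    unfolding regular_def vel using der by (simp add: tvec_of_in_tangent_space[OF c] tvec_of_at)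
  show "velocity A y s c = g" by (simp add: vel tvec_of_self[OF c])
  show "speed A R y s = rho c (snd c (y s)) g" by (simp add: speed_def vel rho_at[OF c])
qed

lemma ac_curve_in_chart:
  assumes ac: "abs_cont u v (\<lambda>s. snd c (y s))" and cA: "c \<in> A" and y: "y ` {u..v} \<subseteq> fst c" and uv: "u < v"
  shows "speed A R y absolutely_integrable_on {u..v} \<and> (\<exists>N. negligible N \<and> (\<forall>s\<in>{u<..<v} - N. regular y s))"
proof -
  let ?x = "\<lambda>s. snd c (y s)"
  obtain g N where g: "g absolutely_integrable_on {u..v}" and N: "negligible N"
    and der: "\<forall>s\<in>{u<..<v} - N. (?x has_vector_derivative g s) (at s)"
    using abs_cont_FTC[OF ac uv] by blast
  have yc: "y s \<in> fst c" if "s \<in> {u..v}" for s using y that by blast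
  then have cy: "c \<in> charts_at A (y s)" if "s \<in> {u..v}" for s using that cA by (simp add: charts_at_def)
  have reg: "regular y s" "speed A R y s = rho c (?x s) (g s)" if s: "s \<in> {u<..<v} - N" for s
  proof -
    have "s \<in> {u..v}" "s \<in> {u<..<v}" "\<And>r. r \<in> {u<..<v} \<Longrightarrow> y r \<in> fst c" using s yc by auto
    note * = cy[OF this(1)] open_greaterThanLessThan this(2,3) der[THEN bspec, OF s]
    show "regular y s" by (rule regularI(1)[OF *])
    show "speed A R y s = rho c (?x s) (g s)" by (rule regularI(3)[OF *])
  qed
  have xX: "?x s \<in> chart_image c" if "s \<in> {u..v}" for s using yc[OF that] by blast
  have contx: "continuous_on {u..v} ?x" by (rule abs_cont_imp_continuous_on[OF ac])
  let ?K = "?x ` {u..v}"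
  have K: "compact ?K" "?K \<subseteq> chart_image c" using contx xX by (auto intro: compact_continuous_image)
  obtain M where "M > 0" and M: "\<forall>x\<in>?K. \<forall>w. rho c x w \<le> M * norm w" using rho_bounds[OF cA K] by blast
  have "(\<lambda>s. rho c (?x s) (g s)) absolutely_integrable_on {u..v}"
  proof (rule measurable_bounded_by_integrable_imp_absolutely_integrable)
    let ?F = "\<lambda>p. indicator (chart_image c \<times> UNIV) p *\<^sub>R (\<lambda>(x, w). rho c x w) p"
    have F: "?F \<in> borel_measurable borel"
      by (rule borel_measurable_continuous_on_indicator[OF _ continuous_on_rho[OF cA]])
         (use open_Times[OF open_chart_image[OF cA] open_UNIV] in \<open>rule borel_open\<close>)
    have "?x \<in> borel_measurable (lebesgue_on {u..v})"
      by (rule continuous_imp_measurable_on_sets_lebesgue[OF contx]) simp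
    moreover have "g \<in> borel_measurable (lebesgue_on {u..v})"
      using absolutely_integrable_imp_borel_measurable[OF g] by simp
    ultimately have "(\<lambda>s. (?x s, g s)) \<in> borel_measurable (lebesgue_on {u..v})" by (rule borel_measurable_Pair)
    from measurable_compose[OF this F]
    show "(\<lambda>s. rho c (?x s) (g s)) \<in> borel_measurable (lebesgue_on {u..v})"
      by (rule measurable_cong[THEN iffD1, rotated]) (use xX in \<open>simp add: indicator_def\<close>)
    show "(\<lambda>s. M * norm (g s)) integrable_on {u..v}"
      using g by (auto simp: absolutely_integrable_on_def intro: integrable_on_mult_right)
    fix s assume s: "s \<in> {u..v}"
    then show "norm (rho c (?x s) (g s)) \<le> M * norm (g s)"
      using M rho_nonneg[OF cA xX[OF s], of "g s"] by simp
  qed simp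
  then have "speed A R y absolutely_integrable_on {u..v}"
    by (rule absolutely_integrable_spike[where S="N \<union> {u, v}"])
       (use N reg(2) in \<open>auto intro: negligible_Un\<close>)
  with N reg(1) show ?thesis by blast
qed

lemma ac_curve_regular_aux:
  assumes ac: "ac_curve A a b y" and ab: "a \<le> b"
  shows "speed A R y absolutely_integrable_on {a..b} \<and> (\<exists>N. negligible N \<and> (\<forall>s\<in>{a<..<b} - N. regular y s))"
proof -
  let ?P = "\<lambda>u v. speed A R y absolutely_integrable_on {u..v} \<and> (\<exists>N. negligible N \<and> (\<forall>s\<in>{u<..<v} - N. regular y s))"
  have "a \<le> a \<and> b \<le> b \<longrightarrow> ?P a b"
    using ab
  proof (induction rule: Bolzano[where P = "\<lambda>u v. a \<le> u \<and> v \<le> b \<longrightarrow> ?P u v"])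
    case (trans u v w)
    show ?case
    proof
      assume *: "a \<le> u \<and> w \<le> b"
      then have 1: "?P u v" and 2: "?P v w" using trans by auto
      obtain N1 N2 where N: "negligible N1" "\<forall>s\<in>{u<..<v} - N1. regular y s" "negligible N2" "\<forall>s\<in>{v<..<w} - N2. regular y s"
        using 1 2 by blast
      have "speed A R y absolutely_integrable_on {u..w}"
      proof -
        have "speed A R y absolutely_integrable_on ({u..v} \<union> {v..w})"
          by (rule absolutely_integrable_Un) (use 1 2 in auto)
        then show ?thesis using trans(3,4) by (simp add: ivl_disj_un_two_touch)
      qed
      moreover have "negligible (N1 \<union> N2 \<union> {v})" using N by (auto intro: negligible_Un)
      moreover have "\<forall>s\<in>{u<..<w} - (N1 \<union> N2 \<union> {v}). regular y s"
      proof
        fix s assume s: "s \<in> {u<..<w} - (N1 \<union> N2 \<union> {v})"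
        then consider "s \<in> {u<..<v} - N1" | "s \<in> {v<..<w} - N2" by force
        then show "regular y s" by cases (use N in auto)
      qed
      ultimately show "?P u w" by blast
    qed
  next
    case (local x)
    then have x: "x \<in> {a..b}" by simp
    from ac_curve_local_chart[OF ac_curve_continuous[OF ac] x]
    obtain c d where c: "c \<in> charts_at A (y x)" and "d > 0" and d: "\<forall>s\<in>{a..b}. \<bar>s - x\<bar> < d \<longrightarrow> y s \<in> fst c" by blast
    have cA: "c \<in> A" using c by (simp add: charts_at_def)
    show ?case
    proof (intro exI[of _ d] conjI[OF \<open>d > 0\<close>], intro allI impI)
      fix u v assume uv: "u \<le> x \<and> x \<le> v \<and> v - u < d" "a \<le> u \<and> v \<le> b"
      show "?P u v"
      proof (cases "u < v")
        case True
        have sub: "y ` {u..v} \<subseteq> fst c" using d uv by auto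
        then have "abs_cont u v (snd c \<circ> y)" by (intro ac_curve_chart[OF ac cA]) (use uv True in auto)
        then show ?thesis by (intro ac_curve_in_chart[OF _ cA sub True]) (simp add: o_def)
      next
        case False
        then have "u = v" using uv by linarith
        then show ?thesis using negligible_empty by (auto intro!: absolutely_integrable_negligible)
      qed
    qed
  qed
  then show ?thesis by simp
qed

lemma ac_curve_regular:
  assumes "ac_curve A a b y"
  shows "\<exists>N. negligible N \<and> (\<forall>s\<in>{a<..<b} - N. regular y s)"
proof (cases "a \<le> b")
  case True
  then show ?thesis using ac_curve_regular_aux[OF assms] by blast
qed (auto intro: exI[of _ "{}"])

text \<open>The speed, made nonnegative on the null set where the curve is not differentiable.\<close>

definition spd :: "(real \<Rightarrow> 'q) \<Rightarrow> real \<Rightarrow> real" where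
  "spd y s = (if regular y s then speed A R y s else 0)"

lemma spd_nonneg: "0 \<le> spd y s"
  using speed_nonneg by (simp add: spd_def)

lemma spd_eq_speed_AE:
  assumes "ac_curve A a b y"
  obtains N where "negligible N" "\<forall>s\<in>{a..b} - N. regular y s" "\<forall>s\<in>{a..b} - N. spd y s = speed A R y s"
proof -
  obtain N where "negligible N" "\<forall>s\<in>{a<..<b} - N. regular y s" using ac_curve_regular[OF assms] by blast
  then show thesis by (intro that[of "N \<union> {a,b}"]) (auto simp: spd_def intro: negligible_Un)
qed

lemma spd_absolutely_integrable:
  assumes "ac_curve A a b y" "a \<le> b"
  shows "spd y absolutely_integrable_on {a..b}"
proof -
  obtain N where N: "negligible N" "\<forall>s\<in>{a..b} - N. spd y s = speed A R y s"
    by (rule spd_eq_speed_AE[OF assms(1)])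
  have "speed A R y absolutely_integrable_on {a..b}" using ac_curve_regular_aux[OF assms] by blast
  then show ?thesis by (rule absolutely_integrable_spike[OF _ N(1)]) (use N(2) in blast)
qed

lemma spd_integrable: "ac_curve A a b y \<Longrightarrow> a \<le> u \<Longrightarrow> u \<le> v \<Longrightarrow> v \<le> b \<Longrightarrow> spd y integrable_on {u..v}"
  using spd_absolutely_integrable[OF ac_curve_subinterval] absolutely_integrable_on_def by blast

lemma curve_length_eq: 
  assumes "ac_curve A 0 1 y"
  shows "curve_length A R y = integral {0..1} (spd y)"
proof -
  obtain N where N: "negligible N" "\<forall>s\<in>{0..1} - N. spd y s = speed A R y s"
    by (rule spd_eq_speed_AE[OF assms(1)])
  show ?thesis unfolding curve_length_def by (rule integral_spike[OF N(1)]) (use N(2) in blast)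
qed

lemma regular_affine_aux:
  assumes reg: "regular y (m * s + k)"
  shows "velocity A (\<lambda>r. y (m * r + k)) s = (\<lambda>c. m *\<^sub>R velocity A y (m * s + k) c)"
    "\<forall>c\<in>charts_at A (y (m * s + k)). ((\<lambda>r. snd c (y (m * r + k))) has_vector_derivative m *\<^sub>R velocity A y (m * s + k) c) (at s)"
proof -
  show der: "\<forall>c\<in>charts_at A (y (m * s + k)). ((\<lambda>r. snd c (y (m * r + k))) has_vector_derivative m *\<^sub>R velocity A y (m * s + k) c) (at s)"
  proof
    fix c assume c: "c \<in> charts_at A (y (m * s + k))"
    have "((\<lambda>r. m * r + k) has_vector_derivative m) (at s)"
      by (auto intro!: derivative_eq_intros simp: has_real_derivative_iff_has_vector_derivative[symmetric])
    from vector_diff_chain_at[OF this regularD[OF reg c]]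
    show "((\<lambda>r. snd c (y (m * r + k))) has_vector_derivative m *\<^sub>R velocity A y (m * s + k) c) (at s)"
      by (simp add: o_def)
  qed
  show "velocity A (\<lambda>r. y (m * r + k)) s = (\<lambda>c. m *\<^sub>R velocity A y (m * s + k) c)"
  proof
    fix c show "velocity A (\<lambda>r. y (m * r + k)) s c = m *\<^sub>R velocity A y (m * s + k) c"
      using vector_derivative_at[OF der[THEN bspec, of c]]
      by (cases "c \<in> charts_at A (y (m * s + k))") (auto simp: velocity_def o_def)
  qed
qed

lemma regular_affine_imp:
  assumes reg: "regular y (m * s + k)"
  shows "regular (\<lambda>r. y (m * r + k)) s" "speed A R (\<lambda>r. y (m * r + k)) s = \<bar>m\<bar> * speed A R y (m * s + k)"
proof -
  note aux = regular_affine_aux[OF reg]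
  have T: "velocity A y (m * s + k) \<in> tangent_space A (y (m * s + k))" using reg by (simp add: regular_def)
  obtain c where c: "c \<in> charts_at A (y (m * s + k))" by (rule chart_around)
  have "velocity A y (m * s + k) = tvec_of A c (y (m * s + k)) (velocity A y (m * s + k) c)"
    by (rule tangent_space_tvec_of[OF T c])
  then have v: "velocity A (\<lambda>r. y (m * r + k)) s = tvec_of A c (y (m * s + k)) (m *\<^sub>R velocity A y (m * s + k) c)"
    unfolding aux(1) tvec_of_linear(2)[OF c] by (metis (no_types, lifting))
  show "regular (\<lambda>r. y (m * r + k)) s"
    unfolding regular_def
  proof
    show "velocity A (\<lambda>r. y (m * r + k)) s \<in> tangent_space A (y (m * s + k))"
      unfolding v by (rule tvec_of_in_tangent_space[OF c])
    show "\<forall>c\<in>charts_at A (y (m * s + k)). ((\<lambda>r. snd c (y (m * r + k))) has_vector_derivative velocity A (\<lambda>r. y (m * r + k)) s c) (at s)"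
      unfolding aux(1) by (rule aux(2))
  qed
  show "speed A R (\<lambda>r. y (m * r + k)) s = \<bar>m\<bar> * speed A R y (m * s + k)"
    unfolding speed_regular[OF reg c] unfolding speed_def v rho_at[OF c, symmetric]
    by (rule rho_scale) (use c in \<open>auto simp: charts_at_def\<close>)
qed

lemma spd_affine:
  assumes "m \<noteq> 0"
  shows "regular (\<lambda>r. y (m * r + k)) s \<longleftrightarrow> regular y (m * s + k)"
    "spd (\<lambda>r. y (m * r + k)) s = \<bar>m\<bar> * spd y (m * s + k)"
proof -
  show *: "regular (\<lambda>r. y (m * r + k)) s \<longleftrightarrow> regular y (m * s + k)"
  proof
    assume "regular (\<lambda>r. y (m * r + k)) s"
    then have "regular (\<lambda>r. y (m * r + k)) ((1/m) * (m * s + k) + (- k / m))"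
      using assms by (simp add: add_divide_distrib)
    from regular_affine_imp(1)[OF this] show "regular y (m * s + k)"
      using assms by (simp add: right_diff_distrib)
  qed (rule regular_affine_imp)
  show "spd (\<lambda>r. y (m * r + k)) s = \<bar>m\<bar> * spd y (m * s + k)"
  proof (cases "regular y (m * s + k)")
    case True
    then show ?thesis by (simp add: spd_def * regular_affine_imp(2)[OF True])
  next
    case False
    then show ?thesis by (simp add: spd_def *)
  qed
qed

lemma ac_curve_affine:
  assumes ac: "ac_curve A (m * a + k) (m * b + k) y" and m: "m > 0"
  shows "ac_curve A a b (\<lambda>s. y (m * s + k))"
  unfolding ac_curve_def
proof (intro conjI ballI allI impI)
  show "continuous_on {a..b} (\<lambda>s. y (m * s + k))"
    by (rule continuous_on_compose2[OF ac_curve_continuous[OF ac]])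
       (use m in \<open>auto intro!: continuous_intros\<close>)
  fix c u v assume c: "c \<in> A" and uv: "a \<le> u \<and> u \<le> v \<and> v \<le> b \<and> (\<lambda>s. y (m * s + k)) ` {u..v} \<subseteq> fst c"
  have "y ` {m * u + k..m * v + k} \<subseteq> fst c"
  proof
    fix p assume "p \<in> y ` {m * u + k..m * v + k}"
    then obtain x where x: "p = y x" "m * u + k \<le> x" "x \<le> m * v + k" by auto
    then have "(x - k) / m \<in> {u..v}" "m * ((x - k) / m) + k = x" using m by (auto simp: field_simps)
    then show "p \<in> fst c" using uv x(1) by (metis image_subset_iff)
  qed
  then have "abs_cont (m * u + k) (m * v + k) (snd c \<circ> y)"
    by (intro ac_curve_chart[OF ac c]) (use uv m in auto)
  from abs_cont_affine[OF this m] show "abs_cont u v (snd c \<circ> (\<lambda>s. y (m * s + k)))" by (simp add: o_def)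
qed

lemma ac_curve_reflect:
  assumes ac: "ac_curve A (- b) (- a) y"
  shows "ac_curve A a b (\<lambda>s. y (- s))"
  unfolding ac_curve_def
proof (intro conjI ballI allI impI)
  show "continuous_on {a..b} (\<lambda>s. y (- s))"
    by (rule continuous_on_compose2[OF ac_curve_continuous[OF ac]]) (auto intro!: continuous_intros)
  fix c u v assume c: "c \<in> A" and uv: "a \<le> u \<and> u \<le> v \<and> v \<le> b \<and> (\<lambda>s. y (- s)) ` {u..v} \<subseteq> fst c"
  have "y x \<in> fst c" if "x \<in> {- v..- u}" for x
  proof -
    have "- x \<in> {u..v}" using that by simp
    then have "y (- (- x)) \<in> (\<lambda>s. y (- s)) ` {u..v}" by (rule imageI)
    then show ?thesis using uv by auto
  qed
  then have "abs_cont (- v) (- u) (snd c \<circ> y)"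
    by (intro ac_curve_chart[OF ac c]) (use uv in auto)
  from abs_cont_reflect[OF this] show "abs_cont u v (snd c \<circ> (\<lambda>s. y (- s)))" by (simp add: o_def)
qed

lemma has_integral_affine_real:
  fixes f :: "real \<Rightarrow> real"
  assumes "(f has_integral i) {m * a + k..m * b + k}" "m > 0"
  shows "((\<lambda>s. m * f (m * s + k)) has_integral i) {a..b}"
proof -
  have e: "(m * x + k - k) /\<^sub>R m = x" for x using assms(2) by simp
  have "((\<lambda>x. f (m *\<^sub>R x + k)) has_integral (i /\<^sub>R m ^ DIM(real)))
           (cbox ((m * a + k - k) /\<^sub>R m) ((m * b + k - k) /\<^sub>R m))"
    by (rule has_integral_affinity') (use assms in simp_all)
  then have "((\<lambda>x. f (m * x + k)) has_integral (i / m)) {a..b}"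
    unfolding e by (simp add: divide_inverse mult.commute)
  from has_integral_mult_right[OF this, of m] show ?thesis using assms(2) by simp
qed

lemma integral_spd_affine:
  assumes "ac_curve A (m * a + k) (m * b + k) y" "m > 0" "a \<le> b"
  shows "integral {a..b} (spd (\<lambda>s. y (m * s + k))) = integral {m * a + k..m * b + k} (spd y)"
proof -
  have "spd y integrable_on {m * a + k..m * b + k}"
    by (rule spd_integrable[OF assms(1)]) (use assms in auto)
  from has_integral_affine_real[OF integrable_integral[OF this] assms(2)]
  moreover have "spd (\<lambda>s. y (m * s + k)) = (\<lambda>s. m * spd y (m * s + k))"
    using spd_affine(2)[of m y k] assms(2) by (intro ext) simp
  ultimately show ?thesis by (simp only: integral_unique)
qed

lemma unit_curve:
  assumes ac: "ac_curve A a b y" and ab: "a < b"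
  defines "y' \<equiv> \<lambda>\<theta>. y ((b - a) * \<theta> + a)"
  shows "y' \<in> curves A (y a) (y b)" "curve_length A R y' = integral {a..b} (spd y)"
proof -
  have ac': "ac_curve A ((b - a) * 0 + a) ((b - a) * 1 + a) y" using ac by simp
  have "ac_curve A 0 1 y'" unfolding y'_def by (rule ac_curve_affine[OF ac']) (use ab in simp)
  then show "y' \<in> curves A (y a) (y b)" by (simp add: curves_def y'_def)
  show "curve_length A R y' = integral {a..b} (spd y)"
    using integral_spd_affine[OF ac'] ab curve_length_eq[OF \<open>ac_curve A 0 1 y'\<close>] by (simp add: y'_def)
qed

section \<open>The distance\<close>

lemma fdist_nonneg: "0 \<le> fdist A R p q"
  unfolding fdist_def
  by (rule cINF_greatest[OF connected])
     (auto simp: curves_def curve_length_eq intro!: Henstock_Kurzweil_Integration.integral_nonneg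
        spd_nonneg spd_integrable)

lemma fdist_le_curve_length: "y \<in> curves A p q \<Longrightarrow> fdist A R p q \<le> curve_length A R y"
  unfolding fdist_def
  by (rule cINF_lower)
     (auto simp: curves_def curve_length_eq intro!: bdd_belowI[of _ 0] Henstock_Kurzweil_Integration.integral_nonneg
        spd_nonneg spd_integrable)

lemma fdist_lessD:
  assumes "fdist A R p q < e"
  obtains y where "y \<in> curves A p q" "integral {0..1} (spd y) < e"
proof -
  have "\<exists>y\<in>curves A p q. curve_length A R y < e"
  proof (rule ccontr)
    assume "\<not> ?thesis"
    then have "e \<le> fdist A R p q" unfolding fdist_def by (intro cINF_greatest[OF connected]) auto
    with assms show False by simp
  qed
  then show thesis using that by (auto simp: curves_def curve_length_eq)
qed

lemma ac_curve_const: "ac_curve A a b (\<lambda>_. p)"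
  unfolding ac_curve_def abs_cont_def by (auto intro: exI[of _ 1])

lemma spd_const: "spd (\<lambda>_. p) s = 0"
proof -
  obtain c where c: "c \<in> charts_at A p" by (rule chart_around)
  then have cA: "c \<in> A" "p \<in> fst c" by (auto simp: charts_at_def)
  have "speed A R (\<lambda>_. p) s = rho c (snd c p) 0"
    by (rule regularI(3)[where S=UNIV]) (use c cA in auto)
  then show ?thesis using rho_zero[OF cA(1), of "snd c p"] cA by (simp add: spd_def)
qed

lemma fdist_self: "fdist A R p p = 0"
proof -
  have "(\<lambda>_. p) \<in> curves A p p" by (simp add: curves_def ac_curve_const)
  moreover have "spd (\<lambda>_. p) = (\<lambda>_. 0)" by (rule ext) (rule spd_const)
  ultimately have "fdist A R p p \<le> 0"
    using fdist_le_curve_length[of "\<lambda>_. p"] by (simp add: curve_length_eq ac_curve_const)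
  then show ?thesis using fdist_nonneg[of p p] by simp
qed

lemma fdist_le_integral:
  assumes ac: "ac_curve A a b y" and ab: "a \<le> b"
  shows "fdist A R (y a) (y b) \<le> integral {a..b} (spd y)"
proof (cases "a = b")
  case True
  then show ?thesis by (simp add: fdist_self)
next
  case False
  then show ?thesis using unit_curve[OF ac] ab fdist_le_curve_length by fastforce
qed

lemma fdist_sym: "fdist A R p q = fdist A R q p"
proof -
  have "fdist A R q p \<le> fdist A R p q" for p q
  proof (rule field_le_epsilon)
    fix e :: real assume "0 < e"
    then obtain y where y: "y \<in> curves A p q" "integral {0..1} (spd y) < fdist A R p q + e"
      using fdist_lessD[of p q "fdist A R p q + e"] by auto
    then have ac: "ac_curve A (- 0) (- (- 1)) y" by (simp add: curves_def)
    have "fdist A R q p \<le> integral {-1..-0} (spd (\<lambda>s. y (- s)))"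
      using fdist_le_integral[OF ac_curve_reflect, of 0 "-1" y] ac y by (simp add: curves_def)
    also have "spd (\<lambda>s. y (- s)) = (\<lambda>s. spd y (- s))"
      using spd_affine(2)[of "-1" y 0] by (auto simp: fun_eq_iff)
    also have "integral {-1..-0} (\<lambda>s. spd y (- s)) = integral {0..1} (spd y)" by (rule Henstock_Kurzweil_Integration.integral_reflect_real)
    finally show "fdist A R q p \<le> fdist A R p q + e" using y by simp
  qed
  then show ?thesis by (metis order_antisym)
qed

lemma spd_cong_open:
  assumes "open S" "s \<in> S" "\<And>r. r \<in> S \<Longrightarrow> f r = f' r"
  shows "spd f s = spd f' s"
proof -
  have der: "((\<lambda>r. h (f r)) has_vector_derivative g) (at s) \<longleftrightarrow> ((\<lambda>r. h (f' r)) has_vector_derivative g) (at s)"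
    for h :: "'q \<Rightarrow> 'e" and g
    by (intro iffI; erule has_vector_derivative_transform_within_open[OF _ assms(1,2)]) (use assms(3) in auto)
  have eq: "f s = f' s" using assms by blast
  then have "velocity A f s = velocity A f' s"
    unfolding velocity_def vector_derivative_def o_def der by simp
  then show ?thesis using eq by (simp add: spd_def regular_def speed_def der)
qed

lemma fdist_triangle: "fdist A R p r \<le> fdist A R p q + fdist A R q r"
proof (rule field_le_epsilon)
  fix e :: real assume "0 < e"
  then obtain y where y: "y \<in> curves A p q" "integral {0..1} (spd y) < fdist A R p q + e/2"
    using fdist_lessD[of p q "fdist A R p q + e/2"] by auto
  obtain z where z: "z \<in> curves A q r" "integral {0..1} (spd z) < fdist A R q r + e/2"
    using fdist_lessD[of q r "fdist A R q r + e/2"] \<open>0 < e\<close> by auto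
  define w where "w s = (if s \<le> 1 then y s else z (1 * s + (- 1)))" for s
  have "ac_curve A (1 * 1 + (- 1)) (1 * 2 + (- 1)) z" using z by (simp add: curves_def)
  then have z1: "ac_curve A 1 2 (\<lambda>s. z (1 * s + (- 1)))" "integral {1..2} (spd (\<lambda>s. z (1 * s + (- 1)))) = integral {0..1} (spd z)"
    using ac_curve_affine[of 1 1 "-1" 2 z] integral_spd_affine[of 1 1 "-1" 2 z] by simp_all
  have ay: "ac_curve A 0 1 y" using y by (simp add: curves_def)
  have "ac_curve A 0 1 w" by (rule ac_curve_cong[OF ay]) (simp add: w_def)
  moreover have "ac_curve A 1 2 w"
    by (rule ac_curve_cong[OF z1(1)]) (use y z in \<open>auto simp: w_def curves_def\<close>)
  ultimately have ac: "ac_curve A 0 2 w" by (rule ac_curve_concat) auto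
  have "fdist A R (w 0) (w 2) \<le> integral {0..2} (spd w)" by (rule fdist_le_integral[OF ac]) simp
  also have "\<dots> = integral {0..1} (spd w) + integral {1..2} (spd w)"
    by (rule Henstock_Kurzweil_Integration.integral_combine[symmetric]) (auto intro: spd_integrable[OF ac])
  also have "integral {0..1} (spd w) = integral {0..1} (spd y)"
    by (rule integral_spike[of "{1}"]) (auto intro!: spd_cong_open[of "{..<1}"] simp: w_def)
  also have "integral {1..2} (spd w) = integral {1..2} (spd (\<lambda>s. z (1 * s + (- 1))))"
    by (rule integral_spike[of "{1}"]) (auto intro!: spd_cong_open[of "{1<..}"] simp: w_def)
  also have "\<dots> = integral {0..1} (spd z)" by (rule z1(2))
  finally have "fdist A R (w 0) (w 2) \<le> integral {0..1} (spd y) + integral {0..1} (spd z)" .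
  moreover have "w 0 = p" "w 2 = r" using y z by (simp_all add: w_def curves_def)
  ultimately show "fdist A R p r \<le> fdist A R p q + fdist A R q r + e" using y z by simp
qed

end

section \<open>Local comparison of the distance with the coordinate norms\<close>

lemma integral_le_negligible:
  fixes f g :: "real \<Rightarrow> real"
  assumes "f integrable_on S" "g integrable_on S" "negligible N" "\<And>x. x \<in> S - N \<Longrightarrow> f x \<le> g x"
  shows "integral S f \<le> integral S g"
proof -
  define h where "h x = (if x \<in> N then g x else f x)" for x
  have "integral S f = integral S h" by (rule integral_spike[OF assms(3)]) (simp add: h_def)
  also have "\<dots> \<le> integral S g"
    by (rule integral_le[OF integrable_spike[OF assms(1,3)] assms(2)]) (use assms(4) in \<open>auto simp: h_def\<close>)
  finally show ?thesis .
qed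

lemma has_vector_derivative_quotient:
  assumes "(x has_vector_derivative g) (at s)"
  shows "((\<lambda>r. (1 / (r - s)) *\<^sub>R (x r - x s)) \<longlongrightarrow> g) (at s)"
proof -
  have "((\<lambda>r. norm ((x r - x s) - (r - s) *\<^sub>R g) / norm (r - s)) \<longlongrightarrow> 0) (at s)"
    using assms unfolding has_vector_derivative_def has_derivative_iff_norm by simp
  then have "((\<lambda>r. norm ((1 / (r - s)) *\<^sub>R (x r - x s) - g)) \<longlongrightarrow> 0) (at s)"
  proof (rule Lim_transform_eventually)
    show "\<forall>\<^sub>F r in at s. norm ((x r - x s) - (r - s) *\<^sub>R g) / norm (r - s) = norm ((1 / (r - s)) *\<^sub>R (x r - x s) - g)"
      unfolding eventually_at_filter
    proof (intro always_eventually allI impI)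
      fix r assume "r \<noteq> s"
      then have "(1 / (r - s)) *\<^sub>R (x r - x s) - g = (1 / (r - s)) *\<^sub>R ((x r - x s) - (r - s) *\<^sub>R g)"
        by (simp add: scaleR_right_diff_distrib)
      then show "norm ((x r - x s) - (r - s) *\<^sub>R g) / norm (r - s) = norm ((1 / (r - s)) *\<^sub>R (x r - x s) - g)"
        by (simp add: abs_divide)
    qed
  qed
  then have "((\<lambda>r. (1 / (r - s)) *\<^sub>R (x r - x s) - g) \<longlongrightarrow> 0) (at s)" by (rule tendsto_norm_zero_cancel)
  then show ?thesis by (rule LIM_zero_cancel)
qed

definition bounded_seminorm :: "real \<Rightarrow> ('e::real_normed_vector \<Rightarrow> real) \<Rightarrow> bool" where
  "bounded_seminorm B N \<longleftrightarrow> 0 \<le> B \<and> (\<forall>v w. N (v + w) \<le> N v + N w) \<and> (\<forall>a v. N (a *\<^sub>R v) = \<bar>a\<bar> * N v) \<and>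
     (\<forall>w. N w \<le> B * norm w)"

lemma bounded_seminorm_facts:
  assumes "bounded_seminorm B N"
  shows "0 \<le> B" "N (v + w) \<le> N v + N w" "N (a *\<^sub>R v) = \<bar>a\<bar> * N v" "N w \<le> B * norm w"
    "N 0 = 0" "N (- v) = N v" "0 \<le> N v" "\<bar>N v - N w\<bar> \<le> N (v - w)"
proof -
  have N: "0 \<le> B" "\<And>v w. N (v + w) \<le> N v + N w" "\<And>a v. N (a *\<^sub>R v) = \<bar>a\<bar> * N v" "\<And>w. N w \<le> B * norm w"
    using assms by (auto simp: bounded_seminorm_def)
  show "0 \<le> B" "N (v + w) \<le> N v + N w" "N (a *\<^sub>R v) = \<bar>a\<bar> * N v" "N w \<le> B * norm w" by (rule N)+
  show N0: "N 0 = 0" using N(3)[of 0 0] by simp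
  have Nm: "N (- v) = N v" for v using N(3)[of "-1" v] by simp
  show "N (- v) = N v" by (rule Nm)
  show "0 \<le> N v" using N(2)[of v "- v"] N0 Nm[of v] by simp
  show "\<bar>N v - N w\<bar> \<le> N (v - w)" using N(2)[of w "v - w"] N(2)[of v "w - v"] Nm[of "v - w"] by simp
qed

lemma bounded_seminorm_tendsto:
  assumes "bounded_seminorm B N" "(f \<longlongrightarrow> g) F"
  shows "((\<lambda>x. N (f x)) \<longlongrightarrow> N g) F"
proof -
  have "((\<lambda>x. N (f x) - N g) \<longlongrightarrow> 0) F"
  proof (rule Lim_null_comparison)
    show "\<forall>\<^sub>F x in F. norm (N (f x) - N g) \<le> B * norm (f x - g)"
      using bounded_seminorm_facts(4,8)[OF assms(1)] by (auto intro!: always_eventually intro: order_trans)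
    show "((\<lambda>x. B * norm (f x - g)) \<longlongrightarrow> 0) F"
      using assms(2) by (intro tendsto_mult_right_zero tendsto_norm_zero) (simp add: LIM_zero)
  qed
  then show ?thesis by (rule LIM_zero_cancel)
qed

context finsler_manifold
begin

lemma rho_seminorm:
  assumes "c \<in> A" "x \<in> chart_image c" "0 \<le> k"
  shows "\<exists>B. bounded_seminorm B (\<lambda>w. k * rho c x w)"
proof -
  obtain M where "M > 0" "\<forall>w. rho c x w \<le> M * norm w" using rho_bounds[OF assms(1), of "{x}"] assms by auto
  then have "bounded_seminorm (k * M) (\<lambda>w. k * rho c x w)"
    unfolding bounded_seminorm_def
  proof (intro conjI allI)
    show "0 \<le> k * M" using assms(3) \<open>M > 0\<close> by simp
    show "k * rho c x (v + w) \<le> k * rho c x v + k * rho c x w" for v w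
      using mult_left_mono[OF rho_triangle[OF assms(1,2), of v w] assms(3)] by (simp add: distrib_left)
    show "k * rho c x (a *\<^sub>R v) = \<bar>a\<bar> * (k * rho c x v)" for a v
      unfolding rho_scale[OF assms(1,2)] by simp
    show "k * rho c x w \<le> k * M * norm w" for w
      using mult_left_mono[of "rho c x w" "M * norm w" k] \<open>\<forall>w. rho c x w \<le> M * norm w\<close> assms(3)
      by (simp add: mult.assoc)
  qed
  then show ?thesis by blast
qed

lemma seminorm_increment_le_length:
  assumes N: "bounded_seminorm B N" and cA: "c \<in> A" and ac: "ac_curve A a b y" and uv: "a \<le> u" "u \<le> v" "v \<le> b"
    and y: "y ` {u..v} \<subseteq> fst c" and le: "\<And>s w. s \<in> {u..v} \<Longrightarrow> N w \<le> rho c (snd c (y s)) w"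
  shows "N (snd c (y v) - snd c (y u)) \<le> integral {u..v} (spd y)"
proof (cases "u = v")
  case True
  then show ?thesis by (simp add: bounded_seminorm_facts(5)[OF N])
next
  case False
  then have "u < v" using uv by simp
  let ?x = "\<lambda>s. snd c (y s)"
  note Nf = bounded_seminorm_facts[OF N]
  define f where "f s = N (?x s - ?x u)" for s
  have acx: "abs_cont u v (\<lambda>s. ?x s)"
    using ac_curve_chart[OF ac cA uv y] by (simp add: o_def)
  have df: "\<bar>f r - f l\<bar> \<le> N (?x r - ?x l)" for r l
    using Nf(8)[of "?x r - ?x u" "?x l - ?x u"] by (simp add: f_def)
  have "dominated u v (\<lambda>l r. norm (f r - f l))"
    by (rule dominated_mono[OF abs_cont_imp_dominated[OF acx uv(2)] Nf(1)])
       (use df Nf(4) in \<open>auto intro: order_trans\<close>)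
  from abs_cont_FTC[OF dominated_imp_abs_cont[OF this] \<open>u < v\<close>]
  obtain g N1 where g: "g absolutely_integrable_on {u..v}" "negligible N1"
    "\<forall>s\<in>{u<..<v} - N1. (f has_vector_derivative g s) (at s)"
    "\<forall>l r. u \<le> l \<longrightarrow> l \<le> r \<longrightarrow> r \<le> v \<longrightarrow> (g has_integral (f r - f l)) {l..r}"
    by blast
  have acuv: "ac_curve A u v y" by (rule ac_curve_subinterval[OF ac uv(1,3)])
  obtain N2 where N2: "negligible N2" "\<forall>s\<in>{u<..<v} - N2. regular y s" using ac_curve_regular[OF acuv] by blast
  have gle: "g s \<le> spd y s" if s: "s \<in> {u..v} - (N1 \<union> N2 \<union> {u,v})" for s
  proof -
    have reg: "regular y s" and fder: "(f has_vector_derivative g s) (at s)" using s N2 g(3) by auto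
    have "s \<in> {u..v}" using s by auto
    then have c: "c \<in> charts_at A (y s)" using y cA by (auto simp: charts_at_def)
    let ?v = "velocity A y s c"
    have "((\<lambda>r. (1 / (r - s)) *\<^sub>R (f r - f s)) \<longlongrightarrow> g s) (at s)" by (rule has_vector_derivative_quotient[OF fder])
    then have 1: "((\<lambda>r. (1 / (r - s)) *\<^sub>R (f r - f s)) \<longlongrightarrow> g s) (at s within {s<..})"
      by (rule tendsto_within_subset) simp
    have "((\<lambda>r. N ((1 / (r - s)) *\<^sub>R (?x r - ?x s))) \<longlongrightarrow> N ?v) (at s)"
      by (rule bounded_seminorm_tendsto[OF N has_vector_derivative_quotient[OF regularD[OF reg c]]])
    then have 2: "((\<lambda>r. N ((1 / (r - s)) *\<^sub>R (?x r - ?x s))) \<longlongrightarrow> N ?v) (at s within {s<..})"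
      by (rule tendsto_within_subset) simp
    have "g s \<le> N ?v"
    proof (rule tendsto_le[OF _ 2 1])
      show "\<forall>\<^sub>F r in at_right s. (1 / (r - s)) *\<^sub>R (f r - f s) \<le> N ((1 / (r - s)) *\<^sub>R (?x r - ?x s))"
        unfolding eventually_at_filter
      proof (intro always_eventually allI impI)
        fix r assume "r \<in> {s<..}"
        then have "0 < 1 / (r - s)" by simp
        have "(1 / (r - s)) * (f r - f s) \<le> (1 / (r - s)) * N (?x r - ?x s)"
          using \<open>0 < 1 / (r - s)\<close> df[of r s] by (intro mult_left_mono) auto
        then show "(1 / (r - s)) *\<^sub>R (f r - f s) \<le> N ((1 / (r - s)) *\<^sub>R (?x r - ?x s))"
          unfolding Nf(3) using \<open>0 < 1 / (r - s)\<close> by simp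
      qed
    qed simp
    also have "\<dots> \<le> rho c (?x s) ?v" by (rule le[OF \<open>s \<in> {u..v}\<close>])
    finally show ?thesis using speed_regular[OF reg c] reg by (simp add: spd_def)
  qed
  have "f v - f u = integral {u..v} g" using g(4) uv(2) by (auto intro!: integral_unique[symmetric])
  also have "\<dots> \<le> integral {u..v} (spd y)"
    by (rule integral_le_negligible[of _ _ _ "N1 \<union> N2 \<union> {u,v}"])
       (use g N2 gle spd_integrable[OF ac uv] in \<open>auto simp: absolutely_integrable_on_def intro!: negligible_Un\<close>)
  finally show ?thesis by (simp add: f_def Nf(5))
qed

lemma curve_stays_or_exits:
  assumes N: "bounded_seminorm B N" and cA: "c \<in> A" and r: "cball x0 r \<subseteq> chart_image c"
    and le: "\<And>x w. x \<in> cball x0 r \<Longrightarrow> N w \<le> rho c x w"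
    and ac: "ac_curve A a b y" and ab: "a \<le> b" and xa: "xa \<in> ball x0 r" and ya: "y a = chart_inv c xa"
  shows "(y b \<in> chart_inv c ` ball x0 r \<and> N (snd c (y b) - xa) \<le> integral {a..b} (spd y)) \<or>
     (\<exists>x'. norm (x' - x0) = r \<and> N (x' - xa) \<le> integral {a..b} (spd y))"
proof -
  let ?V = "chart_inv c ` ball x0 r" and ?K = "chart_inv c ` cball x0 r"
  have "xa \<in> chart_image c" using xa r by auto
  then have sxa: "snd c (y a) = xa" using ya chart_chart_inv[OF cA] by simp
  have Vopen: "open ?V" using r by (intro open_chart_inv_image[OF cA]) auto
  have Kcomp: "compact ?K"
    by (rule compact_continuous_image[OF continuous_on_subset[OF continuous_on_chart_inv[OF cA] r]]) simp
  have KU: "p \<in> fst c \<and> snd c p \<in> cball x0 r" if "p \<in> ?K" for p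
    using that r chart_chart_inv[OF cA] chart_inv_in[OF cA] by auto
  have length: "N (snd c (y t) - xa) \<le> integral {a..b} (spd y)" if t: "t \<in> {a..b}" "y ` {a..t} \<subseteq> ?K" for t
  proof -
    have "N (snd c (y t) - snd c (y a)) \<le> integral {a..t} (spd y)"
      by (rule seminorm_increment_le_length[OF N cA ac]) (use t KU le in \<open>auto simp: image_subset_iff\<close>)
    also have "\<dots> \<le> integral {a..b} (spd y)"
      by (rule integral_subset_le) (use t in \<open>auto intro!: spd_integrable[OF ac] spd_nonneg\<close>)
    finally show ?thesis using sxa by simp
  qed
  define Z where "Z = {a..b} \<inter> y -` (- ?V)"
  have Z: "closed Z" unfolding Z_def
    by (rule continuous_closed_preimage[OF ac_curve_continuous[OF ac]]) (use Vopen in auto)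
  show ?thesis
  proof (cases "Z = {}")
    case True
    then have "y s \<in> ?V" if "s \<in> {a..b}" for s using that by (auto simp: Z_def)
    then have "y ` {a..b} \<subseteq> ?K" "y b \<in> ?V" using ab ball_subset_cball by (auto, fastforce)
    then show ?thesis using length[of b] ab by auto
  next
    case False
    define t where "t = Inf Z"
    have bb: "bdd_below Z" by (auto simp: Z_def intro!: bdd_belowI[of _ a])
    have "t \<in> Z" unfolding t_def by (rule closed_contains_Inf[OF False bb Z])
    then have t: "t \<in> {a..b}" "y t \<notin> ?V" by (auto simp: Z_def)
    have "y a \<in> ?V" using xa ya by blast
    then have "a < t" using t by (cases "a = t") auto
    have before: "y s \<in> ?V" if "s \<in> {a..<t}" for s
    proof (rule ccontr)
      assume "y s \<notin> ?V"
      then have "s \<in> Z" using that t by (auto simp: Z_def)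
      then have "t \<le> s" unfolding t_def by (rule cInf_lower[OF _ bb])
      then show False using that by simp
    qed
    have "y t \<in> ?K"
    proof (rule Lim_in_closed_set)
      show "closed ?K" using Kcomp by (rule compact_imp_closed)
      show "(y \<longlongrightarrow> y t) (at t within {a..<t})"
      proof (rule tendsto_within_subset)
        show "(y \<longlongrightarrow> y t) (at t within {a..b})"
          using ac_curve_continuous[OF ac] t(1) unfolding continuous_on_def by blast
      qed (use t(1) in auto)
      have "t islimpt {a..<t}" using \<open>a < t\<close> by simp
      then show "\<not> trivial_limit (at t within {a..<t})" by (simp add: trivial_limit_within)
      show "\<forall>\<^sub>F s in at t within {a..<t}. y s \<in> ?K"
        unfolding eventually_at_filter using before by (auto intro!: always_eventually) fastforce
    qed
    then obtain x' where x': "x' \<in> cball x0 r" "y t = chart_inv c x'" by blast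
    then have "norm (x' - x0) = r" using t(2) by (force simp: dist_norm norm_minus_commute)
    moreover have "y ` {a..t} \<subseteq> ?K"
    proof
      fix p assume "p \<in> y ` {a..t}"
      then obtain s where s: "p = y s" "s \<in> {a..t}" by blast
      show "p \<in> ?K"
      proof (cases "s = t")
        case False
        then have "y s \<in> ?V" using before s by auto
        then show ?thesis using s ball_subset_cball by blast
      qed (use \<open>y t \<in> ?K\<close> s in simp)
    qed
    moreover have "snd c (y t) = x'" using x' r chart_chart_inv[OF cA] by auto
    ultimately show ?thesis using length[OF t(1)] by auto
  qed
qed

lemma rho_le_fdist_local:
  assumes cA: "c \<in> A" and x0: "x0 \<in> chart_image c" and \<epsilon>: "0 < \<epsilon>" "\<epsilon> < 1"
  shows "\<exists>\<delta>>0. ball x0 \<delta> \<subseteq> chart_image c \<and> (\<forall>x1\<in>ball x0 \<delta>. \<forall>x2\<in>ball x0 \<delta>.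
    (1 - \<epsilon>) * rho c x0 (x2 - x1) \<le> fdist A R (chart_inv c x1) (chart_inv c x2))"
proof -
  obtain r where r: "r > 0" "cball x0 r \<subseteq> chart_image c"
    and le: "\<forall>x\<in>cball x0 r. \<forall>w. (1 - \<epsilon>) * rho c x0 w \<le> rho c x w"
    using rho_almost_constant[OF cA x0 \<epsilon>(1)] by blast
  obtain m M where mM: "m > 0" "M > 0" "\<forall>w. m * norm w \<le> rho c x0 w" "\<forall>w. rho c x0 w \<le> M * norm w"
    using rho_bounds[OF cA, of "{x0}"] x0 by auto
  let ?N = "\<lambda>w. (1 - \<epsilon>) * rho c x0 w"
  obtain B where N: "bounded_seminorm B ?N" using rho_seminorm[OF cA x0, of "1 - \<epsilon>"] \<epsilon> by auto
  define \<delta> where "\<delta> = m * r / (2 * M + m)"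
  have "(2 * M + m) * \<delta> = m * r" using mM by (simp add: \<delta>_def)
  then have "2 * M * \<delta> + m * \<delta> = m * r" by (simp only: distrib_right)
  moreover have "\<delta> > 0" using mM r by (simp add: \<delta>_def)
  ultimately have \<delta>: "\<delta> > 0" "2 * M * \<delta> + m * \<delta> = m * r" by blast+
  have "m * \<delta> < m * r" using \<delta> mM by (smt (verit) mult_pos_pos)
  then have "\<delta> < r" using mM by simp
  show ?thesis
  proof (intro exI[of _ \<delta>] conjI ballI \<delta>(1))
    show "ball x0 \<delta> \<subseteq> chart_image c" using r \<open>\<delta> < r\<close> by (meson ball_subset_cball dual_order.trans less_imp_le subset_ball)
    fix x1 x2 assume x12: "x1 \<in> ball x0 \<delta>" "x2 \<in> ball x0 \<delta>"
    then have x12': "x1 \<in> ball x0 r" "x2 \<in> chart_image c" using \<open>\<delta> < r\<close> r(2) by auto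
    show "?N (x2 - x1) \<le> fdist A R (chart_inv c x1) (chart_inv c x2)"
    proof (rule ccontr)
      assume "\<not> ?thesis"
      then obtain y where y: "y \<in> curves A (chart_inv c x1) (chart_inv c x2)" "integral {0..1} (spd y) < ?N (x2 - x1)"
        using fdist_lessD[of "chart_inv c x1" "chart_inv c x2"] by (metis not_less)
      have ac: "ac_curve A 0 1 y" and y0: "y 0 = chart_inv c x1" and y1: "snd c (y 1) = x2"
        using y(1) chart_chart_inv[OF cA x12'(2)] by (auto simp: curves_def)
      have "(y 1 \<in> chart_inv c ` ball x0 r \<and> ?N (snd c (y 1) - x1) \<le> integral {0..1} (spd y)) \<or>
        (\<exists>x'. norm (x' - x0) = r \<and> ?N (x' - x1) \<le> integral {0..1} (spd y))"
        by (rule curve_stays_or_exits[OF N cA r(2) _ ac _ x12'(1) y0]) (use le in auto)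
      then show False
      proof
        assume "\<exists>x'. norm (x' - x0) = r \<and> ?N (x' - x1) \<le> integral {0..1} (spd y)"
        then obtain x' where x': "norm (x' - x0) = r" "?N (x' - x1) \<le> integral {0..1} (spd y)" by blast
        have n1: "norm (x1 - x0) < \<delta>" and n2: "norm (x2 - x0) < \<delta>" using x12 by (auto simp: dist_norm norm_minus_commute)
        have "norm (x2 - x1) \<le> 2 * \<delta>" "r - \<delta> \<le> norm (x' - x1)"
          using n1 n2 x'(1) norm_triangle_ineq4[of "x2 - x0" "x1 - x0"] norm_triangle_ineq[of "x' - x1" "x1 - x0"] by auto
        then have "rho c x0 (x2 - x1) \<le> M * (2 * \<delta>)" "m * (r - \<delta>) \<le> rho c x0 (x' - x1)"
          using mM by (meson less_imp_le mult_left_mono order_trans)+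
        then have "rho c x0 (x2 - x1) \<le> rho c x0 (x' - x1)" using \<delta>(2) by (simp add: algebra_simps)
        then have "?N (x2 - x1) \<le> ?N (x' - x1)" using \<epsilon> by (intro mult_left_mono) auto
        then show False using x'(2) y(2) by linarith
      qed (use y y1 in auto)
    qed
  qed
qed

lemma fdist_neighbourhood:
  assumes "open V" "p \<in> V"
  shows "\<exists>\<eta>>0. \<forall>q. fdist A R p q < \<eta> \<longrightarrow> q \<in> V"
proof -
  obtain c where c: "c \<in> charts_at A p" by (rule chart_around)
  then have cA: "c \<in> A" "p \<in> fst c" by (auto simp: charts_at_def)
  define x0 where "x0 = snd c p"
  have x0: "x0 \<in> chart_image c" "chart_inv c x0 = p" using cA chart_inv_chart[OF cA] by (auto simp: x0_def)
  have "open (chart_image c \<inter> chart_inv c -` V)"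
    by (rule continuous_open_preimage[OF continuous_on_chart_inv[OF cA(1)] open_chart_image[OF cA(1)] assms(1)])
  moreover have "x0 \<in> chart_image c \<inter> chart_inv c -` V" using x0 assms by simp
  ultimately obtain r0 where r0: "r0 > 0" "ball x0 r0 \<subseteq> chart_image c \<inter> chart_inv c -` V"
    by (meson open_contains_ball)
  obtain r1 where r1: "r1 > 0" "cball x0 r1 \<subseteq> chart_image c"
    and le: "\<forall>x\<in>cball x0 r1. \<forall>w. (1 - 1/2) * rho c x0 w \<le> rho c x w"
    using rho_almost_constant[OF cA(1) x0(1), of "1/2"] by auto
  obtain m where m: "m > 0" "\<forall>w. m * norm w \<le> rho c x0 w"
    using rho_bounds[OF cA(1), of "{x0}"] x0 by auto
  let ?N = "\<lambda>w. (1 - 1/2) * rho c x0 w"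
  obtain B where N: "bounded_seminorm B ?N" using rho_seminorm[OF cA(1) x0(1), of "1 - 1/2"] by auto
  define r where "r = min r0 r1"
  have r: "r > 0" "cball x0 r \<subseteq> cball x0 r1" "ball x0 r \<subseteq> ball x0 r0" using r0 r1 by (auto simp: r_def)
  show ?thesis
  proof (intro exI[of _ "m * r / 2"] conjI allI impI)
    show "0 < m * r / 2" using m r by simp
    fix q assume "fdist A R p q < m * r / 2"
    then obtain y where y: "y \<in> curves A p q" "integral {0..1} (spd y) < m * r / 2" using fdist_lessD by blast
    then have ac: "ac_curve A 0 1 y" and y0: "y 0 = chart_inv c x0" and y1: "y 1 = q"
      using x0 by (auto simp: curves_def)
    have "(y 1 \<in> chart_inv c ` ball x0 r \<and> ?N (snd c (y 1) - x0) \<le> integral {0..1} (spd y)) \<or>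
        (\<exists>x'. norm (x' - x0) = r \<and> ?N (x' - x0) \<le> integral {0..1} (spd y))"
      by (rule curve_stays_or_exits[OF N cA(1) _ _ ac _ _ y0]) (use le r r1 in auto)
    then show "q \<in> V"
    proof
      assume "\<exists>x'. norm (x' - x0) = r \<and> ?N (x' - x0) \<le> integral {0..1} (spd y)"
      then obtain x' where x': "norm (x' - x0) = r" "?N (x' - x0) \<le> integral {0..1} (spd y)" by blast
      have "m * r \<le> rho c x0 (x' - x0)" using m(2) x'(1) by metis
      then show ?thesis using x'(2) y(2) by simp
    qed (use y1 r r0 in auto)
  qed
qed

lemma tendsto_if_fdist:
  assumes "((\<lambda>x. fdist A R p (f x)) \<longlongrightarrow> 0) F"
  shows "(f \<longlongrightarrow> p) F"
proof (rule topological_tendstoI)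
  fix V assume "open V" "p \<in> V"
  then obtain \<eta> where \<eta>: "\<eta> > 0" "\<forall>q. fdist A R p q < \<eta> \<longrightarrow> q \<in> V" using fdist_neighbourhood by blast
  from order_tendstoD(2)[OF assms \<eta>(1)] show "\<forall>\<^sub>F x in F. f x \<in> V" by eventually_elim (use \<eta> in auto)
qed

lemma norm_le_fdist_local:
  assumes c: "c \<in> charts_at A p"
  shows "\<exists>V K. open V \<and> p \<in> V \<and> V \<subseteq> fst c \<and> 0 \<le> K \<and> (\<forall>q\<in>V. \<forall>q'\<in>V. norm (snd c q' - snd c q) \<le> K * fdist A R q q')"
proof -
  have cA: "c \<in> A" "p \<in> fst c" using c by (auto simp: charts_at_def)
  define x0 where "x0 = snd c p"
  have x0: "x0 \<in> chart_image c" "chart_inv c x0 = p" using cA chart_inv_chart[OF cA] by (auto simp: x0_def)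
  obtain \<delta> where \<delta>: "\<delta> > 0" "ball x0 \<delta> \<subseteq> chart_image c" "\<forall>x1\<in>ball x0 \<delta>. \<forall>x2\<in>ball x0 \<delta>.
    (1 - 1/2) * rho c x0 (x2 - x1) \<le> fdist A R (chart_inv c x1) (chart_inv c x2)"
    using rho_le_fdist_local[OF cA(1) x0(1), of "1/2"] by auto
  obtain m where m: "m > 0" "\<forall>w. m * norm w \<le> rho c x0 w"
    using rho_bounds[OF cA(1), of "{x0}"] x0 by auto
  let ?V = "chart_inv c ` ball x0 \<delta>"
  have "norm (snd c q' - snd c q) \<le> (2 / m) * fdist A R q q'" if qq: "q \<in> ?V" "q' \<in> ?V" for q q'
  proof -
    obtain x1 x2 where x: "x1 \<in> ball x0 \<delta>" "q = chart_inv c x1" "x2 \<in> ball x0 \<delta>" "q' = chart_inv c x2" using qq by blast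
    then have "snd c q = x1" "snd c q' = x2" using \<delta>(2) chart_chart_inv[OF cA(1)] by auto
    moreover have "m * norm (x2 - x1) \<le> 2 * fdist A R q q'" using \<delta>(3) x m(2)[THEN spec, of "x2 - x1"] by force
    ultimately show ?thesis using m(1) by (simp add: field_simps)
  qed
  moreover have "open ?V" "p \<in> ?V" "?V \<subseteq> fst c"
    using open_chart_inv_image[OF cA(1) open_ball \<delta>(2)] \<delta> x0 chart_inv_in[OF cA(1)] by (auto intro!: image_eqI[of _ _ x0])
  moreover have "0 \<le> 2 / m" using m by simp
  ultimately show ?thesis by blast
qed

lemma dominated_imp_ac_curve:
  assumes dom: "dominated a b (\<lambda>l r. fdist A R (z l) (z r))"
  shows "ac_curve A a b z"
proof (rule ac_curveI)
  obtain h where h: "\<And>x. 0 \<le> h x" "h integrable_on {a..b}"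
    "\<And>l r. a \<le> l \<Longrightarrow> l \<le> r \<Longrightarrow> r \<le> b \<Longrightarrow> fdist A R (z l) (z r) \<le> integral {l..r} h"
    using dom unfolding dominated_def by blast
  define H where "H s = integral {a..s} h" for s
  have contH: "continuous_on {a..b} H" unfolding H_def by (rule indefinite_integral_continuous_1[OF h(2)])
  have dH: "fdist A R (z s) (z r) \<le> \<bar>H r - H s\<bar>" if "s \<in> {a..b}" "r \<in> {a..b}" for r s
  proof -
    have *: "fdist A R (z l) (z r) \<le> \<bar>H r - H l\<bar>" if "a \<le> l" "l \<le> r" "r \<le> b" for l r
    proof -
      have "integral {a..l} h + integral {l..r} h = integral {a..r} h"
        by (rule Henstock_Kurzweil_Integration.integral_combine) (use that integrable_on_subinterval[OF h(2)] in auto)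
      then show ?thesis using h(3)[OF that] by (simp add: H_def)
    qed
    show ?thesis using *[of s r] *[of r s] that fdist_sym[of "z s" "z r"] by (cases "s \<le> r") auto
  qed
  show cont: "continuous_on {a..b} z"
    unfolding continuous_on_def
  proof
    fix s assume s: "s \<in> {a..b}"
    have "(H \<longlongrightarrow> H s) (at s within {a..b})" using contH s by (auto simp: continuous_on_def)
    then have lim: "((\<lambda>r. \<bar>H r - H s\<bar>) \<longlongrightarrow> 0) (at s within {a..b})"
      by (intro tendsto_rabs_zero) (simp add: LIM_zero)
    have "((\<lambda>r. fdist A R (z s) (z r)) \<longlongrightarrow> 0) (at s within {a..b})"
      by (rule Lim_null_comparison[OF _ lim])
         (use dH[OF s] fdist_nonneg in \<open>auto simp: eventually_at_filter intro!: always_eventually\<close>)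
    then show "(z \<longlongrightarrow> z s) (at s within {a..b})" by (rule tendsto_if_fdist)
  qed
  fix x assume x: "x \<in> {a..b}"
  obtain c where c: "c \<in> charts_at A (z x)" by (rule chart_around)
  obtain V K where V: "open V" "z x \<in> V" "0 \<le> K"
    "\<forall>q\<in>V. \<forall>q'\<in>V. norm (snd c q' - snd c q) \<le> K * fdist A R q q'"
    using norm_le_fdist_local[OF c] by blast
  obtain d where d: "d > 0" "\<forall>s\<in>{a..b}. \<bar>s - x\<bar> < d \<longrightarrow> z s \<in> V"
    using continuous_on_locally_in_open[OF cont x V(1,2)] by blast
  have "dominated u v (\<lambda>l r. norm (snd c (z r) - snd c (z l)))"
    if uv: "a \<le> u \<and> u \<le> x \<and> x \<le> v \<and> v \<le> b \<and> v - u < d" for u v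
  proof (rule dominated_mono[OF dominated_subinterval[OF dom] V(3)])
    fix l r assume "u \<le> l" "l \<le> r" "r \<le> v"
    then have "z l \<in> V" "z r \<in> V" using d(2) uv by auto
    then show "norm (snd c (z r) - snd c (z l)) \<le> K * fdist A R (z l) (z r)" using V(4) by blast
  qed (use uv in auto)
  then show "\<exists>c\<in>charts_at A (z x). \<exists>d>0. \<forall>u v. a \<le> u \<and> u \<le> x \<and> x \<le> v \<and> v \<le> b \<and> v - u < d \<longrightarrow>
       dominated u v (\<lambda>l r. norm (snd c (z r) - snd c (z l)))"
    using c d(1) by blast
qed

lemma speed_le_metric_derivative:
  assumes reg: "regular z s" and cont: "isCont z s" and nt: "at s within P \<noteq> bot"
    and lim: "(\<gamma> \<longlongrightarrow> b) (at s within P)"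
    and le: "\<forall>\<^sub>F r in at s within P. fdist A R (z s) (z r) \<le> \<gamma> r * \<bar>r - s\<bar>"
  shows "speed A R z s \<le> b"
proof -
  obtain c where c: "c \<in> charts_at A (z s)" by (rule chart_around)
  then have cA: "c \<in> A" "z s \<in> fst c" by (auto simp: charts_at_def)
  define x0 where "x0 = snd c (z s)"
  have x0: "x0 \<in> chart_image c" "chart_inv c x0 = z s" using cA chart_inv_chart[OF cA] by (auto simp: x0_def)
  let ?g = "velocity A z s c"
  let ?q = "\<lambda>r. (1 / (r - s)) *\<^sub>R (snd c (z r) - snd c (z s))"
  have q: "(?q \<longlongrightarrow> ?g) (at s within P)"
    by (rule tendsto_within_subset[OF has_vector_derivative_quotient[OF regularD[OF reg c]]]) simp
  have "(1 - \<epsilon>) * rho c x0 ?g \<le> b" if \<epsilon>: "0 < \<epsilon>" "\<epsilon> < 1" for \<epsilon>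
  proof -
    let ?N = "\<lambda>w. (1 - \<epsilon>) * rho c x0 w"
    obtain B where N: "bounded_seminorm B ?N" using rho_seminorm[OF cA(1) x0(1), of "1 - \<epsilon>"] \<epsilon> by auto
    obtain \<delta> where \<delta>: "\<delta> > 0" "ball x0 \<delta> \<subseteq> chart_image c" "\<forall>x1\<in>ball x0 \<delta>. \<forall>x2\<in>ball x0 \<delta>.
      ?N (x2 - x1) \<le> fdist A R (chart_inv c x1) (chart_inv c x2)"
      using rho_le_fdist_local[OF cA(1) x0(1) \<epsilon>] by blast
    have "open (chart_inv c ` ball x0 \<delta>)" "z s \<in> chart_inv c ` ball x0 \<delta>"
      using open_chart_inv_image[OF cA(1) open_ball \<delta>(2)] \<delta> x0 by (auto intro!: image_eqI[of _ _ x0])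
    moreover have "(z \<longlongrightarrow> z s) (at s within P)"
      using cont unfolding isCont_def by (rule tendsto_within_subset) simp
    ultimately have ev: "\<forall>\<^sub>F r in at s within P. z r \<in> chart_inv c ` ball x0 \<delta>" by (metis topological_tendstoD)
    have "\<forall>\<^sub>F r in at s within P. r \<noteq> s" by (simp add: eventually_at_filter)
    with ev le have "\<forall>\<^sub>F r in at s within P. ?N (?q r) \<le> \<gamma> r"
    proof eventually_elim
      case (elim r)
      then obtain x1 where x1: "x1 \<in> ball x0 \<delta>" "z r = chart_inv c x1" by blast
      then have "snd c (z r) = x1" using \<delta>(2) chart_chart_inv[OF cA(1)] by auto
      moreover have "?N (x1 - x0) \<le> fdist A R (z s) (z r)"
        using \<delta>(3)[THEN bspec, THEN bspec, OF _ x1(1), of x0] \<delta>(1) x1(2) x0(2) by simp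
      ultimately have "?N (snd c (z r) - snd c (z s)) \<le> \<gamma> r * \<bar>r - s\<bar>"
        using elim(2) by (simp add: x0_def[symmetric])
      then have "\<bar>1 / (r - s)\<bar> * ?N (snd c (z r) - snd c (z s)) \<le> \<bar>1 / (r - s)\<bar> * (\<gamma> r * \<bar>r - s\<bar>)"
        by (intro mult_left_mono) auto
      also have "\<dots> = \<gamma> r" using elim(3) by (simp add: abs_divide)
      finally show ?case by (simp only: bounded_seminorm_facts(3)[OF N])
    qed
    then show ?thesis using tendsto_le[OF nt lim bounded_seminorm_tendsto[OF N q]] by simp
  qed
  then have "rho c x0 ?g \<le> b"
  proof -
    assume *: "\<And>\<epsilon>. 0 < \<epsilon> \<Longrightarrow> \<epsilon> < 1 \<Longrightarrow> (1 - \<epsilon>) * rho c x0 ?g \<le> b"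
    have "((\<lambda>\<epsilon>. (1 - \<epsilon>) * rho c x0 ?g) \<longlongrightarrow> (1 - 0) * rho c x0 ?g) (at_right 0)" by (intro tendsto_intros)
    then have "(1 - 0) * rho c x0 ?g \<le> b"
      by (rule tendsto_upperbound) (auto simp: eventually_at_right_field intro!: exI[of _ 1] *)
    then show ?thesis by simp
  qed
  then show ?thesis using speed_regular[OF reg c] by (simp add: x0_def)
qed

end

section \<open>Energy and slope along curves\<close>

lemma abs_cont_subinterval:
  assumes "abs_cont a b f" "a \<le> u" "v \<le> b"
  shows "abs_cont u v f"
  unfolding abs_cont_iff_modulus
proof (intro allI impI)
  fix \<epsilon> :: real assume "\<epsilon> > 0"
  then obtain \<delta> where "\<delta> > 0" and \<delta>: "ac_modulus a b f \<epsilon> \<delta>" using abs_cont_modulus[OF assms(1)] by blast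
  have "ac_modulus u v f \<epsilon> \<delta>"
  proof (rule ac_modulusI)
    fix n :: nat and l r :: "nat \<Rightarrow> real"
    assume *: "\<And>i. i < n \<Longrightarrow> u \<le> l i \<and> l i \<le> r i \<and> r i \<le> v"
      "\<And>i j. i < n \<Longrightarrow> j < n \<Longrightarrow> i \<noteq> j \<Longrightarrow> {l i<..<r i} \<inter> {l j<..<r j} = {}" "(\<Sum>i<n. r i - l i) < \<delta>"
    show "(\<Sum>i<n. norm (f (r i) - f (l i))) < \<epsilon>"
    proof (rule ac_modulusD[OF \<delta>])
      fix i assume "i \<in> {..<n}"
      then show "a \<le> l i \<and> l i \<le> r i \<and> r i \<le> b" using *(1)[of i] assms(2,3) by simp
      fix j assume "j \<in> {..<n}" "i \<noteq> j"
      with \<open>i \<in> {..<n}\<close> show "{l i<..<r i} \<inter> {l j<..<r j} = {}" by (intro *(2)) auto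
    qed (use *(3) in simp_all)
  qed
  with \<open>\<delta> > 0\<close> show "\<exists>\<delta>>0. ac_modulus u v f \<epsilon> \<delta>" by blast
qed

lemma AE_lebesgue_iff_negligible: "(AE s in lebesgue. P s) \<longleftrightarrow> (\<exists>N. negligible N \<and> (\<forall>s. s \<notin> N \<longrightarrow> P s))"
proof
  assume "AE s in lebesgue. P s"
  then obtain N where N: "N \<in> null_sets lebesgue" "{s \<in> space lebesgue. \<not> P s} \<subseteq> N" by (auto elim: AE_E simp: eventually_ae_filter)
  then show "\<exists>N. negligible N \<and> (\<forall>s. s \<notin> N \<longrightarrow> P s)" by (auto simp: negligible_iff_null_sets intro!: exI[of _ N])
next
  assume "\<exists>N. negligible N \<and> (\<forall>s. s \<notin> N \<longrightarrow> P s)"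
  then obtain N where N: "negligible N" "\<forall>s. s \<notin> N \<longrightarrow> P s" by blast
  then show "AE s in lebesgue. P s" by (intro AE_I'[of N]) (auto simp: negligible_iff_null_sets)
qed

lemma abs_cont_deriv:
  fixes f :: "real \<Rightarrow> real"
  assumes ac: "abs_cont a b f" and ab: "a < b"
  shows "\<exists>N. negligible N \<and> (\<forall>s\<in>{a<..<b} - N. (f has_real_derivative deriv f s) (at s)) \<and>
    deriv f absolutely_integrable_on {a..b} \<and>
    (\<forall>l r. a \<le> l \<longrightarrow> l \<le> r \<longrightarrow> r \<le> b \<longrightarrow> (deriv f has_integral (f r - f l)) {l..r})"
proof -
  obtain g N where g: "g absolutely_integrable_on {a..b}" "negligible N"
    "\<forall>s\<in>{a<..<b} - N. (f has_vector_derivative g s) (at s)"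
    "\<forall>l r. a \<le> l \<longrightarrow> l \<le> r \<longrightarrow> r \<le> b \<longrightarrow> (g has_integral (f r - f l)) {l..r}"
    using abs_cont_FTC[OF ac ab] by blast
  have der: "(f has_real_derivative g s) (at s)" if "s \<in> {a<..<b} - N" for s
    using g(3) that has_real_derivative_iff_has_vector_derivative by blast
  then have eq: "deriv f s = g s" if "s \<in> {a<..<b} - N" for s using DERIV_imp_deriv that by blast
  let ?N = "N \<union> {a, b}"
  have N: "negligible ?N" using g(2) by (intro negligible_Un) auto
  have "deriv f absolutely_integrable_on {a..b}"
    by (rule absolutely_integrable_spike[OF g(1) N]) (use eq in auto)
  moreover have "(deriv f has_integral (f r - f l)) {l..r}" if "a \<le> l" "l \<le> r" "r \<le> b" for l r
  proof (rule has_integral_spike[OF N])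
    show "(g has_integral (f r - f l)) {l..r}" using g(4) that by blast
    show "deriv f x = g x" if "x \<in> {l..r} - ?N" for x
      by (rule eq) (use that \<open>a \<le> l\<close> \<open>r \<le> b\<close> in auto)
  qed
  ultimately show ?thesis using der eq g(2) by (intro exI[of _ N]) auto
qed

locale finsler_energy = finsler_manifold A R
  for A :: "('q::{t2_space,second_countable_topology}, 'e::euclidean_space) chart set"
    and R :: "'q \<Rightarrow> ('q, 'e) tvec \<Rightarrow> real" +
  fixes E :: "real \<Rightarrow> 'q \<Rightarrow> real" and T :: real
  assumes T_pos: "T > 0" and energy: "C1_energy A T E"
begin

abbreviation sl :: "real \<Rightarrow> 'q \<Rightarrow> real" where "sl \<equiv> slope A R E"

definition dE :: "('q,'e) chart \<Rightarrow> real \<times> 'e \<Rightarrow> (real \<times> 'e) \<Rightarrow>\<^sub>L real" where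
  "dE c = (SOME E'. (\<forall>p\<in>{0..T} \<times> chart_image c.
        ((\<lambda>(t, x). E t (chart_inv c x)) has_derivative blinfun_apply (E' p))
          (at p within {0..T} \<times> chart_image c)) \<and>
     continuous_on ({0..T} \<times> chart_image c) E')"

lemma dE:
  assumes "c \<in> A"
  shows dE_deriv: "p \<in> {0..T} \<times> chart_image c \<Longrightarrow>
      ((\<lambda>(t, x). E t (chart_inv c x)) has_derivative blinfun_apply (dE c p)) (at p within {0..T} \<times> chart_image c)"
    and dE_cont: "continuous_on ({0..T} \<times> chart_image c) (dE c)"
proof -
  have ex: "\<exists>E'. (\<forall>p\<in>{0..T} \<times> chart_image c.
        ((\<lambda>(t, x). E t (chart_inv c x)) has_derivative blinfun_apply (E' p))
          (at p within {0..T} \<times> chart_image c)) \<and>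
     continuous_on ({0..T} \<times> chart_image c) E'"
    by (rule energy[unfolded C1_energy_def, THEN bspec, OF assms])
  note * = someI_ex[OF ex, folded dE_def]
  show "p \<in> {0..T} \<times> chart_image c \<Longrightarrow>
      ((\<lambda>(t, x). E t (chart_inv c x)) has_derivative blinfun_apply (dE c p)) (at p within {0..T} \<times> chart_image c)"
    by (rule *[THEN conjunct1, THEN bspec])
  show "continuous_on ({0..T} \<times> chart_image c) (dE c)" by (rule *[THEN conjunct2])
qed

lemma E_compose_has_derivative:
  assumes cA: "c \<in> A" and S: "s \<in> S" and tt: "\<And>r. r \<in> S \<Longrightarrow> tt r \<in> {0..T}" and x: "\<And>r. r \<in> S \<Longrightarrow> x r \<in> chart_image c"
    and dt: "(tt has_derivative tt') (at s within S)" and dx: "(x has_derivative x') (at s within S)"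
  shows "((\<lambda>r. E (tt r) (chart_inv c (x r))) has_derivative (\<lambda>h. dE c (tt s, x s) (tt' h, x' h))) (at s within S)"
proof -
  have img: "(\<lambda>r. (tt r, x r)) ` S \<subseteq> {0..T} \<times> chart_image c" using tt x by blast
  have p: "(tt s, x s) \<in> {0..T} \<times> chart_image c" using S tt x by blast
  have "((\<lambda>(t, x). E t (chart_inv c x)) has_derivative blinfun_apply (dE c (tt s, x s))) (at (tt s, x s) within (\<lambda>r. (tt r, x r)) ` S)"
    by (rule has_derivative_subset[OF dE_deriv[OF cA p] img])
  from has_derivative_in_compose[OF has_derivative_Pair[OF dt dx] this]
  show ?thesis by simp
qed

lemma E_has_derivative_space:
  assumes "c \<in> A" "t \<in> {0..T}" "x \<in> chart_image c"
  shows "((\<lambda>x. E t (chart_inv c x)) has_derivative (\<lambda>w. dE c (t, x) (0, w))) (at x)"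
proof -
  have "((\<lambda>x. E t (chart_inv c x)) has_derivative (\<lambda>w. dE c (t, x) (0, w))) (at x within chart_image c)"
    by (rule E_compose_has_derivative[OF assms(1), where tt="\<lambda>_. t" and x="\<lambda>x. x" and tt'="\<lambda>_. 0"])
       (use assms in \<open>auto intro!: derivative_eq_intros\<close>)
  then show ?thesis using at_within_open[OF assms(3) open_chart_image[OF assms(1)]] by simp
qed

lemma dtE_chart:
  assumes "c \<in> A" "t \<in> {0..T}" "x \<in> chart_image c"
  shows "dtE T E t (chart_inv c x) = dE c (t, x) (1, 0)"
proof -
  have "((\<lambda>r. E r (chart_inv c x)) has_derivative (\<lambda>h. dE c (t, x) (h, 0))) (at t within {0..T})"
    by (rule E_compose_has_derivative[OF assms(1), where tt="\<lambda>r. r" and x="\<lambda>_. x" and x'="\<lambda>_. 0"])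
       (use assms in \<open>auto intro!: derivative_eq_intros\<close>)
  moreover have "(\<lambda>h. dE c (t, x) (h, 0)) = (\<lambda>h. h *\<^sub>R dE c (t, x) (1, 0))"
  proof
    fix h :: real show "dE c (t, x) (h, 0) = h *\<^sub>R dE c (t, x) (1, 0)"
      using blinfun.scaleR_right[of "dE c (t, x)" h "(1,0)"] by simp
  qed
  ultimately have "((\<lambda>r. E r (chart_inv c x)) has_vector_derivative dE c (t, x) (1, 0)) (at t within {0..T})"
    unfolding has_vector_derivative_def by simp
  then show ?thesis unfolding dtE_def
    using assms(2) T_pos by (intro vector_derivative_within_cbox[of 0 T, unfolded cbox_interval]) auto
qed

lemma differential_chart:
  assumes c: "c \<in> charts_at A q" and t: "t \<in> {0..T}" and v: "v \<in> tangent_space A q"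
  shows "differential A (E t) q v = dE c (t, snd c q) (0, v c)"
proof -
  define c0 where "c0 = (SOME c. c \<in> charts_at A q)"
  have c0: "c0 \<in> charts_at A q" unfolding c0_def using c by (rule someI)
  have A: "c \<in> A" "q \<in> fst c" "c0 \<in> A" "q \<in> fst c0" using c c0 by (auto simp: charts_at_def)
  have X: "snd c q \<in> chart_image c" "snd c0 q \<in> chart_image c0" using A by auto
  let ?D = "frechet_derivative (tr c c0) (at (snd c q))"
  have d0: "((\<lambda>x. E t (chart_inv c0 x)) has_derivative (\<lambda>w. dE c0 (t, snd c0 q) (0, w))) (at (snd c0 q))"
    by (rule E_has_derivative_space[OF A(3) t X(2)])
  have trq: "tr c c0 (snd c q) = snd c0 q" using A chart_inv_chart[OF A(1,2)] by (simp add: tr_def)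
  have "((\<lambda>x. E t (chart_inv c0 (tr c c0 x))) has_derivative (\<lambda>w. dE c0 (t, snd c0 q) (0, ?D w))) (at (snd c q))"
    by (rule has_derivative_compose[OF tr_has_derivative[OF c c0]]) (use d0 trq in simp)
  then have "((\<lambda>x. E t (chart_inv c x)) has_derivative (\<lambda>w. dE c0 (t, snd c0 q) (0, ?D w))) (at (snd c q))"
  proof (rule has_derivative_transform_within_open)
    show "open (overlap c c0)" "snd c q \<in> overlap c c0" using A c c0 by (auto intro: open_overlap overlap_mem)
    fix x assume "x \<in> overlap c c0"
    then show "E t (chart_inv c0 (tr c c0 x)) = E t (chart_inv c x)"
      using overlap_iff[OF A(1)] chart_inv_chart[OF A(3)] by (simp add: tr_def)
  qed
  from has_derivative_unique[OF this E_has_derivative_space[OF A(1) t X(1)]]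
  have eq: "dE c0 (t, snd c0 q) (0, ?D w) = dE c (t, snd c q) (0, w)" for w by (rule fun_cong)
  have "v c0 = ?D (v c)"
    using tangent_space_tvec_of[OF v c] tvec_of_at[OF c0, of c "v c"] by metis
  moreover have "differential A (E t) q v = dE c0 (t, snd c0 q) (0, v c0)"
    using frechet_derivative_at[OF d0] unfolding differential_def c0_def[symmetric] Let_def o_def by metis
  ultimately show ?thesis using eq by simp
qed

lemma dE_zero: "dE c p (0, 0) = 0"
  using blinfun.zero_right[of "dE c p"] by (simp add: zero_prod_def)

lemma dE_minus: "dE c p (0, - w) = - dE c p (0, w)"
  using blinfun.minus_right[of "dE c p" "(0, w)"] by simp

lemma slope_bound:
  assumes c: "c \<in> charts_at A q" and t: "t \<in> {0..T}"
  shows slope_ge: "\<bar>dE c (t, snd c q) (0, w)\<bar> \<le> sl t q * rho c (snd c q) w"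
    and slope_le: "(\<And>w. norm w = 1 \<Longrightarrow> dE c (t, snd c q) (0, w) \<le> b * rho c (snd c q) w) \<Longrightarrow> sl t q \<le> b"
proof -
  have A: "c \<in> A" "q \<in> fst c" using c by (auto simp: charts_at_def)
  have X: "snd c q \<in> chart_image c" using A by auto
  let ?S = "tangent_space A q - {\<lambda>_. 0}"
  let ?f = "\<lambda>v. differential A (E t) q v / R q v"
  have fv: "?f v = dE c (t, snd c q) (0, v c) / rho c (snd c q) (v c)" "v c \<noteq> 0" if "v \<in> ?S" for v
  proof -
    have v: "v \<in> tangent_space A q" "v \<noteq> (\<lambda>_. 0)" using that by auto
    show "?f v = dE c (t, snd c q) (0, v c) / rho c (snd c q) (v c)"
      unfolding differential_chart[OF c t v(1)] rho_at[OF c] tangent_space_tvec_of[OF v(1) c, symmetric] ..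
    show "v c \<noteq> 0"
    proof
      assume "v c = 0"
      then have "v = tvec_of A c q 0" using tangent_space_tvec_of[OF v(1) c] by simp
      also have "\<dots> = (\<lambda>_. 0)" using tvec_of_linear(2)[OF c, of 0 0] by simp
      finally show False using v by simp
    qed
  qed
  have pos: "0 < rho c (snd c q) w" if "w \<noteq> 0" for w
    using rho_nonneg[OF A(1) X, of w] rho_eq_0_iff[OF A(1) X, of w] that by linarith
  have inS: "tvec_of A c q w \<in> ?S \<and> tvec_of A c q w c = w" if "w \<noteq> 0" for w
    using tvec_of_in_tangent_space[OF c, of w] tvec_of_self[OF c, of w] that by auto
  obtain m where m: "m > 0" "\<forall>w. m * norm w \<le> rho c (snd c q) w"
    using rho_bounds[OF A(1), of "{snd c q}"] X by auto
  have bdd: "bdd_above (?f ` ?S)"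
  proof (rule bdd_aboveI2)
    fix v assume v: "v \<in> ?S"
    have "dE c (t, snd c q) (0, v c) \<le> norm (dE c (t, snd c q)) * norm (0::real, v c)"
      using norm_blinfun[of "dE c (t, snd c q)" "(0, v c)"] by simp
    also have "\<dots> = norm (dE c (t, snd c q)) * norm (v c)" by (simp add: norm_Pair)
    also have "\<dots> \<le> norm (dE c (t, snd c q)) * (rho c (snd c q) (v c) / m)"
      using m by (intro mult_left_mono) (auto simp: field_simps)
    finally show "?f v \<le> norm (dE c (t, snd c q)) / m"
      unfolding fv(1)[OF v] using pos[OF fv(2)[OF v]] by (simp add: field_simps)
  qed
  have ge: "dE c (t, snd c q) (0, w) \<le> sl t q * rho c (snd c q) w" for w
  proof (cases "w = 0")
    case False
    have "?f (tvec_of A c q w) \<le> sl t q" unfolding slope_def by (rule cSUP_upper[OF _ bdd]) (use inS[OF False] in blast)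
    then have "dE c (t, snd c q) (0, w) / rho c (snd c q) w \<le> sl t q"
      using fv(1)[of "tvec_of A c q w"] inS[OF False] by simp
    then show ?thesis using pos[OF False] by (simp add: pos_divide_le_eq)
  qed (use dE_zero rho_zero[OF A(1) X] in simp)
  have "rho c (snd c q) (- w) = rho c (snd c q) w" using rho_scale[OF A(1) X, of "-1" w] by simp
  then show "\<bar>dE c (t, snd c q) (0, w)\<bar> \<le> sl t q * rho c (snd c q) w"
    using ge[of w] ge[of "- w"] by (simp add: dE_minus)
  assume b: "\<And>w. norm w = 1 \<Longrightarrow> dE c (t, snd c q) (0, w) \<le> b * rho c (snd c q) w"
  obtain w1 :: 'e where "norm w1 = 1" using vector_choose_size[of 1, where 'a='e] by auto
  then have "?S \<noteq> {}" using inS[of w1] by force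
  then show "sl t q \<le> b" unfolding slope_def
  proof (rule cSUP_least)
    fix v assume v: "v \<in> ?S"
    let ?u = "(1 / norm (v c)) *\<^sub>R v c"
    have "dE c (t, snd c q) (0, ?u) \<le> b * rho c (snd c q) ?u" by (rule b) (use fv(2)[OF v] in simp)
    moreover have "dE c (t, snd c q) (0, ?u) = (1 / norm (v c)) * dE c (t, snd c q) (0, v c)"
      using blinfun.scaleR_right[of "dE c (t, snd c q)" "1 / norm (v c)" "(0, v c)"] by simp
    moreover have "rho c (snd c q) ?u = (1 / norm (v c)) * rho c (snd c q) (v c)"
      using rho_scale[OF A(1) X] by simp
    ultimately have "dE c (t, snd c q) (0, v c) \<le> b * rho c (snd c q) (v c)"
      using fv(2)[OF v] by (simp add: field_simps)
    then show "?f v \<le> b" unfolding fv(1)[OF v] using pos[OF fv(2)[OF v]] by (simp add: field_simps)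
  qed
qed

lemma slope_nonneg:
  assumes "t \<in> {0..T}" shows "0 \<le> sl t q"
proof -
  obtain c where c: "c \<in> charts_at A q" by (rule chart_around)
  then have A: "c \<in> A" "snd c q \<in> chart_image c" by (auto simp: charts_at_def)
  obtain w :: 'e where "norm w = 1" using vector_choose_size[of 1, where 'a='e] by auto
  then have "0 < rho c (snd c q) w"
    using rho_nonneg[OF A, of w] rho_eq_0_iff[OF A, of w] by force
  moreover have "0 \<le> sl t q * rho c (snd c q) w" using slope_ge[OF c assms, of w] by linarith
  ultimately show ?thesis by (simp add: zero_le_mult_iff)
qed

lemma chart_tendsto:
  assumes "c \<in> charts_at A q0"
  shows "((\<lambda>p. snd c (snd p)) \<longlongrightarrow> snd c q0) (at (t0, q0) within S)"
proof -
  have A: "c \<in> A" "q0 \<in> fst c" using assms by (auto simp: charts_at_def)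
  have "continuous (at q0) (snd c)"
    using continuous_on_chart[OF A(1)] open_dom[OF A(1)] A(2) continuous_on_eq_continuous_at by blast
  moreover have "((\<lambda>p. snd p) \<longlongrightarrow> q0) (at (t0, q0) within S)"
    by (rule tendsto_eq_rhs[OF tendsto_snd[OF tendsto_ident_at]]) simp
  ultimately show ?thesis by (rule isCont_tendsto_compose[rotated, unfolded o_def] isCont_tendsto_compose)
qed

lemma slope_continuous: "continuous_on ({0..T} \<times> UNIV) (\<lambda>(t, q). sl t q)"
  unfolding continuous_on_def
proof
  fix p :: "real \<times> 'q" assume "p \<in> {0..T} \<times> UNIV"
  then obtain t0 q0 where p: "p = (t0, q0)" "t0 \<in> {0..T}" by auto
  obtain c where c: "c \<in> charts_at A q0" by (rule chart_around)
  then have A: "c \<in> A" "q0 \<in> fst c" by (auto simp: charts_at_def)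
  define x0 where "x0 = snd c q0"
  have x0: "x0 \<in> chart_image c" using A by (auto simp: x0_def)
  obtain r where r: "r > 0" "cball x0 r \<subseteq> chart_image c"
    using open_chart_image[OF A(1)] x0 open_contains_cball by blast
  let ?C = "({0..T} \<times> cball x0 r) \<times> sphere (0::'e) 1"
  let ?G = "\<lambda>z :: (real \<times> 'e) \<times> 'e. dE c (fst z) (0, snd z) / rho c (snd (fst z)) (snd z)"
  have pos: "0 < rho c x w" if "x \<in> cball x0 r" "norm w = 1" for x w
  proof -
    have "x \<in> chart_image c" "w \<noteq> 0" using that r by auto
    then show ?thesis using rho_nonneg[OF A(1), of x w] rho_eq_0_iff[OF A(1), of x w] by linarith
  qed
  have "continuous_on ?C ?G"
  proof (rule continuous_on_divide)
    have "continuous_on ?C (\<lambda>z. dE c (fst z))"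
      by (rule continuous_on_compose2[OF dE_cont[OF A(1)]]) (use r in \<open>auto intro!: continuous_intros\<close>)
    then show "continuous_on ?C (\<lambda>z. dE c (fst z) (0, snd z))"
      by (intro blinfun.continuous_on continuous_intros)
    have "continuous_on ?C (\<lambda>z. (\<lambda>(x, w). rho c x w) (snd (fst z), snd z))"
      by (rule continuous_on_compose2[OF continuous_on_rho[OF A(1)]]) (use r in \<open>auto intro!: continuous_intros\<close>)
    then show "continuous_on ?C (\<lambda>z. rho c (snd (fst z)) (snd z))" by simp
    show "\<forall>z\<in>?C. rho c (snd (fst z)) (snd z) \<noteq> 0" using pos by force
  qed
  moreover have "compact ?C" by (intro compact_Times) auto
  ultimately have uc: "uniformly_continuous_on ?C ?G" by (rule compact_uniformly_continuous)
  show "((\<lambda>(t, q). sl t q) \<longlongrightarrow> (\<lambda>(t, q). sl t q) p) (at p within {0..T} \<times> UNIV)"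
  proof (rule tendstoI)
    fix e :: real assume "e > 0"
    then have "e / 2 > 0" by simp
    then obtain d where d: "d > 0" "\<forall>z\<in>?C. \<forall>z'\<in>?C. dist z' z < d \<longrightarrow> dist (?G z') (?G z) < e / 2"
      using uc[unfolded uniformly_continuous_on_def, THEN spec, THEN mp] by blast
    have x_lim: "((\<lambda>p. snd c (snd p)) \<longlongrightarrow> x0) (at p within {0..T} \<times> UNIV)"
      unfolding p(1) x0_def by (rule chart_tendsto[OF c])
    have t_lim: "((\<lambda>p. fst p) \<longlongrightarrow> t0) (at p within {0..T} \<times> UNIV)"
      unfolding p(1) by (rule tendsto_eq_rhs[OF tendsto_fst[OF tendsto_ident_at]]) simp
    have q_lim: "((\<lambda>p. snd p) \<longlongrightarrow> q0) (at p within {0..T} \<times> UNIV)"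
      unfolding p(1) by (rule tendsto_eq_rhs[OF tendsto_snd[OF tendsto_ident_at]]) simp
    have ev1: "\<forall>\<^sub>F p in at p within {0..T} \<times> UNIV. dist (snd c (snd p)) x0 < min r (d/2)"
      using tendstoD[OF x_lim, of "min r (d/2)"] r d by simp
    have ev2: "\<forall>\<^sub>F p in at p within {0..T} \<times> UNIV. dist (fst p) t0 < d/2"
      using tendstoD[OF t_lim, of "d/2"] d by simp
    have ev3: "\<forall>\<^sub>F p in at p within {0..T} \<times> UNIV. snd p \<in> fst c"
      by (rule topological_tendstoD[OF q_lim open_dom[OF A(1)] A(2)])
    have ev4: "\<forall>\<^sub>F p in at p within {0..T} \<times> UNIV. p \<in> {0..T} \<times> UNIV"
      by (simp add: eventually_at_filter)
    from ev1 ev2 ev3 ev4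
    show "\<forall>\<^sub>F x in at p within {0..T} \<times> UNIV. dist (case x of (t, q) \<Rightarrow> sl t q) (case p of (t, q) \<Rightarrow> sl t q) < e"
    proof eventually_elim
      case (elim p')
      obtain t q where p': "p' = (t, q)" by (cases p')
      have cq: "c \<in> charts_at A q" using elim(3) A(1) by (simp add: p' charts_at_def)
      define x where "x = snd c q"
      have t: "t \<in> {0..T}" and x: "x \<in> cball x0 r" "x0 \<in> cball x0 r" using elim r by (auto simp: p' x_def dist_commute)
      have "dist (t, x) (t0, x0) \<le> dist t t0 + dist x x0" unfolding dist_Pair_Pair by (rule sqrt_sum_squares_le_sum) auto
      then have close: "dist ((t, x), w) ((t0, x0), w) < d" for w
        using elim(1,2) by (simp add: p' x_def dist_Pair_Pair[of "(_,_)"])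
      have G: "\<bar>?G ((t, x), w) - ?G ((t0, x0), w)\<bar> < e / 2" if "norm w = 1" for w
        using d(2)[THEN bspec, THEN bspec, of "((t0,x0),w)" "((t,x),w)"] close t p(2) x that by (auto simp: dist_real_def)
      have Gle: "?G ((t, x), w) \<le> sl t q" "?G ((t0, x0), w) \<le> sl t0 q0" if "norm w = 1" for w
        using slope_ge[OF cq t, of w] slope_ge[OF c p(2), of w] pos[OF x(1) that] pos[OF x(2) that]
        by (auto simp: x_def x0_def field_simps)
      have "sl t q \<le> sl t0 q0 + e / 2"
      proof (rule slope_le[OF cq t])
        fix w :: 'e assume w: "norm w = 1"
        have "?G ((t, x), w) \<le> sl t0 q0 + e / 2" using G[OF w] Gle(2)[OF w] by linarith
        then show "dE c (t, snd c q) (0, w) \<le> (sl t0 q0 + e / 2) * rho c (snd c q) w"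
          using pos[OF x(1) w] by (simp add: x_def pos_divide_le_eq)
      qed
      moreover have "sl t0 q0 \<le> sl t q + e / 2"
      proof (rule slope_le[OF c p(2)])
        fix w :: 'e assume w: "norm w = 1"
        have "?G ((t0, x0), w) \<le> sl t q + e / 2" using G[OF w] Gle(1)[OF w] by linarith
        then show "dE c (t0, snd c q0) (0, w) \<le> (sl t q + e / 2) * rho c (snd c q0) w"
          using pos[OF x(2) w] by (simp add: x0_def pos_divide_le_eq)
      qed
      ultimately show ?case using \<open>e > 0\<close> unfolding p' p(1) prod.case dist_real_def by arith
    qed
  qed
qed

lemma dtE_continuous: "continuous_on ({0..T} \<times> UNIV) (\<lambda>(t, q). dtE T E t q)"
  unfolding continuous_on_def
proof
  fix p :: "real \<times> 'q" assume "p \<in> {0..T} \<times> UNIV"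
  then obtain t0 q0 where p: "p = (t0, q0)" "t0 \<in> {0..T}" by auto
  obtain c where c: "c \<in> charts_at A q0" by (rule chart_around)
  then have A: "c \<in> A" "q0 \<in> fst c" by (auto simp: charts_at_def)
  have inv: "chart_inv c (snd c q) = q \<and> snd c q \<in> chart_image c" if "q \<in> fst c" for q
    using chart_inv_chart[OF A(1) that] that by auto
  let ?F = "at p within {0..T} \<times> UNIV"
  have x_lim: "((\<lambda>p. snd c (snd p)) \<longlongrightarrow> snd c q0) ?F" unfolding p(1) by (rule chart_tendsto[OF c])
  have t_lim: "((\<lambda>p. fst p) \<longlongrightarrow> t0) ?F"
    unfolding p(1) by (rule tendsto_eq_rhs[OF tendsto_fst[OF tendsto_ident_at]]) simp
  have q_lim: "((\<lambda>p. snd p) \<longlongrightarrow> q0) ?F"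
    unfolding p(1) by (rule tendsto_eq_rhs[OF tendsto_snd[OF tendsto_ident_at]]) simp
  have ev: "\<forall>\<^sub>F p in ?F. snd p \<in> fst c \<and> fst p \<in> {0..T}"
  proof -
    have "\<forall>\<^sub>F p in ?F. p \<in> {0..T} \<times> UNIV" by (simp add: eventually_at_filter)
    with topological_tendstoD[OF q_lim open_dom[OF A(1)] A(2)] show ?thesis by eventually_elim auto
  qed
  have "((\<lambda>p. (fst p, snd c (snd p))) \<longlongrightarrow> (t0, snd c q0)) ?F" by (rule tendsto_Pair[OF t_lim x_lim])
  then have "((\<lambda>p. dE c (fst p, snd c (snd p))) \<longlongrightarrow> dE c (t0, snd c q0)) ?F"
    by (rule continuous_on_tendsto_compose[OF dE_cont[OF A(1)]])
       (use p inv A ev in \<open>auto elim!: eventually_mono\<close>)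
  then have "((\<lambda>p. dE c (fst p, snd c (snd p)) (1, 0)) \<longlongrightarrow> dE c (t0, snd c q0) (1, 0)) ?F"
    by (intro tendsto_intros)
  moreover have "\<forall>\<^sub>F p in ?F. dE c (fst p, snd c (snd p)) (1, 0) = (\<lambda>(t, q). dtE T E t q) p"
    using ev
  proof eventually_elim
    case (elim p')
    then show ?case using dtE_chart[OF A(1), of "fst p'" "snd c (snd p')"] inv by (auto simp: case_prod_unfold)
  qed
  moreover have "dE c (t0, snd c q0) (1, 0) = dtE T E t0 q0"
    using dtE_chart[OF A(1) p(2), of "snd c q0"] inv[OF A(2)] by simp
  ultimately show "((\<lambda>(t, q). dtE T E t q) \<longlongrightarrow> (\<lambda>(t, q). dtE T E t q) p) ?F"
    unfolding p(1) prod.case by (simp add: Lim_transform_eventually)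
qed

lemma continuous_on_along:
  assumes F: "continuous_on ({0..T} \<times> UNIV) (\<lambda>(t, q). F t q)"
    and "continuous_on S tt" "tt ` S \<subseteq> {0..T}" "continuous_on S y"
  shows "continuous_on S (\<lambda>s. F (tt s) (y s :: 'q) :: real)"
proof -
  have "continuous_on S (\<lambda>s. (\<lambda>(t, q). F t q) (tt s, y s))"
    by (rule continuous_on_compose2[OF F]) (use assms in \<open>auto intro!: continuous_intros\<close>)
  then show ?thesis by simp
qed

lemma E_chain:
  assumes reg: "regular y s" and S: "open S" "s \<in> S" "\<And>r. r \<in> S \<Longrightarrow> tt r \<in> {0..T}" and y: "continuous_on S y"
    and dt: "(tt has_real_derivative \<tau>) (at s)"
  shows "\<exists>e. ((\<lambda>r. E (tt r) (y r)) has_real_derivative dtE T E (tt s) (y s) * \<tau> + e) (at s) \<and>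
     \<bar>e\<bar> \<le> sl (tt s) (y s) * speed A R y s"
proof -
  obtain c where c: "c \<in> charts_at A (y s)" by (rule chart_around)
  then have A: "c \<in> A" "y s \<in> fst c" by (auto simp: charts_at_def)
  define S' where "S' = S \<inter> y -` fst c"
  have S': "open S'" "s \<in> S'" unfolding S'_def
    using continuous_open_preimage[OF y S(1) open_dom[OF A(1)]] S(2) A(2) by auto
  let ?v = "velocity A y s c"
  have dx: "((\<lambda>r. snd c (y r)) has_derivative (\<lambda>h. h *\<^sub>R ?v)) (at s within S')"
    using regularD[OF reg c] unfolding has_vector_derivative_def by (rule has_derivative_at_withinI)
  have dt': "(tt has_derivative (\<lambda>h. h *\<^sub>R \<tau>)) (at s within S')"
    using dt unfolding has_real_derivative_iff_has_vector_derivative has_vector_derivative_def by (rule has_derivative_at_withinI)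
  have "((\<lambda>r. E (tt r) (chart_inv c (snd c (y r)))) has_derivative
      (\<lambda>h. dE c (tt s, snd c (y s)) (h *\<^sub>R \<tau>, h *\<^sub>R ?v))) (at s within S')"
    by (rule E_compose_has_derivative[OF A(1) S'(2) _ _ dt' dx]) (use S(3) in \<open>auto simp: S'_def\<close>)
  then have "((\<lambda>r. E (tt r) (chart_inv c (snd c (y r)))) has_derivative
      (\<lambda>h. dE c (tt s, snd c (y s)) (h *\<^sub>R \<tau>, h *\<^sub>R ?v))) (at s)"
    unfolding at_within_open[OF S'(2,1)] .
  then have "((\<lambda>r. E (tt r) (y r)) has_derivative (\<lambda>h. dE c (tt s, snd c (y s)) (h *\<^sub>R \<tau>, h *\<^sub>R ?v))) (at s)"
    by (rule has_derivative_transform_within_open[OF _ S'])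
       (use chart_inv_chart[OF A(1)] in \<open>auto simp: S'_def\<close>)
  moreover have "dE c (tt s, snd c (y s)) (h *\<^sub>R \<tau>, h *\<^sub>R ?v) = h *\<^sub>R (dE c (tt s, snd c (y s)) (\<tau>, ?v))" for h
    using blinfun.scaleR_right[of "dE c (tt s, snd c (y s))" h "(\<tau>, ?v)"] by simp
  ultimately have "((\<lambda>r. E (tt r) (y r)) has_real_derivative dE c (tt s, snd c (y s)) (\<tau>, ?v)) (at s)"
    unfolding has_real_derivative_iff_has_vector_derivative has_vector_derivative_def by simp
  moreover have "dE c (tt s, snd c (y s)) (\<tau>, ?v) = dtE T E (tt s) (y s) * \<tau> + dE c (tt s, snd c (y s)) (0, ?v)"
  proof -
    have "dtE T E (tt s) (y s) = dE c (tt s, snd c (y s)) (1, 0)"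
      using dtE_chart[OF A(1) S(3)[OF S(2)], of "snd c (y s)"] A(2) chart_inv_chart[OF A] by auto
    moreover have "dE c (tt s, snd c (y s)) (\<tau>, ?v) = \<tau> * dE c (tt s, snd c (y s)) (1, 0) + dE c (tt s, snd c (y s)) (0, ?v)"
      using blinfun.add_right[of "dE c (tt s, snd c (y s))" "\<tau> *\<^sub>R (1, 0)" "(0, ?v)"]
        blinfun.scaleR_right[of "dE c (tt s, snd c (y s))" \<tau> "(1, 0)"] by simp
    ultimately show ?thesis by (simp add: mult.commute)
  qed
  moreover have "\<bar>dE c (tt s, snd c (y s)) (0, ?v)\<bar> \<le> sl (tt s) (y s) * speed A R y s"
    unfolding speed_regular[OF reg c] by (rule slope_ge[OF c S(3)[OF S(2)]])
  ultimately show ?thesis by metis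
qed

lemma E_abs_cont:
  assumes tt: "abs_cont a b tt" "tt ` {a..b} \<subseteq> {0..T}" and ac: "ac_curve A a b y" and ab: "a \<le> b"
  shows "abs_cont a b (\<lambda>r. E (tt r) (y r))"
proof (rule dominated_imp_abs_cont, rule dominated_local[OF ab])
  show "norm (E (tt r) (y r) - E (tt l) (y l)) \<le> norm (E (tt m) (y m) - E (tt l) (y l)) + norm (E (tt r) (y r) - E (tt m) (y m))"
    for l m r by (rule norm_diff_triangle_via)
  fix s assume "a \<le> s" "s \<le> b"
  then have s: "s \<in> {a..b}" by simp
  obtain c where c: "c \<in> charts_at A (y s)" by (rule chart_around)
  then have A: "c \<in> A" "y s \<in> fst c" by (auto simp: charts_at_def)
  define x0 where "x0 = snd c (y s)"
  have x0: "x0 \<in> chart_image c" using A by (auto simp: x0_def)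
  obtain r where r: "r > 0" "cball x0 r \<subseteq> chart_image c"
    using open_chart_image[OF A(1)] x0 open_contains_cball by blast
  let ?C = "{0..T} \<times> cball x0 r"
  have sub: "?C \<subseteq> {0..T} \<times> chart_image c" using r by auto
  have "compact (dE c ` ?C)"
    by (rule compact_continuous_image[OF continuous_on_subset[OF dE_cont[OF A(1)] sub]]) (auto intro: compact_Times)
  then obtain L where L: "L > 0" "\<forall>p\<in>?C. norm (dE c p) \<le> L"
    using compact_imp_bounded bounded_pos[of "dE c ` ?C"] by auto
  have lip: "norm (E t (chart_inv c x) - E t' (chart_inv c x')) \<le> L * norm ((t, x) - (t', x'))"
    if "(t, x) \<in> ?C" "(t', x') \<in> ?C" for t x t' x'
  proof -
    have "norm ((\<lambda>(t, x). E t (chart_inv c x)) (t, x) - (\<lambda>(t, x). E t (chart_inv c x)) (t', x')) \<le> L * norm ((t, x) - (t', x'))"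
    proof (rule differentiable_bound[where S="?C" and f'="\<lambda>p. blinfun_apply (dE c p)"])
      show "convex ?C" by (intro convex_Times) auto
      fix p assume p: "p \<in> ?C"
      show "((\<lambda>(t, x). E t (chart_inv c x)) has_derivative blinfun_apply (dE c p)) (at p within ?C)"
        by (rule has_derivative_subset[OF dE_deriv[OF A(1)] sub]) (use p sub in blast)
      show "onorm (blinfun_apply (dE c p)) \<le> L" using L(2)[THEN bspec, OF p] by (simp add: norm_blinfun.rep_eq)
    qed (use that in auto)
    then show ?thesis by simp
  qed
  have Vo: "open (chart_inv c ` ball x0 r)" "y s \<in> chart_inv c ` ball x0 r"
  proof -
    show "open (chart_inv c ` ball x0 r)"
      by (rule open_chart_inv_image[OF A(1) open_ball]) (use r ball_subset_cball in blast)
    show "y s \<in> chart_inv c ` ball x0 r"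
      using r chart_inv_chart[OF A] by (intro image_eqI[of _ _ x0]) (auto simp: x0_def)
  qed
  obtain d where d: "d > 0" "\<forall>r'\<in>{a..b}. \<bar>r' - s\<bar> < d \<longrightarrow> y r' \<in> chart_inv c ` ball x0 r"
    using continuous_on_locally_in_open[OF ac_curve_continuous[OF ac] s Vo] by blast
  have dom: "dominated u v (\<lambda>l r. norm (E (tt r) (y r) - E (tt l) (y l)))"
    if uv: "a \<le> u \<and> u \<le> s \<and> s \<le> v \<and> v \<le> b \<and> v - u < d" for u v
  proof -
    have yV: "y l \<in> fst c \<and> snd c (y l) \<in> cball x0 r" if "l \<in> {u..v}" for l
    proof -
      have "y l \<in> chart_inv c ` ball x0 r" using d(2) that uv by auto
      then obtain x where "x \<in> ball x0 r" "y l = chart_inv c x" by blast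
      moreover then have "x \<in> chart_image c" using r ball_subset_cball by blast
      ultimately show ?thesis using chart_chart_inv[OF A(1)] chart_inv_in[OF A(1)] ball_subset_cball by auto
    qed
    have "abs_cont u v tt" by (rule abs_cont_subinterval[OF tt(1)]) (use uv in auto)
    then have 1: "dominated u v (\<lambda>l r. norm (tt r - tt l))" using uv by (intro abs_cont_imp_dominated) auto
    have "y ` {u..v} \<subseteq> fst c" using yV by blast
    then have "abs_cont u v (snd c \<circ> y)" by (intro ac_curve_chart[OF ac A(1)]) (use uv in auto)
    from abs_cont_imp_dominated[OF this] uv
    have 2: "dominated u v (\<lambda>l r. norm ((snd c \<circ> y) r - (snd c \<circ> y) l))" by linarith
    show ?thesis
    proof (rule dominated_mono[OF dominated_add[OF 1 2], where K=L])
      fix l r' assume lr: "u \<le> l" "l \<le> r'" "r' \<le> v"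
      then have lr': "l \<in> {u..v}" "r' \<in> {u..v}" "l \<in> {a..b}" "r' \<in> {a..b}" using uv by auto
      have "norm (E (tt r') (y r') - E (tt l) (y l)) \<le> L * norm ((tt r', snd c (y r')) - (tt l, snd c (y l)))"
        using lip[of "tt r'" "snd c (y r')" "tt l" "snd c (y l)"] yV[OF lr'(1)] yV[OF lr'(2)] tt(2) lr'
          chart_inv_chart[OF A(1)] by (auto simp: image_subset_iff)
      also have "\<dots> \<le> L * (norm (tt r' - tt l) + norm (snd c (y r') - snd c (y l)))"
        using L(1) norm_Pair_le[of "tt r' - tt l" "snd c (y r') - snd c (y l)"] by (intro mult_left_mono) auto
      finally show "norm (E (tt r') (y r') - E (tt l) (y l)) \<le> L * (norm (tt r' - tt l) + norm ((snd c \<circ> y) r' - (snd c \<circ> y) l))"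
        by simp
    qed (use L in auto)
  qed
  show "\<exists>d>0. \<forall>u v. a \<le> u \<and> u \<le> s \<and> s \<le> v \<and> v \<le> b \<and> v - u < d \<longrightarrow> dominated u v (\<lambda>l r. norm (E (tt r) (y r) - E (tt l) (y l)))"
    using d(1) dom by blast
qed

lemma slope_spd_integrable:
  assumes ac: "ac_curve A a b y" and ab: "a \<le> b" and tt: "continuous_on {a..b} tt" "tt ` {a..b} \<subseteq> {0..T}"
  shows "(\<lambda>s. sl (tt s) (y s) * spd y s) absolutely_integrable_on {a..b}"
proof -
  have cont: "continuous_on {a..b} (\<lambda>s. sl (tt s) (y s))"
    by (rule continuous_on_along[OF slope_continuous tt ac_curve_continuous[OF ac]])
  show ?thesis
  proof (rule absolutely_integrable_bounded_measurable_product_real)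
    show "(\<lambda>s. sl (tt s) (y s)) \<in> borel_measurable (lebesgue_on {a..b})"
      by (rule continuous_imp_measurable_on_sets_lebesgue[OF cont]) simp
    show "bounded ((\<lambda>s. sl (tt s) (y s)) ` {a..b})"
      by (rule compact_imp_bounded[OF compact_continuous_image[OF cont]]) simp
    show "spd y absolutely_integrable_on {a..b}" by (rule spd_absolutely_integrable[OF ac ab])
  qed simp
qed

lemma slope_spd_integrable_on:
  assumes "ac_curve A a b y" "continuous_on {a..b} tt" "tt ` {a..b} \<subseteq> {0..T}" "a \<le> u" "u \<le> v" "v \<le> b"
  shows "(\<lambda>s. sl (tt s) (y s) * spd y s) integrable_on {u..v}"
proof -
  have "(\<lambda>s. sl (tt s) (y s) * spd y s) absolutely_integrable_on {u..v}"
    by (rule slope_spd_integrable[OF ac_curve_subinterval[OF assms(1)]])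
       (use assms in \<open>auto intro: continuous_on_subset\<close>)
  then show ?thesis by (rule set_lebesgue_integral_eq_integral)
qed

lemma energy_along_curve:
  assumes tt: "abs_cont a b tt" "tt ` {a..b} \<subseteq> {0..T}" and ac: "ac_curve A a b y" and ab: "a < b"
  defines "\<psi> \<equiv> \<lambda>r. E (tt r) (y r)"
  shows "\<exists>N. negligible N \<and> (\<forall>s\<in>{a<..<b} - N. regular y s \<and> (tt has_real_derivative deriv tt s) (at s) \<and>
      (\<psi> has_real_derivative deriv \<psi> s) (at s) \<and>
      \<bar>deriv \<psi> s - dtE T E (tt s) (y s) * deriv tt s\<bar> \<le> sl (tt s) (y s) * spd y s) \<and>
    deriv \<psi> absolutely_integrable_on {a..b} \<and>
    (\<forall>l r. a \<le> l \<longrightarrow> l \<le> r \<longrightarrow> r \<le> b \<longrightarrow> (deriv \<psi> has_integral (\<psi> r - \<psi> l)) {l..r})"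
proof -
  obtain N1 where N1: "negligible N1" "\<forall>s\<in>{a<..<b} - N1. (tt has_real_derivative deriv tt s) (at s)"
    using abs_cont_deriv[OF tt(1) ab] by blast
  obtain N2 where N2: "negligible N2" "\<forall>s\<in>{a<..<b} - N2. regular y s" using ac_curve_regular[OF ac] by blast
  have ac\<psi>: "abs_cont a b \<psi>" unfolding \<psi>_def by (rule E_abs_cont[OF tt ac]) (use ab in simp)
  have cont: "continuous_on {a<..<b} y"
    using ac_curve_continuous[OF ac] by (rule continuous_on_subset) auto
  have main: "regular y s \<and> (tt has_real_derivative deriv tt s) (at s) \<and>
      (\<psi> has_real_derivative deriv \<psi> s) (at s) \<and>
      \<bar>deriv \<psi> s - dtE T E (tt s) (y s) * deriv tt s\<bar> \<le> sl (tt s) (y s) * spd y s"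
    if s: "s \<in> {a<..<b} - (N1 \<union> N2)" for s
  proof -
    have reg: "regular y s" and dt: "(tt has_real_derivative deriv tt s) (at s)" and s': "s \<in> {a<..<b}" using s N1 N2 by auto
    obtain e where e: "(\<psi> has_real_derivative dtE T E (tt s) (y s) * deriv tt s + e) (at s)"
      "\<bar>e\<bar> \<le> sl (tt s) (y s) * speed A R y s"
      unfolding \<psi>_def using E_chain[OF reg open_greaterThanLessThan s' _ cont dt] tt(2) by (auto simp: image_subset_iff)
    then have "deriv \<psi> s = dtE T E (tt s) (y s) * deriv tt s + e" by (intro DERIV_imp_deriv)
    then show ?thesis using e reg dt by (simp add: spd_def)
  qed
  have "negligible (N1 \<union> N2)" using N1 N2 by (intro negligible_Un) auto
  then show ?thesis using main abs_cont_deriv[OF ac\<psi> ab] by blast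
qed

lemma E_diff_le:
  assumes t: "t \<in> {0..T}" and ac: "ac_curve A a b y" and ab: "a \<le> b"
  shows "E t (y a) - E t (y b) \<le> integral {a..b} (\<lambda>s. sl t (y s) * spd y s)"
proof (cases "a = b")
  case False
  then have "a < b" using ab by simp
  have tt: "abs_cont a b (\<lambda>_. t)" "(\<lambda>_. t) ` {a..b} \<subseteq> {0..T}"
    using t by (auto simp: abs_cont_def intro: exI[of _ 1])
  let ?\<psi> = "\<lambda>r. E t (y r)"
  obtain N where N: "negligible N" "\<forall>s\<in>{a<..<b} - N. \<bar>deriv ?\<psi> s - dtE T E t (y s) * deriv (\<lambda>_. t) s\<bar> \<le> sl t (y s) * spd y s"
    and int: "(deriv ?\<psi> has_integral (?\<psi> b - ?\<psi> a)) {a..b}"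
    using energy_along_curve[OF tt ac \<open>a < b\<close>] ab by blast
  have "integral {a..b} (\<lambda>s. - deriv ?\<psi> s) \<le> integral {a..b} (\<lambda>s. sl t (y s) * spd y s)"
  proof (rule integral_le_negligible)
    show "(\<lambda>s. - deriv ?\<psi> s) integrable_on {a..b}" using int by (auto intro: integrable_neg has_integral_integrable)
    show "(\<lambda>s. sl t (y s) * spd y s) integrable_on {a..b}"
      using slope_spd_integrable_on[OF ac _ tt(2)] ab by auto
    show "negligible (N \<union> {a, b})" using N(1) by (intro negligible_Un) auto
    fix s assume "s \<in> {a..b} - (N \<union> {a, b})"
    then have "s \<in> {a<..<b} - N" by auto
    from N(2)[THEN bspec, OF this] show "- deriv ?\<psi> s \<le> sl t (y s) * spd y s" by simp
  qed
  moreover have "integral {a..b} (\<lambda>s. - deriv ?\<psi> s) = - (?\<psi> b - ?\<psi> a)" by (rule integral_unique[OF has_integral_neg[OF int]])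
  ultimately show ?thesis by simp
qed simp

lemma slope_integral_affine:
  assumes ac: "ac_curve A a b y" and ab: "a < b" and t: "t \<in> {0..T}"
  shows "integral {0..1} (\<lambda>\<theta>. sl t (y ((b - a) * \<theta> + a)) * speed A R (\<lambda>\<theta>. y ((b - a) * \<theta> + a)) \<theta>) =
    integral {a..b} (\<lambda>s. sl t (y s) * spd y s)"
proof -
  let ?y = "\<lambda>\<theta>. y ((b - a) * \<theta> + a)"
  have "?y \<in> curves A (y a) (y b)" by (rule unit_curve[OF ac ab])
  then have ac': "ac_curve A 0 1 ?y" by (simp add: curves_def)
  obtain N where N: "negligible N" "\<forall>s\<in>{0..1} - N. spd ?y s = speed A R ?y s"
    by (rule spd_eq_speed_AE[OF ac'])
  have "integral {0..1} (\<lambda>\<theta>. sl t (?y \<theta>) * speed A R ?y \<theta>) = integral {0..1} (\<lambda>\<theta>. sl t (?y \<theta>) * spd ?y \<theta>)"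
    by (rule integral_spike[OF N(1)]) (use N(2) in auto)
  moreover have "(\<lambda>s. sl t (y s) * spd y s) integrable_on {(b - a) * 0 + a..(b - a) * 1 + a}"
    by (rule slope_spd_integrable_on[OF ac, where tt="\<lambda>_. t"]) (use t ab in auto)
  from has_integral_affine_real[OF integrable_integral[OF this]]
  have I: "((\<lambda>s. (b - a) * (sl t (?y s) * spd y ((b - a) * s + a))) has_integral integral {a..b} (\<lambda>s. sl t (y s) * spd y s)) {0..1}"
    using ab by simp
  moreover have "(\<lambda>s. sl t (?y s) * spd ?y s) = (\<lambda>s. (b - a) * (sl t (?y s) * spd y ((b - a) * s + a)))"
    using spd_affine(2)[of "b - a" y a] ab by (intro ext) simp
  ultimately show ?thesis by (simp only: integral_unique[OF I])
qed

lemma curves_slope_integral: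
  assumes "y \<in> curves A p q" "t \<in> {0..T}"
  shows "integral {0..1} (\<lambda>s. sl t (y s) * speed A R y s) = integral {0..1} (\<lambda>s. sl t (y s) * spd y s)"
  using slope_integral_affine[of 0 1 y t] assms by (simp add: curves_def)

lemma curves_slope_integral_nonneg:
  assumes "y \<in> curves A p q" "t \<in> {0..T}"
  shows "0 \<le> integral {0..1} (\<lambda>s. sl t (y s) * speed A R y s)"
  unfolding curves_slope_integral[OF assms]
proof (rule Henstock_Kurzweil_Integration.integral_nonneg)
  have ac: "ac_curve A 0 1 y" using assms by (simp add: curves_def)
  show "(\<lambda>s. sl t (y s) * spd y s) integrable_on {0..1}"
    by (rule slope_spd_integrable_on[OF ac, where tt="\<lambda>_. t"]) (use assms in auto)
qed (use slope_nonneg[OF assms(2)] spd_nonneg in simp)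

lemma S0_bdd_below: "t \<in> {0..T} \<Longrightarrow> bdd_below ((\<lambda>y. integral {0..1} (\<lambda>s. sl t (y s) * speed A R y s)) ` curves A p q)"
  using curves_slope_integral_nonneg by (intro bdd_belowI[of _ 0]) auto

lemma S0_nonneg: "t \<in> {0..T} \<Longrightarrow> 0 \<le> S0 A R E t p q"
  unfolding S0_def by (rule cINF_greatest[OF connected curves_slope_integral_nonneg])

lemma S0_le:
  assumes t: "t \<in> {0..T}" and ac: "ac_curve A a b y" and ab: "a \<le> b"
  shows "S0 A R E t (y a) (y b) \<le> integral {a..b} (\<lambda>s. sl t (y s) * spd y s)"
proof (cases "a = b")
  case True
  have "(\<lambda>_. y a) \<in> curves A (y a) (y a)" by (simp add: curves_def ac_curve_const)
  have "S0 A R E t (y a) (y a) \<le> integral {0..1} (\<lambda>s. sl t (y a) * speed A R (\<lambda>_. y a) s)"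
    unfolding S0_def by (rule cINF_lower[OF S0_bdd_below[OF t] \<open>(\<lambda>_. y a) \<in> curves A (y a) (y a)\<close>])
  also have "\<dots> = integral {0..1} (\<lambda>s. sl t (y a) * spd (\<lambda>_. y a) s)"
    by (rule curves_slope_integral[OF \<open>(\<lambda>_. y a) \<in> curves A (y a) (y a)\<close> t])
  finally show ?thesis using True by (simp add: spd_const)
next
  case False
  then have "a < b" using ab by simp
  from cINF_lower[OF S0_bdd_below[OF t] unit_curve(1)[OF ac this]] slope_integral_affine[OF ac this t]
  show ?thesis by (simp add: S0_def)
qed

lemma E_diff_le_S0: "t \<in> {0..T} \<Longrightarrow> E t p - E t q \<le> S0 A R E t p q"
  unfolding S0_def
proof (rule cINF_greatest[OF connected])
  fix y assume t: "t \<in> {0..T}" and y: "y \<in> curves A p q"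
  then show "E t p - E t q \<le> integral {0..1} (\<lambda>s. sl t (y s) * speed A R y s)"
    unfolding curves_slope_integral[OF y t] using E_diff_le[OF t, of 0 1 y] by (simp add: curves_def)
qed

end

section \<open>Comparison of measures on the line\<close>

lemma negligible_countable: "countable (S :: real set) \<Longrightarrow> negligible S"
  by (simp add: negligible_iff_null_sets null_sets_completionI countable_imp_null_set_lborel)

lemma nn_integral_lebesgue_eq_integral:
  fixes f :: "real \<Rightarrow> real"
  assumes "\<And>x. x \<in> S \<Longrightarrow> 0 \<le> f x" "f integrable_on S"
  shows "(\<integral>\<^sup>+x. ennreal (f x) * indicator S x \<partial>lebesgue) = ennreal (integral S f)"
  using nn_integral_has_integral_lebesgue'[OF assms(1) integrable_integral[OF assms(2)]]
  by (simp add: nn_integral_completion)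

lemma right_cont_of_seq:
  fixes H :: "real \<Rightarrow> real"
  assumes mono: "\<And>x y. x \<le> y \<Longrightarrow> H x \<le> H y" and seq: "(\<lambda>i. H (x + 1 / real (Suc i))) \<longlonglongrightarrow> H x"
  shows "continuous (at_right x) H"
  unfolding continuous_within
proof (rule tendstoI)
  fix e :: real assume "e > 0"
  then have "\<forall>\<^sub>F i in sequentially. dist (H (x + 1 / real (Suc i))) (H x) < e" using seq by (rule tendstoD[rotated])
  then obtain i where i: "dist (H (x + 1 / real (Suc i))) (H x) < e" by (auto simp: eventually_sequentially)
  have "dist (H y) (H x) < e" if "x < y" "y < x + 1 / real (Suc i)" for y
    using i mono[of x y] mono[of y "x + 1 / real (Suc i)"] that by (auto simp: dist_real_def)
  then show "\<forall>\<^sub>F y in at_right x. dist (H y) (H x) < e"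
    unfolding eventually_at_right_field by (intro exI[of _ "x + 1 / real (Suc i)"]) auto
qed

lemma finite_measure_right_seq:
  assumes "finite_measure N" and N: "sets N = sets borel"
  shows "(\<lambda>i. measure N {..x + 1 / real (Suc i)}) \<longlonglongrightarrow> measure N {..x :: real}"
proof -
  interpret finite_measure N by fact
  have "(\<lambda>i. measure N {..x + 1 / real (Suc i)}) \<longlonglongrightarrow> measure N (\<Inter>i. {..x + 1 / real (Suc i)})"
  proof (rule finite_Lim_measure_decseq)
    show "range (\<lambda>i. {..x + 1 / real (Suc i)}) \<subseteq> sets N" unfolding N
      using borel_closed[OF closed_atMost] by (intro image_subsetI) blast
    show "decseq (\<lambda>i. {..x + 1 / real (Suc i)})"
      unfolding decseq_def
    proof (intro allI impI)
      fix m n :: nat assume "m \<le> n"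
      then have "1 / real (Suc n) \<le> 1 / real (Suc m)" by (intro frac_le) auto
      then show "{..x + 1 / real (Suc n)} \<le> {..x + 1 / real (Suc m)}" by (simp del: of_nat_Suc)
    qed
  qed
  moreover have "(\<Inter>i. {..x + 1 / real (Suc i)}) = {..x}"
  proof (intro equalityI subsetI)
    fix y assume y: "y \<in> (\<Inter>i. {..x + 1 / real (Suc i)})"
    show "y \<in> {..x}"
    proof (rule ccontr)
      assume "y \<notin> {..x}"
      then obtain i where "inverse (real (Suc i)) < y - x" using reals_Archimedean[of "y - x"] by auto
      moreover have "y \<le> x + 1 / real (Suc i)" using y by blast
      ultimately show False by (simp add: inverse_eq_divide)
    qed
  next
    fix y assume "y \<in> {..x}"
    then show "y \<in> (\<Inter>i. {..x + 1 / real (Suc i)})" by (auto intro: add_increasing2)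
  qed
  ultimately show ?thesis by simp
qed

lemma borel_measure_eqI_Ioc:
  fixes M N :: "real measure"
  assumes M: "sets M = sets borel" and N: "sets N = sets borel"
    and fin: "\<And>a b. emeasure M {a<..b} \<noteq> \<infinity>"
    and eq: "\<And>a b. a \<le> b \<Longrightarrow> emeasure M {a<..b} = emeasure N {a<..b}"
  shows "M = N"
proof (rule measure_eqI_generator_eq[where E="range (\<lambda>(a, b). {a <.. b::real})" and \<Omega>=UNIV and A="\<lambda>i. {- real i<..real i}"])
  show "Int_stable (range (\<lambda>(a, b). {a <.. b::real}))"
  proof (rule Int_stableI_image, safe)
    fix a b c d :: real
    show "\<exists>p\<in>UNIV. {a<..b} \<inter> {c<..d} = (case p of (a, b) \<Rightarrow> {a<..b})"
      by (intro bexI[of _ "(max a c, min b d)"]) auto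
  qed
  show "emeasure M X = emeasure N X" if Xin: "X \<in> range (\<lambda>(a, b). {a <.. b::real})" for X
  proof -
    obtain a b where X: "X = {a<..b}" using Xin by auto
    show ?thesis unfolding X by (cases "a \<le> b") (simp_all add: eq)
  qed
  show "sets M = sigma_sets UNIV (range (\<lambda>(a, b). {a <.. b::real}))"
    "sets N = sigma_sets UNIV (range (\<lambda>(a, b). {a <.. b::real}))"
    unfolding M N borel_sigma_sets_Ioc by (rule sets_measure_of, simp)+
  show "(\<Union>i. {- real i<..real i}) = UNIV"
  proof (intro equalityI subsetI UNIV_I)
    fix x :: real
    obtain i where "\<bar>x\<bar> < real i" using reals_Archimedean2 by blast
    then show "x \<in> (\<Union>i. {- real i<..real i})" by (intro UN_I[of i]) auto
  qed
qed (use fin in auto)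

text \<open>The difference of the distribution functions is again a distribution function.\<close>

lemma borel_measure_leI_Ioc:
  fixes M N :: "real measure"
  assumes M: "sets M = sets borel" and N: "sets N = sets borel"
    and "finite_measure M" "finite_measure N"
    and le: "\<And>a b. a \<le> b \<Longrightarrow> emeasure M {a<..b} \<le> emeasure N {a<..b}"
  shows "M \<le> N"
proof -
  interpret M: finite_measure M by fact
  interpret N: finite_measure N by fact
  define H where "H x = measure N {..x} - measure M {..x}" for x :: real
  have incr: "measure P {a<..b} = measure P {..b} - measure P {..a}"
    if "finite_measure P" "sets P = sets borel" "a \<le> b" for P :: "real measure" and a b
  proof -
    have "{a<..b} = {..b} - {..a}" by auto
    then show ?thesis using finite_measure.finite_measure_Diff[OF that(1), of "{..b}" "{..a}"] that(2,3) by simp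
  qed
  have Hi: "H b - H a = measure N {a<..b} - measure M {a<..b}" if "a \<le> b" for a b
    using incr[OF assms(3) M that] incr[OF assms(4) N that] by (simp add: H_def)
  have mle: "measure M {a<..b} \<le> measure N {a<..b}" if "a \<le> b" for a b
    using le[OF that] by (simp add: M.emeasure_eq_measure N.emeasure_eq_measure)
  have H_mono: "H a \<le> H b" if "a \<le> b" for a b using Hi[OF that] mle[OF that] by simp
  have H_right: "continuous (at_right x) H" for x
  proof (rule right_cont_of_seq)
    show "H x \<le> H y" if "x \<le> y" for x y by (rule H_mono[OF that])
    show "(\<lambda>i. H (x + 1 / real (Suc i))) \<longlonglongrightarrow> H x"
      unfolding H_def by (intro tendsto_diff finite_measure_right_seq assms)
  qed
  define K where "K = interval_measure H"
  have K: "emeasure K {a<..b} = ennreal (H b - H a)" if "a \<le> b" for a b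
    unfolding K_def by (rule emeasure_interval_measure_Ioc[OF that H_mono H_right])
  define P where "P = measure_of UNIV (sets borel) (\<lambda>B. emeasure M B + emeasure K B)"
  have Ps: "sets P = sets borel" unfolding P_def by (simp add: sigma_algebra.sigma_sets_eq[OF sets.sigma_algebra_axioms, of borel, unfolded space_borel] sets.space_closed[of borel, unfolded space_borel])
  have Pe: "emeasure P B = emeasure M B + emeasure K B" if B: "B \<in> sets borel" for B
  proof (rule emeasure_measure_of[OF P_def])
    show "sets borel \<subseteq> Pow UNIV" by simp
    show "B \<in> sets P" using B Ps by simp
    show "positive (sets P) (\<lambda>B. emeasure M B + emeasure K B)" by (simp add: positive_def)
    show "countably_additive (sets P) (\<lambda>B. emeasure M B + emeasure K B)"
      unfolding countably_additive_def
    proof (intro allI impI)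
      fix A :: "nat \<Rightarrow> real set"
      assume A: "range A \<subseteq> sets P" "disjoint_family A" "\<Union> (range A) \<in> sets P"
      have "range A \<subseteq> sets M" "range A \<subseteq> sets K" using A(1) Ps M by (auto simp: K_def)
      then show "(\<Sum>i. emeasure M (A i) + emeasure K (A i)) = emeasure M (\<Union> (range A)) + emeasure K (\<Union> (range A))"
        using A(2) by (simp add: suminf_add[symmetric] suminf_emeasure)
    qed
  qed
  have "P = N"
  proof (rule borel_measure_eqI_Ioc[OF Ps N])
    fix a b :: real
    show eq: "emeasure P {a<..b} = emeasure N {a<..b}" if "a \<le> b" for a b
      using mle[OF that] by (simp add: Pe K[OF that] Hi[OF that] M.emeasure_eq_measure N.emeasure_eq_measure
          ennreal_plus[symmetric] del: ennreal_plus)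
    show "emeasure P {a<..b} \<noteq> \<infinity>"
      using eq[of a b] by (cases "a \<le> b") (simp_all add: N.emeasure_eq_measure)
  qed
  show ?thesis
  proof (subst le_measure)
    show "sets M = sets N" using M N by simp
    show "\<forall>B\<in>sets M. emeasure M B \<le> emeasure N B"
      unfolding \<open>P = N\<close>[symmetric] using Pe M by simp
  qed
qed

definition right_mod :: "real \<Rightarrow> (real \<Rightarrow> real) \<Rightarrow> real \<Rightarrow> real" where
  "right_mod T V t = (if t < 0 then 0 else lim_right T V t)"

lemma mu_eq: "mu d T q = interval_measure (right_mod T (V_fun d q))"
  by (simp add: mu_def right_mod_def[abs_def])

lemma right_mod_tendsto:
  assumes mono: "mono_on {0..T} V" and x: "0 \<le> x" "x < T"
  shows "(V \<longlongrightarrow> right_mod T V x) (at_right x)"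
proof -
  define L where "L = Inf (V ` {x<..T})"
  have bb: "bdd_below (V ` {x<..T})"
    by (rule bdd_belowI2[of _ "V x"]) (use x in \<open>auto intro!: mono_onD[OF mono]\<close>)
  have "(V \<longlongrightarrow> L) (at_right x)"
  proof (rule tendstoI)
    fix e :: real assume "e > 0"
    have "\<exists>v\<in>V ` {x<..T}. v < L + e"
      using cInf_lessD[of "V ` {x<..T}" "L + e"] x \<open>e > 0\<close> by (auto simp: L_def)
    then obtain y where y: "x < y" "y \<le> T" "V y < L + e" by auto
    have "dist (V z) L < e" if "x < z" "z < y" for z
    proof -
      have "L \<le> V z" unfolding L_def by (rule cInf_lower[OF _ bb]) (use that y in auto)
      moreover have "V z \<le> V y" by (rule mono_onD[OF mono]) (use that y x in auto)
      ultimately show ?thesis using y by (simp add: dist_real_def)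
    qed
    then show "\<forall>\<^sub>F z in at_right x. dist (V z) L < e" unfolding eventually_at_right_field using y by blast
  qed
  moreover have "right_mod T V x = L"
    using tendsto_Lim[OF _ \<open>(V \<longlongrightarrow> L) (at_right x)\<close>] x by (simp add: right_mod_def lim_right_def)
  ultimately show ?thesis by simp
qed

lemma eventually_at_right_in: "x < (y::real) \<Longrightarrow> \<forall>\<^sub>F z in at_right x. x < z \<and> z < y"
  unfolding eventually_at_right_field by blast

lemma right_mod_bounds:
  assumes mono: "mono_on {0..T} V" and x: "0 \<le> x"
  shows "x \<le> T \<Longrightarrow> V x \<le> right_mod T V x" "x < y \<Longrightarrow> y \<le> T \<Longrightarrow> right_mod T V x \<le> V y"
    "T \<le> x \<Longrightarrow> right_mod T V x = V T"
proof -
  show ge: "T \<le> x \<Longrightarrow> right_mod T V x = V T" using x by (simp add: right_mod_def lim_right_def)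
  show "V x \<le> right_mod T V x" if "x \<le> T"
  proof (cases "x < T")
    case True
    show ?thesis
      by (rule tendsto_lowerbound[OF right_mod_tendsto[OF mono x True]])
         (use x True in \<open>auto intro!: eventually_mono[OF eventually_at_right_in[OF True]] mono_onD[OF mono]\<close>)
  qed (use ge that x in auto)
  show "right_mod T V x \<le> V y" if "x < y" "y \<le> T"
    by (rule tendsto_upperbound[OF right_mod_tendsto[OF mono x]])
       (use x that in \<open>auto intro!: eventually_mono[OF eventually_at_right_in[OF \<open>x < y\<close>]] mono_onD[OF mono]\<close>)
qed

lemma right_mod_increments:
  assumes V: "mono_on {0..T} V" "V 0 = 0" and W: "mono_on {0..T} W" "W 0 = 0" and T: "0 < T"
    and le: "\<And>u v. 0 \<le> u \<Longrightarrow> u \<le> v \<Longrightarrow> v \<le> T \<Longrightarrow> V v - V u \<le> W v - W u"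
    and ab: "a \<le> b"
  shows "right_mod T V b - right_mod T V a \<le> right_mod T W b - right_mod T W a"
proof -
  define U where "U t = W t - V t" for t
  have U: "mono_on {0..T} U" "U 0 = 0" using le V W by (auto simp: U_def algebra_simps intro!: mono_onI)
  have diff: "right_mod T U t = right_mod T W t - right_mod T V t" for t
  proof (cases "0 \<le> t \<and> t < T")
    case True
    then have "(U \<longlongrightarrow> right_mod T W t - right_mod T V t) (at_right t)"
      unfolding U_def by (intro tendsto_diff right_mod_tendsto V W) auto
    with right_mod_tendsto[OF U(1), of t] True show ?thesis
      by (intro tendsto_unique[of "at_right t" U]) auto
  qed (auto simp: right_mod_def lim_right_def U_def)
  have "right_mod T U a \<le> right_mod T U b"
  proof (cases "a < 0")
    case True
    have "0 \<le> right_mod T U b"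
    proof (cases "b < 0")
      case False
      show ?thesis
      proof (cases "b \<le> T")
        case True
        have "U 0 \<le> U b" by (rule mono_onD[OF U(1)]) (use False True in auto)
        then show ?thesis using right_mod_bounds(1)[OF U(1), of b] False True U(2) by simp
      next
        case False
        have "U 0 \<le> U T" by (rule mono_onD[OF U(1)]) (use T in auto)
        then show ?thesis using right_mod_bounds(3)[OF U(1), of b] False \<open>\<not> b < 0\<close> U(2) by simp
      qed
    qed (simp add: right_mod_def)
    then show ?thesis using True by (simp add: right_mod_def)
  next
    case False
    then have a: "0 \<le> a" by simp
    show ?thesis
    proof (cases "a = b \<or> T \<le> a")
      case True
      then show ?thesis using right_mod_bounds(3)[OF U(1), of a] right_mod_bounds(3)[OF U(1), of b] a ab by auto
    next
      case False
      then have aT: "a < b" "a < T" using ab by auto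
      show ?thesis
      proof (cases "b \<le> T")
        case True
        then show ?thesis using right_mod_bounds(2)[OF U(1) a aT(1)] right_mod_bounds(1)[OF U(1), of b] a ab by simp
      next
        case False
        then show ?thesis using right_mod_bounds(2)[OF U(1) a aT(2)] right_mod_bounds(3)[OF U(1), of b] a ab by simp
      qed
    qed
  qed
  then show ?thesis by (simp add: diff)
qed

lemma right_mod_mono:
  assumes "mono_on {0..T} V" "V 0 = 0" "0 < T" "a \<le> b"
  shows "right_mod T V a \<le> right_mod T V b"
proof -
  have "right_mod T (\<lambda>_. 0) b - right_mod T (\<lambda>_. 0) a \<le> right_mod T V b - right_mod T V a"
    by (rule right_mod_increments) (use assms in \<open>auto intro!: mono_onI mono_onD[OF assms(1)]\<close>)
  moreover have "right_mod T (\<lambda>_. 0) t = 0" for t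
    using tendsto_Lim[of "at_right t" "\<lambda>_. 0::real" 0] by (simp add: right_mod_def lim_right_def)
  ultimately show ?thesis by simp
qed

lemma right_mod_right_cont:
  assumes "mono_on {0..T} V" "V 0 = 0" "0 < T"
  shows "continuous (at_right x) (right_mod T V)"
  unfolding continuous_within
proof (cases "0 \<le> x \<and> x < T")
  case True
  show "(right_mod T V \<longlongrightarrow> right_mod T V x) (at_right x)"
  proof (rule tendstoI)
    fix e :: real assume "e > 0"
    have "\<forall>\<^sub>F z in at_right x. dist (V z) (right_mod T V x) < e"
      by (rule tendstoD[OF right_mod_tendsto \<open>e > 0\<close>]) (use True assms in auto)
    with eventually_at_right_in[of x T] True
    have "\<forall>\<^sub>F z in at_right x. dist (V z) (right_mod T V x) < e \<and> x < z \<and> z < T" by (auto intro: eventually_conj)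
    then obtain y where "x < y" "\<forall>z. x < z \<longrightarrow> z < y \<longrightarrow> dist (V z) (right_mod T V x) < e \<and> x < z \<and> z < T"
      unfolding eventually_at_right_field by blast
    then obtain z where z: "x < z" "z < T" "dist (V z) (right_mod T V x) < e" using dense by blast
    have "dist (right_mod T V w) (right_mod T V x) < e" if "x < w" "w < z" for w
      using right_mod_bounds(2)[OF assms(1), of w z] right_mod_mono[OF assms, of x w] z that True
      by (auto simp: dist_real_def)
    then show "\<forall>\<^sub>F w in at_right x. dist (right_mod T V w) (right_mod T V x) < e"
      unfolding eventually_at_right_field using z(1) by blast
  qed
next
  case False
  then consider "x < 0" | "T \<le> x" by linarith
  then have "\<exists>y>x. \<forall>w. x < w \<longrightarrow> w < y \<longrightarrow> right_mod T V w = right_mod T V x"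
  proof cases
    case 1
    then show ?thesis by (intro exI[of _ 0]) (auto simp: right_mod_def)
  next
    case 2
    then show ?thesis using assms(3) by (intro exI[of _ "x + 1"]) (auto simp: right_mod_def lim_right_def)
  qed
  then have "\<forall>\<^sub>F w in at_right x. right_mod T V w = right_mod T V x" unfolding eventually_at_right_field by blast
  then show "(right_mod T V \<longlongrightarrow> right_mod T V x) (at_right x)" by (rule tendsto_eventually)
qed

lemma emeasure_right_mod_Ioc:
  assumes "mono_on {0..T} V" "V 0 = 0" "0 < T" "a \<le> b"
  shows "emeasure (interval_measure (right_mod T V)) {a<..b} = ennreal (right_mod T V b - right_mod T V a)"
  by (rule emeasure_interval_measure_Ioc) (use assms right_mod_mono right_mod_right_cont in auto)

lemma finite_measure_right_mod:
  assumes V: "mono_on {0..T} V" "V 0 = 0" "0 < T"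
  shows "finite_measure (interval_measure (right_mod T V))"
proof
  let ?M = "interval_measure (right_mod T V)"
  have rm: "0 \<le> right_mod T V x" "right_mod T V x \<le> V T" for x
    using right_mod_mono[OF V, of "-1" x] right_mod_mono[OF V, of x "max x T"] right_mod_mono[OF V, of "min x (-1)" x] V(3)
      right_mod_bounds(3)[OF V(1), of "max x T"] by (auto simp: right_mod_def)
  have UN: "(\<Union>i. {- real i<..real i}) = UNIV"
  proof (intro equalityI subsetI UNIV_I)
    fix x :: real
    obtain i where "\<bar>x\<bar> < real i" using reals_Archimedean2 by blast
    then show "x \<in> (\<Union>i. {- real i<..real i})" by (intro UN_I[of i]) auto
  qed
  have "emeasure ?M (\<Union>i. {- real i<..real i}) = (SUP i. emeasure ?M {- real i<..real i})"
    by (rule SUP_emeasure_incseq[symmetric]) (auto simp: incseq_def)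
  also have "\<dots> \<le> ennreal (V T)"
  proof (rule SUP_least)
    fix i :: nat
    show "emeasure ?M {- real i<..real i} \<le> ennreal (V T)"
      using rm(1)[of "- real i"] rm(2)[of "real i"]
      by (subst emeasure_right_mod_Ioc[OF V]) (auto intro!: ennreal_leI)
  qed
  finally have "emeasure ?M UNIV \<le> ennreal (V T)" unfolding UN .
  then show "emeasure ?M (space ?M) \<noteq> \<infinity>" by (auto simp: top_unique)
qed

section \<open>Monotone changes of time\<close>

locale time_change =
  fixes tt \<sigma> :: "real \<Rightarrow> real" and s0 s1 T :: real
  assumes T_pos: "0 < T" and s01: "s0 \<le> s1"
    and tt_cont: "continuous_on {s0..s1} tt" and tt_mono: "mono_on {s0..s1} tt"
    and tt_s0: "tt s0 = 0" and tt_s1: "tt s1 = T"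
    and \<sigma>: "t \<in> {0..T} \<Longrightarrow> \<sigma> t \<in> {s0..s1}" "t \<in> {0..T} \<Longrightarrow> tt (\<sigma> t) = t"
    and \<sigma>_0: "\<sigma> 0 = s0" and \<sigma>_T: "\<sigma> T = s1"
begin

lemma s0_less_s1: "s0 < s1"
  using s01 tt_s0 tt_s1 T_pos by (cases "s0 = s1") auto

lemma tt_le: "s0 \<le> s \<Longrightarrow> s \<le> r \<Longrightarrow> r \<le> s1 \<Longrightarrow> tt s \<le> tt r"
  using mono_onD[OF tt_mono, of s r] by simp

lemma tt_range: "s \<in> {s0..s1} \<Longrightarrow> tt s \<in> {0..T}"
  using tt_le[of s0 s] tt_le[of s s1] tt_s0 tt_s1 by auto

lemma \<sigma>_less:
  assumes "0 \<le> u" "u < v" "v \<le> T" shows "\<sigma> u < \<sigma> v"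
proof (rule ccontr)
  assume "\<not> \<sigma> u < \<sigma> v"
  then have "tt (\<sigma> v) \<le> tt (\<sigma> u)" using \<sigma>(1)[of u] \<sigma>(1)[of v] assms by (intro tt_le) auto
  then show False using \<sigma>(2)[of u] \<sigma>(2)[of v] assms by simp
qed

lemma \<sigma>_mono: "0 \<le> u \<Longrightarrow> u \<le> v \<Longrightarrow> v \<le> T \<Longrightarrow> \<sigma> u \<le> \<sigma> v"
  using \<sigma>_less[of u v] by (cases "u = v") auto

definition fibre :: "real \<Rightarrow> real set" where "fibre t = {s\<in>{s0..s1}. tt s = t}"
definition lo :: "real \<Rightarrow> real" where "lo t = Inf (fibre t)"
definition hi :: "real \<Rightarrow> real" where "hi t = Sup (fibre t)"

lemma fibre_closed: "closed (fibre t)"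
proof -
  have "fibre t = {s0..s1} \<inter> tt -` {t}" by (auto simp: fibre_def)
  then show ?thesis using continuous_closed_preimage[OF tt_cont, of "{t}"] by simp
qed

lemma fibre_facts:
  assumes t: "t \<in> {0..T}"
  shows lo_in: "lo t \<in> {s0..s1}" "tt (lo t) = t" and hi_in: "hi t \<in> {s0..s1}" "tt (hi t) = t"
    and lo_le_\<sigma>: "lo t \<le> \<sigma> t" and \<sigma>_le_hi: "\<sigma> t \<le> hi t"
    and tt_eq_iff: "s \<in> {s0..s1} \<Longrightarrow> tt s = t \<longleftrightarrow> lo t \<le> s \<and> s \<le> hi t"
proof -
  have ne: "\<sigma> t \<in> fibre t" using \<sigma>[OF t] by (simp add: fibre_def)
  have bb: "bdd_below (fibre t)" "bdd_above (fibre t)" by (auto simp: fibre_def)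
  have "lo t \<in> fibre t" unfolding lo_def using ne bb fibre_closed by (intro closed_contains_Inf) auto
  then show lo: "lo t \<in> {s0..s1}" "tt (lo t) = t" by (auto simp: fibre_def)
  have "hi t \<in> fibre t" unfolding hi_def using ne bb fibre_closed by (intro closed_contains_Sup) auto
  then show hi: "hi t \<in> {s0..s1}" "tt (hi t) = t" by (auto simp: fibre_def)
  have lb: "lo t \<le> s" "s \<le> hi t" if "s \<in> fibre t" for s
    using cInf_lower[OF that bb(1)] cSup_upper[OF that bb(2)] by (auto simp: lo_def hi_def)
  then show "lo t \<le> \<sigma> t" "\<sigma> t \<le> hi t" using ne by auto
  show "s \<in> {s0..s1} \<Longrightarrow> tt s = t \<longleftrightarrow> lo t \<le> s \<and> s \<le> hi t"
    using lb[of s] tt_le[of "lo t" s] tt_le[of s "hi t"] lo hi by (auto simp: fibre_def)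
qed

lemma tt_less_lo: "t \<in> {0..T} \<Longrightarrow> s0 \<le> s \<Longrightarrow> s < lo t \<Longrightarrow> tt s < t"
  using tt_eq_iff[of t s] tt_le[of s "lo t"] lo_in[of t] by auto

lemma tt_greater_hi: "t \<in> {0..T} \<Longrightarrow> s \<le> s1 \<Longrightarrow> hi t < s \<Longrightarrow> t < tt s"
  using tt_eq_iff[of t s] tt_le[of "hi t" s] hi_in[of t] by auto

lemma lo_0: "lo 0 = s0" and hi_T: "hi T = s1"
  using tt_eq_iff[of 0 s0] lo_in[of 0] tt_eq_iff[of T s1] hi_in[of T] tt_s0 tt_s1 T_pos s01 by auto

lemma lo_gt: "0 < t \<Longrightarrow> t \<le> T \<Longrightarrow> s0 < lo t"
  using lo_in[of t] tt_s0 by (cases "lo t = s0") auto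

lemma hi_lt: "0 \<le> t \<Longrightarrow> t < T \<Longrightarrow> hi t < s1"
  using hi_in[of t] tt_s1 by (cases "hi t = s1") auto

lemma \<sigma>_tendsto_left:
  assumes t: "0 < t" "t \<le> T"
  shows "(\<sigma> \<longlongrightarrow> lo t) (at_left t)"
proof (rule tendstoI)
  fix e :: real assume "e > 0"
  have tT: "t \<in> {0..T}" using t by auto
  define s where "s = max s0 (lo t - e / 2)"
  have s: "s0 \<le> s" "s < lo t" "lo t - e < s" using lo_gt[OF t] \<open>e > 0\<close> by (auto simp: s_def)
  have "dist (\<sigma> r) (lo t) < e" if r: "max 0 (tt s) < r" "r < t" for r
  proof -
    have r': "r \<in> {0..T}" using r t by auto
    have "s < \<sigma> r"
    proof (rule ccontr)
      assume "\<not> s < \<sigma> r"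
      then have "tt (\<sigma> r) \<le> tt s" using \<sigma>(1)[OF r'] s lo_in[OF tT] by (intro tt_le) auto
      then show False using \<sigma>(2)[OF r'] r by simp
    qed
    moreover have "\<sigma> r < lo t"
    proof (rule ccontr)
      assume "\<not> \<sigma> r < lo t"
      then have "tt (lo t) \<le> tt (\<sigma> r)" using \<sigma>(1)[OF r'] lo_in[OF tT] by (intro tt_le) auto
      then show False using \<sigma>(2)[OF r'] lo_in(2)[OF tT] r by simp
    qed
    ultimately show ?thesis using s by (simp add: dist_real_def)
  qed
  moreover have "max 0 (tt s) < t" using tt_less_lo[OF tT s(1,2)] t by simp
  ultimately show "\<forall>\<^sub>F r in at_left t. dist (\<sigma> r) (lo t) < e"
    unfolding eventually_at_left_field by (intro exI[of _ "max 0 (tt s)"]) simp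
qed

lemma \<sigma>_tendsto_right:
  assumes t: "0 \<le> t" "t < T"
  shows "(\<sigma> \<longlongrightarrow> hi t) (at_right t)"
proof (rule tendstoI)
  fix e :: real assume "e > 0"
  have tT: "t \<in> {0..T}" using t by auto
  define s where "s = min s1 (hi t + e / 2)"
  have s: "s \<le> s1" "hi t < s" "s < hi t + e" using hi_lt[OF t] \<open>e > 0\<close> by (auto simp: s_def)
  have "dist (\<sigma> r) (hi t) < e" if r: "t < r" "r < min T (tt s)" for r
  proof -
    have r': "r \<in> {0..T}" using r t by auto
    have "\<sigma> r < s"
    proof (rule ccontr)
      assume "\<not> \<sigma> r < s"
      then have "tt s \<le> tt (\<sigma> r)" using \<sigma>(1)[OF r'] s hi_in[OF tT] by (intro tt_le) auto
      then show False using \<sigma>(2)[OF r'] r by simp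
    qed
    moreover have "hi t < \<sigma> r"
    proof (rule ccontr)
      assume "\<not> hi t < \<sigma> r"
      then have "tt (\<sigma> r) \<le> tt (hi t)" using \<sigma>(1)[OF r'] hi_in[OF tT] by (intro tt_le) auto
      then show False using \<sigma>(2)[OF r'] hi_in(2)[OF tT] r by simp
    qed
    ultimately show ?thesis using s by (simp add: dist_real_def)
  qed
  moreover have "t < min T (tt s)" using tt_greater_hi[OF tT s(1,2)] t by simp
  ultimately show "\<forall>\<^sub>F r in at_right t. dist (\<sigma> r) (hi t) < e"
    unfolding eventually_at_right_field by (intro exI[of _ "min T (tt s)"]) simp
qed

lemma lim_left_compose:
  fixes Q :: "real \<Rightarrow> 'a::t2_space"
  assumes Q: "continuous_on {s0..s1} Q" and t: "t \<in> {0..T}" and q: "\<And>r. r \<in> {0..T} \<Longrightarrow> q r = Q (\<sigma> r)"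
  shows "lim_left q t = Q (lo t)"
proof (cases "t = 0")
  case True
  then show ?thesis using q[of 0] T_pos by (simp add: lim_left_def \<sigma>_0 lo_0)
next
  case False
  then have t': "0 < t" "t \<le> T" using t by auto
  have ev: "\<forall>\<^sub>F r in at_left t. r \<in> {0..T}"
    unfolding eventually_at_left_field using t' by (intro exI[of _ 0]) auto
  have "((\<lambda>r. Q (\<sigma> r)) \<longlongrightarrow> Q (lo t)) (at_left t)"
    by (rule continuous_on_tendsto_compose[OF Q \<sigma>_tendsto_left[OF t'] lo_in(1)[OF t]])
       (use \<sigma>(1) in \<open>auto intro: eventually_mono[OF ev]\<close>)
  then have "(q \<longlongrightarrow> Q (lo t)) (at_left t)"
    by (rule Lim_transform_eventually) (use q in \<open>auto intro: eventually_mono[OF ev]\<close>)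
  then show ?thesis using t' by (simp add: lim_left_def tendsto_Lim)
qed

lemma lim_right_tendsto:
  fixes Q :: "real \<Rightarrow> 'a::t2_space"
  assumes Q: "continuous_on {s0..s1} Q" and t: "0 \<le> t" "t < T" and q: "\<And>r. r \<in> {0..T} \<Longrightarrow> q r = Q (\<sigma> r)"
  shows "(q \<longlongrightarrow> Q (hi t)) (at_right t)"
proof -
  have ev: "\<forall>\<^sub>F r in at_right t. r \<in> {0..T}"
    unfolding eventually_at_right_field using t by (intro exI[of _ T]) auto
  have "((\<lambda>r. Q (\<sigma> r)) \<longlongrightarrow> Q (hi t)) (at_right t)"
    by (rule continuous_on_tendsto_compose[OF Q \<sigma>_tendsto_right[OF t] hi_in(1)])
       (use \<sigma>(1) t in \<open>auto intro: eventually_mono[OF ev]\<close>)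
  then show ?thesis
    by (rule Lim_transform_eventually) (use q in \<open>auto intro: eventually_mono[OF ev]\<close>)
qed

lemma lim_right_compose:
  fixes Q :: "real \<Rightarrow> 'a::t2_space"
  assumes Q: "continuous_on {s0..s1} Q" and t: "t \<in> {0..T}" and q: "\<And>r. r \<in> {0..T} \<Longrightarrow> q r = Q (\<sigma> r)"
  shows "lim_right T q t = Q (hi t)"
proof (cases "t = T")
  case True
  then show ?thesis using q[of T] T_pos by (simp add: lim_right_def \<sigma>_T hi_T)
next
  case False
  then have t': "0 \<le> t" "t < T" using t by auto
  then show ?thesis using lim_right_tendsto[OF Q t' q] by (simp add: lim_right_def tendsto_Lim)
qed

definition multi :: "real set" where "multi = {t\<in>{0..T}. lo t < hi t}"

lemma hi_less_lo:
  assumes "0 \<le> t" "t < t'" "t' \<le> T" shows "hi t < lo t'"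
proof (rule ccontr)
  assume "\<not> hi t < lo t'"
  then have "tt (lo t') \<le> tt (hi t)" using lo_in(1)[of t'] hi_in(1)[of t] assms by (intro tt_le) auto
  then show False using lo_in(2)[of t'] hi_in(2)[of t] assms by simp
qed

lemma countable_multi: "countable multi"
proof -
  have "\<exists>q\<in>\<rat>. lo t < q \<and> q < hi t" if "t \<in> multi" for t
    using that Rats_dense_in_real[of "lo t" "hi t"] by (auto simp: multi_def)
  then obtain f where f: "\<And>t. t \<in> multi \<Longrightarrow> f t \<in> \<rat> \<and> lo t < f t \<and> f t < hi t" by metis
  have "inj_on f multi"
  proof (rule inj_onI)
    fix t t' assume tt': "t \<in> multi" "t' \<in> multi" "f t = f t'"
    then show "t = t'"
      using hi_less_lo[of t t'] hi_less_lo[of t' t] f[of t] f[of t'] by (force simp: multi_def)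
  qed
  moreover have "f ` multi \<subseteq> \<rat>" using f by blast
  ultimately show ?thesis by (metis countable_image_inj_on countable_rat countable_subset)
qed

lemma not_multi: "t \<in> {0..T} \<Longrightarrow> t \<notin> multi \<Longrightarrow> lo t = \<sigma> t \<and> hi t = \<sigma> t"
  using lo_le_\<sigma>[of t] \<sigma>_le_hi[of t] by (auto simp: multi_def)

lemma \<sigma>_tt: "s \<in> {s0..s1} \<Longrightarrow> tt s \<notin> multi \<Longrightarrow> \<sigma> (tt s) = s"
  using not_multi[OF tt_range] tt_eq_iff[OF tt_range, of s s] by auto

text \<open>Substitution: the indefinite integral of \<open>f tt'\<close>, read at \<open>\<sigma>\<close>, is Lipschitz, and at the
  continuity points of \<open>\<sigma>\<close> its derivative is \<open>f \<circ> \<sigma>\<close>.\<close>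

lemma substitution:
  assumes f: "continuous_on {s0..s1} f" and \<tau>: "\<And>s. 0 \<le> \<tau> s"
    "\<And>l r. s0 \<le> l \<Longrightarrow> l \<le> r \<Longrightarrow> r \<le> s1 \<Longrightarrow> (\<tau> has_integral (tt r - tt l)) {l..r}"
    and t01: "0 \<le> t0" "t0 \<le> t1" "t1 \<le> T"
  shows "(\<lambda>s. f s * \<tau> s) integrable_on {s0..s1}"
    "((\<lambda>t. f (\<sigma> t)) has_integral integral {\<sigma> t0..\<sigma> t1} (\<lambda>s. f s * \<tau> s)) {t0..t1}"
proof -
  have "\<tau> integrable_on {s0..s1}" using \<tau>(2)[of s0 s1] s01 by (auto intro: has_integral_integrable)
  then have \<tau>abs: "\<tau> absolutely_integrable_on {s0..s1}"
    using \<tau>(1) by (intro nonnegative_absolutely_integrable_1) auto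
  have bdd: "bounded (f ` {s0..s1})" by (rule compact_imp_bounded[OF compact_continuous_image[OF f]]) simp
  have abs: "(\<lambda>s. f s * \<tau> s) absolutely_integrable_on {s0..s1}"
    by (rule absolutely_integrable_bounded_measurable_product_real[OF _ _ bdd \<tau>abs])
       (use continuous_imp_measurable_on_sets_lebesgue[OF f] in auto)
  then show int: "(\<lambda>s. f s * \<tau> s) integrable_on {s0..s1}" by (rule set_lebesgue_integral_eq_integral)
  define \<Phi> where "\<Phi> t = integral {s0..\<sigma> t} (\<lambda>s. f s * \<tau> s)" for t
  have inc: "\<Phi> v - \<Phi> u = integral {\<sigma> u..\<sigma> v} (\<lambda>s. f s * \<tau> s)" if "0 \<le> u" "u \<le> v" "v \<le> T" for u v
  proof -
    have "integral {s0..\<sigma> u} (\<lambda>s. f s * \<tau> s) + integral {\<sigma> u..\<sigma> v} (\<lambda>s. f s * \<tau> s) = integral {s0..\<sigma> v} (\<lambda>s. f s * \<tau> s)"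
      by (rule Henstock_Kurzweil_Integration.integral_combine)
         (use \<sigma>(1)[of u] \<sigma>(1)[of v] \<sigma>_mono that in \<open>auto intro: integrable_on_subinterval[OF int]\<close>)
    then show ?thesis by (simp add: \<Phi>_def)
  qed
  have est: "\<bar>\<Phi> v - \<Phi> u - k * (v - u)\<bar> \<le> e * (v - u)"
    if uv: "0 \<le> u" "u \<le> v" "v \<le> T" and e: "\<And>s. s \<in> {\<sigma> u..\<sigma> v} \<Longrightarrow> \<bar>f s - k\<bar> \<le> e" for u v k e
  proof -
    have \<sigma>uv: "s0 \<le> \<sigma> u" "\<sigma> u \<le> \<sigma> v" "\<sigma> v \<le> s1" using \<sigma>(1)[of u] \<sigma>(1)[of v] \<sigma>_mono[OF uv] uv by auto
    have i1: "(\<lambda>s. f s * \<tau> s) integrable_on {\<sigma> u..\<sigma> v}" by (rule integrable_on_subinterval[OF int]) (use \<sigma>uv in auto)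
    have i2: "(\<tau> has_integral (v - u)) {\<sigma> u..\<sigma> v}" using \<tau>(2)[OF \<sigma>uv] \<sigma>(2)[of u] \<sigma>(2)[of v] uv by simp
    have i3: "((\<lambda>s. f s * \<tau> s - k * \<tau> s) has_integral (\<Phi> v - \<Phi> u - k * (v - u))) {\<sigma> u..\<sigma> v}"
      unfolding inc[OF uv] by (intro has_integral_diff has_integral_mult_right i2 integrable_integral i1)
    have "norm (integral {\<sigma> u..\<sigma> v} (\<lambda>s. f s * \<tau> s - k * \<tau> s)) \<le> integral {\<sigma> u..\<sigma> v} (\<lambda>s. e * \<tau> s)"
    proof (rule integral_norm_bound_integral)
      show "(\<lambda>s. f s * \<tau> s - k * \<tau> s) integrable_on {\<sigma> u..\<sigma> v}" using i3 by (rule has_integral_integrable)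
      show "(\<lambda>s. e * \<tau> s) integrable_on {\<sigma> u..\<sigma> v}" using has_integral_mult_right[OF i2, of e] by (rule has_integral_integrable)
      fix s assume "s \<in> {\<sigma> u..\<sigma> v}"
      then have "\<bar>f s - k\<bar> * \<tau> s \<le> e * \<tau> s" using e \<tau>(1) by (intro mult_right_mono) auto
      then show "norm (f s * \<tau> s - k * \<tau> s) \<le> e * \<tau> s"
        using \<tau>(1)[of s] by (simp add: left_diff_distrib[symmetric] abs_mult)
    qed
    then show ?thesis
      unfolding integral_unique[OF i3] integral_unique[OF has_integral_mult_right[OF i2, of e]] real_norm_def .
  qed
  show "((\<lambda>t. f (\<sigma> t)) has_integral integral {\<sigma> t0..\<sigma> t1} (\<lambda>s. f s * \<tau> s)) {t0..t1}"
  proof (cases "t0 = t1")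
    case False
    then have t01': "t0 < t1" using t01 by simp
    obtain B where B: "\<forall>s\<in>{s0..s1}. \<bar>f s\<bar> \<le> B" using bdd by (auto simp: bounded_iff)
    have "dominated t0 t1 (\<lambda>l r. norm (\<Phi> r - \<Phi> l))"
    proof (rule dominatedI[of "\<lambda>_. \<bar>B\<bar>"])
      fix l r assume "t0 \<le> l" "l \<le> r" "r \<le> t1"
      then have lr: "0 \<le> l" "l \<le> r" "r \<le> T" using t01 by auto
      have "\<bar>\<Phi> r - \<Phi> l - 0 * (r - l)\<bar> \<le> B * (r - l)"
        by (rule est[OF lr]) (use B \<sigma>(1)[of l] \<sigma>(1)[of r] lr in auto)
      also have "\<dots> \<le> \<bar>B\<bar> * (r - l)" using lr by (intro mult_right_mono) auto
      finally show "norm (\<Phi> r - \<Phi> l) \<le> integral {l..r} (\<lambda>_. \<bar>B\<bar>)" using lr by (simp add: mult.commute)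
    qed auto
    from abs_cont_FTC[OF dominated_imp_abs_cont[OF this] t01']
    obtain g N where g: "negligible N" "\<forall>s\<in>{t0<..<t1} - N. (\<Phi> has_vector_derivative g s) (at s)"
      "\<forall>l r. t0 \<le> l \<longrightarrow> l \<le> r \<longrightarrow> r \<le> t1 \<longrightarrow> (g has_integral (\<Phi> r - \<Phi> l)) {l..r}" by blast
    have gf: "g t = f (\<sigma> t)" if t: "t \<in> {t0..t1} - (N \<union> multi \<union> {t0, t1})" for t
    proof -
      have t': "t \<in> {0..T}" "t \<in> {t0<..<t1} - N" "0 < t" "t < T" "t \<notin> multi" using t t01 by auto
      have lim: "((\<lambda>r. (1 / (r - t)) *\<^sub>R (\<Phi> r - \<Phi> t)) \<longlongrightarrow> g t) (at t within {t<..})"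
        by (rule tendsto_within_subset[OF has_vector_derivative_quotient]) (use g(2) t' in auto)
      have lim2: "((\<lambda>r. (1 / (r - t)) *\<^sub>R (\<Phi> r - \<Phi> t)) \<longlongrightarrow> f (\<sigma> t)) (at t within {t<..})"
      proof (rule tendstoI)
        fix e :: real assume "e > 0"
        have \<sigma>t: "\<sigma> t \<in> {s0..s1}" using \<sigma>(1) t' by auto
        obtain d where d: "d > 0" "\<forall>s\<in>{s0..s1}. dist s (\<sigma> t) < d \<longrightarrow> dist (f s) (f (\<sigma> t)) < e / 2"
          using f[unfolded continuous_on_iff, THEN bspec, OF \<sigma>t, THEN spec, THEN mp, of "e/2"] \<open>e > 0\<close> by auto
        have "(\<sigma> \<longlongrightarrow> \<sigma> t) (at_right t)" using \<sigma>_tendsto_right[of t] not_multi[OF t'(1,5)] t' by auto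
        from tendstoD[OF this d(1)] eventually_at_right_in[OF t'(4)]
        show "\<forall>\<^sub>F r in at_right t. dist ((1 / (r - t)) *\<^sub>R (\<Phi> r - \<Phi> t)) (f (\<sigma> t)) < e"
        proof eventually_elim
          case (elim r)
          have r: "0 \<le> t" "t \<le> r" "r \<le> T" using elim t' by auto
          have "\<bar>\<Phi> r - \<Phi> t - f (\<sigma> t) * (r - t)\<bar> \<le> (e / 2) * (r - t)"
          proof (rule est[OF r])
            fix s assume "s \<in> {\<sigma> t..\<sigma> r}"
            then have "s \<in> {s0..s1}" "dist s (\<sigma> t) < d" using elim(1) \<sigma>t \<sigma>(1)[of r] r by (auto simp: dist_real_def)
            then show "\<bar>f s - f (\<sigma> t)\<bar> \<le> e / 2" using d(2) by (force simp: dist_real_def)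
          qed
          moreover have "(1 / (r - t)) *\<^sub>R (\<Phi> r - \<Phi> t) - f (\<sigma> t) = (\<Phi> r - \<Phi> t - f (\<sigma> t) * (r - t)) / (r - t)"
            using elim(2) by (simp add: field_simps)
          ultimately have "dist ((1 / (r - t)) *\<^sub>R (\<Phi> r - \<Phi> t)) (f (\<sigma> t)) \<le> e / 2"
            using elim(2) by (simp add: dist_real_def abs_divide pos_divide_le_eq)
          then show ?case using \<open>e > 0\<close> by simp
        qed
      qed
      show ?thesis by (rule tendsto_unique[OF trivial_limit_at_right_real lim lim2])
    qed
    have Nn: "negligible (N \<union> multi \<union> {t0, t1})"
      using g(1) negligible_countable[OF countable_multi] by (intro negligible_Un) auto
    have gi: "(g has_integral (\<Phi> t1 - \<Phi> t0)) {t0..t1}" using g(3) t01 by auto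
    have "((\<lambda>t. f (\<sigma> t)) has_integral (\<Phi> t1 - \<Phi> t0)) {t0..t1}"
      by (rule has_integral_spike[OF Nn gf[symmetric] gi])
    then show ?thesis unfolding inc[OF t01] .
  qed (simp add: has_integral_refl)
qed

definition clamp_tt :: "real \<Rightarrow> real" where "clamp_tt s = tt (max s0 (min s1 s))"

definition push :: "(real \<Rightarrow> real) \<Rightarrow> real measure" where
  "push m = distr (density lebesgue (\<lambda>s. ennreal (m s) * indicator {s0..s1} s)) borel clamp_tt"

lemma clamp_tt: "s \<in> {s0..s1} \<Longrightarrow> clamp_tt s = tt s"
  by (simp add: clamp_tt_def min_absorb2 max_absorb2)

lemma clamp_tt_measurable: "clamp_tt \<in> borel_measurable lebesgue"
proof -
  have "continuous_on UNIV clamp_tt"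
    unfolding clamp_tt_def by (rule continuous_on_compose2[OF tt_cont]) (use s01 in \<open>auto intro!: continuous_intros\<close>)
  then have "clamp_tt \<in> borel_measurable borel" by (rule borel_measurable_continuous_onI)
  then show ?thesis by (simp add: measurable_completion)
qed

context
  fixes m :: "real \<Rightarrow> real"
  assumes m: "\<And>s. 0 \<le> m s" "m integrable_on {s0..s1}"
begin

lemma m_measurable: "(\<lambda>s. ennreal (m s) * indicator {s0..s1} s) \<in> borel_measurable lebesgue"
proof -
  have "(\<lambda>s. indicator {s0..s1} s *\<^sub>R m s) \<in> borel_measurable lebesgue"
    by (rule has_integral_implies_lebesgue_measurable[OF integrable_integral[OF m(2)]])
  then have "(\<lambda>s. ennreal (indicator {s0..s1} s *\<^sub>R m s)) \<in> borel_measurable lebesgue" by simp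
  also have "(\<lambda>s. ennreal (indicator {s0..s1} s *\<^sub>R m s)) = (\<lambda>s. ennreal (m s) * indicator {s0..s1} s)"
    by (auto simp: indicator_def)
  finally show ?thesis .
qed

lemma push_sets: "sets (push m) = sets borel"
  by (simp add: push_def)

lemma nn_integral_push:
  assumes g: "g \<in> borel_measurable borel"
  shows "(\<integral>\<^sup>+t. g t \<partial>push m) = (\<integral>\<^sup>+s. g (tt s) * ennreal (m s) * indicator {s0..s1} s \<partial>lebesgue)"
proof -
  let ?D = "density lebesgue (\<lambda>s. ennreal (m s) * indicator {s0..s1} s)"
  have 1: "clamp_tt \<in> measurable ?D borel" using clamp_tt_measurable by simp
  have 2: "(\<lambda>s. g (clamp_tt s)) \<in> borel_measurable lebesgue" by (rule measurable_compose[OF clamp_tt_measurable g])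
  have "(\<integral>\<^sup>+t. g t \<partial>push m) = (\<integral>\<^sup>+s. g (clamp_tt s) \<partial>?D)"
    unfolding push_def by (rule nn_integral_distr[OF 1]) (use g in simp)
  also have "\<dots> = (\<integral>\<^sup>+s. (ennreal (m s) * indicator {s0..s1} s) * g (clamp_tt s) \<partial>lebesgue)"
    by (rule nn_integral_density[OF m_measurable 2])
  also have "\<dots> = (\<integral>\<^sup>+s. g (tt s) * ennreal (m s) * indicator {s0..s1} s \<partial>lebesgue)"
    by (rule nn_integral_cong) (auto simp: indicator_def clamp_tt ac_simps)
  finally show ?thesis .
qed

lemma emeasure_push: "B \<in> sets borel \<Longrightarrow>
    emeasure (push m) B = (\<integral>\<^sup>+s. ennreal (m s) * indicator {s\<in>{s0..s1}. tt s \<in> B} s \<partial>lebesgue)"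
  using nn_integral_push[of "indicator B"] push_sets
  by (auto simp: indicator_def intro!: nn_integral_cong elim!: trans[rotated] simp flip: nn_integral_indicator)

lemma finite_measure_push: "finite_measure (push m)"
proof
  have "emeasure (push m) UNIV = (\<integral>\<^sup>+s. ennreal (m s) * indicator {s0..s1} s \<partial>lebesgue)"
    by (subst emeasure_push) (auto intro!: nn_integral_cong simp: indicator_def)
  also have "\<dots> = ennreal (integral {s0..s1} m)" by (rule nn_integral_lebesgue_eq_integral) (use m in auto)
  finally show "emeasure (push m) (space (push m)) \<noteq> \<infinity>" by (simp add: push_def)
qed

lemma push_Ioc:
  assumes ab: "a \<le> b"
  defines "W \<equiv> \<lambda>t. integral {s0..\<sigma> t} m"
  shows "emeasure (push m) {a<..b} = ennreal (right_mod T W b - right_mod T W a)"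
    and "mono_on {0..T} W" "W 0 = 0"
proof -
  define G where "G s = integral {s0..s} m" for s
  have G_inc: "G r - G l = integral {l..r} m" if "s0 \<le> l" "l \<le> r" "r \<le> s1" for l r
  proof -
    have "integral {s0..l} m + integral {l..r} m = integral {s0..r} m"
      by (rule Henstock_Kurzweil_Integration.integral_combine) (use that integrable_on_subinterval[OF m(2)] in auto)
    then show ?thesis by (simp add: G_def)
  qed
  have int_nonneg: "0 \<le> integral {l..r} m" if "s0 \<le> l" "r \<le> s1" for l r
    by (rule Henstock_Kurzweil_Integration.integral_nonneg) (use that m integrable_on_subinterval[OF m(2)] in auto)
  have G_cont: "continuous_on {s0..s1} G" unfolding G_def by (rule indefinite_integral_continuous_1[OF m(2)])
  show W0: "W 0 = 0" by (simp add: W_def \<sigma>_0)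
  show Wm: "mono_on {0..T} W"
  proof (rule mono_onI)
    fix u v assume "u \<in> {0..T}" "v \<in> {0..T}" "u \<le> v"
    then show "W u \<le> W v" using G_inc[of "\<sigma> u" "\<sigma> v"] int_nonneg[of "\<sigma> u" "\<sigma> v"] \<sigma>(1)[of u] \<sigma>(1)[of v] \<sigma>_mono[of u v]
      by (simp add: W_def G_def)
  qed
  define h where "h x = (if x < 0 then s0 else if T \<le> x then s1 else hi x)" for x
  have h: "h x \<in> {s0..s1}" for x using hi_in(1)[of x] s01 by (auto simp: h_def)
  have rm: "right_mod T W x = G (h x)" for x
  proof (cases "0 \<le> x \<and> x < T")
    case True
    have "right_mod T W x = lim_right T W x" using True by (simp add: right_mod_def)
    also have "\<dots> = G (hi x)" by (rule lim_right_compose[OF G_cont]) (use True in \<open>auto simp: W_def G_def\<close>)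
    finally show ?thesis using True by (simp add: h_def)
  next
    case False
    then show ?thesis using T_pos by (auto simp: right_mod_def lim_right_def h_def G_def W_def \<sigma>_T)
  qed
  have tt_le_iff: "tt s \<le> x \<longleftrightarrow> s \<le> h x" if s: "s \<in> {s0<..s1}" for s x
  proof -
    have s': "s \<in> {s0..s1}" "0 \<le> tt s" "tt s \<le> T" using s tt_range[of s] by auto
    consider "x < 0" | "T \<le> x" | "0 \<le> x" "x < T" by linarith
    then show ?thesis
    proof cases
      case 3
      then have x: "x \<in> {0..T}" by simp
      have "tt s \<le> tt (hi x)" if "s \<le> hi x" using that hi_in(1)[OF x] s by (intro tt_le) auto
      then show ?thesis using tt_greater_hi[OF x, of s] s hi_in(2)[OF x] 3 by (force simp: h_def)
    qed (use s s' in \<open>auto simp: h_def\<close>)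
  qed
  have hab: "h a \<le> h b"
  proof (cases "h a = s0")
    case False
    then have "h a \<in> {s0<..s1}" using h[of a] by auto
    then show ?thesis using tt_le_iff[of "h a" a] tt_le_iff[of "h a" b] ab by auto
  qed (use h in auto)
  have "emeasure (push m) {a<..b} = (\<integral>\<^sup>+s. ennreal (m s) * indicator {s\<in>{s0..s1}. tt s \<in> {a<..b}} s \<partial>lebesgue)"
    by (rule emeasure_push) simp
  also have "\<dots> = (\<integral>\<^sup>+s. ennreal (m s) * indicator {h a..h b} s \<partial>lebesgue)"
  proof (rule nn_integral_cong_AE, unfold AE_lebesgue_iff_negligible, intro exI conjI allI impI)
    show "negligible {s0, h a}" by simp
    fix s assume s: "s \<notin> {s0, h a}"
    show "ennreal (m s) * indicator {s\<in>{s0..s1}. tt s \<in> {a<..b}} s = ennreal (m s) * indicator {h a..h b} s"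
    proof (cases "s \<in> {s0<..s1}")
      case True
      then show ?thesis using tt_le_iff[of s a] tt_le_iff[of s b] s by (auto simp: indicator_def)
    next
      case False
      then show ?thesis using s h[of a] h[of b] by (auto simp: indicator_def)
    qed
  qed
  also have "\<dots> = ennreal (integral {h a..h b} m)"
    by (rule nn_integral_lebesgue_eq_integral)
       (use m h[of a] h[of b] in \<open>auto intro: integrable_on_subinterval[OF m(2)]\<close>)
  finally show "emeasure (push m) {a<..b} = ennreal (right_mod T W b - right_mod T W a)"
    using G_inc[of "h a" "h b"] h[of a] h[of b] hab by (simp add: rm)
qed

end

end

section \<open>Curves with a change of time\<close>

lemma integral_eq_0_imp_negligible:
  fixes g :: "real \<Rightarrow> real"
  assumes g: "g integrable_on {a..b}" "\<And>s. s \<in> {a..b} \<Longrightarrow> 0 \<le> g s" "integral {a..b} g = 0"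
  shows "\<exists>N. negligible N \<and> (\<forall>s\<in>{a<..<b} - N. g s = 0)"
proof -
  obtain N where N: "negligible N" "\<forall>x\<in>{a<..<b} - N. ((\<lambda>x. integral {a..x} g) has_vector_derivative g x) (at x)"
    using negligible_not_has_vector_derivative_integral[OF g(1)] by blast
  have zero: "integral {a..x} g = 0" if "x \<in> {a<..<b}" for x
  proof (rule antisym)
    show "integral {a..x} g \<le> 0"
      unfolding g(3)[symmetric]
      by (rule integral_subset_le) (use that g integrable_on_subinterval[OF g(1)] in auto)
    show "0 \<le> integral {a..x} g"
      by (rule Henstock_Kurzweil_Integration.integral_nonneg) (use that g integrable_on_subinterval[OF g(1)] in auto)
  qed
  have "g s = 0" if s: "s \<in> {a<..<b} - N" for s
  proof -
    have "((\<lambda>x. 0) has_vector_derivative g s) (at s)"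
      by (rule has_vector_derivative_transform_within_open[OF N(2)[THEN bspec, OF s], of "{a<..<b}"])
         (use s zero in auto)
    then show ?thesis using vector_derivative_unique_at[OF _ has_vector_derivative_const] by blast
  qed
  then show ?thesis using N(1) by blast
qed

lemma ge_if_ge_except_negligible:
  fixes f :: "real \<Rightarrow> real"
  assumes "continuous_on {a..b} f" "a < b" "negligible N" "\<And>s. s \<in> {a<..<b} - N \<Longrightarrow> c \<le> f s" and x: "x \<in> {a..b}"
  shows "c \<le> f x"
proof -
  have cont: "continuous_on {a<..<b} f" using assms(1) by (rule continuous_on_subset) auto
  let ?S = "{a<..<b} \<inter> f -` {..<c}"
  have "open ?S" by (rule continuous_open_preimage[OF cont]) auto
  moreover have "?S \<subseteq> N" using assms(4) by force
  then have "negligible ?S" using assms(3) negligible_subset by blast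
  ultimately have "?S = {}" using open_not_negligible by blast
  then have ge: "c \<le> f s" if "s \<in> {a<..<b}" for s using that by force
  show ?thesis
    by (rule continuous_ge_on_closure[where S="{a<..<b}"]) (use assms ge in auto)
qed

lemma mono_deriv_nonneg:
  fixes f :: "real \<Rightarrow> real"
  assumes "mono_on {a..b} f" "s \<in> {a<..<b}" "(f has_real_derivative D) (at s)"
  shows "0 \<le> D"
proof (rule tendsto_lowerbound)
  have "(f has_vector_derivative D) (at s)" using assms(3) by (simp add: has_real_derivative_iff_has_vector_derivative)
  then show "((\<lambda>r. (1 / (r - s)) *\<^sub>R (f r - f s)) \<longlongrightarrow> D) (at s within {s<..})"
    by (intro tendsto_within_subset[OF has_vector_derivative_quotient]) auto
  have "s < b" using assms(2) by simp
  show "\<forall>\<^sub>F r in at_right s. 0 \<le> (1 / (r - s)) *\<^sub>R (f r - f s)"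
    using eventually_at_right_in[OF \<open>s < b\<close>]
  proof eventually_elim
    case (elim r)
    then have "f s \<le> f r" using assms(2) by (intro mono_onD[OF assms(1)]) auto
    then show ?case using elim by simp
  qed
qed simp

locale param_curve = finsler_energy A R E T + time_change tt \<sigma> s0 s1 T
  for A :: "('q::{t2_space,second_countable_topology}, 'e::euclidean_space) chart set"
    and R :: "'q \<Rightarrow> ('q, 'e) tvec \<Rightarrow> real" and E T tt \<sigma> s0 s1 +
  fixes Q q :: "real \<Rightarrow> 'q"
  assumes Q_ac: "ac_curve A s0 s1 Q" and tt_ac: "abs_cont s0 s1 tt" and q_eq: "t \<in> {0..T} \<Longrightarrow> q t = Q (\<sigma> t)"
begin

abbreviation d where "d \<equiv> fdist A R"
abbreviation V where "V \<equiv> V_fun d q"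

sublocale d_var: variation_dist d
  by unfold_locales (auto simp: fdist_nonneg fdist_self fdist_triangle)

lemma Q_cont: "continuous_on {s0..s1} Q"
  by (rule ac_curve_continuous[OF Q_ac])

lemma spd_Q: "0 \<le> spd Q s" "spd Q integrable_on {s0..s1}"
  using spd_nonneg spd_integrable[OF Q_ac _ s01] by auto

definition W where "W t = integral {s0..\<sigma> t} (spd Q)"

lemma dist_le_W:
  assumes "0 \<le> u" "u \<le> v" "v \<le> T"
  shows "d (q u) (q v) \<le> W v - W u"
proof -
  have s: "s0 \<le> \<sigma> u" "\<sigma> u \<le> \<sigma> v" "\<sigma> v \<le> s1" using \<sigma>(1)[of u] \<sigma>(1)[of v] \<sigma>_mono[OF assms] assms by auto
  have "integral {s0..\<sigma> u} (spd Q) + integral {\<sigma> u..\<sigma> v} (spd Q) = integral {s0..\<sigma> v} (spd Q)"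
    by (rule Henstock_Kurzweil_Integration.integral_combine) (use s spd_integrable[OF Q_ac] in auto)
  moreover have "d (Q (\<sigma> u)) (Q (\<sigma> v)) \<le> integral {\<sigma> u..\<sigma> v} (spd Q)"
    by (rule fdist_le_integral[OF ac_curve_subinterval[OF Q_ac] s(2)]) (use s in auto)
  ultimately show ?thesis using q_eq[of u] q_eq[of v] assms by (simp add: W_def)
qed

lemma Var_le_W: "0 \<le> u \<Longrightarrow> u \<le> v \<Longrightarrow> v \<le> T \<Longrightarrow> Var d q {u..v} \<le> ennreal (W v - W u)"
  by (rule d_var.Var_le_telescope) (auto intro: dist_le_W)

lemma BV_q: "BV d T q"
  unfolding BV_def using Var_le_W[of 0 T] T_pos by (auto intro: le_less_trans)

lemma V_step:
  assumes "0 \<le> u" "u \<le> v" "v \<le> T"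
  shows "d (q u) (q v) \<le> V v - V u" "V v - V u \<le> W v - W u"
proof -
  have fin: "Var d q {0..x} < top" if "x \<le> T" for x
    using Var_mono[of "{0..x}" "{0..T}" d q] BV_q that unfolding BV_def by (auto intro: le_less_trans)
  have "enn2real (Var d q {0..u} + ennreal (d (q u) (q v))) \<le> V v"
    unfolding V_fun_def by (rule enn2real_mono[OF d_var.Var_step]) (use assms fin in auto)
  then show "d (q u) (q v) \<le> V v - V u"
    using fin[of u] assms fdist_nonneg by (simp add: enn2real_plus V_fun_def)
  have W0: "0 \<le> W v - W u" using dist_le_W[OF assms] fdist_nonneg[of "q u" "q v"] by linarith
  have "Var d q {0..v} \<le> Var d q {0..u} + Var d q {u..v}" by (rule d_var.Var_subadd) (use assms in auto)
  also have "\<dots> \<le> Var d q {0..u} + ennreal (W v - W u)" by (intro add_left_mono Var_le_W assms)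
  finally have "V v \<le> enn2real (Var d q {0..u} + ennreal (W v - W u))"
    unfolding V_fun_def by (rule enn2real_mono) (use fin[of u] assms in auto)
  then show "V v - V u \<le> W v - W u" using fin[of u] assms W0 by (simp add: enn2real_plus V_fun_def)
qed

lemma V_mono: "mono_on {0..T} V"
proof (rule mono_onI)
  fix u v assume "u \<in> {0..T}" "v \<in> {0..T}" "u \<le> v"
  then show "V u \<le> V v" using V_step(1)[of u v] fdist_nonneg[of "q u" "q v"] by simp
qed

lemma V_0: "V 0 = 0"
  unfolding V_fun_def d_var.Var_singleton by simp

lemma mu_le_push: "mu d T q \<le> push (spd Q)"
  unfolding mu_eq
proof (rule borel_measure_leI_Ioc)
  show "finite_measure (interval_measure (right_mod T V))" by (rule finite_measure_right_mod[OF V_mono V_0 T_pos])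
  show "finite_measure (push (spd Q))" by (rule finite_measure_push[OF spd_Q])
  show "sets (push (spd Q)) = sets borel" by (rule push_sets[OF spd_Q])
  fix a b :: real assume ab: "a \<le> b"
  note P = push_Ioc[OF spd_Q ab, folded W_def]
  have W': "(\<lambda>t. integral {s0..\<sigma> t} (spd Q)) = W" by (simp add: W_def[abs_def])
  show "emeasure (interval_measure (right_mod T V)) {a<..b} \<le> emeasure (push (spd Q)) {a<..b}"
    unfolding emeasure_right_mod_Ioc[OF V_mono V_0 T_pos ab] P(1)[unfolded W']
    by (rule ennreal_leI[OF right_mod_increments[OF V_mono V_0 _ _ T_pos V_step(2) ab]])
       (use P(2,3) W' in auto)
qed simp

lemma lim_q: "t \<in> {0..T} \<Longrightarrow> lim_left q t = Q (lo t)" "t \<in> {0..T} \<Longrightarrow> lim_right T q t = Q (hi t)"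
  using lim_left_compose[OF Q_cont _ q_eq] lim_right_compose[OF Q_cont _ q_eq] by blast+

lemma Jset_subset: "Jset T q \<subseteq> multi"
proof
  fix t assume t: "t \<in> Jset T q"
  then have tT: "t \<in> {0..T}" by (simp add: Jset_def)
  show "t \<in> multi"
  proof (rule ccontr)
    assume "t \<notin> multi"
    then have "lim_left q t = q t" "lim_right T q t = q t" using lim_q[OF tT] not_multi[OF tT] q_eq[OF tT] by auto
    then show False using t tT by (auto simp: Jset_def Cset_def)
  qed
qed

definition \<tau> :: "real \<Rightarrow> real" where "\<tau> s = max 0 (deriv tt s)"

definition \<psi> :: "real \<Rightarrow> real" where "\<psi> s = E (tt s) (Q s)"

definition \<xi> :: "real \<Rightarrow> real" where "\<xi> s = sl (tt s) (Q s)"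

definition g :: "real \<Rightarrow> real" where "g s = \<xi> s * spd Q s"

definition p :: "real \<Rightarrow> real" where "p s = dtE T E (tt s) (Q s)"

lemma tt_image: "tt ` {s0..s1} \<subseteq> {0..T}"
  using tt_range by blast

lemma \<xi>_cont: "continuous_on {s0..s1} \<xi>"
  unfolding \<xi>_def[abs_def] by (rule continuous_on_along[OF slope_continuous tt_cont tt_image Q_cont])

lemma p_cont: "continuous_on {s0..s1} p"
  unfolding p_def[abs_def] by (rule continuous_on_along[OF dtE_continuous tt_cont tt_image Q_cont])

lemma \<xi>_nonneg: "s \<in> {s0..s1} \<Longrightarrow> 0 \<le> \<xi> s"
  unfolding \<xi>_def by (rule slope_nonneg[OF tt_range])

lemma g_nonneg: "s \<in> {s0..s1} \<Longrightarrow> 0 \<le> g s"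
  unfolding g_def using \<xi>_nonneg spd_Q by simp

lemma g_integrable: "s0 \<le> l \<Longrightarrow> l \<le> r \<Longrightarrow> r \<le> s1 \<Longrightarrow> g integrable_on {l..r}"
  unfolding g_def[abs_def] \<xi>_def by (rule slope_spd_integrable_on[OF Q_ac tt_cont tt_image])

lemma a_e_facts:
  "\<exists>N. negligible N \<and> (\<forall>s\<in>{s0<..<s1} - N. regular Q s \<and> (tt has_real_derivative deriv tt s) (at s) \<and>
      (\<psi> has_real_derivative deriv \<psi> s) (at s) \<and> 0 \<le> deriv tt s \<and> \<bar>deriv \<psi> s - p s * deriv tt s\<bar> \<le> g s)"
proof -
  obtain N where N: "negligible N" "\<forall>s\<in>{s0<..<s1} - N. regular Q s \<and> (tt has_real_derivative deriv tt s) (at s) \<and>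
      (\<psi> has_real_derivative deriv \<psi> s) (at s) \<and> \<bar>deriv \<psi> s - p s * deriv tt s\<bar> \<le> g s"
    using energy_along_curve[OF tt_ac tt_image Q_ac s0_less_s1] unfolding \<psi>_def[abs_def] p_def g_def \<xi>_def by blast
  have "0 \<le> deriv tt s" if "s \<in> {s0<..<s1} - N" for s
    using mono_deriv_nonneg[OF tt_mono, of s] N(2) that by blast
  with N show ?thesis by blast
qed

lemma \<tau>_integral:
  assumes "s0 \<le> l" "l \<le> r" "r \<le> s1"
  shows "(\<tau> has_integral (tt r - tt l)) {l..r}"
proof -
  obtain N where N: "negligible N" "\<forall>s\<in>{s0<..<s1} - N. 0 \<le> deriv tt s" using a_e_facts by blast
  have "(deriv tt has_integral (tt r - tt l)) {l..r}" using abs_cont_deriv[OF tt_ac s0_less_s1] assms by blast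
  moreover have "negligible (N \<union> {s0, s1})" using N by (intro negligible_Un) auto
  moreover have "\<tau> s = deriv tt s" if "s \<in> {l..r} - (N \<union> {s0, s1})" for s
    using N(2) that assms by (auto simp: \<tau>_def)
  ultimately show ?thesis by (intro has_integral_spike[of "N \<union> {s0, s1}" _ \<tau> "deriv tt"])
qed

lemma \<tau>_nonneg: "0 \<le> \<tau> s"
  by (simp add: \<tau>_def)

lemma \<psi>_integral: "s0 \<le> l \<Longrightarrow> l \<le> r \<Longrightarrow> r \<le> s1 \<Longrightarrow> (deriv \<psi> has_integral (\<psi> r - \<psi> l)) {l..r}"
  using energy_along_curve[OF tt_ac tt_image Q_ac s0_less_s1] unfolding \<psi>_def[abs_def] by blast

lemma p_q_integral:
  assumes "0 \<le> t0" "t0 \<le> t1" "t1 \<le> T"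
  shows "(\<lambda>s. p s * \<tau> s) integrable_on {s0..s1}"
    "integral {t0..t1} (\<lambda>t. dtE T E t (q t)) = integral {\<sigma> t0..\<sigma> t1} (\<lambda>s. p s * \<tau> s)"
proof -
  note S = substitution[OF p_cont \<tau>_nonneg \<tau>_integral assms]
  show "(\<lambda>s. p s * \<tau> s) integrable_on {s0..s1}" by (rule S(1))
  have "integral {t0..t1} (\<lambda>t. dtE T E t (q t)) = integral {t0..t1} (\<lambda>t. p (\<sigma> t))"
    by (rule Henstock_Kurzweil_Integration.integral_cong) (use assms \<sigma>(2) q_eq in \<open>auto simp: p_def\<close>)
  also have "\<dots> = integral {\<sigma> t0..\<sigma> t1} (\<lambda>s. p s * \<tau> s)" by (rule integral_unique[OF S(2)])
  finally show "integral {t0..t1} (\<lambda>t. dtE T E t (q t)) = integral {\<sigma> t0..\<sigma> t1} (\<lambda>s. p s * \<tau> s)" .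
qed

lemma deriv_tt_fibre: "t \<in> {0..T} \<Longrightarrow> s \<in> {lo t<..<hi t} \<Longrightarrow> tt s = t \<and> deriv tt s = 0"
proof -
  assume t: "t \<in> {0..T}" and s: "s \<in> {lo t<..<hi t}"
  have const: "tt r = t" if "r \<in> {lo t<..<hi t}" for r
    using tt_eq_iff[OF t, of r] lo_in(1)[OF t] hi_in(1)[OF t] that by auto
  have "((\<lambda>_. t) has_real_derivative 0) (at s)" by simp
  then have "(tt has_real_derivative 0) (at s)"
    by (rule has_field_derivative_transform_within_open[where S="{lo t<..<hi t}"]) (use s const in auto)
  then show ?thesis using DERIV_imp_deriv const[OF s] by blast
qed

lemma Cset_eq: "Cset T q = {0..T} - Jset T q"
  by (auto simp: Jset_def Cset_def)

lemma Cset_borel: "Cset T q \<in> sets borel"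
proof -
  have "countable (Jset T q)" using Jset_subset countable_multi countable_subset by blast
  then show ?thesis unfolding Cset_eq by (auto intro: borel_closed sets.countable simp: sets.Diff)
qed

lemma slope_q_borel:
  assumes "0 \<le> a" "b \<le> T"
  shows "(\<lambda>r. ennreal (sl r (q r)) * indicator {a..b} r) \<in> borel_measurable borel"
proof -
  define \<sigma>' where "\<sigma>' r = \<sigma> (max 0 (min T r))" for r
  define \<xi>' where "\<xi>' s = \<xi> (max s0 (min s1 s))" for s
  have "mono \<sigma>'" unfolding \<sigma>'_def mono_def using T_pos by (auto intro!: \<sigma>_mono)
  then have 1: "\<sigma>' \<in> borel_measurable borel" by (rule borel_measurable_mono)
  have "continuous_on UNIV \<xi>'" unfolding \<xi>'_def
    by (rule continuous_on_compose2[OF \<xi>_cont]) (use s01 in \<open>auto intro!: continuous_intros\<close>)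
  then have 2: "\<xi>' \<in> borel_measurable borel" by (rule borel_measurable_continuous_onI)
  have 3: "(\<lambda>r. \<xi>' (\<sigma>' r)) \<in> borel_measurable borel" by (rule measurable_compose[OF 1 2])
  then have "(\<lambda>r. ennreal (\<xi>' (\<sigma>' r)) * indicator {a..b} r) \<in> borel_measurable borel" by simp
  moreover have "ennreal (\<xi>' (\<sigma>' r)) * indicator {a..b} r = ennreal (sl r (q r)) * indicator {a..b} r" for r
  proof (cases "r \<in> {a..b}")
    case True
    then have r: "r \<in> {0..T}" using assms by auto
    then have "\<sigma>' r = \<sigma> r" by (auto simp: \<sigma>'_def min_absorb2 max_absorb2)
    moreover have "\<xi>' (\<sigma> r) = sl r (q r)"
      using \<sigma>[OF r] q_eq[OF r] by (simp add: \<xi>'_def \<xi>_def min_absorb2 max_absorb2)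
    ultimately show ?thesis by simp
  qed simp
  ultimately show ?thesis by simp
qed

end

locale param_curve_J = param_curve +
  assumes J: "Jset T q = multi"
begin

lemma Q_at_C: "s \<in> {s0..s1} \<Longrightarrow> tt s \<in> Cset T q \<Longrightarrow> q (tt s) = Q s"
  using \<sigma>_tt[of s] q_eq[OF tt_range] unfolding Cset_eq J by auto

lemma slope_integral_push:
  assumes m: "\<And>s. 0 \<le> m s" "m integrable_on {s0..s1}" and ab: "0 \<le> a" "b \<le> T"
  shows "(\<integral>\<^sup>+r. indicator (Cset T q) r * (ennreal (sl r (q r)) * indicator {a..b} r) \<partial>push m) =
    (\<integral>\<^sup>+s. ennreal (\<xi> s * m s) * indicator {s\<in>{s0..s1}. tt s \<in> Cset T q \<inter> {a..b}} s \<partial>lebesgue)"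
proof -
  have "(\<lambda>r. indicator (Cset T q) r * (ennreal (sl r (q r)) * indicator {a..b} r)) \<in> borel_measurable borel"
    by (rule borel_measurable_times_ennreal[OF borel_measurable_indicator[OF Cset_borel] slope_q_borel[OF ab]])
  from nn_integral_push[OF m this]
  have "(\<integral>\<^sup>+r. indicator (Cset T q) r * (ennreal (sl r (q r)) * indicator {a..b} r) \<partial>push m) =
    (\<integral>\<^sup>+s. indicator (Cset T q) (tt s) * (ennreal (sl (tt s) (q (tt s))) * indicator {a..b} (tt s)) * ennreal (m s) * indicator {s0..s1} s \<partial>lebesgue)" .
  also have "\<dots> = (\<integral>\<^sup>+s. ennreal (\<xi> s * m s) * indicator {s\<in>{s0..s1}. tt s \<in> Cset T q \<inter> {a..b}} s \<partial>lebesgue)"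
  proof (rule nn_integral_cong)
    fix s
    show "indicator (Cset T q) (tt s) * (ennreal (sl (tt s) (q (tt s))) * indicator {a..b} (tt s)) * ennreal (m s) * indicator {s0..s1} s =
       ennreal (\<xi> s * m s) * indicator {s\<in>{s0..s1}. tt s \<in> Cset T q \<inter> {a..b}} s"
    proof (cases "s \<in> {s0..s1} \<and> tt s \<in> Cset T q \<inter> {a..b}")
      case True
      then have "sl (tt s) (q (tt s)) = \<xi> s" using Q_at_C[of s] by (simp add: \<xi>_def)
      then show ?thesis using True \<xi>_nonneg[of s] m(1)[of s] by (simp add: ennreal_mult)
    qed (auto simp: indicator_def)
  qed
  finally show ?thesis .
qed

definition \<nu> :: "real measure" where "\<nu> = density lebesgue (\<lambda>s. ennreal (g s) * indicator {s0..s1} s)"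

lemma g_measurable: "(\<lambda>s. ennreal (g s) * indicator {s0..s1} s) \<in> borel_measurable lebesgue"
proof -
  have "(\<lambda>s. indicator {s0..s1} s *\<^sub>R g s) \<in> borel_measurable lebesgue"
    by (rule has_integral_implies_lebesgue_measurable[OF integrable_integral[OF g_integrable]]) (use s01 in auto)
  then have "(\<lambda>s. ennreal (indicator {s0..s1} s *\<^sub>R g s)) \<in> borel_measurable lebesgue" by simp
  also have "(\<lambda>s. ennreal (indicator {s0..s1} s *\<^sub>R g s)) = (\<lambda>s. ennreal (g s) * indicator {s0..s1} s)"
    by (auto simp: indicator_def)
  finally show ?thesis .
qed

lemma \<nu>_sets: "sets \<nu> = sets lebesgue"
  by (simp add: \<nu>_def)

lemma emeasure_\<nu>: "X \<in> sets lebesgue \<Longrightarrow> X \<subseteq> {s0..s1} \<Longrightarrow> emeasure \<nu> X = (\<integral>\<^sup>+s. ennreal (g s) * indicator X s \<partial>lebesgue)"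
  unfolding \<nu>_def by (subst emeasure_density[OF g_measurable]) (auto intro!: nn_integral_cong simp: indicator_def)

lemma emeasure_\<nu>_interval:
  assumes "s0 \<le> l" "l \<le> r" "r \<le> s1"
  shows "emeasure \<nu> {l..r} = ennreal (integral {l..r} g)" "emeasure \<nu> {l<..<r} = ennreal (integral {l..r} g)"
proof -
  have gi: "g integrable_on {l..r}" and g0: "\<And>x. x \<in> {l..r} \<Longrightarrow> 0 \<le> g x" using g_integrable g_nonneg assms by auto
  show 1: "emeasure \<nu> {l..r} = ennreal (integral {l..r} g)"
    using nn_integral_lebesgue_eq_integral[OF g0 gi] assms by (subst emeasure_\<nu>) auto
  have "g integrable_on {l<..<r}" using gi by (simp add: integrable_on_open_interval_real)
  moreover have "\<And>x. x \<in> {l<..<r} \<Longrightarrow> 0 \<le> g x" using g0 by auto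
  ultimately show "emeasure \<nu> {l<..<r} = ennreal (integral {l..r} g)"
    using nn_integral_lebesgue_eq_integral[of "{l<..<r}" g] assms
    by (subst emeasure_\<nu>) (auto simp: integral_open_interval_real)
qed

lemma C_part_sets: "{s\<in>{s0..s1}. tt s \<in> Cset T q \<inter> {a..b}} \<in> sets lebesgue"
proof -
  have "{s\<in>{s0..s1}. tt s \<in> Cset T q \<inter> {a..b}} = {s0..s1} \<inter> (clamp_tt -` (Cset T q \<inter> {a..b}) \<inter> space lebesgue)"
    using clamp_tt by auto
  moreover have "clamp_tt -` (Cset T q \<inter> {a..b}) \<inter> space lebesgue \<in> sets lebesgue"
    by (rule measurable_sets[OF clamp_tt_measurable]) (use Cset_borel in auto)
  ultimately show ?thesis by (auto intro: sets.Int)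
qed

lemma S0_le_integral:
  assumes t: "t \<in> {0..T}" and lr: "lo t \<le> l" "l \<le> r" "r \<le> hi t"
  shows "S0 A R E t (Q l) (Q r) \<le> integral {l..r} g"
proof -
  have s: "s0 \<le> l" "r \<le> s1" using lr lo_in(1)[OF t] hi_in(1)[OF t] by auto
  have "S0 A R E t (Q l) (Q r) \<le> integral {l..r} (\<lambda>s. sl t (Q s) * spd Q s)"
    by (rule S0_le[OF t ac_curve_subinterval[OF Q_ac s] lr(2)])
  also have "\<dots> = integral {l..r} g"
  proof (rule Henstock_Kurzweil_Integration.integral_cong)
    fix s assume "s \<in> {l..r}"
    then have "tt s = t" using tt_eq_iff[OF t, of s] lr s by auto
    then show "sl t (Q s) * spd Q s = g s" by (simp add: g_def \<xi>_def)
  qed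
  finally show ?thesis .
qed

text \<open>The dissipation on \<open>[t0,t1]\<close> is dominated by the one of the parametrized curve: the diffuse
  part lives on the fibres of continuity points, and each jump on its own fibre.\<close>

lemma Sigma0_le:
  assumes t01: "0 \<le> t0" "t0 < t1" "t1 \<le> T"
  shows "Sigma0 A R E T q t0 t1 \<le> ennreal (integral {\<sigma> t0..\<sigma> t1} g)"
proof -
  define SA where "SA = {s\<in>{s0..s1}. tt s \<in> Cset T q \<inter> {t0..t1}}"
  define l where "l t = max (lo t) (\<sigma> t0)" for t
  define r where "r t = min (hi t) (\<sigma> t1)" for t
  have tT: "t0 \<in> {0..T}" "t1 \<in> {0..T}" using t01 by auto
  have \<sigma>01: "s0 \<le> \<sigma> t0" "\<sigma> t0 < \<sigma> t1" "\<sigma> t1 \<le> s1" using \<sigma>(1)[OF tT(1)] \<sigma>(1)[OF tT(2)] \<sigma>_less t01 by auto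
  have lr: "l t \<le> r t" "lo t \<le> l t" "r t \<le> hi t" "s0 \<le> l t" "r t \<le> s1" if "t \<in> {t0..t1}" for t
  proof -
    have t: "t \<in> {0..T}" using that t01 by auto
    have "\<sigma> t0 \<le> \<sigma> t" "\<sigma> t \<le> \<sigma> t1" using that t01 by (auto intro: \<sigma>_mono)
    then show "l t \<le> r t" "lo t \<le> l t" "r t \<le> hi t" "s0 \<le> l t" "r t \<le> s1"
      using lo_le_\<sigma>[OF t] \<sigma>_le_hi[OF t] lo_in(1)[OF t] hi_in(1)[OF t] \<sigma>01 by (auto simp: l_def r_def)
  qed
  have tt_in: "tt s = t" if "t \<in> {t0..t1}" "s \<in> {l t<..<r t}" for s t
    using lr[OF that(1)] tt_eq_iff[of t s] that t01 by auto
  have A: "(\<integral>\<^sup>+r\<in>{t0..t1}. ennreal (sl r (q r)) \<partial>mu_co d T q) \<le> emeasure \<nu> SA"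
  proof -
    have "(\<integral>\<^sup>+r\<in>{t0..t1}. ennreal (sl r (q r)) \<partial>mu_co d T q) =
      (\<integral>\<^sup>+r. indicator (Cset T q) r * (ennreal (sl r (q r)) * indicator {t0..t1} r) \<partial>mu d T q)"
      unfolding mu_co_def
      by (rule nn_integral_density) (use Cset_borel slope_q_borel t01 in \<open>auto simp: mu_def\<close>)
    also have "\<dots> \<le> (\<integral>\<^sup>+r. indicator (Cset T q) r * (ennreal (sl r (q r)) * indicator {t0..t1} r) \<partial>push (spd Q))"
      by (rule nn_integral_mono_measure[OF _ mu_le_push]) (simp add: mu_def push_sets[OF spd_Q])
    also have "\<dots> = (\<integral>\<^sup>+s. ennreal (g s) * indicator SA s \<partial>lebesgue)"
      unfolding SA_def g_def by (rule slope_integral_push[OF spd_Q]) (use t01 in auto)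
    also have "\<dots> = emeasure \<nu> SA"
      by (rule emeasure_\<nu>[symmetric]) (use C_part_sets in \<open>auto simp: SA_def\<close>)
    finally show ?thesis .
  qed
  have lr0: "l t0 = \<sigma> t0" "r t0 = hi t0" and lr1: "l t1 = lo t1" "r t1 = \<sigma> t1"
    using lo_le_\<sigma>[OF tT(1)] lo_le_\<sigma>[OF tT(2)] \<sigma>_le_hi[OF tT(1)] \<sigma>_le_hi[OF tT(2)] hi_less_lo[of t0 t1] t01
    by (auto simp: l_def r_def)
  have I: "ennreal (integral {l t..r t} g) = emeasure \<nu> {l t<..<r t}" if "t \<in> {t0..t1}" for t
    using emeasure_\<nu>_interval(2)[of "l t" "r t"] lr[OF that] by simp
  have B: "ennreal (S0 A R E t0 (q t0) (lim_right T q t0)) \<le> emeasure \<nu> {l t0<..<r t0}"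
    using S0_le_integral[OF tT(1), of "\<sigma> t0" "hi t0"] I[of t0] t01 lo_le_\<sigma>[OF tT(1)] \<sigma>_le_hi[OF tT(1)]
    by (auto simp: lim_q[OF tT(1)] q_eq[OF tT(1)] lr0 intro!: ennreal_leI elim!: subst)
  have C: "ennreal (S0 A R E t1 (lim_left q t1) (q t1)) \<le> emeasure \<nu> {l t1<..<r t1}"
    using S0_le_integral[OF tT(2), of "lo t1" "\<sigma> t1"] I[of t1] t01 lo_le_\<sigma>[OF tT(2)] \<sigma>_le_hi[OF tT(2)]
    by (auto simp: lim_q[OF tT(2)] q_eq[OF tT(2)] lr1 intro!: ennreal_leI elim!: subst)
  have D: "ennreal (S0 A R E t (lim_left q t) (q t)) + ennreal (S0 A R E t (q t) (lim_right T q t)) \<le> emeasure \<nu> {l t<..<r t}"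
    if t: "t \<in> {t0<..<t1}" for t
  proof -
    have tT': "t \<in> {0..T}" "t \<in> {t0..t1}" using t t01 by auto
    have "\<sigma> t0 \<le> hi t0" "lo t1 \<le> \<sigma> t1" by (rule \<sigma>_le_hi[OF tT(1)], rule lo_le_\<sigma>[OF tT(2)])
    then have lrt: "l t = lo t" "r t = hi t"
      using hi_less_lo[of t0 t] hi_less_lo[of t t1] t t01 by (auto simp: l_def r_def)
    note lh = lo_le_\<sigma>[OF tT'(1)] \<sigma>_le_hi[OF tT'(1)]
    have "integral {lo t..\<sigma> t} g + integral {\<sigma> t..hi t} g = integral {lo t..hi t} g"
      by (rule Henstock_Kurzweil_Integration.integral_combine[OF lh g_integrable])
         (use lh lo_in(1)[OF tT'(1)] hi_in(1)[OF tT'(1)] in auto)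
    then have "S0 A R E t (Q (lo t)) (q t) + S0 A R E t (q t) (Q (hi t)) \<le> integral {l t..r t} g"
      using S0_le_integral[OF tT'(1) order_refl lh] S0_le_integral[OF tT'(1) lh order_refl]
      by (simp add: lrt q_eq[OF tT'(1)])
    then have "ennreal (S0 A R E t (Q (lo t)) (q t) + S0 A R E t (q t) (Q (hi t))) \<le> emeasure \<nu> {l t<..<r t}"
      using I[OF tT'(2)] ennreal_leI by metis
    then show ?thesis using S0_nonneg[OF tT'(1)] by (simp add: lim_q[OF tT'(1)] ennreal_plus)
  qed
  let ?tot = "ennreal (integral {\<sigma> t0..\<sigma> t1} g)"
  have main: "emeasure \<nu> SA + (\<Sum>t\<in>F. emeasure \<nu> {l t<..<r t}) \<le> ?tot" if F: "finite F" "F \<subseteq> {t0..t1}" for F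
  proof -
    let ?U = "\<Union>t\<in>F. {l t<..<r t}"
    have "(\<Sum>t\<in>F. emeasure \<nu> {l t<..<r t}) = emeasure \<nu> ?U"
    proof (rule sum_emeasure)
      show "disjoint_family_on (\<lambda>t. {l t<..<r t}) F"
        unfolding disjoint_family_on_def using tt_in F(2) by blast
    qed (use F in \<open>auto simp: \<nu>_sets\<close>)
    moreover have "SA \<inter> ?U = {}"
    proof (rule ccontr)
      assume "SA \<inter> ?U \<noteq> {}"
      then obtain s t where s: "s \<in> SA" "t \<in> F" "s \<in> {l t<..<r t}" by blast
      then have t: "t \<in> {t0..t1}" "tt s = t" using F tt_in by auto
      then have "t \<in> multi" using lr[OF t(1)] s(3) t01 by (auto simp: multi_def)
      then show False using s(1) t J by (auto simp: SA_def Cset_eq)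
    qed
    moreover have "SA \<in> sets \<nu>" "?U \<in> sets \<nu>" using C_part_sets F by (auto simp: SA_def \<nu>_sets)
    ultimately have "emeasure \<nu> SA + (\<Sum>t\<in>F. emeasure \<nu> {l t<..<r t}) = emeasure \<nu> (SA \<union> ?U)"
      by (simp add: plus_emeasure)
    also have "\<dots> \<le> emeasure \<nu> {\<sigma> t0..\<sigma> t1}"
    proof (rule emeasure_mono)
      show "SA \<union> ?U \<subseteq> {\<sigma> t0..\<sigma> t1}"
      proof
        fix s assume "s \<in> SA \<union> ?U"
        then show "s \<in> {\<sigma> t0..\<sigma> t1}"
        proof
          assume s: "s \<in> SA"
          then have "\<sigma> (tt s) = s" using \<sigma>_tt[of s] J by (auto simp: SA_def Cset_eq)
          moreover have "t0 \<le> tt s" "tt s \<le> t1" using s by (auto simp: SA_def)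
          ultimately show ?thesis using \<sigma>_mono[of t0 "tt s"] \<sigma>_mono[of "tt s" t1] t01 by auto
        qed (auto simp: l_def r_def)
      qed
    qed (simp add: \<nu>_sets)
    also have "\<dots> = ?tot" using emeasure_\<nu>_interval(1)[of "\<sigma> t0" "\<sigma> t1"] \<sigma>01 by simp
    finally show ?thesis .
  qed
  let ?f = "\<lambda>t. ennreal (S0 A R E t (lim_left q t) (q t)) + ennreal (S0 A R E t (q t) (lim_right T q t))"
  let ?c = "(\<integral>\<^sup>+r\<in>{t0..t1}. ennreal (sl r (q r)) \<partial>mu_co d T q) + ennreal (S0 A R E t0 (q t0) (lim_right T q t0)) +
     ennreal (S0 A R E t1 (lim_left q t1) (q t1))"
  have fin: "?c + sum ?f F \<le> ?tot" if F: "finite F" "F \<subseteq> Jset T q \<inter> {t0<..<t1}" for F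
  proof -
    have "sum ?f F \<le> (\<Sum>t\<in>F. emeasure \<nu> {l t<..<r t})" by (rule sum_mono) (use D F in auto)
    then have "?c + sum ?f F \<le> (emeasure \<nu> SA + emeasure \<nu> {l t0<..<r t0} + emeasure \<nu> {l t1<..<r t1}) + (\<Sum>t\<in>F. emeasure \<nu> {l t<..<r t})"
      by (intro add_mono A B C)
    also have "\<dots> = emeasure \<nu> SA + (\<Sum>t\<in>insert t0 (insert t1 F). emeasure \<nu> {l t<..<r t})"
    proof -
      have "t1 \<notin> F" "t0 \<notin> insert t1 F" using F t01 by auto
      then show ?thesis using F(1) by (simp add: ac_simps)
    qed
    also have "\<dots> \<le> ?tot" by (rule main) (use F t01 in auto)
    finally show ?thesis .
  qed
  have "infsum ?f (Jset T q \<inter> {t0<..<t1}) \<le> ?tot - ?c"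
  proof (rule infsum_le_finite_sums)
    show "?f summable_on Jset T q \<inter> {t0<..<t1}" by (rule nonneg_summable_on_complete) simp
    fix F assume "finite F" "F \<subseteq> Jset T q \<inter> {t0<..<t1}"
    from fin[OF this] show "sum ?f F \<le> ?tot - ?c" by (simp add: ennreal_le_minus_iff add.commute)
  qed
  then have "?c + infsum ?f (Jset T q \<inter> {t0<..<t1}) \<le> ?c + (?tot - ?c)" by (rule add_left_mono)
  also have "\<dots> = ?tot" using fin[of "{}"] by (intro add_diff_inverse_ennreal) auto
  finally show ?thesis unfolding Sigma0_def .
qed

end

section \<open>From parametrized solutions to BV solutions\<close>

lemma Xi_iff: "(\<alpha>, \<nu>, \<xi>) \<in> Xi \<longleftrightarrow>
    (0 \<le> \<alpha> \<and> \<nu> = 0 \<and> 0 \<le> \<xi> \<and> \<xi> < 1) \<or> (0 < \<alpha> \<and> 0 \<le> \<nu> \<and> \<xi> = 1) \<or> (\<alpha> = 0 \<and> 0 \<le> \<nu> \<and> 1 \<le> \<xi>)"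
  unfolding Xi_def by auto

locale param_solution = param_curve +
  fixes M :: "real \<times> real \<times> real \<Rightarrow> ennreal"
  assumes M: "admissible_M M"
    and dissipation: "\<exists>N. negligible N \<and> (\<forall>s\<in>{s0<..<s1} - N.
      ereal (deriv \<psi> s - p s * deriv tt s) \<le> - enn2ereal (M (deriv tt s, speed A R Q s, \<xi> s)))"
    and nonstop: "\<exists>N. negligible N \<and> (\<forall>s\<in>{s0<..<s1} - N. deriv tt s + speed A R Q s > 0)"
begin

lemma in_Xi:
  "\<exists>N. negligible N \<and> (\<forall>s\<in>{s0<..<s1} - N. (deriv tt s, spd Q s, \<xi> s) \<in> Xi \<and>
      deriv \<psi> s - p s * deriv tt s = - g s \<and> 0 \<le> deriv tt s \<and> 0 < deriv tt s + spd Q s)"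
proof -
  obtain N1 where N1: "negligible N1" "\<forall>s\<in>{s0<..<s1} - N1. regular Q s \<and> 0 \<le> deriv tt s \<and> \<bar>deriv \<psi> s - p s * deriv tt s\<bar> \<le> g s"
    using a_e_facts by blast
  obtain N2 where N2: "negligible N2" "\<forall>s\<in>{s0<..<s1} - N2.
      ereal (deriv \<psi> s - p s * deriv tt s) \<le> - enn2ereal (M (deriv tt s, speed A R Q s, \<xi> s))" using dissipation by blast
  obtain N3 where N3: "negligible N3" "\<forall>s\<in>{s0<..<s1} - N3. deriv tt s + speed A R Q s > 0" using nonstop by blast
  have "(deriv tt s, spd Q s, \<xi> s) \<in> Xi \<and> deriv \<psi> s - p s * deriv tt s = - g s \<and> 0 \<le> deriv tt s \<and> 0 < deriv tt s + spd Q s"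
    if s: "s \<in> {s0<..<s1} - (N1 \<union> N2 \<union> N3)" for s
  proof -
    have reg: "regular Q s" and a: "0 \<le> deriv tt s" and le: "\<bar>deriv \<psi> s - p s * deriv tt s\<bar> \<le> g s" using s N1 by auto
    have sp: "speed A R Q s = spd Q s" using reg by (simp add: spd_def)
    have 3: "deriv tt s + spd Q s > 0"
    proof -
      have "deriv tt s + speed A R Q s > 0" using s N3(2) by auto
      then show ?thesis unfolding sp .
    qed
    have x: "0 \<le> \<xi> s" by (rule \<xi>_nonneg) (use s in auto)
    have nn: "0 \<le> spd Q s" by (rule spd_nonneg)
    let ?m = "M (deriv tt s, spd Q s, \<xi> s)"
    have 2: "ereal (deriv \<psi> s - p s * deriv tt s) \<le> - enn2ereal ?m"
    proof -
      have "ereal (deriv \<psi> s - p s * deriv tt s) \<le> - enn2ereal (M (deriv tt s, speed A R Q s, \<xi> s))" using s N2(2) by blast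
      then show ?thesis unfolding sp .
    qed
    have Mf: "ennreal (spd Q s * \<xi> s) \<le> ?m" "?m = ennreal (spd Q s * \<xi> s) \<longleftrightarrow> (deriv tt s, spd Q s, \<xi> s) \<in> Xi"
      using M[unfolded admissible_M_def, THEN conjunct2, THEN spec, THEN mp, OF a, THEN spec, THEN mp, OF nn, THEN spec, THEN mp, OF x]
      by blast+
    have gs: "spd Q s * \<xi> s = g s" by (simp add: g_def mult.commute)
    have g0: "0 \<le> g s" unfolding g_def using x nn by simp
    obtain r where r: "0 \<le> r" "?m = ennreal r"
      using 2 by (cases ?m) auto
    have "deriv \<psi> s - p s * deriv tt s \<le> - r" using 2 r by (simp add: enn2ereal_ennreal)
    moreover have "g s \<le> r" using Mf(1) r g0 unfolding gs by (simp add: ennreal_le_iff)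
    ultimately have "r = g s" "deriv \<psi> s - p s * deriv tt s = - g s" using le by auto
    then show ?thesis using Mf(2) r gs 3 a by simp
  qed
  moreover have "negligible (N1 \<union> N2 \<union> N3)" using N1 N2 N3 by (intro negligible_Un)
  ultimately show ?thesis by blast
qed

lemma energy_identity:
  assumes "s0 \<le> l" "l \<le> r" "r \<le> s1"
  shows "\<psi> r - \<psi> l = integral {l..r} (\<lambda>s. p s * \<tau> s) - integral {l..r} g"
proof -
  obtain N where N: "negligible N" "\<forall>s\<in>{s0<..<s1} - N. deriv \<psi> s - p s * deriv tt s = - g s \<and> 0 \<le> deriv tt s"
    using in_Xi by blast
  have i1: "(\<lambda>s. p s * \<tau> s) integrable_on {l..r}"
    by (rule integrable_on_subinterval[OF p_q_integral(1)[of 0 0]]) (use assms T_pos in auto)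
  have "\<psi> r - \<psi> l = integral {l..r} (deriv \<psi>)" using \<psi>_integral[OF assms] by (simp add: integral_unique)
  also have "\<dots> = integral {l..r} (\<lambda>s. p s * \<tau> s - g s)"
  proof (rule integral_spike)
    show "negligible (N \<union> {s0, s1})" using N by (intro negligible_Un) auto
    fix s assume s: "s \<in> {l..r} - (N \<union> {s0, s1})"
    then have "s \<in> {s0<..<s1} - N" using assms by auto
    with N(2) have "deriv \<psi> s - p s * deriv tt s = - g s" "0 \<le> deriv tt s" by blast+
    then show "p s * \<tau> s - g s = deriv \<psi> s" by (simp add: \<tau>_def)
  qed
  also have "\<dots> = integral {l..r} (\<lambda>s. p s * \<tau> s) - integral {l..r} g"
    by (rule Henstock_Kurzweil_Integration.integral_diff[OF i1 g_integrable[OF assms]])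
  finally show ?thesis .
qed

lemma fibre_subset: "t \<in> {0..T} \<Longrightarrow> {lo t<..<hi t} \<subseteq> {s0<..<s1}"
  using lo_in(1)[of t] hi_in(1)[of t] by auto

lemma slope_ge_1_on_fibre:
  assumes t: "t \<in> multi" and s: "s \<in> {lo t..hi t}"
  shows "1 \<le> \<xi> s"
proof -
  have tT: "t \<in> {0..T}" and lh: "lo t < hi t" using t by (auto simp: multi_def)
  obtain N where N: "negligible N" "\<forall>s\<in>{s0<..<s1} - N. (deriv tt s, spd Q s, \<xi> s) \<in> Xi \<and> 0 < deriv tt s + spd Q s"
    using in_Xi by blast
  show ?thesis
  proof (rule ge_if_ge_except_negligible[OF _ lh N(1) _ s])
    show "continuous_on {lo t..hi t} \<xi>"
      using \<xi>_cont by (rule continuous_on_subset) (use lo_in(1)[OF tT] hi_in(1)[OF tT] in auto)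
    fix r assume r: "r \<in> {lo t<..<hi t} - N"
    then have "(deriv tt r, spd Q r, \<xi> r) \<in> Xi" "0 < deriv tt r + spd Q r" "deriv tt r = 0"
      using N(2) fibre_subset[OF tT] deriv_tt_fibre[OF tT, of r] by blast+
    then show "1 \<le> \<xi> r" by (auto simp: Xi_iff)
  qed
qed

lemma energy_jump:
  assumes tT: "t \<in> {0..T}"
  shows "E t (Q (hi t)) - E t (Q (lo t)) = - integral {lo t..hi t} g"
proof -
  have lh: "s0 \<le> lo t" "lo t \<le> hi t" "hi t \<le> s1"
    using lo_in(1)[OF tT] hi_in(1)[OF tT] lo_le_\<sigma>[OF tT] \<sigma>_le_hi[OF tT] by auto
  have "integral {lo t..hi t} (\<lambda>s. p s * \<tau> s) = integral {lo t..hi t} (\<lambda>s. 0)"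
    by (rule integral_spike[of "{lo t, hi t}"]) (use deriv_tt_fibre[OF tT] in \<open>auto simp: \<tau>_def\<close>)
  then show ?thesis using energy_identity[OF lh] lo_in(2)[OF tT] hi_in(2)[OF tT] by (simp add: \<psi>_def)
qed

lemma fibre_ends_distinct:
  assumes t: "t \<in> multi"
  shows "Q (lo t) \<noteq> Q (hi t)"
proof
  assume eq: "Q (lo t) = Q (hi t)"
  have tT: "t \<in> {0..T}" and lh: "lo t < hi t" using t by (auto simp: multi_def)
  have sub: "s0 \<le> lo t" "hi t \<le> s1" using lo_in(1)[OF tT] hi_in(1)[OF tT] by auto
  have "integral {lo t..hi t} g = 0" using energy_jump[OF tT] eq by simp
  then obtain N1 where N1: "negligible N1" "\<forall>s\<in>{lo t<..<hi t} - N1. g s = 0"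
    using integral_eq_0_imp_negligible[OF g_integrable[OF sub(1) _ sub(2)]] lh g_nonneg sub by force
  obtain N where N: "negligible N" "\<forall>s\<in>{s0<..<s1} - N. 0 < deriv tt s + spd Q s"
    using in_Xi by blast
  have "{lo t<..<hi t} \<subseteq> N1 \<union> N"
  proof
    fix s assume s: "s \<in> {lo t<..<hi t}"
    show "s \<in> N1 \<union> N"
    proof (rule ccontr)
      assume "s \<notin> N1 \<union> N"
      then have "g s = 0" "0 < deriv tt s + spd Q s" using s N1 N fibre_subset[OF tT] by blast+
      moreover have "1 \<le> \<xi> s" by (rule slope_ge_1_on_fibre[OF t]) (use s in auto)
      ultimately show False using deriv_tt_fibre[OF tT s] by (simp add: g_def)
    qed
  qed
  then have "negligible {lo t<..<hi t}" using N1 N by (meson negligible_Un negligible_subset)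
  then show False using open_not_negligible[of "{lo t<..<hi t}"] lh by auto
qed

lemma J_eq: "Jset T q = multi"
proof
  show "multi \<subseteq> Jset T q"
  proof
    fix t assume t: "t \<in> multi"
    then have "t \<in> {0..T}" by (simp add: multi_def)
    then show "t \<in> Jset T q"
      using fibre_ends_distinct[OF t] lim_q[of t] by (auto simp: Jset_def Cset_def)
  qed
qed (rule Jset_subset)

sublocale param_curve_J by unfold_locales (rule J_eq)

lemma BV_energy:
  assumes t01: "0 \<le> t0" "t0 < t1" "t1 \<le> T"
  shows "ereal (E t1 (q t1) - E t0 (q t0) - integral {t0..t1} (\<lambda>t. dtE T E t (q t))) \<le> - enn2ereal (Sigma0 A R E T q t0 t1)"
proof -
  have tT: "t0 \<in> {0..T}" "t1 \<in> {0..T}" using t01 by auto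
  have \<sigma>01: "s0 \<le> \<sigma> t0" "\<sigma> t0 \<le> \<sigma> t1" "\<sigma> t1 \<le> s1" using \<sigma>(1)[OF tT(1)] \<sigma>(1)[OF tT(2)] \<sigma>_mono t01 by auto
  have "E t1 (q t1) - E t0 (q t0) - integral {t0..t1} (\<lambda>t. dtE T E t (q t)) = - integral {\<sigma> t0..\<sigma> t1} g"
    using energy_identity[OF \<sigma>01] p_q_integral(2)[of t0 t1] t01 \<sigma>(2)[OF tT(1)] \<sigma>(2)[OF tT(2)] q_eq[OF tT(1)] q_eq[OF tT(2)]
    by (simp add: \<psi>_def)
  moreover have "0 \<le> integral {\<sigma> t0..\<sigma> t1} g"
    by (rule Henstock_Kurzweil_Integration.integral_nonneg[OF g_integrable[OF \<sigma>01]]) (use g_nonneg \<sigma>01 in auto)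
  moreover have "enn2ereal (Sigma0 A R E T q t0 t1) \<le> enn2ereal (ennreal (integral {\<sigma> t0..\<sigma> t1} g))"
    using Sigma0_le[OF t01] by (simp add: less_eq_ennreal.rep_eq)
  ultimately show ?thesis by (simp add: enn2ereal_ennreal ereal_uminus_le_reorder flip: uminus_ereal.simps(1))
qed

lemma slope_le_1:
  assumes t: "t \<in> {0..T} - Jset T q"
  shows "sl t (q t) \<le> 1"
proof (rule ccontr)
  assume "\<not> sl t (q t) \<le> 1"
  moreover have tT: "t \<in> {0..T}" and nm: "t \<notin> multi" using t J by auto
  ultimately have gt: "\<xi> (\<sigma> t) > 1" using \<sigma>[OF tT] q_eq[OF tT] by (simp add: \<xi>_def)
  have \<sigma>t: "\<sigma> t \<in> {s0..s1}" by (rule \<sigma>(1)[OF tT])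
  obtain d where d: "d > 0" "\<forall>s\<in>{s0..s1}. dist s (\<sigma> t) < d \<longrightarrow> dist (\<xi> s) (\<xi> (\<sigma> t)) < \<xi> (\<sigma> t) - 1"
    using \<xi>_cont[unfolded continuous_on_iff, THEN bspec, OF \<sigma>t, THEN spec, THEN mp, of "\<xi> (\<sigma> t) - 1"] gt by auto
  define l r where "l = max s0 (\<sigma> t - d/2)" and "r = min s1 (\<sigma> t + d/2)"
  have lr: "s0 \<le> l" "l < r" "r \<le> s1" "l \<le> \<sigma> t" "\<sigma> t \<le> r" using \<sigma>t d(1) s0_less_s1 by (auto simp: l_def r_def)
  have big: "\<xi> s > 1" if "s \<in> {l..r}" for s
  proof -
    have "s \<in> {s0..s1}" "dist s (\<sigma> t) < d" using that lr d(1) by (auto simp: l_def r_def dist_real_def)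
    then have "dist (\<xi> s) (\<xi> (\<sigma> t)) < \<xi> (\<sigma> t) - 1" using d(2) by blast
    then show ?thesis by (auto simp: dist_real_def)
  qed
  obtain N where N: "negligible N" "\<forall>s\<in>{s0<..<s1} - N. (deriv tt s, spd Q s, \<xi> s) \<in> Xi" using in_Xi by blast
  have "integral {l..r} \<tau> = integral {l..r} (\<lambda>s. 0)"
  proof (rule integral_spike)
    show "negligible (N \<union> {s0, s1})" using N by (intro negligible_Un) auto
    fix s assume s: "s \<in> {l..r} - (N \<union> {s0, s1})"
    then have "(deriv tt s, spd Q s, \<xi> s) \<in> Xi" "\<xi> s > 1" using N(2) big[of s] lr by auto
    then show "0 = \<tau> s" by (auto simp: Xi_iff \<tau>_def)
  qed
  then have "tt r = tt l" using \<tau>_integral[of l r] lr by (simp add: integral_unique)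
  then have "tt l = t" "tt r = t" using tt_le[of l "\<sigma> t"] tt_le[of "\<sigma> t" r] lr \<sigma>(2)[OF tT] by auto
  then have "lo t \<le> l" "r \<le> hi t" using tt_eq_iff[OF tT, of l] tt_eq_iff[OF tT, of r] lr by auto
  then show False using nm tT lr by (auto simp: multi_def)
qed

lemma slope_ge_1:
  assumes t: "t \<in> msupport (mu d T q)"
  shows "1 \<le> sl t (q t)"
proof (rule ccontr)
  assume lt: "\<not> 1 \<le> sl t (q t)"
  have null: False if U: "open U" "t \<in> U" and zero: "\<exists>N. negligible N \<and> (\<forall>s\<in>{s0..s1} - N. tt s \<in> U \<longrightarrow> spd Q s = 0)" for U
  proof -
    obtain N where N: "negligible N" "\<forall>s\<in>{s0..s1} - N. tt s \<in> U \<longrightarrow> spd Q s = 0" using zero by blast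
    have "emeasure (mu d T q) U \<le> emeasure (push (spd Q)) U"
      using mu_le_push le_measure[of "mu d T q" "push (spd Q)"] U(1) by (simp add: mu_def push_sets[OF spd_Q])
    also have "\<dots> = (\<integral>\<^sup>+s. ennreal (spd Q s) * indicator {s\<in>{s0..s1}. tt s \<in> U} s \<partial>lebesgue)"
      by (rule emeasure_push[OF spd_Q]) (use U in simp)
    also have "\<dots> = (\<integral>\<^sup>+(s::real). 0 \<partial>lebesgue)"
    proof (rule nn_integral_cong_AE, unfold AE_lebesgue_iff_negligible, intro exI conjI allI impI)
      show "negligible N" by (rule N(1))
      fix s assume "s \<notin> N"
      then show "ennreal (spd Q s) * indicator {s\<in>{s0..s1}. tt s \<in> U} s = 0"
        using N(2) by (cases "s \<in> {s0..s1} \<and> tt s \<in> U") auto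
    qed
    finally show False using t U by (auto simp: msupport_def)
  qed
  show False
  proof (cases "t \<in> {0..T}")
    case False
    show False
      by (rule null[of "- {0..T}"]) (use False tt_range in \<open>auto intro!: exI[of _ "{}"]\<close>)
  next
    case tT: True
    have \<xi>\<sigma>: "\<xi> (\<sigma> t) < 1" using lt \<sigma>[OF tT] q_eq[OF tT] by (simp add: \<xi>_def)
    show False
    proof (cases "t \<in> multi")
      case True
      then show False using slope_ge_1_on_fibre[OF True, of "\<sigma> t"] lo_le_\<sigma>[OF tT] \<sigma>_le_hi[OF tT] \<xi>\<sigma> by auto
    next
      case False
      have \<sigma>t: "\<sigma> t \<in> {s0..s1}" by (rule \<sigma>(1)[OF tT])
      obtain d where d: "d > 0" "\<forall>s\<in>{s0..s1}. dist s (\<sigma> t) < d \<longrightarrow> dist (\<xi> s) (\<xi> (\<sigma> t)) < 1 - \<xi> (\<sigma> t)"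
        using \<xi>_cont[unfolded continuous_on_iff, THEN bspec, OF \<sigma>t, THEN spec, THEN mp, of "1 - \<xi> (\<sigma> t)"] \<xi>\<sigma> by auto
      let ?K = "tt ` ({s0..s1} - ball (\<sigma> t) d)"
      have "compact ({s0..s1} - ball (\<sigma> t) d)" by (rule compact_diff) auto
      then have "compact ?K" by (rule compact_continuous_image[OF continuous_on_subset[OF tt_cont], rotated]) auto
      then have op: "open (- ?K)" by (simp add: compact_imp_closed open_Compl)
      have tK: "t \<in> - ?K"
      proof
        assume "t \<in> ?K"
        then obtain s where s: "s \<in> {s0..s1}" "s \<notin> ball (\<sigma> t) d" "tt s = t" by blast
        then have "s = \<sigma> t" using \<sigma>_tt[of s] False by simp
        then show False using s(2) d(1) by simp
      qed
      obtain N where N: "negligible N" "\<forall>s\<in>{s0<..<s1} - N. (deriv tt s, spd Q s, \<xi> s) \<in> Xi" using in_Xi by blast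
      have "spd Q s = 0" if s: "s \<in> {s0..s1} - (N \<union> {s0, s1})" "tt s \<in> - ?K" for s
      proof -
        have "s \<in> {s0..s1}" "dist s (\<sigma> t) < d" using s by (auto simp: dist_commute)
        then have "dist (\<xi> s) (\<xi> (\<sigma> t)) < 1 - \<xi> (\<sigma> t)" using d(2) by blast
        then have "\<xi> s < 1" by (auto simp: dist_real_def)
        moreover have "(deriv tt s, spd Q s, \<xi> s) \<in> Xi" using N(2) s(1) by auto
        ultimately show ?thesis by (auto simp: Xi_iff)
      qed
      moreover have "negligible (N \<union> {s0, s1})" using N by (intro negligible_Un) auto
      ultimately show False by (intro null[OF op tK]) blast
    qed
  qed
qed

lemma has_jump_curve:
  assumes t: "t \<in> Jset T q"
  shows "\<exists>y. jump_curve A R E T q t y"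
proof -
  have tm: "t \<in> multi" and tT: "t \<in> {0..T}" and lh: "lo t < hi t" using t J by (auto simp: multi_def)
  have sub: "s0 \<le> lo t" "hi t \<le> s1" using lo_in(1)[OF tT] hi_in(1)[OF tT] by auto
  define y where "y \<theta> = Q ((hi t - lo t) * \<theta> + lo t)" for \<theta>
  have ac: "ac_curve A (lo t) (hi t) Q" by (rule ac_curve_subinterval[OF Q_ac sub])
  have range: "(hi t - lo t) * \<theta> + lo t \<in> {lo t..hi t}" if "\<theta> \<in> {0..1}" for \<theta>
  proof -
    have "(hi t - lo t) * \<theta> \<le> hi t - lo t" using that lh mult_left_le[of \<theta> "hi t - lo t"] by auto
    moreover have "0 \<le> (hi t - lo t) * \<theta>" using that lh by auto
    ultimately show ?thesis by auto
  qed
  have ttr: "tt s = t" if "s \<in> {lo t..hi t}" for s using tt_eq_iff[OF tT, of s] that sub by auto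
  have "jump_curve A R E T q t y"
    unfolding jump_curve_def lim_q[OF tT]
  proof (intro conjI ballI)
    show "y \<in> curves A (Q (lo t)) (Q (hi t))" unfolding y_def by (rule unit_curve(1)[OF ac lh])
    show "\<exists>\<theta>\<in>{0..1}. y \<theta> = q t"
    proof
      let ?\<theta> = "(\<sigma> t - lo t) / (hi t - lo t)"
      show "?\<theta> \<in> {0..1}" using lo_le_\<sigma>[OF tT] \<sigma>_le_hi[OF tT] lh by (auto simp: divide_le_eq)
      show "y ?\<theta> = q t" using lh by (simp add: y_def q_eq[OF tT])
    qed
    fix \<theta> :: real assume "\<theta> \<in> {0..1}"
    then show "1 \<le> sl t (y \<theta>)"
      using slope_ge_1_on_fibre[OF tm range] ttr[OF range] by (simp add: y_def \<xi>_def)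
  next
    have "integral {0..1} (\<lambda>\<theta>. sl t (y \<theta>) * speed A R y \<theta>) = integral {lo t..hi t} (\<lambda>s. sl t (Q s) * spd Q s)"
      unfolding y_def[abs_def] by (rule slope_integral_affine[OF ac lh tT])
    also have "\<dots> = integral {lo t..hi t} g"
      by (rule Henstock_Kurzweil_Integration.integral_cong) (use ttr in \<open>simp add: g_def \<xi>_def\<close>)
    finally show "E t (Q (hi t)) - E t (Q (lo t)) = - integral {0..1} (\<lambda>\<theta>. sl t (y \<theta>) * speed A R y \<theta>)"
      using energy_jump[OF tT] by simp
  qed
  then show ?thesis by blast
qed

theorem BV_solution: "BV_solution A R E T q"
  unfolding BV_solution_def using BV_q BV_energy slope_le_1 slope_ge_1 has_jump_curve by blast

end

context finsler_energy
begin

lemma BV_solution_of_parametrized: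
  assumes M: "admissible_M M" and sol: "parametrized_metric_solution A R E T M s0 s1 tt qq"
    and \<sigma>: "\<forall>t\<in>{0..T}. \<sigma> t \<in> {s0..s1} \<and> tt (\<sigma> t) = t \<and> q t = qq (\<sigma> t)"
  shows "BV_solution A R E T q"
proof -
  have s: "s0 < s1" "abs_cont s0 s1 tt" "tt ` {s0..s1} \<subseteq> {0..T}" "ac_curve A s0 s1 qq" "mono_on {s0..s1} tt"
    and D: "AE s in lebesgue. s \<in> {s0<..<s1} \<longrightarrow>
        ereal (deriv (\<lambda>r. E (tt r) (qq r)) s - dtE T E (tt s) (qq s) * deriv tt s)
          \<le> - enn2ereal (M (deriv tt s, speed A R qq s, slope A R E (tt s) (qq s)))"
    and P: "AE s in lebesgue. s \<in> {s0<..<s1} \<longrightarrow> deriv tt s + speed A R qq s > 0"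
    using sol unfolding parametrized_metric_solution_def stopping_parametrized_solution_def by blast+
  have \<sigma>t: "\<sigma> t \<in> {s0..s1}" "tt (\<sigma> t) = t" "q t = qq (\<sigma> t)" if "t \<in> {0..T}" for t using \<sigma> that by auto
  have T0: "0 \<in> {0..T}" "T \<in> {0..T}" using T_pos by auto
  have mono: "\<sigma> u \<le> \<sigma> v" if uv: "u \<in> {0..T}" "v \<in> {0..T}" "u \<le> v" for u v
  proof (rule ccontr)
    assume "\<not> \<sigma> u \<le> \<sigma> v"
    then have "tt (\<sigma> v) \<le> tt (\<sigma> u)" using \<sigma>t uv by (intro mono_onD[OF s(5)]) auto
    then have "u = v" using \<sigma>t uv by simp
    then show False using \<open>\<not> \<sigma> u \<le> \<sigma> v\<close> by simp
  qed
  have sub: "s0 \<le> \<sigma> 0" "\<sigma> T \<le> s1" using \<sigma>t[OF T0(1)] \<sigma>t[OF T0(2)] by auto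
  interpret param_curve A R E T tt \<sigma> "\<sigma> 0" "\<sigma> T" qq q
  proof unfold_locales
    show "\<sigma> 0 \<le> \<sigma> T" using mono T0 T_pos by auto
    show "continuous_on {\<sigma> 0..\<sigma> T} tt"
      by (rule continuous_on_subset[OF abs_cont_imp_continuous_on[OF s(2)]]) (use sub in auto)
    show "mono_on {\<sigma> 0..\<sigma> T} tt" by (rule mono_on_subset[OF s(5)]) (use sub in auto)
    show "\<sigma> t \<in> {\<sigma> 0..\<sigma> T}" if "t \<in> {0..T}" for t using mono[of 0 t] mono[of t T] T0 that by auto
    show "ac_curve A (\<sigma> 0) (\<sigma> T) qq" by (rule ac_curve_subinterval[OF s(4) sub])
    show "abs_cont (\<sigma> 0) (\<sigma> T) tt" by (rule abs_cont_subinterval[OF s(2) sub])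
  qed (use T_pos \<sigma>t T0 in auto)
  interpret param_solution A R E T tt \<sigma> "\<sigma> 0" "\<sigma> T" qq q M
  proof unfold_locales
    obtain N where N: "negligible N" "\<forall>s. s \<notin> N \<longrightarrow> s \<in> {s0<..<s1} \<longrightarrow>
        ereal (deriv (\<lambda>r. E (tt r) (qq r)) s - dtE T E (tt s) (qq s) * deriv tt s)
          \<le> - enn2ereal (M (deriv tt s, speed A R qq s, slope A R E (tt s) (qq s)))"
      using D unfolding AE_lebesgue_iff_negligible by blast
    show "\<exists>N. negligible N \<and> (\<forall>s\<in>{\<sigma> 0<..<\<sigma> T} - N.
      ereal (deriv \<psi> s - p s * deriv tt s) \<le> - enn2ereal (M (deriv tt s, speed A R qq s, \<xi> s)))"
      using N sub unfolding \<psi>_def[abs_def] p_def \<xi>_def by (intro exI[of _ N]) auto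
    obtain N' where "negligible N'" "\<forall>s. s \<notin> N' \<longrightarrow> s \<in> {s0<..<s1} \<longrightarrow> deriv tt s + speed A R qq s > 0"
      using P unfolding AE_lebesgue_iff_negligible by blast
    then show "\<exists>N. negligible N \<and> (\<forall>s\<in>{\<sigma> 0<..<\<sigma> T} - N. deriv tt s + speed A R qq s > 0)"
      using sub by (intro exI[of _ N']) auto
  qed (rule M)
  show ?thesis by (rule BV_solution)
qed

end

section \<open>From BV solutions to parametrized solutions\<close>

lemma countable_isolated_points:
  fixes P :: "'a::{t2_space,second_countable_topology} set"
  shows "countable {x\<in>P. \<not> x islimpt P}" (is "countable ?I")
proof -
  obtain B :: "'a set set" where B: "countable B" "topological_basis B" using ex_countable_basis by blast
  have "\<exists>b\<in>B. b \<inter> P = {x}" if x: "x \<in> ?I" for x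
  proof -
    obtain T where T: "x \<in> T" "open T" "\<forall>y\<in>P. y \<in> T \<longrightarrow> y = x" using x unfolding islimpt_def by auto
    then obtain b where "b \<in> B" "x \<in> b" "b \<subseteq> T" using topological_basisE[OF B(2)] by metis
    then show ?thesis using T x by (intro bexI[of _ b]) auto
  qed
  then have "\<forall>x\<in>?I. \<exists>b. b \<in> B \<and> b \<inter> P = {x}" by blast
  from bchoice[OF this] obtain f where f: "\<forall>x\<in>?I. f x \<in> B \<and> f x \<inter> P = {x}" ..
  have "inj_on f ?I"
  proof (rule inj_onI)
    fix x x' assume x: "x \<in> ?I" "x' \<in> ?I" and eq: "f x = f x'"
    have "{x} = f x \<inter> P" by (rule f[THEN bspec, OF x(1), THEN conjunct2, symmetric])
    also have "\<dots> = {x'}" unfolding eq by (rule f[THEN bspec, OF x(2), THEN conjunct2])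
    finally have "{x} = {x'}" .
    then show "x = x'" by (rule singleton_inject)
  qed
  moreover have "f ` ?I \<subseteq> B"
    by (rule image_subsetI) (rule f[THEN bspec, THEN conjunct1])
  then have "countable (f ` ?I)" using B(1) by (rule countable_subset)
  ultimately show ?thesis by (rule countable_image_inj_on[rotated])
qed

lemma sum_le_infsum_ennreal:
  fixes f :: "'a \<Rightarrow> ennreal"
  assumes "finite F" "F \<subseteq> A"
  shows "sum f F \<le> infsum f A"
  by (subst nonneg_infsum_complete) (use assms in \<open>auto intro: SUP_upper\<close>)

context time_change
begin

definition flats :: "real set" where "flats = (\<Union>t\<in>multi. {lo t<..<hi t})"

lemma multi_in: "t \<in> multi \<Longrightarrow> t \<in> {0..T}" and multi_less: "t \<in> multi \<Longrightarrow> lo t < hi t"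
  by (auto simp: multi_def)

lemma fibre_sub: "t \<in> {0..T} \<Longrightarrow> lo t \<le> s \<Longrightarrow> s \<le> hi t \<Longrightarrow> s \<in> {s0..s1} \<and> tt s = t"
  using tt_eq_iff[of t s] lo_in(1)[of t] hi_in(1)[of t] by auto

lemma flats_iff: "s \<in> flats \<longleftrightarrow> s \<in> {s0..s1} \<and> tt s \<in> multi \<and> lo (tt s) < s \<and> s < hi (tt s)"
proof
  assume "s \<in> flats"
  then obtain t where t: "t \<in> multi" "lo t < s" "s < hi t" by (auto simp: flats_def)
  then have "s \<in> {s0..s1} \<and> tt s = t" using multi_in fibre_sub[of t s] by auto
  with t show "s \<in> {s0..s1} \<and> tt s \<in> multi \<and> lo (tt s) < s \<and> s < hi (tt s)" by simp
qed (auto simp: flats_def)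

lemma flats_integral:
  assumes int: "\<And>t. t \<in> multi \<Longrightarrow> f integrable_on {lo t..hi t}" and f: "\<And>s. s \<in> {s0..s1} \<Longrightarrow> 0 \<le> (f s :: real)"
    and B: "\<And>F. finite F \<Longrightarrow> F \<subseteq> multi \<Longrightarrow> (\<Sum>t\<in>F. integral {lo t..hi t} f) \<le> B"
  shows "(\<lambda>s. if s \<in> flats then f s else 0) integrable_on {s0..s1}"
    "integral {s0..s1} (\<lambda>s. if s \<in> flats then f s else 0) \<le> B"
proof -
  define F where "F n = {t\<in>multi. to_nat_on multi t < n}" for n :: nat
  define U where "U n = (\<Union>t\<in>F n. {lo t<..<hi t})" for n
  define h where "h n s = (if s \<in> U n then f s else 0)" for n s
  have Fm: "F n \<subseteq> multi" for n by (auto simp: F_def)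
  have Ffin: "finite (F n)" for n
  proof (rule finite_imageD)
    show "finite (to_nat_on multi ` F n)" by (rule finite_subset[of _ "{..<n}"]) (auto simp: F_def)
    show "inj_on (to_nat_on multi) (F n)"
      using inj_on_to_nat_on[OF countable_multi] Fm by (rule inj_on_subset)
  qed
  have Usub: "U n \<subseteq> {s0..s1}" for n
  proof
    fix s assume "s \<in> U n"
    then obtain t where t: "t \<in> F n" "lo t < s" "s < hi t" by (auto simp: U_def)
    then show "s \<in> {s0..s1}" using fibre_sub[OF multi_in, of t s] Fm by auto
  qed
  have hi: "(h n has_integral (\<Sum>t\<in>F n. integral {lo t..hi t} f)) {s0..s1}" for n
    unfolding h_def has_integral_restrict[OF Usub] unfolding U_def
  proof (rule has_integral_UN[OF Ffin])
    fix t assume "t \<in> F n"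
    then have "(f has_integral integral {lo t..hi t} f) {lo t..hi t}" using int Fm by (auto intro: integrable_integral)
    then show "(f has_integral integral {lo t..hi t} f) {lo t<..<hi t}" by (simp add: has_integral_Icc_iff_Ioo)
  next
    show "pairwise (\<lambda>i i'. negligible ({lo i<..<hi i} \<inter> {lo i'<..<hi i'})) (F n)"
    proof (rule pairwiseI)
      fix i i' assume i: "i \<in> F n" "i' \<in> F n" "i \<noteq> i'"
      have "{lo i<..<hi i} \<inter> {lo i'<..<hi i'} = {}"
      proof (rule equals0I)
        fix s assume "s \<in> {lo i<..<hi i} \<inter> {lo i'<..<hi i'}"
        then have "tt s = i" "tt s = i'" using fibre_sub[OF multi_in, of i s] fibre_sub[OF multi_in, of i' s] i Fm by auto
        then show False using i by simp
      qed
      then show "negligible ({lo i<..<hi i} \<inter> {lo i'<..<hi i'})" by simp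
    qed
  qed
  have hle: "integral {s0..s1} (h n) \<le> B" for n
    using integral_unique[OF hi] B[OF Ffin Fm] by simp
  have h0: "0 \<le> integral {s0..s1} (h n)" for n
    by (rule Henstock_Kurzweil_Integration.integral_nonneg) (use hi f in \<open>auto simp: h_def\<close>)
  have "(\<lambda>s. if s \<in> flats then f s else 0) integrable_on {s0..s1} \<and>
      (\<lambda>n. integral {s0..s1} (h n)) \<longlonglongrightarrow> integral {s0..s1} (\<lambda>s. if s \<in> flats then f s else 0)"
  proof (rule monotone_convergence_increasing)
    show "h n integrable_on {s0..s1}" for n using hi by (rule has_integral_integrable)
    fix s assume s: "s \<in> {s0..s1}"
    have "U n \<subseteq> U (Suc n)" for n unfolding U_def F_def by (rule UN_mono) auto
    then show "h n s \<le> h (Suc n) s" for n using f[OF s] by (auto simp: h_def)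
    have "\<forall>\<^sub>F n in sequentially. h n s = (if s \<in> flats then f s else 0)"
    proof (cases "s \<in> flats")
      case True
      then obtain t where t: "t \<in> multi" "lo t < s" "s < hi t" by (auto simp: flats_def)
      have "s \<in> U n" if "n > to_nat_on multi t" for n using t that by (auto simp: U_def F_def)
      then show ?thesis unfolding eventually_sequentially using True
        by (intro exI[of _ "Suc (to_nat_on multi t)"]) (auto simp: h_def)
    next
      case False
      then have "s \<notin> U n" for n using Fm by (auto simp: U_def flats_def)
      then show ?thesis using False by (simp add: h_def)
    qed
    then show "(\<lambda>n. h n s) \<longlonglongrightarrow> (if s \<in> flats then f s else 0)" by (rule tendsto_eventually)
  next
    show "bounded (range (\<lambda>n. integral {s0..s1} (h n)))"
      unfolding bounded_iff using hle h0 by (intro exI[of _ B]) auto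
  qed
  then show "(\<lambda>s. if s \<in> flats then f s else 0) integrable_on {s0..s1}"
    "integral {s0..s1} (\<lambda>s. if s \<in> flats then f s else 0) \<le> B"
    using LIMSEQ_le_const2[of _ _ B] hle by blast+
qed

end

locale bv_param = finsler_energy A R E T
  for A :: "('q::{t2_space,second_countable_topology}, 'e::euclidean_space) chart set"
    and R :: "'q \<Rightarrow> ('q, 'e) tvec \<Rightarrow> real" and E T +
  fixes q :: "real \<Rightarrow> 'q" and y :: "real \<Rightarrow> real \<Rightarrow> 'q" and \<sigma> S tt and qq z :: "real \<Rightarrow> 'q"
  assumes sol: "BV_solution A R E T q"
    and jump: "t \<in> Jset T q \<Longrightarrow> jump_curve A R E T q t (y t)"
    and \<sigma>_eq: "t \<in> {0..T} \<Longrightarrow> \<sigma> t = t + V_fun (fdist A R) q t"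
    and S_eq: "S = \<sigma> T"
    and tt_0: "tt 0 = 0" and tt_Sup: "s \<in> {0<..S} \<Longrightarrow> tt s = Sup {t\<in>{0..T}. \<sigma> t < s}"
    and lip: "r \<in> {0..S} \<Longrightarrow> s \<in> {0..S} \<Longrightarrow> \<bar>tt r - tt s\<bar> + fdist A R (qq r) (qq s) \<le> \<bar>r - s\<bar>"
    and \<sigma>_inv: "t \<in> {0..T} \<Longrightarrow> tt (\<sigma> t) = t" "t \<in> {0..T} \<Longrightarrow> qq (\<sigma> t) = q t"
    and z_C: "s \<in> {0..S} \<Longrightarrow> tt s \<in> Cset T q \<Longrightarrow> z s = qq s"
    and z_J: "s \<in> {0..S} \<Longrightarrow> \<theta> \<in> {0..1} \<Longrightarrow> tt s \<in> Jset T q \<Longrightarrow>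
      s = (1 - \<theta>) * lim_left \<sigma> (tt s) + \<theta> * lim_right T \<sigma> (tt s) \<Longrightarrow> z s = y (tt s) \<theta>"
begin

lemma BV_fin: "t \<le> T \<Longrightarrow> Var (fdist A R) q {0..t} < top"
  using Var_mono[of "{0..t}" "{0..T}" "fdist A R" q] sol unfolding BV_solution_def BV_def by (auto intro: le_less_trans)

lemma \<sigma>_zero: "\<sigma> 0 = 0"
proof -
  interpret variation_dist "fdist A R" by unfold_locales (auto simp: fdist_nonneg fdist_self fdist_triangle)
  have "V_fun (fdist A R) q 0 = 0" unfolding V_fun_def Var_singleton by simp
  then show ?thesis using \<sigma>_eq[of 0] T_pos by simp
qed

lemma \<sigma>_range: "t \<in> {0..T} \<Longrightarrow> \<sigma> t \<in> {0..S}"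
proof -
  assume t: "t \<in> {0..T}"
  have "Var (fdist A R) q {0..t} \<le> Var (fdist A R) q {0..T}" by (rule Var_mono) (use t in auto)
  then have "V_fun (fdist A R) q t \<le> V_fun (fdist A R) q T"
    unfolding V_fun_def by (rule enn2real_mono) (use BV_fin[of T] in auto)
  moreover have "0 \<le> V_fun (fdist A R) q t" by (simp add: V_fun_def)
  ultimately show ?thesis using \<sigma>_eq[OF t] \<sigma>_eq[of T] t T_pos by (auto simp: S_eq)
qed

lemma lip1: "0 \<le> s \<Longrightarrow> s \<le> r \<Longrightarrow> r \<le> S \<Longrightarrow> \<bar>tt r - tt s\<bar> \<le> r - s" "0 \<le> s \<Longrightarrow> s \<le> r \<Longrightarrow> r \<le> S \<Longrightarrow> fdist A R (qq s) (qq r) \<le> r - s"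
  using lip[of r s] lip[of s r] fdist_nonneg[of "qq r" "qq s"] by auto

lemma tt_mono_S: "mono_on {0..S} tt"
proof (rule mono_onI)
  fix s r assume sr: "s \<in> {0..S}" "r \<in> {0..S}" "s \<le> r"
  have bdd: "bdd_above {t\<in>{0..T}. \<sigma> t < x}" for x by (rule bdd_aboveI[of _ T]) auto
  have in0: "0 \<in> {t\<in>{0..T}. \<sigma> t < x}" if "0 < x" for x using T_pos that \<sigma>_zero by auto
  show "tt s \<le> tt r"
  proof (cases "s = 0")
    case True
    show ?thesis
    proof (cases "r = 0")
      case False
      then have r: "r \<in> {0<..S}" using sr by auto
      then have "0 \<le> tt r" unfolding tt_Sup[OF r] by (intro cSup_upper[OF in0 bdd]) auto
      then show ?thesis using True tt_0 by simp
    qed (use True in simp)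
  next
    case False
    then have s: "s \<in> {0<..S}" "r \<in> {0<..S}" using sr by auto
    show ?thesis unfolding tt_Sup[OF s(1)] tt_Sup[OF s(2)]
      by (rule cSup_subset_mono) (use in0[of s] s sr bdd in auto)
  qed
qed

sublocale param_curve A R E T tt \<sigma> 0 S qq q
proof unfold_locales
  have T0: "0 \<in> {0..T}" "T \<in> {0..T}" using T_pos by auto
  show S0: "0 \<le> S" using \<sigma>_range[OF T0(1)] by auto
  have dom1: "dominated 0 S (\<lambda>l r. norm (tt r - tt l))"
    by (rule dominatedI[of "\<lambda>_. 1"]) (use lip1 in auto)
  then show ac: "abs_cont 0 S tt" by (rule dominated_imp_abs_cont)
  show "continuous_on {0..S} tt" by (rule abs_cont_imp_continuous_on[OF ac])
  have "dominated 0 S (\<lambda>l r. fdist A R (qq l) (qq r))"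
    by (rule dominatedI[of "\<lambda>_. 1"]) (use lip1 in auto)
  then show "ac_curve A 0 S qq" by (rule dominated_imp_ac_curve)
  show "tt S = T" using \<sigma>_inv(1)[OF T0(2)] by (simp add: S_eq)
qed (use T_pos \<sigma>_range \<sigma>_inv \<sigma>_zero tt_mono_S tt_0 S_eq in auto)

lemma lim_\<sigma>: "t \<in> {0..T} \<Longrightarrow> lim_left \<sigma> t = lo t" "t \<in> {0..T} \<Longrightarrow> lim_right T \<sigma> t = hi t"
  using lim_left_compose[OF continuous_on_id, of t \<sigma>] lim_right_compose[OF continuous_on_id, of t \<sigma>] by auto

lemma Var_small:
  assumes "\<epsilon> > 0"
  shows "\<exists>P. finite P \<and> (\<forall>u v. 0 \<le> u \<and> u \<le> v \<and> v \<le> T \<and> {u<..<v} \<inter> P = {} \<longrightarrow> V v - V u \<le> d (q u) (q v) + \<epsilon>)"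
  by (rule d_var.Var_increment_avoiding[OF BV_fin[OF order_refl] assms less_imp_le[OF T_pos]])
     (unfold V_fun_def, blast)

lemma eventually_avoids:
  fixes P :: "real set"
  assumes "finite P"
  shows "\<forall>\<^sub>F u in at_left t. {u<..<t} \<inter> P = {}" "\<forall>\<^sub>F u in at_right t. {t<..<u} \<inter> P = {}"
proof -
  have "open (- (P - {t}))" using assms by (intro open_Compl finite_imp_closed) auto
  then obtain e where e: "e > 0" "ball t e \<subseteq> - (P - {t})" using open_contains_ball[of "- (P - {t})"] by blast
  show "\<forall>\<^sub>F u in at_left t. {u<..<t} \<inter> P = {}"
    unfolding eventually_at_left_field by (rule exI[of _ "t - e"]) (use e in \<open>force simp: dist_real_def\<close>)
  show "\<forall>\<^sub>F u in at_right t. {t<..<u} \<inter> P = {}"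
    unfolding eventually_at_right_field by (rule exI[of _ "t + e"]) (use e in \<open>force simp: dist_real_def\<close>)
qed

lemma multi_jump:
  assumes t: "t \<in> Cset T q"
  shows "t \<notin> multi"
proof -
  have tT: "t \<in> {0..T}" and L: "qq (lo t) = q t" and Rr: "q t = qq (hi t)"
    using t lim_q[of t] by (auto simp: Cset_def)
  have q\<sigma>: "qq (\<sigma> t) = q t" by (rule \<sigma>_inv(2)[OF tT])
  have left: "\<not> lo t < \<sigma> t"
  proof
    assume less: "lo t < \<sigma> t"
    then have t0: "0 < t" "t \<le> T" using tT \<sigma>_zero lo_0 by (cases "t = 0", auto)
    define \<epsilon> where "\<epsilon> = (\<sigma> t - lo t) / 4"
    have \<epsilon>: "\<epsilon> > 0" using less by (simp add: \<epsilon>_def)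
    obtain P where P: "finite P" "\<forall>u v. 0 \<le> u \<and> u \<le> v \<and> v \<le> T \<and> {u<..<v} \<inter> P = {} \<longrightarrow> V v - V u \<le> d (q u) (q v) + \<epsilon>"
      using Var_small[OF \<epsilon>] by blast
    have "\<forall>\<^sub>F u in at_left t. max 0 (t - \<epsilon>) < u \<and> u < t"
      unfolding eventually_at_left_field using t0 \<epsilon> by (intro exI[of _ "max 0 (t - \<epsilon>)"]) auto
    with tendstoD[OF \<sigma>_tendsto_left[OF t0] \<epsilon>] eventually_avoids(1)[OF P(1), of t]
    have "\<forall>\<^sub>F u in at_left t. dist (\<sigma> u) (lo t) < \<epsilon> \<and> {u<..<t} \<inter> P = {} \<and> max 0 (t - \<epsilon>) < u \<and> u < t"
      by eventually_elim auto
    then obtain u where u: "dist (\<sigma> u) (lo t) < \<epsilon>" "{u<..<t} \<inter> P = {}" "max 0 (t - \<epsilon>) < u" "u < t"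
      using eventually_happens'[OF trivial_limit_at_left_real] by blast
    have uT: "u \<in> {0..T}" using u t0 by auto
    have "V t - V u \<le> d (q u) (q t) + \<epsilon>" using P(2) u t0 by auto
    moreover have "d (q u) (q t) \<le> lo t - \<sigma> u"
    proof -
      have "\<sigma> u \<le> hi u" "hi u < lo t" using \<sigma>_le_hi[OF uT] hi_less_lo[of u t] u t0 by auto
      then have "d (qq (\<sigma> u)) (qq (lo t)) \<le> lo t - \<sigma> u"
        using \<sigma>(1)[OF uT] lo_in(1)[OF tT] by (intro lip1(2)) auto
      then show ?thesis using L \<sigma>_inv(2)[OF uT] by simp
    qed
    ultimately have "\<sigma> t - \<sigma> u \<le> (t - u) + (lo t - \<sigma> u) + \<epsilon>" using \<sigma>_eq[OF tT] \<sigma>_eq[OF uT] by simp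
    moreover have "t - u < \<epsilon>" using u(3) by simp
    moreover have "4 * \<epsilon> = \<sigma> t - lo t" by (simp add: \<epsilon>_def)
    ultimately show False using \<epsilon> by linarith
  qed
  have right: "\<not> \<sigma> t < hi t"
  proof
    assume less: "\<sigma> t < hi t"
    have "t \<noteq> T"
    proof
      assume "t = T"
      then have "\<sigma> t = hi t" unfolding hi_T \<sigma>_T by (simp only: hi_T \<sigma>_T)
      then show False using less by simp
    qed
    then have t0: "0 \<le> t" "t < T" using tT by auto
    define \<epsilon> where "\<epsilon> = (hi t - \<sigma> t) / 4"
    have \<epsilon>: "\<epsilon> > 0" using less by (simp add: \<epsilon>_def)
    obtain P where P: "finite P" "\<forall>u v. 0 \<le> u \<and> u \<le> v \<and> v \<le> T \<and> {u<..<v} \<inter> P = {} \<longrightarrow> V v - V u \<le> d (q u) (q v) + \<epsilon>"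
      using Var_small[OF \<epsilon>] by blast
    have "\<forall>\<^sub>F u in at_right t. t < u \<and> u < min T (t + \<epsilon>)"
      by (rule eventually_at_right_in) (use t0 \<epsilon> in auto)
    with tendstoD[OF \<sigma>_tendsto_right[OF t0] \<epsilon>] eventually_avoids(2)[OF P(1), of t]
    have "\<forall>\<^sub>F u in at_right t. dist (\<sigma> u) (hi t) < \<epsilon> \<and> {t<..<u} \<inter> P = {} \<and> t < u \<and> u < min T (t + \<epsilon>)"
      by eventually_elim auto
    then obtain u where u: "dist (\<sigma> u) (hi t) < \<epsilon>" "{t<..<u} \<inter> P = {}" "t < u" "u < min T (t + \<epsilon>)"
      using eventually_happens'[OF trivial_limit_at_right_real] by blast
    have uT: "u \<in> {0..T}" using u t0 by auto
    have "V u - V t \<le> d (q t) (q u) + \<epsilon>" using P(2) u t0 by auto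
    moreover have "d (q t) (q u) \<le> \<sigma> u - hi t"
    proof -
      have "lo u \<le> \<sigma> u" "hi t < lo u" using lo_le_\<sigma>[OF uT] hi_less_lo[of t u] u t0 by auto
      then have "d (qq (hi t)) (qq (\<sigma> u)) \<le> \<sigma> u - hi t"
        using \<sigma>(1)[OF uT] hi_in(1)[OF tT] by (intro lip1(2)) auto
      then show ?thesis using Rr \<sigma>_inv(2)[OF uT] by simp
    qed
    ultimately have "\<sigma> u - \<sigma> t \<le> (u - t) + (\<sigma> u - hi t) + \<epsilon>" using \<sigma>_eq[OF tT] \<sigma>_eq[OF uT] by simp
    moreover have "u - t < \<epsilon>" using u(4) by simp
    moreover have "4 * \<epsilon> = hi t - \<sigma> t" by (simp add: \<epsilon>_def)
    ultimately show False using \<epsilon> by linarith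
  qed
  show ?thesis using left right lo_le_\<sigma>[OF tT] \<sigma>_le_hi[OF tT] by (auto simp: multi_def)
qed

lemma Jset_multi: "Jset T q = multi"
  using multi_jump Jset_subset by (auto simp: Cset_eq multi_def)

lemma z_eq: "s \<in> {0..S} \<Longrightarrow> tt s \<notin> multi \<Longrightarrow> z s = qq s"
  using z_C[of s] tt_range[of s] by (simp add: Cset_eq Jset_multi)

text \<open>The jump curve rescaled to its fibre, in the affine form of \<open>ac_curve_affine\<close>.\<close>

definition resc :: "real \<Rightarrow> real \<Rightarrow> 'q" where
  "resc t s = y t (1 / (hi t - lo t) * s + - lo t / (hi t - lo t))"

lemma jump_facts:
  assumes t: "t \<in> multi"
  shows "y t \<in> curves A (qq (lo t)) (qq (hi t))" "\<exists>\<theta>\<in>{0..1}. y t \<theta> = q t" "\<And>\<theta>. \<theta> \<in> {0..1} \<Longrightarrow> 1 \<le> sl t (y t \<theta>)"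
    "E t (qq (lo t)) - E t (qq (hi t)) = integral {0..1} (\<lambda>\<theta>. sl t (y t \<theta>) * speed A R (y t) \<theta>)"
  using jump[of t] t lim_q[OF multi_in[OF t]] unfolding Jset_multi jump_curve_def by auto

lemma coord: "1 / (b - a) * s + - a / (b - a) = (s - a) / (b - a)" for a b s :: real
  by (simp add: diff_divide_distrib)

lemma fibre_coord:
  assumes t: "t \<in> multi" and s: "s \<in> {lo t..hi t}"
  shows "1 / (hi t - lo t) * s + - lo t / (hi t - lo t) \<in> {0..1}"
    "s = (1 - (1 / (hi t - lo t) * s + - lo t / (hi t - lo t))) * lo t + (1 / (hi t - lo t) * s + - lo t / (hi t - lo t)) * hi t"
proof -
  have lh: "0 < hi t - lo t" using multi_less[OF t] by simp
  show "1 / (hi t - lo t) * s + - lo t / (hi t - lo t) \<in> {0..1}" unfolding coord using s lh by (auto simp: divide_le_eq)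
  define \<theta> where "\<theta> = (s - lo t) / (hi t - lo t)"
  have "\<theta> * (hi t - lo t) = s - lo t" using lh by (simp add: \<theta>_def)
  then show "s = (1 - (1 / (hi t - lo t) * s + - lo t / (hi t - lo t))) * lo t + (1 / (hi t - lo t) * s + - lo t / (hi t - lo t)) * hi t"
    unfolding coord \<theta>_def[symmetric] by (simp add: algebra_simps)
qed

lemma z_fibre: "t \<in> multi \<Longrightarrow> s \<in> {lo t..hi t} \<Longrightarrow> z s = resc t s"
proof -
  assume t: "t \<in> multi" and s: "s \<in> {lo t..hi t}"
  have s': "s \<in> {0..S}" "tt s = t" using fibre_sub[OF multi_in[OF t], of s] s by auto
  show ?thesis
    using z_J[OF s'(1) fibre_coord(1)[OF t s]] fibre_coord(2)[OF t s] t lim_\<sigma>[OF multi_in[OF t]] s'(2)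
    by (simp add: Jset_multi resc_def)
qed

lemma z_ends: "t \<in> {0..T} \<Longrightarrow> z (lo t) = qq (lo t)" "t \<in> {0..T} \<Longrightarrow> z (hi t) = qq (hi t)"
proof -
  assume t: "t \<in> {0..T}"
  have "z (lo t) = qq (lo t) \<and> z (hi t) = qq (hi t)"
  proof (cases "t \<in> multi")
    case True
    have lh: "lo t < hi t" by (rule multi_less[OF True])
    have "resc t (lo t) = y t 0" by (simp add: resc_def)
    moreover have "1 / (hi t - lo t) * hi t + - lo t / (hi t - lo t) = 1" unfolding coord using lh by simp
    then have "resc t (hi t) = y t 1" unfolding resc_def by (simp only:)
    ultimately show ?thesis using z_fibre[OF True, of "lo t"] z_fibre[OF True, of "hi t"] lh jump_facts(1)[OF True]
      by (auto simp: curves_def)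
  next
    case False
    then show ?thesis using z_eq[of "lo t"] z_eq[of "hi t"] lo_in[OF t] hi_in[OF t] by auto
  qed
  then show "z (lo t) = qq (lo t)" "z (hi t) = qq (hi t)" by auto
qed

lemma resc_ac: "t \<in> multi \<Longrightarrow> ac_curve A (lo t) (hi t) (resc t)"
proof -
  assume t: "t \<in> multi"
  have lh: "0 < hi t - lo t" using multi_less[OF t] by simp
  have e: "1 / (hi t - lo t) * lo t + - lo t / (hi t - lo t) = 0" "1 / (hi t - lo t) * hi t + - lo t / (hi t - lo t) = 1"
    unfolding coord using lh by simp_all
  show ?thesis unfolding resc_def[abs_def]
    by (rule ac_curve_affine) (use e lh jump_facts(1)[OF t] in \<open>simp_all add: curves_def\<close>)
qed

lemma z_fibre_ac: "t \<in> multi \<Longrightarrow> ac_curve A (lo t) (hi t) z"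
  by (rule ac_curve_cong[OF resc_ac]) (auto intro: z_fibre)

lemma spd_z_fibre: "t \<in> multi \<Longrightarrow> s \<in> {lo t<..<hi t} \<Longrightarrow> spd z s = spd (resc t) s"
  by (rule spd_cong_open[of "{lo t<..<hi t}"]) (auto intro: z_fibre)

lemma slope_z_fibre: "t \<in> multi \<Longrightarrow> s \<in> {lo t..hi t} \<Longrightarrow> 1 \<le> sl t (z s)"
  using jump_facts(3)[OF _ fibre_coord(1)] z_fibre by (simp add: resc_def)

abbreviation gz where "gz s \<equiv> sl (tt s) (z s) * spd z s"

lemma gz_fibre:
  assumes t: "t \<in> multi"
  shows "integral {lo t..hi t} gz = E t (qq (lo t)) - E t (qq (hi t))" "gz integrable_on {lo t..hi t}"
    "integral {lo t..hi t} (spd z) \<le> integral {lo t..hi t} gz"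
proof -
  have lh: "lo t < hi t" by (rule multi_less[OF t])
  have tT: "t \<in> {0..T}" by (rule multi_in[OF t])
  have unscale: "(\<lambda>\<theta>. resc t ((hi t - lo t) * \<theta> + lo t)) = y t"
  proof
    fix \<theta>
    have "1 / (hi t - lo t) * ((hi t - lo t) * \<theta> + lo t) + - lo t / (hi t - lo t) = \<theta>" unfolding coord using lh by simp
    then show "resc t ((hi t - lo t) * \<theta> + lo t) = y t \<theta>" unfolding resc_def by (simp only:)
  qed
  have "integral {0..1} (\<lambda>\<theta>. sl t (y t \<theta>) * speed A R (y t) \<theta>) = integral {lo t..hi t} (\<lambda>s. sl t (resc t s) * spd (resc t) s)"
    using slope_integral_affine[OF resc_ac[OF t] lh tT] unfolding unscale[THEN fun_cong] unscale .
  also have "\<dots> = integral {lo t..hi t} gz"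
  proof (rule integral_spike[of "{lo t, hi t}"])
    fix s assume s: "s \<in> {lo t..hi t} - {lo t, hi t}"
    then have "tt s = t" using fibre_sub[OF tT, of s] by auto
    then show "gz s = sl t (resc t s) * spd (resc t) s"
      using spd_z_fibre[OF t, of s] z_fibre[OF t, of s] s by simp
  qed simp
  finally show "integral {lo t..hi t} gz = E t (qq (lo t)) - E t (qq (hi t))" using jump_facts(4)[OF t] by simp
  have "continuous_on {lo t..hi t} tt" by (rule continuous_on_subset[OF tt_cont]) (use lo_in(1)[OF tT] hi_in(1)[OF tT] in auto)
  moreover have "tt ` {lo t..hi t} \<subseteq> {0..T}" using fibre_sub[OF tT] tT by auto
  ultimately show gi: "gz integrable_on {lo t..hi t}"
    by (intro slope_spd_integrable_on[OF z_fibre_ac[OF t]]) (use lh in auto)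
  show "integral {lo t..hi t} (spd z) \<le> integral {lo t..hi t} gz"
  proof (rule integral_le[OF spd_integrable[OF z_fibre_ac[OF t]] gi])
    fix s assume s: "s \<in> {lo t..hi t}"
    then have "tt s = t" using fibre_sub[OF tT, of s] by auto
    then show "spd z s \<le> gz s" using mult_right_mono[OF slope_z_fibre[OF t s] spd_nonneg[of z s]] by simp
  qed (use lh in auto)
qed

definition loss :: real where
  "loss = E 0 (q 0) - E T (q T) + integral {0..T} (\<lambda>t. dtE T E t (q t))"

definition diffuse :: ennreal where
  "diffuse = (\<integral>\<^sup>+r\<in>{0..T}. ennreal (sl r (q r)) \<partial>mu_co d T q)"

lemma Sigma0_le_loss: "0 \<le> loss" "Sigma0 A R E T q 0 T \<le> ennreal loss"
proof -
  let ?X = "E T (q T) - E 0 (q 0) - integral {0..T} (\<lambda>t. dtE T E t (q t))"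
  have "ereal ?X \<le> - enn2ereal (Sigma0 A R E T q 0 T)"
    using sol T_pos unfolding BV_solution_def by auto
  moreover have "?X = - loss" by (simp add: loss_def)
  ultimately have "- ereal loss \<le> - enn2ereal (Sigma0 A R E T q 0 T)" by simp
  then have le: "enn2ereal (Sigma0 A R E T q 0 T) \<le> ereal loss" unfolding ereal_minus_le_minus .
  moreover have "0 \<le> enn2ereal (Sigma0 A R E T q 0 T)" by simp
  ultimately have "0 \<le> ereal loss" by (rule order_trans[rotated])
  then show l0: "0 \<le> loss" by simp
  show "Sigma0 A R E T q 0 T \<le> ennreal loss"
    using le l0 by (simp add: less_eq_ennreal.rep_eq enn2ereal_ennreal)
qed

lemma jump_sum:
  assumes F: "finite F" "F \<subseteq> multi"
  shows "diffuse + ennreal (\<Sum>t\<in>F. integral {lo t..hi t} gz) \<le> ennreal loss"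
proof -
  let ?D = "\<lambda>t. ennreal (integral {lo t..hi t} gz)"
  let ?L = "\<lambda>t. ennreal (S0 A R E t (lim_left q t) (q t))" and ?R = "\<lambda>t. ennreal (S0 A R E t (q t) (lim_right T q t))"
  have D: "integral {lo t..hi t} gz \<le> S0 A R E t (lim_left q t) (q t) + S0 A R E t (q t) (lim_right T q t)"
    if t: "t \<in> multi" for t
    using E_diff_le_S0[OF multi_in[OF t], of "lim_left q t" "q t"] E_diff_le_S0[OF multi_in[OF t], of "q t" "lim_right T q t"]
      gz_fibre(1)[OF t] lim_q[OF multi_in[OF t]] by simp
  have D0: "0 \<le> integral {lo t..hi t} gz" if "t \<in> multi" for t
  proof (rule Henstock_Kurzweil_Integration.integral_nonneg[OF gz_fibre(2)[OF that]])
    fix s assume "s \<in> {lo t..hi t}"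
    then have "tt s = t" using fibre_sub[OF multi_in[OF that], of s] by auto
    then show "0 \<le> gz s" using slope_nonneg[OF multi_in[OF that]] spd_nonneg by simp
  qed
  have mid: "?D t \<le> ?L t + ?R t" if t: "t \<in> multi" for t
    using D[OF t] S0_nonneg[OF multi_in[OF t]] by (simp add: ennreal_leI flip: ennreal_plus)
  have left: "?D 0 \<le> ?R 0" if "0 \<in> multi"
  proof (rule ennreal_leI)
    have "lim_left q 0 = q 0" by (simp add: lim_left_def)
    then show "integral {lo 0..hi 0} gz \<le> S0 A R E 0 (q 0) (lim_right T q 0)"
      using E_diff_le_S0[OF multi_in[OF that], of "q 0" "lim_right T q 0"] gz_fibre(1)[OF that] lim_q[OF multi_in[OF that]] by simp
  qed
  have right: "?D T \<le> ?L T" if "T \<in> multi"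
  proof (rule ennreal_leI)
    have "lim_right T q T = q T" by (simp add: lim_right_def)
    then show "integral {lo T..hi T} gz \<le> S0 A R E T (lim_left q T) (q T)"
      using E_diff_le_S0[OF multi_in[OF that], of "lim_left q T" "q T"] gz_fibre(1)[OF that] lim_q[OF multi_in[OF that]] by simp
  qed
  define F' where "F' = F - {0, T}"
  have F': "finite F'" "F' \<subseteq> Jset T q \<inter> {0<..<T}" "0 \<notin> F'" "T \<notin> F'" "F' \<subseteq> multi"
    using F multi_in by (auto simp: F'_def Jset_multi less_le)
  have "(\<Sum>t\<in>F'. ?D t) \<le> (\<Sum>t\<in>F'. ?L t + ?R t)" by (rule sum_mono) (use F' mid in auto)
  also have "\<dots> \<le> infsum (\<lambda>t. ?L t + ?R t) (Jset T q \<inter> {0<..<T})" by (rule sum_le_infsum_ennreal[OF F'(1,2)])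
  finally have s1: "(\<Sum>t\<in>F'. ?D t) \<le> infsum (\<lambda>t. ?L t + ?R t) (Jset T q \<inter> {0<..<T})" .
  have s0: "(\<Sum>t\<in>F \<inter> {0}. ?D t) \<le> ?R 0"
    by (cases "0 \<in> F") (use left F in \<open>auto simp: Int_insert_right\<close>)
  have sT: "(\<Sum>t\<in>F \<inter> {T}. ?D t) \<le> ?L T"
    by (cases "T \<in> F") (use right F in \<open>auto simp: Int_insert_right\<close>)
  have "F = (F' \<union> (F \<inter> {0})) \<union> (F \<inter> {T})" by (auto simp: F'_def)
  then have "(\<Sum>t\<in>F. ?D t) = sum ?D ((F' \<union> (F \<inter> {0})) \<union> (F \<inter> {T}))" by simp
  also have "\<dots> = sum ?D F' + sum ?D (F \<inter> {0}) + sum ?D (F \<inter> {T})"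
    using F' F T_pos by (subst sum.union_disjoint sum.union_disjoint; auto)+
  finally have "diffuse + (\<Sum>t\<in>F. ?D t) = diffuse + sum ?D (F \<inter> {0}) + sum ?D (F \<inter> {T}) + sum ?D F'" by (simp add: ac_simps)
  also have "\<dots> \<le> Sigma0 A R E T q 0 T"
    unfolding Sigma0_def diffuse_def by (intro add_mono order_refl s0 s1 sT)
  also have "\<dots> \<le> ennreal loss" by (rule Sigma0_le_loss)
  also have "(\<Sum>t\<in>F. ?D t) = ennreal (\<Sum>t\<in>F. integral {lo t..hi t} gz)"
    by (rule sum_ennreal) (use D0 F in auto)
  finally show ?thesis .
qed

lemma flats_gz:
  shows "(\<lambda>s. if s \<in> flats then gz s else 0) integrable_on {0..S}"
    and "diffuse + ennreal (integral {0..S} (\<lambda>s. if s \<in> flats then gz s else 0)) \<le> ennreal loss"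
    and "(\<lambda>s. if s \<in> flats then spd z s else 0) integrable_on {0..S}"
proof -
  have "diffuse \<le> ennreal loss" using jump_sum[of "{}"] by simp
  then obtain c where c: "0 \<le> c" "diffuse = ennreal c" by (cases diffuse) (auto simp: top_unique)
  have B: "(\<Sum>t\<in>F. integral {lo t..hi t} gz) \<le> loss - c" if F: "finite F" "F \<subseteq> multi" for F
  proof (cases "0 \<le> (\<Sum>t\<in>F. integral {lo t..hi t} gz)")
    case True
    then show ?thesis using jump_sum[OF F] c Sigma0_le_loss(1) by (simp add: flip: ennreal_plus)
  next
    case False
    then show ?thesis using jump_sum[of "{}"] c Sigma0_le_loss(1) by simp
  qed
  have gz0: "0 \<le> gz s" if "s \<in> {0..S}" for s using slope_nonneg[OF tt_range[OF that]] spd_nonneg by simp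
  note G = flats_integral[OF gz_fibre(2) gz0 B]
  show "(\<lambda>s. if s \<in> flats then gz s else 0) integrable_on {0..S}" by (rule G(1))
  have "0 \<le> integral {0..S} (\<lambda>s. if s \<in> flats then gz s else 0)"
    by (rule Henstock_Kurzweil_Integration.integral_nonneg[OF G(1)]) (use gz0 in auto)
  then show "diffuse + ennreal (integral {0..S} (\<lambda>s. if s \<in> flats then gz s else 0)) \<le> ennreal loss"
    using G(2) c by (auto simp: ennreal_leI simp flip: ennreal_plus)
  show "(\<lambda>s. if s \<in> flats then spd z s else 0) integrable_on {0..S}"
  proof (rule flats_integral(1))
    show "spd z integrable_on {lo t..hi t}" if "t \<in> multi" for t
      by (rule spd_integrable[OF z_fibre_ac[OF that]]) (use multi_less[OF that] in auto)
    show "(\<Sum>t\<in>F. integral {lo t..hi t} (spd z)) \<le> loss - c" if F: "finite F" "F \<subseteq> multi" for F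
      by (rule order_trans[OF sum_mono B[OF F]]) (use gz_fibre(3) F in auto)
  qed (rule spd_nonneg)
qed

lemma z_ac: "ac_curve A 0 S z"
proof (rule dominated_imp_ac_curve, rule dominatedI)
  define h where "h s = 1 + (if s \<in> flats then spd z s else 0)" for s
  show "0 \<le> h s" for s using spd_nonneg[of z s] by (simp add: h_def)
  show hi: "h integrable_on {0..S}" unfolding h_def[abs_def] by (intro integrable_add flats_gz(3) integrable_const_ivl)
  have hI: "h integrable_on {l..r}" if "0 \<le> l" "r \<le> S" for l r
    by (rule integrable_on_subinterval[OF hi]) (use that in auto)
  have on_fibre: "d (z l) (z r) \<le> integral {l..r} h" if t: "t \<in> multi" and lr: "lo t \<le> l" "l \<le> r" "r \<le> hi t" for t l r
  proof -
    have "0 \<le> l" "r \<le> S" using lr lo_in(1)[OF multi_in[OF t]] hi_in(1)[OF multi_in[OF t]] by auto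
    have "d (z l) (z r) \<le> integral {l..r} (spd z)"
      by (rule fdist_le_integral[OF ac_curve_subinterval[OF z_fibre_ac[OF t]] lr(2)]) (use lr in auto)
    also have "\<dots> \<le> integral {l..r} h"
    proof (rule integral_le_negligible[where N="{lo t, hi t}"])
      fix s assume s: "s \<in> {l..r} - {lo t, hi t}"
      then have "s \<in> flats" using t lr by (auto simp: flats_def intro!: bexI[of _ t])
      then show "spd z s \<le> h s" by (simp add: h_def)
    qed (use spd_integrable[OF z_fibre_ac[OF t]] lr hI[OF \<open>0 \<le> l\<close> \<open>r \<le> S\<close>] in auto)
    finally show ?thesis .
  qed
  have on_qq: "d (qq l) (qq r) \<le> integral {l..r} h" if lr: "0 \<le> l" "l \<le> r" "r \<le> S" for l r
  proof -
    have "d (qq l) (qq r) \<le> r - l" by (rule lip1(2)[OF lr])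
    also have "r - l = integral {l..r} (\<lambda>s. 1)" using lr by simp
    also have "\<dots> \<le> integral {l..r} h"
      by (rule integral_le[OF _ hI]) (use lr spd_nonneg in \<open>auto simp: h_def\<close>)
    finally show ?thesis .
  qed
  have comb: "integral {l..c} h + integral {c..r} h = integral {l..r} h" if "0 \<le> l" "l \<le> c" "c \<le> r" "r \<le> S" for l c r
    by (rule Henstock_Kurzweil_Integration.integral_combine) (use that hI in auto)
  fix l r assume lr: "0 \<le> l" "l \<le> r" "r \<le> S"
  then have lT: "tt l \<in> {0..T}" "tt r \<in> {0..T}" and lS: "l \<in> {0..S}" "r \<in> {0..S}" using tt_range by auto
  note El = tt_eq_iff[OF lT(1) lS(1)] and Er = tt_eq_iff[OF lT(2) lS(2)]
  show "d (z l) (z r) \<le> integral {l..r} h"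
  proof (cases "tt l = tt r")
    case True
    show ?thesis
    proof (cases "tt l \<in> multi")
      case True': True
      show ?thesis by (rule on_fibre[OF True']) (use El Er True lr in auto)
    next
      case False
      have "l = \<sigma> (tt l)" by (rule \<sigma>_tt[OF lS(1) False, symmetric])
      also have "\<dots> = r" unfolding True by (rule \<sigma>_tt[OF lS(2)]) (use False in \<open>simp add: True\<close>)
      finally have "l = r" .
      then show ?thesis by (simp add: fdist_self)
    qed
  next
    case False
    then have less: "tt l < tt r" using tt_le[OF lr] by simp
    have ord: "l \<le> hi (tt l)" "hi (tt l) \<le> lo (tt r)" "lo (tt r) \<le> r"
      using El Er hi_less_lo[of "tt l" "tt r"] less lT by auto
    have a: "d (z l) (z (hi (tt l))) \<le> integral {l..hi (tt l)} h"
    proof (cases "tt l \<in> multi")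
      case True then show ?thesis by (rule on_fibre) (use El ord in auto)
    next
      case F: False
      then have "hi (tt l) = l" using \<sigma>_tt[OF lS(1)] not_multi[OF lT(1)] by simp
      then show ?thesis by (simp add: fdist_self)
    qed
    have b: "d (z (lo (tt r))) (z r) \<le> integral {lo (tt r)..r} h"
    proof (cases "tt r \<in> multi")
      case True then show ?thesis by (rule on_fibre) (use Er ord in auto)
    next
      case F: False
      then have "lo (tt r) = r" using \<sigma>_tt[OF lS(2)] not_multi[OF lT(2)] by simp
      then show ?thesis by (simp add: fdist_self)
    qed
    have c: "d (z (hi (tt l))) (z (lo (tt r))) \<le> integral {hi (tt l)..lo (tt r)} h"
      unfolding z_ends(2)[OF lT(1)] z_ends(1)[OF lT(2)] by (rule on_qq) (use ord lr in auto)
    have "d (z l) (z r) \<le> d (z l) (z (hi (tt l))) + (d (z (hi (tt l))) (z (lo (tt r))) + d (z (lo (tt r))) (z r))"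
      using fdist_triangle[of "z l" "z r" "z (hi (tt l))"] fdist_triangle[of "z (hi (tt l))" "z r" "z (lo (tt r))"] by linarith
    also have "\<dots> \<le> integral {l..hi (tt l)} h + (integral {hi (tt l)..lo (tt r)} h + integral {lo (tt r)..r} h)"
      by (intro add_mono a b c)
    also have "\<dots> = integral {l..r} h"
      using comb[of "hi (tt l)" "lo (tt r)" r] comb[of l "hi (tt l)" r] ord lr by simp
    finally show ?thesis .
  qed
qed

definition \<sigma>' :: "real \<Rightarrow> real" where
  "\<sigma>' t = (if t = 0 then 0 else if t = T then S else SOME s. s \<in> {0..S} \<and> tt s = t \<and> z s = q t)"

lemma \<sigma>':
  assumes t: "t \<in> {0..T}"
  shows "\<sigma>' t \<in> {0..S}" "tt (\<sigma>' t) = t" "z (\<sigma>' t) = q t"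
proof -
  have "\<sigma>' t \<in> {0..S} \<and> tt (\<sigma>' t) = t \<and> z (\<sigma>' t) = q t"
  proof -
    consider "t = 0" | "t = T" "t \<noteq> 0" | "t \<noteq> 0" "t \<noteq> T" by blast
    then show ?thesis
    proof cases
      case 1
      then show ?thesis using z_ends(1)[OF t] \<sigma>_inv(2)[OF t] \<sigma>_zero lo_0 tt_s0 s01 by (simp add: \<sigma>'_def)
    next
      case 2
      then show ?thesis using z_ends(2)[OF t] \<sigma>_inv(2)[OF t] hi_T tt_s1 s01 \<sigma>_T by (simp add: \<sigma>'_def)
    next
      case 3
      have "\<exists>s. s \<in> {0..S} \<and> tt s = t \<and> z s = q t"
      proof (cases "t \<in> multi")
        case True
        then obtain \<theta> where \<theta>: "\<theta> \<in> {0..1}" "y t \<theta> = q t" using jump_facts(2) by blast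
        have lh: "lo t < hi t" by (rule multi_less[OF True])
        define s where "s = (hi t - lo t) * \<theta> + lo t"
        have "(hi t - lo t) * \<theta> \<le> hi t - lo t" using \<theta> lh mult_left_le[of \<theta> "hi t - lo t"] by auto
        moreover have "0 \<le> (hi t - lo t) * \<theta>" using \<theta> lh by auto
        ultimately have s: "s \<in> {lo t..hi t}" by (simp add: s_def)
        have "1 / (hi t - lo t) * s + - lo t / (hi t - lo t) = \<theta>" unfolding coord using lh by (simp add: s_def)
        then have "resc t s = q t" using \<theta>(2) unfolding resc_def by (simp only:)
        then show ?thesis using z_fibre[OF True s] fibre_sub[OF t, of s] s by auto
      next
        case False
        then show ?thesis using z_eq[of "\<sigma> t"] \<sigma>[OF t] \<sigma>_inv(2)[OF t] by auto
      qed
      then have "(\<lambda>s. s \<in> {0..S} \<and> tt s = t \<and> z s = q t) (\<sigma>' t)"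
        unfolding \<sigma>'_def using 3 by (simp only: if_False) (rule someI_ex)
      then show ?thesis .
    qed
  qed
  then show "\<sigma>' t \<in> {0..S}" "tt (\<sigma>' t) = t" "z (\<sigma>' t) = q t" by auto
qed

sublocale Z: param_curve_J A R E T tt \<sigma>' 0 S z q
proof unfold_locales
  show "ac_curve A 0 S z" by (rule z_ac)
  show "\<sigma>' 0 = 0" "\<sigma>' T = S" using T_pos by (simp_all add: \<sigma>'_def)
  show "Jset T q = time_change.multi tt 0 S T" by (rule Jset_multi)
qed (use \<sigma>' tt_ac T_pos s01 tt_cont tt_mono tt_s0 tt_s1 in auto)

end

lemma negligible_affine_vimage:
  fixes m k :: real
  assumes "negligible N" "m \<noteq> 0"
  shows "negligible {s. m * s + k \<in> N}"
proof -
  have "negligible ((\<lambda>x. (x - k) / m) ` N)"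
    by (rule negligible_differentiable_image_negligible[OF order_refl assms(1)])
       (use assms(2) in \<open>auto simp: differentiable_on_def\<close>)
  moreover have "{s. m * s + k \<in> N} \<subseteq> (\<lambda>x. (x - k) / m) ` N"
    using assms(2) by (force intro: image_eqI[of _ _ "m * _ + k"])
  ultimately show ?thesis by (rule negligible_subset)
qed

lemma emeasure_Compl_msupport:
  fixes M :: "real measure"
  assumes M: "sets M = sets borel"
  shows "open (- msupport M)" "emeasure M (- msupport M) = 0"
proof -
  define F where "F = {U. open U \<and> emeasure M U = 0}"
  have eq: "- msupport M = \<Union>F" by (auto simp: msupport_def F_def not_gr_zero)
  have F: "open U" if "U \<in> F" for U using that by (simp add: F_def)
  then show "open (- msupport M)" unfolding eq by (rule open_Union[rule_format])
  obtain F' where F': "F' \<subseteq> F" "countable F'" "\<Union>F' = \<Union>F" using Lindelof[of F] F by metis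
  have "(\<Union>U\<in>F'. U) \<in> null_sets M"
    by (rule null_sets_UN'[OF F'(2)]) (use F'(1) M in \<open>auto simp: F_def null_sets_def\<close>)
  then show "emeasure M (- msupport M) = 0" unfolding eq F'(3)[symmetric] by (simp add: null_sets_def)
qed

context bv_param
begin

lemma tt_deriv_bounds:
  "\<exists>N. negligible N \<and> (\<forall>s\<in>{0<..<S} - N. isCont z s \<and> regular z s \<and> (tt has_real_derivative deriv tt s) (at s) \<and>
      0 \<le> deriv tt s \<and> deriv tt s \<le> 1)"
proof -
  obtain N where N: "negligible N" "\<forall>s\<in>{0<..<S} - N. regular z s \<and> (tt has_real_derivative deriv tt s) (at s) \<and> 0 \<le> deriv tt s"
    using Z.a_e_facts by blast
  have "isCont z s \<and> deriv tt s \<le> 1" if s: "s \<in> {0<..<S} - N" for s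
  proof
    show "isCont z s"
      using continuous_on_interior[OF Z.Q_cont, of s] s by simp
    have D: "(tt has_real_derivative deriv tt s) (at s)" using N(2) s by blast
    then have "(tt has_vector_derivative deriv tt s) (at s)" by (simp add: has_real_derivative_iff_has_vector_derivative)
    then have lim: "((\<lambda>r. (1 / (r - s)) *\<^sub>R (tt r - tt s)) \<longlongrightarrow> deriv tt s) (at_right s)"
      by (intro tendsto_within_subset[OF has_vector_derivative_quotient]) auto
    have "s < S" using s by simp
    from eventually_at_right_in[OF this]
    have "\<forall>\<^sub>F r in at_right s. (1 / (r - s)) *\<^sub>R (tt r - tt s) \<le> 1"
    proof eventually_elim
      case (elim r)
      then show ?case using lip1(1)[of s r] s by (simp add: divide_le_eq)
    qed
    then show "deriv tt s \<le> 1" by (rule tendsto_upperbound[OF lim _ trivial_limit_at_right_real])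
  qed
  then show ?thesis using N by (intro exI[of _ N]) blast
qed

definition \<kappa> :: "real \<Rightarrow> real" where "\<kappa> s = max 0 (1 - deriv tt s)"

lemma \<kappa>_nonneg: "0 \<le> \<kappa> s"
  by (simp add: \<kappa>_def)

lemma \<kappa>_integral:
  assumes "0 \<le> l" "l \<le> r" "r \<le> S"
  shows "(\<kappa> has_integral (r - l - (tt r - tt l))) {l..r}"
proof -
  obtain N where N: "negligible N" "\<forall>s\<in>{0<..<S} - N. 0 \<le> deriv tt s \<and> deriv tt s \<le> 1" using tt_deriv_bounds by blast
  have "((\<lambda>s. 1 - \<tau> s) has_integral ((r - l) - (tt r - tt l))) {l..r}"
    using has_integral_const_real[of "1::real" l r] assms by (intro has_integral_diff \<tau>_integral) auto
  moreover have "negligible (N \<union> {0, S})" using N by (intro negligible_Un) auto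
  moreover have "\<kappa> s = 1 - \<tau> s" if "s \<in> {l..r} - (N \<union> {0, S})" for s
  proof -
    have "s \<in> {0<..<S} - N" using that assms by auto
    then have "0 \<le> deriv tt s \<and> deriv tt s \<le> 1" using N by blast
    then show ?thesis by (simp add: \<kappa>_def \<tau>_def)
  qed
  ultimately show ?thesis by (intro has_integral_spike[of "N \<union> {0, S}" _ \<kappa> "\<lambda>s. 1 - \<tau> s"])
qed

lemma \<kappa>_integrable: "\<kappa> integrable_on {0..S}"
  using \<kappa>_integral[of 0 S] s01 by (auto intro: has_integral_integrable)

text \<open>In the parametrization by \<open>t + V\<close>, the density \<open>1 - tt'\<close> is carried by \<open>V\<close>.\<close>

lemma push_\<kappa>_le_mu: "push \<kappa> \<le> mu d T q"
  unfolding mu_eq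
proof (rule borel_measure_leI_Ioc)
  show "finite_measure (interval_measure (right_mod T V))" by (rule finite_measure_right_mod[OF V_mono V_0 T_pos])
  show "finite_measure (push \<kappa>)" by (rule finite_measure_push[OF \<kappa>_nonneg \<kappa>_integrable])
  show "sets (push \<kappa>) = sets borel" by (rule push_sets[OF \<kappa>_nonneg \<kappa>_integrable])
  fix a b :: real assume ab: "a \<le> b"
  define U where "U t = integral {0..\<sigma> t} \<kappa>" for t
  note P = push_Ioc[OF \<kappa>_nonneg \<kappa>_integrable ab, folded U_def]
  have U': "(\<lambda>t. integral {0..\<sigma> t} \<kappa>) = U" by (simp add: U_def[abs_def])
  have U_V: "U t = V t" if "t \<in> {0..T}" for t
    using integral_unique[OF \<kappa>_integral[of 0 "\<sigma> t"]] \<sigma>[OF that] \<sigma>_eq[OF that] tt_s0 by (simp add: U_def)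
  show "emeasure (push \<kappa>) {a<..b} \<le> emeasure (interval_measure (right_mod T V)) {a<..b}"
    unfolding emeasure_right_mod_Ioc[OF V_mono V_0 T_pos ab] P(1)[unfolded U']
    by (rule ennreal_leI[OF right_mod_increments[OF _ _ V_mono V_0 T_pos _ ab]])
       (use P(2,3) U' U_V in auto)
qed simp

lemma spd_le_\<kappa>:
  "\<exists>N. negligible N \<and> (\<forall>s\<in>{0..S} - N. tt s \<notin> multi \<longrightarrow> spd z s \<le> \<kappa> s)"
proof -
  obtain N where N: "negligible N" "\<forall>s\<in>{0<..<S} - N. isCont z s \<and> regular z s \<and> (tt has_real_derivative deriv tt s) (at s)"
    using tt_deriv_bounds by blast
  define P where "P = {s\<in>{0..S}. tt s \<notin> multi}"
  let ?N = "N \<union> {s\<in>P. \<not> s islimpt P} \<union> {0, S}"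
  have "spd z s \<le> \<kappa> s" if s: "s \<in> {0..S} - ?N" and nm: "tt s \<notin> multi" for s
  proof -
    have sP: "s \<in> P" "s islimpt P" "s \<in> {0<..<S} - N" using s nm by (auto simp: P_def)
    then have cont: "isCont z s" and reg: "regular z s" and D: "(tt has_real_derivative deriv tt s) (at s)" using N by blast+
    have "((\<lambda>r. 1 - (1 / (r - s)) *\<^sub>R (tt r - tt s)) \<longlongrightarrow> 1 - deriv tt s) (at s within P)"
      by (intro tendsto_diff tendsto_const tendsto_within_subset[OF has_vector_derivative_quotient])
         (use D in \<open>auto simp: has_real_derivative_iff_has_vector_derivative\<close>)
    note lim = this
    have "speed A R z s \<le> 1 - deriv tt s"
    proof (rule speed_le_metric_derivative[OF reg cont _ lim])
      show "at s within P \<noteq> bot" using sP(2) trivial_limit_within by blast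
      show "\<forall>\<^sub>F r in at s within P. d (z s) (z r) \<le> (1 - (1 / (r - s)) *\<^sub>R (tt r - tt s)) * \<bar>r - s\<bar>"
        unfolding eventually_at_filter
      proof (rule eventuallyI, intro impI)
        fix r assume r: "r \<noteq> s" "r \<in> P"
        have rS: "r \<in> {0..S}" "s \<in> {0..S}" using r sP by (auto simp: P_def)
        have "z s = qq s" "z r = qq r" using r sP z_eq by (auto simp: P_def)
        then have "d (z s) (z r) \<le> \<bar>r - s\<bar> - \<bar>tt r - tt s\<bar>"
          using lip[OF rS(2,1)] by (simp add: abs_minus_commute)
        also have "\<bar>tt r - tt s\<bar> = (1 / (r - s)) *\<^sub>R (tt r - tt s) * \<bar>r - s\<bar>"
        proof (cases "s < r")
          case True
          then show ?thesis using tt_le[of s r] rS by simp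
        next
          case False
          then show ?thesis using tt_le[of r s] rS r(1) by (simp add: field_simps)
        qed
        finally show "d (z s) (z r) \<le> (1 - (1 / (r - s)) *\<^sub>R (tt r - tt s)) * \<bar>r - s\<bar>" by (simp add: left_diff_distrib)
      qed
    qed
    then show ?thesis using reg by (simp add: \<kappa>_def spd_def)
  qed
  moreover have "negligible ?N"
    using N(1) negligible_countable[OF countable_isolated_points[of P]] by (intro negligible_Un) auto
  ultimately show ?thesis by blast
qed

lemma integral_g_le_loss: "integral {0..S} Z.g \<le> loss"
proof -
  define P where "P = {s\<in>{0..S}. tt s \<in> Cset T q \<inter> {0..T}}"
  define K where "K = lo ` multi \<union> hi ` multi"
  have Z_g: "Z.g = gz" by (auto simp: Z.g_def Z.\<xi>_def)
  have P: "P \<in> sets lebesgue" unfolding P_def by (rule Z.C_part_sets)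
  have "open flats" unfolding flats_def by (intro open_UN) auto
  then have fl: "flats \<in> sets lebesgue" "flats \<subseteq> {0..S}"
    using flats_iff by (auto intro!: sets_completionI_sets)
  have negK: "negligible (K \<inter> {0..S})" using countable_multi by (intro negligible_countable) (auto simp: K_def)
  then have K: "K \<inter> {0..S} \<in> sets lebesgue" by (rule negligible_imp_sets)
  have "emeasure Z.\<nu> {0..S} \<le> emeasure Z.\<nu> (P \<union> (flats \<union> K \<inter> {0..S}))"
  proof (rule emeasure_mono)
    show "{0..S} \<subseteq> P \<union> (flats \<union> K \<inter> {0..S})"
    proof
      fix s assume s: "s \<in> {0..S}"
      have "s \<in> flats \<union> K \<inter> {0..S}" if m: "tt s \<in> multi"
      proof -
        have "lo (tt s) \<le> s" "s \<le> hi (tt s)" using tt_eq_iff[OF tt_range[OF s] s] by auto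
        then consider "s \<in> flats" | "s = lo (tt s)" | "s = hi (tt s)" using m s flats_iff[of s] by force
        then show ?thesis using m s by cases (auto simp: K_def)
      qed
      then show "s \<in> P \<union> (flats \<union> K \<inter> {0..S})" using s tt_range[OF s] by (auto simp: P_def Cset_eq Jset_multi)
    qed
  qed (use P fl K in \<open>auto simp: Z.\<nu>_sets\<close>)
  also have "\<dots> \<le> emeasure Z.\<nu> P + emeasure Z.\<nu> (flats \<union> K \<inter> {0..S})"
    by (rule emeasure_subadditive) (use P fl K in \<open>auto simp: Z.\<nu>_sets\<close>)
  also have "emeasure Z.\<nu> (flats \<union> K \<inter> {0..S}) = ennreal (integral {0..S} (\<lambda>s. if s \<in> flats then gz s else 0))"
  proof -
    have "emeasure Z.\<nu> (flats \<union> K \<inter> {0..S}) = (\<integral>\<^sup>+s. ennreal (gz s) * indicator (flats \<union> K \<inter> {0..S}) s \<partial>lebesgue)"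
      using fl K by (subst Z.emeasure_\<nu>) (auto simp: Z_g)
    also have "\<dots> = (\<integral>\<^sup>+s. ennreal (if s \<in> flats then gz s else 0) * indicator {0..S} s \<partial>lebesgue)"
    proof (rule nn_integral_cong_AE, unfold AE_lebesgue_iff_negligible, intro exI conjI allI impI)
      show "negligible (K \<inter> {0..S})" by (rule negK)
      fix s assume "s \<notin> K \<inter> {0..S}"
      then show "ennreal (gz s) * indicator (flats \<union> K \<inter> {0..S}) s = ennreal (if s \<in> flats then gz s else 0) * indicator {0..S} s"
        using fl(2) by (auto simp: indicator_def)
    qed
    also have "\<dots> = ennreal (integral {0..S} (\<lambda>s. if s \<in> flats then gz s else 0))"
      by (rule nn_integral_lebesgue_eq_integral[OF _ flats_gz(1)])
         (use slope_nonneg[OF tt_range] spd_nonneg in auto)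
    finally show ?thesis .
  qed
  also have "emeasure Z.\<nu> P \<le> diffuse"
  proof -
    obtain N where N: "negligible N" "\<forall>s\<in>{0..S} - N. tt s \<notin> multi \<longrightarrow> spd z s \<le> \<kappa> s" using spd_le_\<kappa> by blast
    have "emeasure Z.\<nu> P = (\<integral>\<^sup>+s. ennreal (Z.g s) * indicator P s \<partial>lebesgue)"
      by (rule Z.emeasure_\<nu>[OF P]) (auto simp: P_def)
    also have "\<dots> \<le> (\<integral>\<^sup>+s. ennreal (Z.\<xi> s * \<kappa> s) * indicator P s \<partial>lebesgue)"
    proof (rule nn_integral_mono_AE, unfold AE_lebesgue_iff_negligible, intro exI conjI allI impI)
      show "negligible N" by (rule N(1))
      fix s assume s: "s \<notin> N"
      show "ennreal (Z.g s) * indicator P s \<le> ennreal (Z.\<xi> s * \<kappa> s) * indicator P s"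
      proof (cases "s \<in> P")
        case True
        then have "s \<in> {0..S} - N" "tt s \<notin> multi" using s by (auto simp: P_def Cset_eq Jset_multi)
        then have "spd z s \<le> \<kappa> s" "0 \<le> Z.\<xi> s" using N(2) Z.\<xi>_nonneg[of s] by auto
        then have "Z.g s \<le> Z.\<xi> s * \<kappa> s" unfolding Z.g_def by (rule mult_left_mono)
        then show ?thesis by (intro mult_right_mono ennreal_leI) auto
      qed simp
    qed
    also have "\<dots> = (\<integral>\<^sup>+r. indicator (Cset T q) r * (ennreal (sl r (q r)) * indicator {0..T} r) \<partial>push \<kappa>)"
      unfolding P_def by (rule Z.slope_integral_push[symmetric, OF \<kappa>_nonneg \<kappa>_integrable]) auto
    also have "\<dots> \<le> (\<integral>\<^sup>+r. indicator (Cset T q) r * (ennreal (sl r (q r)) * indicator {0..T} r) \<partial>mu d T q)"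
      by (rule nn_integral_mono_measure[OF _ push_\<kappa>_le_mu]) (simp add: mu_def push_sets[OF \<kappa>_nonneg \<kappa>_integrable])
    also have "\<dots> = diffuse"
      unfolding diffuse_def mu_co_def
      by (rule nn_integral_density[symmetric]) (use Cset_borel slope_q_borel[of 0 T] in \<open>auto simp: mu_def\<close>)
    finally show ?thesis .
  qed
  finally have "emeasure Z.\<nu> {0..S} \<le> diffuse + ennreal (integral {0..S} (\<lambda>s. if s \<in> flats then gz s else 0))"
    by (simp add: add_right_mono)
  also have "\<dots> \<le> ennreal loss" by (rule flats_gz(2))
  finally have "ennreal (integral {0..S} Z.g) \<le> ennreal loss" using Z.emeasure_\<nu>_interval(1)[of 0 S] s01 by simp
  then show ?thesis using Sigma0_le_loss(1) by (simp add: ennreal_le_iff)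
qed

lemma dissipation_equality:
  "\<exists>N. negligible N \<and> (\<forall>s\<in>{0<..<S} - N. deriv Z.\<psi> s - Z.p s * deriv tt s = - Z.g s)"
proof -
  define \<omega> where "\<omega> s = deriv Z.\<psi> s - Z.p s * \<tau> s + Z.g s" for s
  obtain N where N: "negligible N" "\<forall>s\<in>{0<..<S} - N. 0 \<le> deriv tt s \<and> \<bar>deriv Z.\<psi> s - Z.p s * deriv tt s\<bar> \<le> Z.g s"
    using Z.a_e_facts by blast
  have \<omega>0: "0 \<le> \<omega> s" "\<tau> s = deriv tt s" if "s \<in> {0<..<S} - N" for s
    using N(2)[THEN bspec, OF that] by (auto simp: \<omega>_def \<tau>_def)
  have pint: "(\<lambda>s. Z.p s * \<tau> s) integrable_on {0..S}"
      "integral {0..T} (\<lambda>t. dtE T E t (q t)) = integral {0..S} (\<lambda>s. Z.p s * \<tau> s)"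
    using Z.p_q_integral[of 0 T] T_pos Z.\<sigma>_0 Z.\<sigma>_T by (auto simp: Z.\<tau>_def[abs_def] \<tau>_def[abs_def])
  have I: "(\<omega> has_integral (Z.\<psi> S - Z.\<psi> 0 - integral {0..S} (\<lambda>s. Z.p s * \<tau> s) + integral {0..S} Z.g)) {0..S}"
    unfolding \<omega>_def[abs_def]
    by (intro has_integral_add has_integral_diff Z.\<psi>_integral integrable_integral pint(1) Z.g_integrable) (use s01 in auto)
  have neg: "negligible (N \<union> {0, S})" using N by (intro negligible_Un) auto
  have I': "((\<lambda>s. max 0 (\<omega> s)) has_integral (Z.\<psi> S - Z.\<psi> 0 - integral {0..S} (\<lambda>s. Z.p s * \<tau> s) + integral {0..S} Z.g)) {0..S}"
    by (rule has_integral_spike[OF neg _ I]) (use \<omega>0(1) in auto)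
  have "Z.\<psi> S = E T (q T)" "Z.\<psi> 0 = E 0 (q 0)"
    using \<sigma>'(3)[of 0] \<sigma>'(3)[of T] T_pos tt_s0 tt_s1 by (auto simp: Z.\<psi>_def \<sigma>'_def)
  then have "integral {0..S} (\<lambda>s. max 0 (\<omega> s)) \<le> 0"
    using integral_unique[OF I'] integral_g_le_loss pint(2) by (simp add: loss_def)
  moreover have "0 \<le> integral {0..S} (\<lambda>s. max 0 (\<omega> s))"
    by (rule Henstock_Kurzweil_Integration.integral_nonneg) (use I' in auto)
  ultimately have "integral {0..S} (\<lambda>s. max 0 (\<omega> s)) = 0" by simp
  then obtain N' where N': "negligible N'" "\<forall>s\<in>{0<..<S} - N'. max 0 (\<omega> s) = 0"
    using integral_eq_0_imp_negligible[OF has_integral_integrable[OF I']] by force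
  have "deriv Z.\<psi> s - Z.p s * deriv tt s = - Z.g s" if s: "s \<in> {0<..<S} - (N \<union> N')" for s
  proof -
    have "\<omega> s = 0" using \<omega>0(1)[of s] N'(2)[THEN bspec, of s] s by auto
    then show ?thesis using \<omega>0(2)[of s] s by (simp add: \<omega>_def)
  qed
  moreover have "negligible (N \<union> N')" using N N' by (intro negligible_Un)
  ultimately show ?thesis by blast
qed

lemma stationary_off_support:
  "\<exists>N. negligible N \<and> (\<forall>s\<in>{0..S} - N. tt s \<notin> msupport (mu d T q) \<longrightarrow> \<kappa> s = 0)"
proof -
  let ?O = "- msupport (mu d T q)"
  have O: "open ?O" "emeasure (mu d T q) ?O = 0" using emeasure_Compl_msupport[of "mu d T q"] by (simp_all add: mu_def)
  have "emeasure (push \<kappa>) ?O \<le> emeasure (mu d T q) ?O"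
    using push_\<kappa>_le_mu le_measure[of "push \<kappa>" "mu d T q"] O(1) by (simp add: mu_def push_sets[OF \<kappa>_nonneg \<kappa>_integrable])
  then have "(\<integral>\<^sup>+s. ennreal (\<kappa> s) * indicator {s\<in>{0..S}. tt s \<in> ?O} s \<partial>lebesgue) = 0"
    using O emeasure_push[OF \<kappa>_nonneg \<kappa>_integrable, of ?O] by simp
  moreover have "(\<lambda>s. ennreal (\<kappa> s) * indicator {s\<in>{0..S}. tt s \<in> ?O} s) \<in> borel_measurable lebesgue"
  proof -
    have "(\<lambda>s. (ennreal (\<kappa> s) * indicator {0..S} s) * indicator ?O (clamp_tt s)) \<in> borel_measurable lebesgue"
      by (rule borel_measurable_times_ennreal[OF m_measurable[OF \<kappa>_nonneg \<kappa>_integrable]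
            measurable_compose[OF clamp_tt_measurable borel_measurable_indicator]]) (use O in simp)
    also have "(\<lambda>s. (ennreal (\<kappa> s) * indicator {0..S} s) * indicator ?O (clamp_tt s)) =
        (\<lambda>s. ennreal (\<kappa> s) * indicator {s\<in>{0..S}. tt s \<in> ?O} s)"
      by (auto simp: indicator_def clamp_tt)
    finally show ?thesis .
  qed
  ultimately have "AE s in lebesgue. ennreal (\<kappa> s) * indicator {s\<in>{0..S}. tt s \<in> ?O} s = 0"
    by (simp add: nn_integral_0_iff_AE)
  then obtain N where N: "negligible N" "\<forall>s. s \<notin> N \<longrightarrow> ennreal (\<kappa> s) * indicator {s\<in>{0..S}. tt s \<in> ?O} s = 0"
    unfolding AE_lebesgue_iff_negligible by blast
  have "\<kappa> s = 0" if s: "s \<in> {0..S} - N" "tt s \<notin> msupport (mu d T q)" for s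
  proof -
    have "ennreal (\<kappa> s) * indicator {s\<in>{0..S}. tt s \<in> ?O} s = 0" using N(2) s by blast
    then show ?thesis using s \<kappa>_nonneg[of s] by (simp add: ennreal_eq_0_iff)
  qed
  then show ?thesis using N(1) by blast
qed

lemma not_in_flats:
  "\<exists>N. negligible N \<and> (\<forall>s\<in>{0..S} - N. s \<in> flats \<or> tt s \<notin> multi)"
proof -
  have "negligible (lo ` multi \<union> hi ` multi)" using countable_multi by (intro negligible_countable) auto
  moreover have "s \<in> flats \<or> tt s \<notin> multi" if "s \<in> {0..S} - (lo ` multi \<union> hi ` multi)" for s
  proof (rule ccontr)
    assume "\<not> ?thesis"
    then have m: "tt s \<in> multi" "s \<notin> flats" by auto
    have "lo (tt s) \<le> s" "s \<le> hi (tt s)" using tt_eq_iff[OF tt_range, of s s] that by auto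
    moreover have "s \<noteq> lo (tt s)" "s \<noteq> hi (tt s)" using that m(1) by auto
    ultimately show False using m flats_iff[of s] that by auto
  qed
  ultimately show ?thesis by blast
qed

lemma in_Xi:
  "\<exists>N. negligible N \<and> (\<forall>s\<in>{0<..<S} - N. (deriv tt s, spd z s, Z.\<xi> s) \<in> Xi)"
proof -
  obtain N1 where N1: "negligible N1" "\<forall>s\<in>{0<..<S} - N1. 0 \<le> deriv tt s \<and> deriv tt s \<le> 1" using tt_deriv_bounds by blast
  obtain N2 where N2: "negligible N2" "\<forall>s\<in>{0..S} - N2. tt s \<notin> multi \<longrightarrow> spd z s \<le> \<kappa> s" using spd_le_\<kappa> by blast
  obtain N3 where N3: "negligible N3" "\<forall>s\<in>{0..S} - N3. tt s \<notin> msupport (mu d T q) \<longrightarrow> \<kappa> s = 0"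
    using stationary_off_support by blast
  obtain N4 where N4: "negligible N4" "\<forall>s\<in>{0..S} - N4. s \<in> flats \<or> tt s \<notin> multi" using not_in_flats by blast
  have "(deriv tt s, spd z s, Z.\<xi> s) \<in> Xi" if s: "s \<in> {0<..<S} - (N1 \<union> N2 \<union> N3 \<union> N4)" for s
  proof -
    have sS: "s \<in> {0..S}" using s by auto
    have a: "0 \<le> deriv tt s" "deriv tt s \<le> 1" using N1 s by auto
    have n: "0 \<le> spd z s" by (rule spd_nonneg)
    have x: "0 \<le> Z.\<xi> s" by (rule Z.\<xi>_nonneg[OF sS])
    consider "s \<in> flats" | "tt s \<notin> multi" using N4(2) s sS by blast
    then show ?thesis
    proof cases
      case 1
      then have t: "tt s \<in> multi" "s \<in> {lo (tt s)<..<hi (tt s)}" using flats_iff by auto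
      then have "deriv tt s = 0" using deriv_tt_fibre[OF multi_in] by blast
      moreover have "1 \<le> Z.\<xi> s" unfolding Z.\<xi>_def by (rule slope_z_fibre[OF t(1)]) (use t(2) in auto)
      ultimately show ?thesis using n by (simp add: Xi_iff)
    next
      case 2
      have tT: "tt s \<in> {0..T}" by (rule tt_range[OF sS])
      have "z s = q (tt s)" using z_eq[OF sS 2] \<sigma>_tt[OF sS 2] \<sigma>_inv(2)[OF tT] by simp
      then have \<xi>s: "Z.\<xi> s = sl (tt s) (q (tt s))" by (simp add: Z.\<xi>_def)
      have "tt s \<in> {0..T} - Jset T q" using tT 2 Jset_multi by auto
      then have le1: "Z.\<xi> s \<le> 1" using sol \<xi>s unfolding BV_solution_def by simp
      have sp: "spd z s \<le> \<kappa> s" using N2(2) s sS 2 by blast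
      have lt: "spd z s = 0" if "Z.\<xi> s < 1"
      proof -
        have "tt s \<notin> msupport (mu d T q)" using sol \<xi>s that unfolding BV_solution_def by force
        then have "\<kappa> s = 0" using N3(2) s sS by blast
        then show ?thesis using sp n by simp
      qed
      show ?thesis using a n x le1 lt unfolding Xi_iff by (cases "Z.\<xi> s < 1"; cases "deriv tt s = 0") auto
    qed
  qed
  moreover have "negligible (N1 \<union> N2 \<union> N3 \<union> N4)" using N1 N2 N3 N4 by (intro negligible_Un)
  ultimately show ?thesis by blast
qed

lemma stopping_solution:
  assumes M: "admissible_M M"
  shows "stopping_parametrized_solution A R E T M 0 S tt z"
  unfolding stopping_parametrized_solution_def
proof (intro conjI)
  obtain N1 where N1: "negligible N1" "\<forall>s\<in>{0<..<S} - N1. (deriv tt s, spd z s, Z.\<xi> s) \<in> Xi" using in_Xi by blast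
  obtain N2 where N2: "negligible N2" "\<forall>s\<in>{0<..<S} - N2. deriv Z.\<psi> s - Z.p s * deriv tt s = - Z.g s"
    using dissipation_equality by blast
  obtain N3 where N3: "negligible N3" "\<forall>s\<in>{0<..<S} - N3. regular z s \<and> 0 \<le> deriv tt s" using tt_deriv_bounds by blast
  have "ereal (deriv (\<lambda>r. E (tt r) (z r)) s - dtE T E (tt s) (z s) * deriv tt s)
          \<le> - enn2ereal (M (deriv tt s, speed A R z s, slope A R E (tt s) (z s)))"
    if s: "s \<notin> N1 \<union> N2 \<union> N3" "s \<in> {0<..<S}" for s
  proof -
    have X: "(deriv tt s, spd z s, Z.\<xi> s) \<in> Xi" and D: "deriv Z.\<psi> s - Z.p s * deriv tt s = - Z.g s"
      and reg: "regular z s" and a: "0 \<le> deriv tt s" using N1 N2 N3 s by auto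
    have sp: "speed A R z s = spd z s" using reg by (simp add: spd_def)
    have x: "0 \<le> Z.\<xi> s" by (rule Z.\<xi>_nonneg) (use s in auto)
    have "M (deriv tt s, spd z s, Z.\<xi> s) = ennreal (spd z s * Z.\<xi> s)"
      using M[unfolded admissible_M_def, THEN conjunct2, THEN spec, THEN mp, OF a, THEN spec, THEN mp, OF spd_nonneg[of z s], THEN spec, THEN mp, OF x] X
      by blast
    also have "spd z s * Z.\<xi> s = Z.g s" by (simp add: Z.g_def mult.commute)
    finally have Mg: "M (deriv tt s, speed A R z s, slope A R E (tt s) (z s)) = ennreal (Z.g s)" by (simp add: sp Z.\<xi>_def)
    have "0 \<le> Z.g s" by (rule Z.g_nonneg) (use s in auto)
    then show ?thesis unfolding Mg using D by (simp add: enn2ereal_ennreal Z.\<psi>_def[abs_def] Z.p_def)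
  qed
  moreover have "negligible (N1 \<union> N2 \<union> N3)" using N1 N2 N3 by (intro negligible_Un)
  ultimately show "AE s in lebesgue. s \<in> {0<..<S} \<longrightarrow>
      ereal (deriv (\<lambda>r. E (tt r) (z r)) s - dtE T E (tt s) (z s) * deriv tt s)
          \<le> - enn2ereal (M (deriv tt s, speed A R z s, slope A R E (tt s) (z s)))"
    unfolding AE_lebesgue_iff_negligible by blast
qed (use s0_less_s1 tt_ac tt_image z_ac tt_mono in auto)

lemma \<kappa>_eq_spd:
  "\<exists>N. negligible N \<and> (\<forall>s\<in>{0<..<S} - N. tt s \<notin> multi \<longrightarrow> \<kappa> s = spd z s)"
proof -
  define P where "P = {s\<in>{0..S}. tt s \<in> Cset T q}"
  have P: "P \<in> sets lebesgue"
  proof -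
    have "P = {s\<in>{0..S}. tt s \<in> Cset T q \<inter> {0..T}}" using tt_range by (auto simp: P_def)
    then show ?thesis using Z.C_part_sets[of 0 T] by simp
  qed
  have Pm: "s \<in> P \<longleftrightarrow> tt s \<notin> multi" if "s \<in> {0..S}" for s
    using that tt_range[OF that] by (auto simp: P_def Cset_eq Jset_multi)
  obtain N where N: "negligible N" "\<forall>s\<in>{0..S} - N. tt s \<notin> multi \<longrightarrow> spd z s \<le> \<kappa> s" using spd_le_\<kappa> by blast
  have restr: "(\<lambda>s. if s \<in> P then f s else 0) integrable_on {0..S}"
    "(\<integral>\<^sup>+s. ennreal (f s) * indicator P s \<partial>lebesgue) = ennreal (integral {0..S} (\<lambda>s. if s \<in> P then f s else 0))"
    if f: "\<And>s. 0 \<le> f s" "f integrable_on {0..S}" for f :: "real \<Rightarrow> real"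
  proof -
    have "f absolutely_integrable_on {0..S}" using f by (intro nonnegative_absolutely_integrable_1) auto
    then have "f absolutely_integrable_on P"
      by (rule set_integrable_subset[OF _ P]) (auto simp: P_def)
    then have "f integrable_on P" by (rule set_lebesgue_integral_eq_integral)
    moreover have sub: "P \<subseteq> {0..S}" by (auto simp: P_def)
    ultimately show "(\<lambda>s. if s \<in> P then f s else 0) integrable_on {0..S}"
      using has_integral_restrict[OF sub, of f] unfolding integrable_on_def by blast
    from nn_integral_lebesgue_eq_integral[OF _ this]
    have "(\<integral>\<^sup>+s. ennreal (if s \<in> P then f s else 0) * indicator {0..S} s \<partial>lebesgue) = ennreal (integral {0..S} (\<lambda>s. if s \<in> P then f s else 0))"
      using f by simp
    moreover have "(\<lambda>s. ennreal (if s \<in> P then f s else 0) * indicator {0..S} s) = (\<lambda>s. ennreal (f s) * indicator P s)"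
    proof
      fix s show "ennreal (if s \<in> P then f s else 0) * indicator {0..S} s = ennreal (f s) * indicator P s"
        using sub by (cases "s \<in> P") auto
    qed
    ultimately show "(\<integral>\<^sup>+s. ennreal (f s) * indicator P s \<partial>lebesgue) = ennreal (integral {0..S} (\<lambda>s. if s \<in> P then f s else 0))" by simp
  qed
  note Rk = restr[OF \<kappa>_nonneg \<kappa>_integrable] and Rs = restr[OF Z.spd_Q]
  have "push \<kappa> \<le> push (spd z)" by (rule order_trans[OF push_\<kappa>_le_mu Z.mu_le_push])
  then have "emeasure (push \<kappa>) (Cset T q) \<le> emeasure (push (spd z)) (Cset T q)"
    using le_measure[of "push \<kappa>" "push (spd z)"] Cset_borel by (simp add: push_sets[OF \<kappa>_nonneg \<kappa>_integrable] push_sets[OF Z.spd_Q])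
  then have "(\<integral>\<^sup>+s. ennreal (\<kappa> s) * indicator P s \<partial>lebesgue) \<le> (\<integral>\<^sup>+s. ennreal (spd z s) * indicator P s \<partial>lebesgue)"
    unfolding emeasure_push[OF \<kappa>_nonneg \<kappa>_integrable Cset_borel] emeasure_push[OF Z.spd_Q Cset_borel] P_def .
  then have le: "integral {0..S} (\<lambda>s. if s \<in> P then \<kappa> s else 0) \<le> integral {0..S} (\<lambda>s. if s \<in> P then spd z s else 0)"
  proof -
    assume *: "(\<integral>\<^sup>+s. ennreal (\<kappa> s) * indicator P s \<partial>lebesgue) \<le> (\<integral>\<^sup>+s. ennreal (spd z s) * indicator P s \<partial>lebesgue)"
    have "0 \<le> integral {0..S} (\<lambda>s. if s \<in> P then spd z s else 0)"
      by (rule Henstock_Kurzweil_Integration.integral_nonneg[OF Rs(1)]) (use spd_nonneg in auto)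
    then show ?thesis using * unfolding Rk(2) Rs(2) by (simp add: ennreal_le_iff)
  qed
  define h where "h s = max 0 ((if s \<in> P then \<kappa> s else 0) - (if s \<in> P then spd z s else 0))" for s
  have h: "(h has_integral (integral {0..S} (\<lambda>s. if s \<in> P then \<kappa> s else 0) - integral {0..S} (\<lambda>s. if s \<in> P then spd z s else 0))) {0..S}"
    by (rule has_integral_spike[OF N(1) _ has_integral_diff[OF integrable_integral[OF Rk(1)] integrable_integral[OF Rs(1)]]])
       (use N(2) Pm in \<open>auto simp: h_def\<close>)
  have "0 \<le> integral {0..S} h"
    by (rule Henstock_Kurzweil_Integration.integral_nonneg) (use h in \<open>auto simp: h_def\<close>)
  then have "integral {0..S} h = 0" using integral_unique[OF h] le by simp
  then obtain N' where N': "negligible N'" "\<forall>s\<in>{0<..<S} - N'. h s = 0"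
    using integral_eq_0_imp_negligible[OF has_integral_integrable[OF h]] by (force simp: h_def)
  have "\<kappa> s = spd z s" if s: "s \<in> {0<..<S} - (N \<union> N')" and nm: "tt s \<notin> multi" for s
  proof -
    have "s \<in> P" using Pm[of s] s nm by auto
    moreover have "h s = 0" using N'(2) s by blast
    moreover have "spd z s \<le> \<kappa> s" using N(2) s nm by auto
    ultimately show ?thesis by (simp add: h_def)
  qed
  moreover have "negligible (N \<union> N')" using N N' by (intro negligible_Un)
  ultimately show ?thesis by blast
qed

lemma spd_pos_on_flats:
  assumes pos: "\<And>t. t \<in> multi \<Longrightarrow> AE \<theta> in lebesgue. \<theta> \<in> {0<..<1} \<longrightarrow> speed A R (y t) \<theta> > 0"
  shows "\<exists>N. negligible N \<and> (\<forall>s\<in>{0..S} - N. s \<in> flats \<longrightarrow> 0 < spd z s)"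
proof -
  have "\<exists>N. negligible N \<and> (\<forall>s\<in>{lo t<..<hi t} - N. 0 < spd z s)" if t: "t \<in> multi" for t
  proof -
    have lh: "0 < hi t - lo t" using multi_less[OF t] by simp
    let ?m = "1 / (hi t - lo t)" and ?k = "- lo t / (hi t - lo t)"
    obtain N1 where N1: "negligible N1" "\<forall>\<theta>. \<theta> \<notin> N1 \<longrightarrow> \<theta> \<in> {0<..<1} \<longrightarrow> speed A R (y t) \<theta> > 0"
      using pos[OF t] unfolding AE_lebesgue_iff_negligible by blast
    have "ac_curve A 0 1 (y t)" using jump_facts(1)[OF t] by (simp add: curves_def)
    then obtain N2 where N2: "negligible N2" "\<forall>\<theta>\<in>{0<..<1} - N2. regular (y t) \<theta>" using ac_curve_regular by blast
    have neg: "negligible {s. ?m * s + ?k \<in> N1 \<union> N2}"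
      by (rule negligible_affine_vimage) (use N1 N2 lh in \<open>auto intro: negligible_Un\<close>)
    have "0 < spd z s" if s: "s \<in> {lo t<..<hi t} - {s. ?m * s + ?k \<in> N1 \<union> N2}" for s
    proof -
      have "?m * s + ?k \<in> {0<..<1}" unfolding coord using s lh by (auto simp: divide_less_eq)
      then have "speed A R (y t) (?m * s + ?k) > 0" "regular (y t) (?m * s + ?k)" using N1 N2 s by auto
      then have "0 < spd (y t) (?m * s + ?k)" by (simp add: spd_def)
      then have "0 < spd (resc t) s" unfolding resc_def[abs_def] using lh by (subst spd_affine(2)) auto
      then show ?thesis using spd_z_fibre[OF t, of s] s by simp
    qed
    then show ?thesis using neg by blast
  qed
  then have "\<forall>t\<in>multi. \<exists>N. negligible N \<and> (\<forall>s\<in>{lo t<..<hi t} - N. 0 < spd z s)" by blast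
  from bchoice[OF this] obtain N where N: "\<forall>t\<in>multi. negligible (N t) \<and> (\<forall>s\<in>{lo t<..<hi t} - N t. 0 < spd z s)" ..
  have "negligible (\<Union>(N ` multi))"
    by (rule negligible_countable_Union) (use N countable_multi in auto)
  moreover have "0 < spd z s" if "s \<in> {0..S} - \<Union>(N ` multi)" "s \<in> flats" for s
    using that N unfolding flats_def by blast
  ultimately show ?thesis by blast
qed

lemma parametrized_solution:
  assumes M: "admissible_M M"
    and pos: "\<forall>t\<in>Jset T q. AE \<theta> in lebesgue. \<theta> \<in> {0<..<1} \<longrightarrow> speed A R (y t) \<theta> > 0"
  shows "parametrized_metric_solution A R E T M 0 S tt z"
  unfolding parametrized_metric_solution_def
proof (intro conjI stopping_solution[OF M])
  obtain N1 where N1: "negligible N1" "\<forall>s\<in>{0<..<S} - N1. regular z s \<and> 0 \<le> deriv tt s \<and> deriv tt s \<le> 1"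
    using tt_deriv_bounds by blast
  obtain N2 where N2: "negligible N2" "\<forall>s\<in>{0<..<S} - N2. tt s \<notin> multi \<longrightarrow> \<kappa> s = spd z s" using \<kappa>_eq_spd by blast
  obtain N3 where N3: "negligible N3" "\<forall>s\<in>{0..S} - N3. s \<in> flats \<longrightarrow> 0 < spd z s"
    using spd_pos_on_flats pos unfolding Jset_multi by blast
  obtain N4 where N4: "negligible N4" "\<forall>s\<in>{0..S} - N4. s \<in> flats \<or> tt s \<notin> multi" using not_in_flats by blast
  have "deriv tt s + speed A R z s > 0" if s: "s \<notin> N1 \<union> N2 \<union> N3 \<union> N4" "s \<in> {0<..<S}" for s
  proof -
    have a: "0 \<le> deriv tt s" "deriv tt s \<le> 1" and reg: "regular z s" using N1 s by auto
    have sp: "speed A R z s = spd z s" using reg by (simp add: spd_def)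
    have sS: "s \<in> {0..S}" using s by auto
    consider "s \<in> flats" | "tt s \<notin> multi" using N4(2) s sS by blast
    then show ?thesis
    proof cases
      case 1
      then have "0 < spd z s" using N3(2) s sS by blast
      then show ?thesis using a sp by simp
    next
      case 2
      then have "\<kappa> s = spd z s" using N2(2) s by blast
      then show ?thesis using a sp by (simp add: \<kappa>_def)
    qed
  qed
  moreover have "negligible (N1 \<union> N2 \<union> N3 \<union> N4)" using N1 N2 N3 N4 by (intro negligible_Un)
  ultimately show "AE s in lebesgue. s \<in> {0<..<S} \<longrightarrow> deriv tt s + speed A R z s > 0"
    unfolding AE_lebesgue_iff_negligible by blast
qed

end

theorem proposition4p5:
  fixes A :: "('q::{t2_space,second_countable_topology}, 'e::euclidean_space) chart set"
    and R :: "'q \<Rightarrow> ('q, 'e) tvec \<Rightarrow> real"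
    and E :: "real \<Rightarrow> 'q \<Rightarrow> real"
    and T :: real
    and M :: "real \<times> real \<times> real \<Rightarrow> ennreal"
  assumes "T > 0"
    and "smooth_atlas A"
    and "finsler_norm A R"
    and "has_minimal_curves A R"
    and "Metric_space.mcomplete UNIV (fdist A R)"
    and "C1_energy A T E"
    and "admissible_M M"
  shows
    "(\<forall>q y \<sigma> S tt qq z.
        BV_solution A R E T q \<and>
        (\<forall>t\<in>Jset T q. jump_curve A R E T q t (y t)) \<and>
        (\<forall>t\<in>{0..T}. \<sigma> t = t + V_fun (fdist A R) q t) \<and>
        S = \<sigma> T \<and>
        tt 0 = 0 \<and> (\<forall>s\<in>{0<..S}. tt s = Sup {t\<in>{0..T}. \<sigma> t < s}) \<and>
        (\<forall>r\<in>{0..S}. \<forall>s\<in>{0..S}. \<bar>tt r - tt s\<bar> + fdist A R (qq r) (qq s) \<le> \<bar>r - s\<bar>) \<and>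
        (\<forall>t\<in>{0..T}. tt (\<sigma> t) = t \<and> qq (\<sigma> t) = q t) \<and>
        (\<forall>s\<in>{0..S}. tt s \<in> Cset T q \<longrightarrow> z s = qq s) \<and>
        (\<forall>s\<in>{0..S}. \<forall>\<theta>\<in>{0..1}.
           tt s \<in> Jset T q \<and>
           s = (1 - \<theta>) * lim_left \<sigma> (tt s) + \<theta> * lim_right T \<sigma> (tt s) \<longrightarrow>
           z s = y (tt s) \<theta>)
        \<longrightarrow>
        stopping_parametrized_solution A R E T M 0 S tt z \<and>
        ((\<forall>t\<in>Jset T q. AE \<theta> in lebesgue. \<theta> \<in> {0<..<1} \<longrightarrow> speed A R (y t) \<theta> > 0)
           \<longrightarrow> parametrized_metric_solution A R E T M 0 S tt z))
     \<and>
     (\<forall>s0 s1 tt qq \<sigma> q.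
        parametrized_metric_solution A R E T M s0 s1 tt qq \<and>
        tt s0 = 0 \<and> tt s1 = T \<and>
        (\<forall>t\<in>{0..T}. \<sigma> t \<in> {s0..s1} \<and> tt (\<sigma> t) = t \<and> q t = qq (\<sigma> t))
        \<longrightarrow> BV_solution A R E T q)"
proof -
  interpret finsler_energy A R E T
  proof unfold_locales
    show "curves A p q \<noteq> {}" for p q using assms(4) unfolding has_minimal_curves_def by blast
  qed (use assms in auto)
  show ?thesis
  proof (intro conjI allI impI)
    fix q y \<sigma> S tt qq z
    assume H: "BV_solution A R E T q \<and>
        (\<forall>t\<in>Jset T q. jump_curve A R E T q t (y t)) \<and>
        (\<forall>t\<in>{0..T}. \<sigma> t = t + V_fun (fdist A R) q t) \<and>
        S = \<sigma> T \<and>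
        tt 0 = 0 \<and> (\<forall>s\<in>{0<..S}. tt s = Sup {t\<in>{0..T}. \<sigma> t < s}) \<and>
        (\<forall>r\<in>{0..S}. \<forall>s\<in>{0..S}. \<bar>tt r - tt s\<bar> + fdist A R (qq r) (qq s) \<le> \<bar>r - s\<bar>) \<and>
        (\<forall>t\<in>{0..T}. tt (\<sigma> t) = t \<and> qq (\<sigma> t) = q t) \<and>
        (\<forall>s\<in>{0..S}. tt s \<in> Cset T q \<longrightarrow> z s = qq s) \<and>
        (\<forall>s\<in>{0..S}. \<forall>\<theta>\<in>{0..1}.
           tt s \<in> Jset T q \<and>
           s = (1 - \<theta>) * lim_left \<sigma> (tt s) + \<theta> * lim_right T \<sigma> (tt s) \<longrightarrow>
           z s = y (tt s) \<theta>)"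
    interpret bv_param A R E T q y \<sigma> S tt qq z
      by unfold_locales (use H in blast)+
    show "stopping_parametrized_solution A R E T M 0 S tt z" by (rule stopping_solution[OF assms(7)])
    assume "\<forall>t\<in>Jset T q. AE \<theta> in lebesgue. \<theta> \<in> {0<..<1} \<longrightarrow> speed A R (y t) \<theta> > 0"
    then show "parametrized_metric_solution A R E T M 0 S tt z" by (rule parametrized_solution[OF assms(7)])
  next
    fix s0 s1 tt qq \<sigma> q
    assume "parametrized_metric_solution A R E T M s0 s1 tt qq \<and> tt s0 = 0 \<and> tt s1 = T \<and>
      (\<forall>t\<in>{0..T}. \<sigma> t \<in> {s0..s1} \<and> tt (\<sigma> t) = t \<and> q t = qq (\<sigma> t))"
    then show "BV_solution A R E T q" using BV_solution_of_parametrized[OF assms(7)] by blast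
  qed
qed

end
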